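(* Let $m_1,m_2,m_3,t_1,t_2\in\mathbb{R}$. Let the operator $T$ be defined by $$Tu(x)=(2\pi)^{-n}\int_{\mathbb{R}^n}\int_{\mathbb{R}^n}e^{i(\phi(x,\xi)-y\cdot\xi)}a(x,y,\xi)u(y)\,dy\,d\xi .$$ Let the phase $\phi=\phi(x,\xi)$ be any real-valued function, and let $a=a(x,y,\xi)\in C^\infty(\mathbb{R}^n\times\mathbb{R}^n\times\mathbb{R}^n)$ satisfy, for all multi-indices $\alpha,\beta,\gamma$, $$|\partial_x^\alpha\partial_y^\beta\partial_\xi^\gamma a(x,y,\xi)|\le C_{\alpha\beta\gamma}\langle x\rangle^{m_1}\langle y\rangle^{m_2}\langle\xi\rangle^{m_3}\quad\text{for all }x,y,\xi\in\mathbb{R}^n.$$ Let $p=p(y,\eta)\in C^\infty(\mathbb{R}^n\times\mathbb{R}^n)$ satisfy, for all multi-indices $\alpha,\beta$, $$|\partial_y^\alpha\partial_\eta^\beta p(y,\eta)|\le C_{\alpha\beta}\langle y\rangle^{t_1}\langle\eta\rangle^{t_2-|\beta|}\quad\text{for all }y,\eta\in\mathbb{R}^n,$$ and let $P=P(x,D)$ be the pseudo-differential operator with symbol $p$. Then the composition $B=T\circ P(x,D)$ is an operator of the form $$(TPu)(x)=(2\pi)^{-n}\int_{\mathbb{R}^n}\int_{\mathbb{R}^n}e^{i(\phi(x,\xi)-z\cdot\xi)}c(x,z,\xi)u(z)\,dz\,d\xi,$$ with amplitude $c(x,z,\xi)$ satisfying $$|\partial_x^\alpha\partial_z^\beta\partial_\xi^\gamma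 c(x,z,\xi)|\le C_{\alpha\beta\gamma}\langle x\rangle^{m_1}\langle z\rangle^{m_2+t_1}\langle\xi\rangle^{m_3+t_2}$$ for all $\alpha,\beta,\gamma$ and all $x,z,\xi\in\mathbb{R}^n$. Moreover, we have the asymptotic expansion, improving in $\xi$: $$c(x,z,\xi)\sim\sum_\alpha\frac{i^{-|\alpha|}}{\alpha!}\,\partial_y^\alpha\left[a(x,y,\xi)\,\partial_\xi^\alpha p(y,\xi)\right]\Big|_{y=z}.$$
   Context: $\langle x\rangle=(1+|x|^2)^{1/2}$. The pseudo-differential operator with symbol $p$ is $Pu(x)=(2\pi)^{-n}\int_{\mathbb{R}^n}\int_{\mathbb{R}^n}e^{i(x-y)\cdot\xi}p(x,\xi)u(y)\,dy\,d\xi$. Operators given by such double integrals are understood as limits in $\mathcal{S}(\mathbb{R}^n)$, as $\epsilon\to0$, of the operators with amplitude $a(x,y,\xi)$ replaced by $a(x,y,\xi)\gamma(\epsilon y,\epsilon\xi)$, where $\gamma\in C_0^\infty(\mathbb{R}^n\times\mathbb{R}^n)$ equals $1$ near the origin. An asymptotic expansion $c\sim\sum_{j=1}^\infty c_j$ of an amplitude $c(x,z,\xi)$ of orders $\mu_1,\mu_2,\mu_3$ in $x,z,\xi$ is said to be improving in $\xi$ if for every $\alpha,\beta,\gamma$ and $M$ there exist $N$ and $C$ such that $|\partial_x^\alpha\partial_z^\beta\partial_\xi^\gamma(c-\sum_{j=1}^N c_j)|\le C\langle x\rangle^{\mu_1}\langle z\rangle^{\mu_2}\langle\xi\rangle^{\mu_3-M}$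 for all $x,z,\xi\in\mathbb{R}^n$. Here $\mu_1=m_1$, $\mu_2=m_2+t_1$, $\mu_3=m_3+t_2$.
   Formalization: The coefficient i^{-|α|} is corrected to i^{|α|} (the printed sign fails for p=yη, a=1, φ=xξ); the formula for TPu is asserted at those x where e^{iφ(x,·)} is measurable, and the limits ε→0 defining T and the operator with amplitude c are taken pointwise in x. *)

theory Defs
  imports "HOL-Analysis.Analysis"
begin

definition jbracket :: "'a::real_normed_vector \<Rightarrow> real" where
  "jbracket x = sqrt (1 + (norm x)\<^sup>2)"

definition dir_deriv ::
  "'a::real_normed_vector \<Rightarrow> ('a \<Rightarrow> 'b::real_normed_vector) \<Rightarrow> 'a \<Rightarrow> 'b" where
  "dir_deriv v f x = vector_derivative (\<lambda>t. f (x + t *\<^sub>R v)) (at 0)"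

fun dir_derivs ::
  "'a::real_normed_vector list \<Rightarrow> ('a \<Rightarrow> 'b::real_normed_vector) \<Rightarrow> 'a \<Rightarrow> 'b" where
  "dir_derivs [] f = f"
| "dir_derivs (v # vs) f = dir_deriv v (dir_derivs vs f)"

text \<open>\<open>C\<^sup>\<infinity>\<close> on the whole space: every iterated partial derivative is (totally) differentiable
  everywhere, so in particular all of them exist and are continuous.  For functions of several
  variables the space is a product type, whose \<^const>\<open>Basis\<close> consists of the
  coordinate directions of the factors.\<close>

definition smooth :: "('a::euclidean_space \<Rightarrow> 'b::real_normed_vector) \<Rightarrow> bool" where
  "smooth f \<longleftrightarrow> (\<forall>vs. set vs \<subseteq> Basis \<longrightarrow> dir_derivs vs f differentiable_on UNIV)"

text \<open>Multi-indices for \<open>\<real>\<^sup>n\<close> are functions \<open>\<alpha> :: 'n \<Rightarrow> nat\<close> on the finite index type.  The derivative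
  \<open>\<partial>\<^sup>\<alpha>\<close> differentiates \<open>\<alpha> i\<close> times in the \<open>i\<close>-th coordinate.  An index type carries no
  order, so the order of differentiation is an arbitrary fixed one; for smooth functions it is
  immaterial.\<close>

definition mi_order :: "('n::finite \<Rightarrow> nat) \<Rightarrow> nat" where
  "mi_order \<alpha> = (\<Sum>i\<in>UNIV. \<alpha> i)"

definition mi_fact :: "('n::finite \<Rightarrow> nat) \<Rightarrow> nat" where
  "mi_fact \<alpha> = (\<Prod>i\<in>UNIV. fact (\<alpha> i))"

definition mi_deriv ::
  "('n::finite \<Rightarrow> nat) \<Rightarrow> (real^'n \<Rightarrow> 'b::real_normed_vector) \<Rightarrow> real^'n \<Rightarrow> 'b" where
  "mi_deriv \<alpha> f =
     dir_derivs (map (\<lambda>i. axis i 1) (SOME is. \<forall>i. count_list is i = \<alpha> i)) f"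

definition mi_deriv2 ::
  "('n::finite \<Rightarrow> nat) \<Rightarrow> ('n \<Rightarrow> nat) \<Rightarrow> (real^'n \<Rightarrow> real^'n \<Rightarrow> complex) \<Rightarrow>
   real^'n \<Rightarrow> real^'n \<Rightarrow> complex" where
  "mi_deriv2 \<alpha> \<beta> p y \<eta> = mi_deriv \<alpha> (\<lambda>y. mi_deriv \<beta> (\<lambda>\<eta>. p y \<eta>) \<eta>) y"

definition mi_deriv3 ::
  "('n::finite \<Rightarrow> nat) \<Rightarrow> ('n \<Rightarrow> nat) \<Rightarrow> ('n \<Rightarrow> nat) \<Rightarrow>
   (real^'n \<Rightarrow> real^'n \<Rightarrow> real^'n \<Rightarrow> complex) \<Rightarrow>
   real^'n \<Rightarrow> real^'n \<Rightarrow> real^'n \<Rightarrow> complex" where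
  "mi_deriv3 \<alpha> \<beta> \<gamma> a x y \<xi> =
     mi_deriv \<alpha> (\<lambda>x. mi_deriv \<beta> (\<lambda>y. mi_deriv \<gamma> (\<lambda>\<xi>. a x y \<xi>) \<xi>) y) x"

definition amplitude_bounds ::
  "real \<Rightarrow> real \<Rightarrow> real \<Rightarrow> (real^'n \<Rightarrow> real^'n \<Rightarrow> real^'n \<Rightarrow> complex) \<Rightarrow> bool" where
  "amplitude_bounds m1 m2 m3 a \<longleftrightarrow>
     (\<forall>\<alpha> \<beta> \<gamma>. \<exists>C. \<forall>x y \<xi>. norm (mi_deriv3 \<alpha> \<beta> \<gamma> a x y \<xi>)
        \<le> C * jbracket x powr m1 * jbracket y powr m2 * jbracket \<xi> powr m3)"

definition symbol_bounds ::
  "real \<Rightarrow> real \<Rightarrow> (real^'n \<Rightarrow> real^'n \<Rightarrow> complex) \<Rightarrow> bool" where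
  "symbol_bounds t1 t2 p \<longleftrightarrow>
     (\<forall>\<alpha> \<beta>. \<exists>C. \<forall>y \<eta>. norm (mi_deriv2 \<alpha> \<beta> p y \<eta>)
        \<le> C * jbracket y powr t1 * jbracket \<eta> powr (t2 - real (mi_order \<beta>)))"

definition schwartz :: "(real^'n \<Rightarrow> complex) set" where
  "schwartz = {u. smooth u \<and>
     (\<forall>(k::nat) \<alpha>. \<exists>C. \<forall>x. jbracket x ^ k * norm (mi_deriv \<alpha> u x) \<le> C)}"

definition schwartz_tendsto ::
  "('i \<Rightarrow> real^'n \<Rightarrow> complex) \<Rightarrow> (real^'n \<Rightarrow> complex) \<Rightarrow> 'i filter \<Rightarrow> bool" where
  "schwartz_tendsto f v F \<longleftrightarrow> v \<in> schwartz \<and> (\<forall>\<^sub>F i in F. f i \<in> schwartz) \<and>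
     (\<forall>(k::nat) \<alpha>. uniform_limit UNIV
        (\<lambda>i x. jbracket x ^ k *\<^sub>R mi_deriv \<alpha> (f i) x)
        (\<lambda>x. jbracket x ^ k *\<^sub>R mi_deriv \<alpha> v x) F)"

definition cutoffs :: "((real^'n) \<times> (real^'n) \<Rightarrow> complex) set" where
  "cutoffs = {\<gamma>. smooth \<gamma> \<and> compact (closure {w. \<gamma> w \<noteq> 0}) \<and> (\<forall>\<^sub>F w in nhds 0. \<gamma> w = 1)}"

text \<open>The integral with phase \<open>\<phi>(x,\<xi>) - y\<cdot>\<xi>\<close> whose amplitude is replaced by
  \<open>a(x,y,\<xi>) \<gamma>(\<epsilon>y,\<epsilon>\<xi>)\<close>.\<close>

definition fio_reg ::
  "(real^'n \<Rightarrow> real^'n \<Rightarrow> real) \<Rightarrow> (real^'n \<Rightarrow> real^'n \<Rightarrow> real^'n \<Rightarrow> complex) \<Rightarrow>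
   ((real^'n) \<times> (real^'n) \<Rightarrow> complex) \<Rightarrow> real \<Rightarrow> (real^'n \<Rightarrow> complex) \<Rightarrow> real^'n \<Rightarrow> complex" where
  "fio_reg \<phi> a \<gamma> \<epsilon> u x =
     complex_of_real (1 / (2 * pi) ^ CARD('n)) *
     (LINT \<xi>|lebesgue. LINT y|lebesgue.
        cis (\<phi> x \<xi> - y \<bullet> \<xi>) * (a x y \<xi> * \<gamma> (\<epsilon> *\<^sub>R y, \<epsilon> *\<^sub>R \<xi>)) * u y)"

text \<open>\<open>fio_value \<phi> a u x w\<close>: the integral operator with phase \<open>\<phi>\<close> and amplitude \<open>a\<close> is defined on
  \<open>u\<close> at the point \<open>x\<close>, with value \<open>w\<close>.  Nothing is assumed about the dependence of \<open>\<phi>\<close> on \<open>x\<close>, so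
  the functions of \<open>x\<close> obtained need not be continuous, let alone lie in the Schwartz space; hence
  the limit is taken at each point \<open>x\<close>.  It agrees with the limit in the Schwartz space whenever the
  latter exists.\<close>

definition fio_value ::
  "(real^'n \<Rightarrow> real^'n \<Rightarrow> real) \<Rightarrow> (real^'n \<Rightarrow> real^'n \<Rightarrow> real^'n \<Rightarrow> complex) \<Rightarrow>
   (real^'n \<Rightarrow> complex) \<Rightarrow> real^'n \<Rightarrow> complex \<Rightarrow> bool" where
  "fio_value \<phi> a u x w \<longleftrightarrow>
     (\<forall>\<gamma>\<in>cutoffs. ((\<lambda>\<epsilon>. fio_reg \<phi> a \<gamma> \<epsilon> u x) \<longlongrightarrow> w) (at_right 0))"

text \<open>\<open>psdo_value p u v\<close>: the pseudo-differential operator \<open>P(x,D)\<close> with symbol \<open>p\<close>, that is, the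
  operator with phase \<open>x\<cdot>\<xi>\<close> and amplitude \<open>p(x,\<xi>)\<close>, maps \<open>u\<close> to \<open>v\<close>; here the limit is one
  in the Schwartz space.\<close>

definition psdo_value ::
  "(real^'n \<Rightarrow> real^'n \<Rightarrow> complex) \<Rightarrow> (real^'n \<Rightarrow> complex) \<Rightarrow> (real^'n \<Rightarrow> complex) \<Rightarrow> bool" where
  "psdo_value p u v \<longleftrightarrow>
     (\<forall>\<gamma>\<in>cutoffs. schwartz_tendsto
        (\<lambda>\<epsilon>. fio_reg (\<lambda>x \<xi>. x \<bullet> \<xi>) (\<lambda>x y \<xi>. p x \<xi>) \<gamma> \<epsilon> u) v (at_right 0))"

text \<open>\<open>c \<sim> \<Sum>\<^sub>j\<^sub>\<ge>\<^sub>1 cs j\<close>, improving in \<open>\<xi>\<close>, for an amplitude \<open>c\<close> of orders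
  \<open>\<mu>1\<close>, \<open>\<mu>2\<close>, \<open>\<mu>3\<close>.\<close>

definition asymp_improving ::
  "real \<Rightarrow> real \<Rightarrow> real \<Rightarrow> (real^'n \<Rightarrow> real^'n \<Rightarrow> real^'n \<Rightarrow> complex) \<Rightarrow>
   (nat \<Rightarrow> real^'n \<Rightarrow> real^'n \<Rightarrow> real^'n \<Rightarrow> complex) \<Rightarrow> bool" where
  "asymp_improving \<mu>1 \<mu>2 \<mu>3 c cs \<longleftrightarrow>
     (\<forall>\<alpha> \<beta> \<gamma>. \<forall>M::real. \<exists>N\<ge>1. \<exists>C. \<forall>x z \<xi>.
        norm (mi_deriv3 \<alpha> \<beta> \<gamma> (\<lambda>x z \<xi>. c x z \<xi> - (\<Sum>j=1..N. cs j x z \<xi>)) x z \<xi>)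
        \<le> C * jbracket x powr \<mu>1 * jbracket z powr \<mu>2 * jbracket \<xi> powr (\<mu>3 - M))"

text \<open>The \<open>j\<close>-th term (\<open>j \<ge> 1\<close>) of the expansion of the composed amplitude collects the
  multi-indices of order \<open>j - 1\<close>.  The factor is \<open>i\<^bsup>|\<alpha>|\<^esup>\<close>, because
  \<open>(2\<pi>)\<^sup>-\<^sup>n \<integral>\<integral> e\<^bsup>iw\<cdot>\<theta>\<^esup> \<theta>\<^sup>\<alpha> f(w) dw d\<theta> = i\<^bsup>|\<alpha>|\<^esup> \<partial>\<^sup>\<alpha> f(0)\<close>.
  Pitfall: with the kernel \<open>e\<^bsup>i(x-y)\<cdot>\<xi>\<^esup>\<close> used here the factor \<open>i\<^bsup>-|\<alpha>|\<^esup>\<close> belongs to the passage from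
  amplitudes to left symbols and would be wrong in this formula.  For instance, for \<open>n = 1\<close>,
  \<open>\<phi>(x,\<xi>) = x\<xi>\<close>, \<open>a = 1\<close> and \<open>p(y,\<eta>) = y\<eta>\<close> we have \<open>P = xD = Dx + i\<close>, so
  \<open>c(x,z,\<xi>) = z\<xi> + i\<close> and not \<open>z\<xi> - i\<close>.\<close>

definition composition_term ::
  "(real^'n \<Rightarrow> real^'n \<Rightarrow> real^'n \<Rightarrow> complex) \<Rightarrow> (real^'n \<Rightarrow> real^'n \<Rightarrow> complex) \<Rightarrow>
   nat \<Rightarrow> real^'n \<Rightarrow> real^'n \<Rightarrow> real^'n \<Rightarrow> complex" where
  "composition_term a p j x z \<xi> =
     (\<Sum>\<alpha> | mi_order \<alpha> = j - 1. \<i> ^ mi_order \<alpha> / of_nat (mi_fact \<alpha>) *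
        mi_deriv \<alpha> (\<lambda>y. a x y \<xi> * mi_deriv \<alpha> (\<lambda>\<eta>. p y \<eta>) \<xi>) z)"

end

theory Submission
  imports Defs "HOL-Combinatorics.Multiset_Permutations" "HOL-Probability.Sinc_Integral"
    "HOL-Probability.Characteristic_Functions"
begin

text \<open>The amplitude is the oscillatory integral
  \<open>c(x,z,\<xi>) = (2\<pi>)\<^sup>-\<^sup>n \<integral>\<integral> e\<^bsup>iw\<cdot>\<theta>\<^esup> a(x,z+w,\<xi>) p(z+w,\<xi>+\<theta>) dw d\<theta>\<close>, which is made absolutely convergent
  by repeated integration by parts; the estimates for \<open>c\<close> then follow from Peetre's inequality.
  Taylor expansion of \<open>p\<close> in \<open>\<theta>\<close> together with \<open>\<theta>\<^sub>j e\<^bsup>iw\<cdot>\<theta>\<^esup> = -i \<partial>\<^bsub>w\<^sub>j\<^esub> e\<^bsup>iw\<cdot>\<theta>\<^esup>\<close> trades every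
  factor \<open>\<theta>\<^sub>j\<close> for \<open>i \<partial>\<^bsub>w\<^sub>j\<^esub>\<close>, and a function of \<open>w\<close> alone integrates to its value at \<open>0\<close>: this
  gives the expansion, the remainder having gained one order in \<open>\<xi>\<close> per derivative of \<open>p\<close>.
  Since the phase depends on \<open>(x,\<xi>)\<close> only, the identity of the two operators reduces, for fixed
  \<open>x\<close> and \<open>\<xi>\<close>, to the equality of the Fourier transforms in \<open>y\<close> of \<open>a Pu\<close> and in \<open>z\<close> of \<open>c u\<close>.
  With \<open>p(y,\<eta>)\<close> damped by a Gaussian in \<open>\<epsilon>(y,\<eta>)\<close> this is Fubini's theorem, and both sides
  depend continuously on the symbol.\<close>

section \<open>Directional derivatives of smooth functions\<close>

text \<open>The phase \<phi> is arbitrary, so neither its derivatives nor its growth can be used,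
  and no integration by parts in \<xi> is possible in the operators themselves. What makes them
  converge is the Fourier transform in y alone, which decays faster than any power of \<xi> because
  both u and Pu are Schwartz functions; the factor e^{i\<phi>} only has to be measurable in \<xi>
  and of modulus 1. In the amplitude, on the other hand, \<phi> does not occur, and the derivatives
  of the quadratic phase w\<cdot>\<theta> are explicit.

  The cutoffs of the statement and the Gaussians of the proof are handled alike. All derivatives of
  \<gamma>(\<epsilon>q) - 1 are bounded by C\<epsilon>\<langle>q\<rangle>: a cutoff is removed at
  the price of one power of the weight, and since oscillatory integrals make sense for every order,
  this price does not matter. Gaussians serve inside the proof because no cutoff has to be
  constructed and their Fourier transform is explicit. The one value computed from it, that the
  normalised oscillatory integral of 1 equals 1, takes the place of Fourier inversion.\<close>

lemma dir_deriv_eq: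
  assumes "(f has_derivative f') (at x)"
  shows "dir_deriv v f x = f' v"
proof -
  have "((\<lambda>t. f (x + t *\<^sub>R v)) has_derivative (\<lambda>t. f' (t *\<^sub>R v))) (at (0::real))"
  proof (rule has_derivative_compose[where f = "\<lambda>t. x + t *\<^sub>R v"])
    show "((\<lambda>t. x + t *\<^sub>R v) has_derivative (\<lambda>t. t *\<^sub>R v)) (at (0::real))"
      by (auto intro!: derivative_eq_intros)
  qed (use assms in simp)
  then have "((\<lambda>t. f (x + t *\<^sub>R v)) has_vector_derivative f' v) (at 0)"
    using linear_scale[OF has_derivative_linear[OF assms], of _ v] by (simp add: has_vector_derivative_def)
  then show ?thesis
    unfolding dir_deriv_def by (rule vector_derivative_at)
qed

lemma has_derivative_dir_deriv:
  assumes "f differentiable (at x)"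
  shows "(f has_derivative (\<lambda>v. dir_deriv v f x)) (at x)"
proof -
  from assms obtain f' where f': "(f has_derivative f') (at x)"
    by (auto simp: differentiable_def)
  then have "f' = (\<lambda>v. dir_deriv v f x)"
    by (simp add: dir_deriv_eq fun_eq_iff)
  with f' show ?thesis by simp
qed

lemma has_vector_derivative_dir_deriv:
  assumes "f differentiable (at (x + t *\<^sub>R v))"
  shows "((\<lambda>t. f (x + t *\<^sub>R v)) has_vector_derivative dir_deriv v f (x + t *\<^sub>R v)) (at t within S)"
proof -
  note d = has_derivative_dir_deriv[OF assms]
  have "((\<lambda>t. f (x + t *\<^sub>R v)) has_derivative (\<lambda>s. dir_deriv (s *\<^sub>R v) f (x + t *\<^sub>R v))) (at t within S)"
  proof (rule has_derivative_compose[where f = "\<lambda>t. x + t *\<^sub>R v"])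
    show "((\<lambda>t. x + t *\<^sub>R v) has_derivative (\<lambda>t. t *\<^sub>R v)) (at t within S)"
      by (auto intro!: derivative_eq_intros)
  qed (use d in simp)
  then show ?thesis
    using linear_scale[OF has_derivative_linear[OF d], of _ v] by (simp add: has_vector_derivative_def)
qed

lemma dir_derivs_append: "dir_derivs (vs @ us) f = dir_derivs vs (dir_derivs us f)"
  by (induction vs) auto

lemma smooth_differentiable:
  assumes "smooth f"
  shows "f differentiable (at x)"
proof -
  have "dir_derivs [] f differentiable_on UNIV"
    using assms unfolding smooth_def by (elim allE[of _ "[]"]) simp
  then show ?thesis by (simp add: differentiable_on_def)
qed

lemma smooth_differentiable_on: "smooth f \<Longrightarrow> f differentiable_on S"
  by (simp add: differentiable_on_def differentiable_at_withinI smooth_differentiable)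

lemma smooth_continuous_on: "smooth f \<Longrightarrow> continuous_on S f"
  by (simp add: differentiable_imp_continuous_on smooth_differentiable_on)

text \<open>An invariant class closed under basis derivatives replaces formulas for iterated
  derivatives: for sums and compositions it is then enough to differentiate once.\<close>

lemma smooth_coinduct [consumes 1, case_names differentiable deriv]:
  assumes "P f"
    and "\<And>g x. P g \<Longrightarrow> g differentiable (at x)"
    and "\<And>g v. P g \<Longrightarrow> v \<in> Basis \<Longrightarrow> P (dir_deriv v g)"
  shows "smooth f"
proof -
  have "P (dir_derivs vs f)" if "set vs \<subseteq> Basis" for vs
    using that assms by (induction vs) auto
  then show ?thesis
    unfolding smooth_def differentiable_on_def using assms(2) by auto
qed

lemma smooth_dir_deriv_Basis:
  assumes "smooth f" "v \<in> Basis"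
  shows "smooth (dir_deriv v f)"
  unfolding smooth_def
proof (intro allI impI)
  fix vs :: "'a list" assume "set vs \<subseteq> Basis"
  then have "dir_derivs (vs @ [v]) f differentiable_on UNIV"
    using assms unfolding smooth_def by (intro assms(1)[unfolded smooth_def, rule_format]) auto
  then show "dir_derivs vs (dir_deriv v f) differentiable_on UNIV"
    by (simp add: dir_derivs_append)
qed

section \<open>Rules of differentiation and closure properties of smooth functions\<close>

lemma dir_deriv_add:
  assumes "\<And>x. f differentiable (at x)" "\<And>x. g differentiable (at x)"
  shows "dir_deriv v (\<lambda>x. f x + g x) = (\<lambda>x. dir_deriv v f x + dir_deriv v g x)"
  by (rule ext, rule dir_deriv_eq[where f' = "\<lambda>v. dir_deriv v f x + dir_deriv v g x" for x])
    (intro has_derivative_add has_derivative_dir_deriv assms)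

lemma dir_deriv_bounded_linear:
  assumes "\<And>x. f differentiable (at x)" "bounded_linear L"
  shows "dir_deriv v (\<lambda>x. L (f x)) = (\<lambda>x. L (dir_deriv v f x))"
  by (rule ext, rule dir_deriv_eq[where f' = "\<lambda>v. L (dir_deriv v f x)" for x])
    (rule bounded_linear.has_derivative[OF assms(2) has_derivative_dir_deriv[OF assms(1)]])

lemma dir_deriv_const [simp]: "dir_deriv v (\<lambda>x. c) = (\<lambda>x. 0)"
  by (rule ext, rule dir_deriv_eq[where f' = "\<lambda>v. 0"]) simp

lemma dir_deriv_mult:
  fixes f g :: "'a::real_normed_vector \<Rightarrow> 'b::real_normed_algebra"
  assumes "\<And>x. f differentiable (at x)" "\<And>x. g differentiable (at x)"
  shows "dir_deriv v (\<lambda>x. f x * g x) = (\<lambda>x. f x * dir_deriv v g x + dir_deriv v f x * g x)"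
  by (rule ext, rule dir_deriv_eq[where f' = "\<lambda>v. f x * dir_deriv v g x + dir_deriv v f x * g x" for x])
    (intro has_derivative_mult has_derivative_dir_deriv assms)

lemma smooth_const: "smooth (\<lambda>x. c)"
  by (rule smooth_coinduct[where P = "\<lambda>f. \<exists>c. f = (\<lambda>x. c)"]) auto

lemma smooth_add:
  fixes f g :: "'a::euclidean_space \<Rightarrow> 'b::real_normed_vector"
  assumes "smooth f" "smooth g"
  shows "smooth (\<lambda>x. f x + g x)"
proof (rule smooth_coinduct[where P = "\<lambda>h. \<exists>f g. smooth f \<and> smooth g \<and> h = (\<lambda>x. f x + g x)"])
  show "\<exists>f' g'. smooth f' \<and> smooth g' \<and> (\<lambda>x. f x + g x) = (\<lambda>x. f' x + g' x)"
    using assms by blast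
next
  fix h :: "'a \<Rightarrow> 'b" and v :: 'a
  assume "\<exists>f g. smooth f \<and> smooth g \<and> h = (\<lambda>x. f x + g x)" and v: "v \<in> Basis"
  then obtain f g where h: "smooth f" "smooth g" "h = (\<lambda>x. f x + g x)" by blast
  then show "\<exists>f g. smooth f \<and> smooth g \<and> dir_deriv v h = (\<lambda>x. f x + g x)"
    using v by (intro exI[of _ "dir_deriv v f"] exI[of _ "dir_deriv v g"])
      (auto simp: smooth_dir_deriv_Basis dir_deriv_add smooth_differentiable)
qed (auto intro!: differentiable_add simp: smooth_differentiable)

lemma smooth_bounded_linear:
  fixes f :: "'a::euclidean_space \<Rightarrow> 'b::real_normed_vector"
    and L :: "'b \<Rightarrow> 'c::real_normed_vector"
  assumes "smooth f" "bounded_linear L"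
  shows "smooth (\<lambda>x. L (f x))"
proof (rule smooth_coinduct[where P = "\<lambda>h. \<exists>f. smooth f \<and> h = (\<lambda>x. L (f x))"])
  show "\<exists>f'. smooth f' \<and> (\<lambda>x. L (f x)) = (\<lambda>x. L (f' x))"
    using assms by blast
next
  fix h :: "'a \<Rightarrow> 'c" and v :: 'a
  assume "\<exists>f. smooth f \<and> h = (\<lambda>x. L (f x))" and v: "v \<in> Basis"
  then obtain f where h: "smooth f" "h = (\<lambda>x. L (f x))" by blast
  then show "\<exists>f. smooth f \<and> dir_deriv v h = (\<lambda>x. L (f x))"
    using v assms by (intro exI[of _ "dir_deriv v f"])
      (auto simp: smooth_dir_deriv_Basis dir_deriv_bounded_linear smooth_differentiable)
next
  fix h :: "'a \<Rightarrow> 'c" and x assume "\<exists>f. smooth f \<and> h = (\<lambda>x. L (f x))"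
  then obtain f where "smooth f" "h = (\<lambda>x. L (f x))" by blast
  then show "h differentiable (at x)"
    using bounded_linear.has_derivative[OF assms(2) has_derivative_dir_deriv[OF smooth_differentiable]]
    by (auto intro!: differentiableI)
qed

lemma smooth_sum:
  assumes "\<And>i. i \<in> A \<Longrightarrow> smooth (f i)"
  shows "smooth (\<lambda>x. \<Sum>i\<in>A. f i x)"
  using assms by (induction A rule: infinite_finite_induct) (auto simp: smooth_const smooth_add)

lemma dir_deriv_expand:
  fixes f :: "'a::euclidean_space \<Rightarrow> 'b::real_normed_vector"
  assumes "f differentiable (at x)"
  shows "dir_deriv v f x = (\<Sum>b\<in>Basis. (v \<bullet> b) *\<^sub>R dir_deriv b f x)"
proof -
  note l = has_derivative_linear[OF has_derivative_dir_deriv[OF assms]]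
  have "dir_deriv (\<Sum>b\<in>Basis. (v \<bullet> b) *\<^sub>R b) f x = (\<Sum>b\<in>Basis. (v \<bullet> b) *\<^sub>R dir_deriv b f x)"
    by (simp only: linear_sum[OF l] linear_scale[OF l])
  then show ?thesis by (simp add: euclidean_representation)
qed

lemma smooth_dir_deriv:
  assumes "smooth f"
  shows "smooth (dir_deriv v f)"
proof -
  have "dir_deriv v f = (\<lambda>x. \<Sum>b\<in>Basis. (v \<bullet> b) *\<^sub>R dir_deriv b f x)"
    using dir_deriv_expand smooth_differentiable[OF assms] by blast
  then show ?thesis
    by (auto intro!: smooth_sum smooth_bounded_linear[OF _ bounded_linear_scaleR_right]
        smooth_dir_deriv_Basis assms)
qed

lemma smooth_dir_derivs: "smooth f \<Longrightarrow> smooth (dir_derivs vs f)"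
  by (induction vs) (auto intro: smooth_dir_deriv)

lemma dir_derivs_const: "dir_derivs vs (\<lambda>x. c) = (\<lambda>x. if vs = [] then c else 0)"
  by (induction vs) auto

lemma dir_derivs_add:
  assumes "smooth f" "smooth g"
  shows "dir_derivs vs (\<lambda>x. f x + g x) = (\<lambda>x. dir_derivs vs f x + dir_derivs vs g x)"
  by (induction vs) (auto simp: dir_deriv_add smooth_differentiable smooth_dir_derivs assms)

lemma dir_derivs_bounded_linear:
  assumes "smooth f" "bounded_linear L"
  shows "dir_derivs vs (\<lambda>x. L (f x)) = (\<lambda>x. L (dir_derivs vs f x))"
  by (induction vs) (simp_all add: dir_deriv_bounded_linear[OF smooth_differentiable[OF smooth_dir_derivs[OF assms(1)]] assms(2)])

lemma dir_derivs_sum: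
  assumes "\<And>i. i \<in> A \<Longrightarrow> smooth (f i)"
  shows "dir_derivs vs (\<lambda>x. \<Sum>i\<in>A. f i x) = (\<lambda>x. \<Sum>i\<in>A. dir_derivs vs (f i) x)"
  using assms
  by (induction A rule: infinite_finite_induct) (auto simp: dir_derivs_add smooth_sum dir_derivs_const)

text \<open>Since A(x + tv) + c = (Ax + c) + tAv, both sides differentiate the same function of one
  real variable; this holds for every f.\<close>

lemma dir_deriv_affine:
  assumes "linear A"
  shows "dir_deriv v (\<lambda>x. f (A x + c)) = (\<lambda>x. dir_deriv (A v) f (A x + c))"
  unfolding dir_deriv_def fun_eq_iff
  by (simp add: linear_add[OF assms] linear_scale[OF assms] algebra_simps)

lemma dir_derivs_affine:
  assumes "linear A"
  shows "dir_derivs vs (\<lambda>x. f (A x + c)) = (\<lambda>x. dir_derivs (map A vs) f (A x + c))"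
  by (induction vs) (simp_all add: dir_deriv_affine[OF assms])

lemma smooth_affine:
  fixes A :: "'a::euclidean_space \<Rightarrow> 'c::euclidean_space"
    and f :: "'c \<Rightarrow> 'b::real_normed_vector"
  assumes "smooth f" "linear A"
  shows "smooth (\<lambda>x. f (A x + c))"
proof (rule smooth_coinduct[where P = "\<lambda>h. \<exists>f. smooth f \<and> h = (\<lambda>x. f (A x + c))"])
  show "\<exists>f'. smooth f' \<and> (\<lambda>x. f (A x + c)) = (\<lambda>x. f' (A x + c))"
    using assms by blast
next
  fix h :: "'a \<Rightarrow> 'b" and v :: 'a
  assume "\<exists>f. smooth f \<and> h = (\<lambda>x. f (A x + c))"
  then obtain f where f: "smooth f" "h = (\<lambda>x. f (A x + c))" by blast
  show "\<exists>f. smooth f \<and> dir_deriv v h = (\<lambda>x. f (A x + c))"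
    unfolding f(2) dir_deriv_affine[OF assms(2)]
    by (rule exI[of _ "dir_deriv (A v) f"]) (simp add: f(1) smooth_dir_deriv)
next
  fix h :: "'a \<Rightarrow> 'b" and x assume "\<exists>f. smooth f \<and> h = (\<lambda>x. f (A x + c))"
  then obtain f where "smooth f" "h = (\<lambda>x. f (A x + c))" by blast
  moreover have "(\<lambda>x. A x + c) differentiable (at x)"
    using assms(2) by (simp add: linear_imp_differentiable)
  ultimately show "h differentiable (at x)"
    using differentiable_chain_at[of "\<lambda>x. A x + c" x f] by (simp add: smooth_differentiable o_def)
qed

text \<open>The mean value inequality is applied twice: in direction v to the u-derivative of f, and
  then in direction u to the difference of f along v. In each case the expected linear term is
  subtracted, so only the oscillation e of the mixed derivative near x remains.\<close>

lemma second_difference_bound: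
  fixes f :: "'a::euclidean_space \<Rightarrow> 'b::real_normed_vector"
  assumes f: "smooth f" and "0 < e"
  shows "\<exists>d>0. \<forall>s. 0 < s \<and> s < d \<longrightarrow>
    norm (f (x + s *\<^sub>R u + s *\<^sub>R v) - f (x + s *\<^sub>R u) - f (x + s *\<^sub>R v) + f x
      - (s * s) *\<^sub>R dir_deriv v (dir_deriv u f) x) \<le> e * s * s"
proof -
  define L where "L = dir_deriv v (dir_deriv u f) x"
  have "isCont (dir_deriv v (dir_deriv u f)) x"
    using smooth_continuous_on[of "dir_deriv v (dir_deriv u f)" UNIV] f
    by (simp add: smooth_dir_deriv continuous_on_eq_continuous_at)
  then have "\<exists>r>0. \<forall>y. dist y x < r \<longrightarrow> dist (dir_deriv v (dir_deriv u f) y) L < e"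
    using \<open>0 < e\<close> by (simp add: continuous_at_eps_delta L_def)
  then obtain r where r: "r > 0"
    and rL': "\<And>y. dist y x < r \<Longrightarrow> dist (dir_deriv v (dir_deriv u f) y) L < e"
    by blast
  have rL: "norm (dir_deriv v (dir_deriv u f) y - L) \<le> e" if "dist y x < r" for y
    using rL'[OF that] by (simp add: dist_norm)
  \<comment> \<open>For s1 and s2 in [0, s] with s < d the point x + s1 u + s2 v stays within r of
    x; the summand 1 keeps the denominator positive when u = v = 0.\<close>
  define d where "d = r / (norm u + norm v + 1)"
  have d: "d > 0" unfolding d_def using r by (auto intro!: divide_pos_pos add_nonneg_pos)
  have "norm (f (x + s *\<^sub>R u + s *\<^sub>R v) - f (x + s *\<^sub>R u) - f (x + s *\<^sub>R v) + f x - (s * s) *\<^sub>R L) \<le> e * s * s"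
    if s: "0 < s" "s < d" for s
  proof -
    have near: "dist (x + s1 *\<^sub>R u + s2 *\<^sub>R v) x < r" if "s1 \<in> {0..s}" "s2 \<in> {0..s}" for s1 s2
    proof -
      have "dist (x + s1 *\<^sub>R u + s2 *\<^sub>R v) x \<le> norm (s1 *\<^sub>R u) + norm (s2 *\<^sub>R v)"
        by (simp add: dist_norm add.assoc norm_triangle_ineq del: norm_scaleR)
      also have "\<dots> \<le> s * norm u + s * norm v"
        using that by (auto intro!: add_mono mult_right_mono)
      also have "\<dots> \<le> s * (norm u + norm v + 1)"
        using s by (simp add: algebra_simps)
      also have "\<dots> < r"
        using s unfolding d_def by (simp add: pos_less_divide_eq add_nonneg_pos)
      finally show ?thesis .
    qed
    have inner: "norm (dir_deriv u f (x + s1 *\<^sub>R u + s *\<^sub>R v) - dir_deriv u f (x + s1 *\<^sub>R u) - s *\<^sub>R L) \<le> e * s"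
      if s1: "s1 \<in> {0..s}" for s1
    proof -
      define g where "g = (\<lambda>t. dir_deriv u f (x + s1 *\<^sub>R u + t *\<^sub>R v) - t *\<^sub>R L)"
      have "norm (g s - g 0) \<le> e * norm (s - 0)"
      proof (rule differentiable_bound[where S = "{0..s}" and f' = "\<lambda>t h. h *\<^sub>R (dir_deriv v (dir_deriv u f) (x + s1 *\<^sub>R u + t *\<^sub>R v) - L)"])
        fix t assume t: "t \<in> {0..s}"
        have "(g has_vector_derivative (dir_deriv v (dir_deriv u f) (x + s1 *\<^sub>R u + t *\<^sub>R v) - L)) (at t within {0..s})"
          unfolding g_def using f
          by (auto intro!: derivative_eq_intros has_vector_derivative_dir_deriv smooth_differentiable smooth_dir_deriv)
        then show "(g has_derivative (\<lambda>h. h *\<^sub>R (dir_deriv v (dir_deriv u f) (x + s1 *\<^sub>R u + t *\<^sub>R v) - L))) (at t within {0..s})"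
          by (simp add: has_vector_derivative_def)
        show "onorm (\<lambda>h. h *\<^sub>R (dir_deriv v (dir_deriv u f) (x + s1 *\<^sub>R u + t *\<^sub>R v) - L)) \<le> e"
          using rL[OF near[OF s1 t]] by (simp add: onorm_scaleR_left bounded_linear_ident onorm_id)
      qed (use s in auto)
      then show ?thesis using s by (simp add: g_def algebra_simps)
    qed
    define g where "g = (\<lambda>t. f (x + s *\<^sub>R v + t *\<^sub>R u) - f (x + t *\<^sub>R u) - t *\<^sub>R (s *\<^sub>R L))"
    have "norm (g s - g 0) \<le> (e * s) * norm (s - 0)"
    proof (rule differentiable_bound[where S = "{0..s}" and f' = "\<lambda>t h. h *\<^sub>R (dir_deriv u f (x + s *\<^sub>R v + t *\<^sub>R u) - dir_deriv u f (x + t *\<^sub>R u) - s *\<^sub>R L)"])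
      fix t assume t: "t \<in> {0..s}"
      have "(g has_vector_derivative (dir_deriv u f (x + s *\<^sub>R v + t *\<^sub>R u) - dir_deriv u f (x + t *\<^sub>R u) - s *\<^sub>R L)) (at t within {0..s})"
        unfolding g_def using f
        by (auto intro!: derivative_eq_intros has_vector_derivative_dir_deriv smooth_differentiable smooth_dir_deriv)
      then show "(g has_derivative (\<lambda>h. h *\<^sub>R (dir_deriv u f (x + s *\<^sub>R v + t *\<^sub>R u) - dir_deriv u f (x + t *\<^sub>R u) - s *\<^sub>R L))) (at t within {0..s})"
        by (simp add: has_vector_derivative_def)
      show "onorm (\<lambda>h. h *\<^sub>R (dir_deriv u f (x + s *\<^sub>R v + t *\<^sub>R u) - dir_deriv u f (x + t *\<^sub>R u) - s *\<^sub>R L)) \<le> e * s"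
        using inner[OF t] by (simp add: onorm_scaleR_left bounded_linear_ident onorm_id add.commute add.left_commute)
    qed (use s in auto)
    then show ?thesis using s by (simp add: g_def algebra_simps)
  qed
  with d show ?thesis unfolding L_def by blast
qed

text \<open>The second difference with steps su and sv is symmetric in u and v and, divided by s^2,
  comes within e of either mixed derivative. If these differed by D, then |D| \<le> 2e, which fails
  for e = |D| / 3.\<close>

lemma dir_deriv_commute:
  fixes f :: "'a::euclidean_space \<Rightarrow> 'b::real_normed_vector"
  assumes f: "smooth f"
  shows "dir_deriv u (dir_deriv v f) = dir_deriv v (dir_deriv u f)"
proof
  fix x
  show "dir_deriv u (dir_deriv v f) x = dir_deriv v (dir_deriv u f) x"
  proof (rule ccontr)
    define D where "D = dir_deriv u (dir_deriv v f) x - dir_deriv v (dir_deriv u f) x"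
    assume "\<not> ?thesis"
    then have D: "norm D > 0" by (simp add: D_def)
    define e where "e = norm D / 3"
    have e: "e > 0" using D by (simp add: e_def)
    obtain d1 where d1: "d1 > 0" "\<And>s. 0 < s \<and> s < d1 \<Longrightarrow>
       norm (f (x + s *\<^sub>R u + s *\<^sub>R v) - f (x + s *\<^sub>R u) - f (x + s *\<^sub>R v) + f x
      - (s * s) *\<^sub>R dir_deriv v (dir_deriv u f) x) \<le> e * s * s"
      using second_difference_bound[OF f e, of x u v] by blast
    obtain d2 where d2: "d2 > 0" "\<And>s. 0 < s \<and> s < d2 \<Longrightarrow>
       norm (f (x + s *\<^sub>R v + s *\<^sub>R u) - f (x + s *\<^sub>R v) - f (x + s *\<^sub>R u) + f x
      - (s * s) *\<^sub>R dir_deriv u (dir_deriv v f) x) \<le> e * s * s"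
      using second_difference_bound[OF f e, of x v u] by blast
    define s where "s = min d1 d2 / 2"
    have s: "0 < s" "s < d1" "s < d2" using d1 d2 by (auto simp: s_def)
    define \<Delta> where "\<Delta> = f (x + s *\<^sub>R u + s *\<^sub>R v) - f (x + s *\<^sub>R u) - f (x + s *\<^sub>R v) + f x"
    have 1: "norm (\<Delta> - (s * s) *\<^sub>R dir_deriv v (dir_deriv u f) x) \<le> e * s * s"
      using d1(2)[of s] s by (simp add: \<Delta>_def)
    have 2: "norm (\<Delta> - (s * s) *\<^sub>R dir_deriv u (dir_deriv v f) x) \<le> e * s * s"
    proof -
      have "x + s *\<^sub>R v + s *\<^sub>R u = x + s *\<^sub>R u + s *\<^sub>R v" by simp
      then have "\<Delta> = f (x + s *\<^sub>R v + s *\<^sub>R u) - f (x + s *\<^sub>R v) - f (x + s *\<^sub>R u) + f x"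
        by (simp add: \<Delta>_def ac_simps)
      then show ?thesis using d2(2)[of s] s by simp
    qed
    have "norm ((s * s) *\<^sub>R D) \<le> e * s * s + e * s * s"
    proof -
      have "(s * s) *\<^sub>R D = (\<Delta> - (s * s) *\<^sub>R dir_deriv v (dir_deriv u f) x)
          - (\<Delta> - (s * s) *\<^sub>R dir_deriv u (dir_deriv v f) x)"
        by (simp add: D_def scaleR_right_diff_distrib)
      then show ?thesis using 1 2 norm_triangle_le_diff[OF add_mono[OF 1 2]] by metis
    qed
    then have "(s * s) * norm D \<le> (s * s) * (2 * e)" using s by simp
    then have "norm D \<le> 2 * e" using s by simp
    then show False using D by (simp add: e_def)
  qed
qed

lemma dir_derivs_dir_deriv_commute:
  assumes "smooth f"
  shows "dir_derivs vs (dir_deriv v f) = dir_deriv v (dir_derivs vs f)"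
  by (induction vs) (auto simp: dir_deriv_commute smooth_dir_derivs assms)

text \<open>Symmetry of second derivatives moves any direction to the front. This makes the
  arbitrary order of differentiation in \<open>mi_deriv\<close> harmless and allows derivatives to
  be sorted by groups of variables.\<close>

lemma dir_derivs_mset:
  assumes "smooth f" "mset vs = mset us"
  shows "dir_derivs vs f = dir_derivs us f"
  using assms(2)
proof (induction vs arbitrary: us)
  case (Cons v vs)
  then have "v \<in> set us" by (metis list.set_intros(1) mset_eq_setD)
  then obtain us1 us2 where us: "us = us1 @ v # us2" by (meson split_list)
  then have "dir_derivs vs f = dir_derivs (us1 @ us2) f"
    using Cons by (intro Cons.IH) auto
  then show ?case
    using dir_derivs_dir_deriv_commute[OF smooth_dir_derivs[OF assms(1)], of us1 v us2]
    by (simp add: us dir_derivs_append)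
qed simp

text \<open>Words in the basis instead of multi-indices: iterated derivatives in arbitrary
  directions then expand by multilinearity, without multinomial coefficients. These appear when
  words are grouped by multi-index, in \<open>sum_basis_lists_multi_index\<close>.\<close>

definition basis_lists :: "nat \<Rightarrow> 'a::euclidean_space list set" where
  "basis_lists k = {bs. set bs \<subseteq> Basis \<and> length bs = k}"

definition coeff_prod :: "'a::euclidean_space list \<Rightarrow> 'a list \<Rightarrow> real" where
  "coeff_prod vs bs = prod_list (map2 (\<bullet>) vs bs)"

lemma finite_basis_lists [simp]: "finite (basis_lists k)"
  unfolding basis_lists_def by (rule finite_lists_length_eq) simp

lemma basis_lists_0 [simp]: "basis_lists 0 = {[]}"
  by (auto simp: basis_lists_def)

lemma sum_basis_lists_Suc:
  fixes h :: "'a::euclidean_space list \<Rightarrow> 'b::comm_monoid_add"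
  shows "(\<Sum>bs\<in>basis_lists (Suc k). h bs) = (\<Sum>b\<in>Basis. \<Sum>bs\<in>basis_lists k. h (b # bs))"
proof -
  have "basis_lists (Suc k) = (\<lambda>(b::'a, bs). b # bs) ` (Basis \<times> basis_lists k)"
    unfolding basis_lists_def by (auto simp: length_Suc_conv image_iff)
  then show ?thesis
    by (simp only:) (subst sum.reindex, auto simp: inj_on_def sum.cartesian_product split_beta)
qed

lemma dir_derivs_expand:
  fixes f :: "'a::euclidean_space \<Rightarrow> 'b::real_normed_vector"
  assumes "smooth f"
  shows "dir_derivs vs f = (\<lambda>x. \<Sum>bs\<in>basis_lists (length vs). coeff_prod vs bs *\<^sub>R dir_derivs bs f x)"
proof (induction vs)
  case (Cons v vs)
  have "dir_derivs (v # vs) f x =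
     (\<Sum>bs\<in>basis_lists (length (v # vs)). coeff_prod (v # vs) bs *\<^sub>R dir_derivs bs f x)" for x
  proof -
    have "dir_derivs (v # vs) f x = dir_derivs [v] (\<lambda>x. \<Sum>bs\<in>basis_lists (length vs). coeff_prod vs bs *\<^sub>R dir_derivs bs f x) x"
      using Cons by simp
    also have "\<dots> = (\<Sum>bs\<in>basis_lists (length vs). coeff_prod vs bs *\<^sub>R dir_deriv v (dir_derivs bs f) x)"
      by (subst dir_derivs_sum)
        (auto intro!: smooth_bounded_linear[OF _ bounded_linear_scaleR_right] smooth_dir_derivs assms sum.cong
          simp: dir_deriv_bounded_linear[OF _ bounded_linear_scaleR_right] smooth_differentiable smooth_dir_derivs assms)
    also have "\<dots> = (\<Sum>bs\<in>basis_lists (length vs). \<Sum>b\<in>Basis. (coeff_prod vs bs * (v \<bullet> b)) *\<^sub>R dir_derivs (b # bs) f x)"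
      by (intro sum.cong refl, subst dir_deriv_expand)
        (auto simp: smooth_differentiable smooth_dir_derivs assms scaleR_sum_right)
    also have "\<dots> = (\<Sum>b\<in>Basis. \<Sum>bs\<in>basis_lists (length vs). coeff_prod (v # vs) (b # bs) *\<^sub>R dir_derivs (b # bs) f x)"
      by (subst sum.swap) (simp add: coeff_prod_def mult.commute)
    finally show ?thesis by (simp add: sum_basis_lists_Suc)
  qed
  then show ?case by blast
qed (simp add: coeff_prod_def)

lemma abs_coeff_prod_le:
  "bs \<in> basis_lists (length vs) \<Longrightarrow> \<bar>coeff_prod vs bs\<bar> \<le> prod_list (map norm vs)"
proof (induction vs arbitrary: bs)
  case (Cons v vs)
  then obtain b bs' where bs: "bs = b # bs'" "b \<in> Basis" "bs' \<in> basis_lists (length vs)"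
    by (auto simp: basis_lists_def length_Suc_conv)
  have "\<bar>v \<bullet> b\<bar> * \<bar>coeff_prod vs bs'\<bar> \<le> norm v * prod_list (map norm vs)"
    using Cons.IH[OF bs(3)] Basis_le_norm[OF bs(2), of v] by (intro mult_mono) auto
  then show ?case by (simp add: bs coeff_prod_def abs_mult)
qed (simp add: coeff_prod_def)

section \<open>Uniform symbol estimates\<close>

lemma norm_dir_derivs_le:
  fixes f :: "'a::euclidean_space \<Rightarrow> 'b::real_normed_vector"
  assumes "smooth f"
  shows "norm (dir_derivs vs f x) \<le>
    prod_list (map norm vs) * (\<Sum>bs\<in>basis_lists (length vs). norm (dir_derivs bs f x))"
proof -
  have "norm (dir_derivs vs f x) \<le>
      (\<Sum>bs\<in>basis_lists (length vs). \<bar>coeff_prod vs bs\<bar> * norm (dir_derivs bs f x))"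
    by (subst dir_derivs_expand[OF assms]) (rule order_trans[OF norm_sum], simp)
  also have "\<dots> \<le> (\<Sum>bs\<in>basis_lists (length vs). prod_list (map norm vs) * norm (dir_derivs bs f x))"
    by (intro sum_mono mult_right_mono abs_coeff_prod_le) auto
  finally show ?thesis by (simp add: sum_distrib_left)
qed

text \<open>The bounds are uniform in the index \<open>i\<close>.  Families indexed by the cutoff parameter
  \<open>\<epsilon>\<close>, with \<open>\<epsilon>\<close> as a factor of the weight, turn every limit \<open>\<epsilon> \<rightarrow> 0\<close> into an estimate.\<close>

definition symb ::
  "'i set \<Rightarrow> ('i \<Rightarrow> 'a::euclidean_space \<Rightarrow> real) \<Rightarrow> ('i \<Rightarrow> 'a \<Rightarrow> 'b::real_normed_vector) \<Rightarrow> bool" where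
  "symb I W f \<longleftrightarrow> (\<forall>i\<in>I. smooth (f i)) \<and> (\<forall>i\<in>I. \<forall>x. 0 \<le> W i x) \<and>
     (\<forall>vs. \<exists>C. \<forall>i\<in>I. \<forall>x. norm (dir_derivs vs (f i) x) \<le> C * W i x)"

lemma symb_smooth: "symb I W f \<Longrightarrow> i \<in> I \<Longrightarrow> smooth (f i)"
  by (simp add: symb_def)

lemma symb_nonneg: "symb I W f \<Longrightarrow> i \<in> I \<Longrightarrow> 0 \<le> W i x"
  by (simp add: symb_def)

lemma symb_derivs_bound:
  assumes "symb I W f"
  obtains C where "0 \<le> C" "\<And>i x. i \<in> I \<Longrightarrow> norm (dir_derivs vs (f i) x) \<le> C * W i x"
proof -
  from assms obtain C where C: "\<And>i x. i \<in> I \<Longrightarrow> norm (dir_derivs vs (f i) x) \<le> C * W i x"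
    unfolding symb_def by meson
  have "norm (dir_derivs vs (f i) x) \<le> max C 0 * W i x" if "i \<in> I" for i x
    using C[OF that, of x] mult_right_mono[OF max.cobounded1[of C 0] symb_nonneg[OF assms that, of x]]
    by linarith
  then show ?thesis using that[of "max C 0"] by simp
qed

lemma symb_bound:
  assumes "symb I W f"
  obtains C where "0 \<le> C" "\<And>i x. i \<in> I \<Longrightarrow> norm (f i x) \<le> C * W i x"
  using symb_derivs_bound[OF assms, of "[]"] by auto

text \<open>By multilinearity the constant for an arbitrary word comes from the finitely many basis
  words of the same length.\<close>

lemma symbI_Basis:
  fixes f :: "'i \<Rightarrow> 'a::euclidean_space \<Rightarrow> 'b::real_normed_vector"
  assumes "\<And>i. i \<in> I \<Longrightarrow> smooth (f i)" "\<And>i x. i \<in> I \<Longrightarrow> 0 \<le> W i x"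
    and "\<And>vs. set vs \<subseteq> Basis \<Longrightarrow> \<exists>C. \<forall>i\<in>I. \<forall>x. norm (dir_derivs vs (f i) x) \<le> C * W i x"
  shows "symb I W f"
  unfolding symb_def
proof (intro conjI allI)
  fix vs :: "'a list"
  have "\<forall>bs\<in>basis_lists (length vs). \<exists>C. \<forall>i\<in>I. \<forall>x. norm (dir_derivs bs (f i) x) \<le> C * W i x"
    using assms(3) by (auto simp: basis_lists_def)
  then obtain C where C: "\<And>bs i x. bs \<in> basis_lists (length vs) \<Longrightarrow> i \<in> I \<Longrightarrow>
      norm (dir_derivs bs (f i) x) \<le> C bs * W i x"
    by metis
  have "norm (dir_derivs vs (f i) x) \<le> (prod_list (map norm vs) * sum C (basis_lists (length vs))) * W i x"
    if "i \<in> I" for i x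
  proof -
    have "norm (dir_derivs vs (f i) x) \<le>
        prod_list (map norm vs) * (\<Sum>bs\<in>basis_lists (length vs). norm (dir_derivs bs (f i) x))"
      by (rule norm_dir_derivs_le[OF assms(1)[OF that]])
    also have "\<dots> \<le> prod_list (map norm vs) * (\<Sum>bs\<in>basis_lists (length vs). C bs * W i x)"
      using that by (intro mult_left_mono sum_mono C prod_list_nonneg) auto
    finally show ?thesis by (simp add: sum_distrib_right mult.assoc)
  qed
  then show "\<exists>C. \<forall>i\<in>I. \<forall>x. norm (dir_derivs vs (f i) x) \<le> C * W i x" by blast
qed (use assms in auto)

text \<open>As for smoothness, one derivative at a time. Every member of the invariant class has to
  satisfy the bound with the same weight, though with its own constant.\<close>

lemma symb_coinduct [consumes 2, case_names differentiable bound deriv]: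
  fixes f :: "'i \<Rightarrow> 'a::euclidean_space \<Rightarrow> 'b::real_normed_vector"
  assumes "P f" "\<And>i x. i \<in> I \<Longrightarrow> 0 \<le> W i x"
    and diff: "\<And>g i x. P g \<Longrightarrow> i \<in> I \<Longrightarrow> g i differentiable (at x)"
    and bnd: "\<And>g. P g \<Longrightarrow> \<exists>C. \<forall>i\<in>I. \<forall>x. norm (g i x) \<le> C * W i x"
    and der: "\<And>g v. P g \<Longrightarrow> v \<in> Basis \<Longrightarrow> P (\<lambda>i. dir_deriv v (g i))"
  shows "symb I W f"
proof -
  have P: "P (\<lambda>i. dir_derivs vs (f i))" if "set vs \<subseteq> Basis" for vs
    using that by (induction vs) (auto intro: der assms(1))
  show ?thesis
  proof (rule symbI_Basis)
    fix i assume "i \<in> I"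
    then show "smooth (f i)"
      unfolding smooth_def differentiable_on_def using diff[OF P] by auto
  next
    fix vs :: "'a list" assume "set vs \<subseteq> Basis"
    from bnd[OF P[OF this]] show "\<exists>C. \<forall>i\<in>I. \<forall>x. norm (dir_derivs vs (f i) x) \<le> C * W i x" .
  qed (use assms in auto)
qed

lemma symb_dir_derivs:
  assumes "symb I W f"
  shows "symb I W (\<lambda>i. dir_derivs vs (f i))"
  unfolding symb_def
proof (intro conjI ballI allI)
  fix us
  show "\<exists>C. \<forall>i\<in>I. \<forall>x. norm (dir_derivs us (dir_derivs vs (f i)) x) \<le> C * W i x"
    using symb_derivs_bound[OF assms, of "us @ vs"] by (metis dir_derivs_append)
qed (use assms in \<open>auto simp: symb_def smooth_dir_derivs\<close>)

lemma symb_dir_deriv: "symb I W f \<Longrightarrow> symb I W (\<lambda>i. dir_deriv v (f i))"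
  using symb_dir_derivs[of I W f "[v]"] by simp

section \<open>Closure properties of the symbol estimates\<close>

lemma symb_mono:
  assumes f: "symb I W f"
    and "\<And>i x. i \<in> I \<Longrightarrow> W i x \<le> C * W' i x" "\<And>i x. i \<in> I \<Longrightarrow> 0 \<le> W' i x"
  shows "symb I W' f"
  unfolding symb_def
proof (intro conjI allI)
  fix vs
  obtain D where D: "0 \<le> D" "\<And>i x. i \<in> I \<Longrightarrow> norm (dir_derivs vs (f i) x) \<le> D * W i x"
    using symb_derivs_bound[OF f] by blast
  have "norm (dir_derivs vs (f i) x) \<le> (D * C) * W' i x" if "i \<in> I" for i x
    using D(2)[OF that, of x] mult_left_mono[OF assms(2)[OF that, of x] D(1)] by (simp add: mult.assoc)
  then show "\<exists>C. \<forall>i\<in>I. \<forall>x. norm (dir_derivs vs (f i) x) \<le> C * W' i x" by blast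
qed (use assms in \<open>auto simp: symb_def\<close>)

lemma symb_weight_eq:
  "symb I W f \<Longrightarrow> (\<And>i x. i \<in> I \<Longrightarrow> W i x = W' i x) \<Longrightarrow> symb I W' f"
  by (simp add: symb_def)

lemma symb_cong:
  "(\<And>i. i \<in> I \<Longrightarrow> f i = g i) \<Longrightarrow> symb I W f \<longleftrightarrow> symb I W g"
  by (simp add: symb_def)

lemma symb_reindex:
  assumes "symb I W f" "\<And>j. j \<in> J \<Longrightarrow> h j \<in> I"
  shows "symb J (\<lambda>j. W (h j)) (\<lambda>j. f (h j))"
  using assms unfolding symb_def by meson

lemma symb_single:
  assumes "symb I W f" "i \<in> I"
  shows "symb J (\<lambda>_. W i) (\<lambda>_. f i)"
  using symb_reindex[OF assms(1), of J "\<lambda>_. i"] assms(2) by simp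

lemma symb_bounded_linear:
  assumes f: "symb I W f" and L: "bounded_linear L"
  shows "symb I W (\<lambda>i x. L (f i x))"
  unfolding symb_def
proof (intro conjI allI ballI)
  fix vs
  obtain D where D: "0 \<le> D" "\<And>i x. i \<in> I \<Longrightarrow> norm (dir_derivs vs (f i) x) \<le> D * W i x"
    using symb_derivs_bound[OF f] by blast
  obtain K where K: "0 \<le> K" "\<And>x. norm (L x) \<le> norm x * K"
    using bounded_linear.nonneg_bounded[OF L] by blast
  have "norm (dir_derivs vs (\<lambda>x. L (f i x)) x) \<le> (D * K) * W i x" if "i \<in> I" for i x
    using order_trans[OF K(2) mult_right_mono[OF D(2)[OF that, of x] K(1)]]
    by (simp add: dir_derivs_bounded_linear[OF symb_smooth[OF f that] L] ac_simps)
  then show "\<exists>C. \<forall>i\<in>I. \<forall>x. norm (dir_derivs vs (\<lambda>x. L (f i x)) x) \<le> C * W i x" by blast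
qed (use f in \<open>auto simp: symb_def intro: smooth_bounded_linear[OF _ L]\<close>)

lemma symb_cmult:
  fixes f :: "'i \<Rightarrow> 'a::euclidean_space \<Rightarrow> complex"
  shows "symb I W f \<Longrightarrow> symb I W (\<lambda>i x. c * f i x)"
  by (rule symb_bounded_linear[OF _ bounded_linear_mult_right])

lemma symb_uminus: "symb I W f \<Longrightarrow> symb I W (\<lambda>i x. - f i x)"
  by (rule symb_bounded_linear[OF _ bounded_linear_minus[OF bounded_linear_ident]])

lemma symb_add:
  assumes f: "symb I W f" and g: "symb I W g"
  shows "symb I W (\<lambda>i x. f i x + g i x)"
  unfolding symb_def
proof (intro conjI allI)
  fix vs
  obtain C where C: "0 \<le> C" "\<And>i x. i \<in> I \<Longrightarrow> norm (dir_derivs vs (f i) x) \<le> C * W i x"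
    using symb_derivs_bound[OF f] by blast
  obtain D where D: "0 \<le> D" "\<And>i x. i \<in> I \<Longrightarrow> norm (dir_derivs vs (g i) x) \<le> D * W i x"
    using symb_derivs_bound[OF g] by blast
  have "norm (dir_derivs vs (\<lambda>x. f i x + g i x) x) \<le> (C + D) * W i x" if "i \<in> I" for i x
    using norm_triangle_le[OF add_mono[OF C(2)[OF that, of x] D(2)[OF that, of x]]]
    by (simp add: dir_derivs_add[OF symb_smooth[OF f that] symb_smooth[OF g that]] algebra_simps)
  then show "\<exists>C. \<forall>i\<in>I. \<forall>x. norm (dir_derivs vs (\<lambda>x. f i x + g i x) x) \<le> C * W i x" by blast
qed (use f g in \<open>auto simp: symb_def intro: smooth_add\<close>)

lemma symb_const:
  "symb I (\<lambda>_ _. 1) (\<lambda>_ _. c)"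
  unfolding symb_def by (auto simp: smooth_const dir_derivs_const intro!: exI[of _ "norm c"])

lemma symb_zero:
  assumes "\<And>i x. i \<in> I \<Longrightarrow> 0 \<le> W i x"
  shows "symb I W (\<lambda>_ _. 0)"
  using assms unfolding symb_def by (auto simp: smooth_const dir_derivs_const intro!: exI[of _ 0])

lemma symb_sum:
  assumes "\<And>j. j \<in> A \<Longrightarrow> symb I W (f j)" "\<And>i x. i \<in> I \<Longrightarrow> 0 \<le> W i x"
  shows "symb I W (\<lambda>i x. \<Sum>j\<in>A. f j i x)"
  using assms by (induction A rule: infinite_finite_induct) (auto simp: symb_zero intro: symb_add)

text \<open>Sums of products of symbols with the two weights are closed under the product rule, and
  this stands in for the general Leibniz formula. The rule \<open>cong\<close> is there because
  derivatives are computed for indices in I, while the values at other indices are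
  arbitrary.\<close>

inductive product_sum ::
  "'i set \<Rightarrow> ('i \<Rightarrow> 'a::euclidean_space \<Rightarrow> real) \<Rightarrow> ('i \<Rightarrow> 'a \<Rightarrow> real) \<Rightarrow> ('i \<Rightarrow> 'a \<Rightarrow> complex) \<Rightarrow> bool"
  for I W1 W2 where
  product: "symb I W1 f \<Longrightarrow> symb I W2 g \<Longrightarrow> product_sum I W1 W2 (\<lambda>i x. f i x * g i x)"
| plus: "product_sum I W1 W2 f \<Longrightarrow> product_sum I W1 W2 g \<Longrightarrow> product_sum I W1 W2 (\<lambda>i x. f i x + g i x)"
| cong: "product_sum I W1 W2 f \<Longrightarrow> (\<And>i. i \<in> I \<Longrightarrow> f i = g i) \<Longrightarrow> product_sum I W1 W2 g"

lemma product_sum_differentiable: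
  "product_sum I W1 W2 h \<Longrightarrow> i \<in> I \<Longrightarrow> h i differentiable (at x)"
proof (induction arbitrary: x rule: product_sum.induct)
  case (cong f g)
  then show ?case by metis
qed (auto intro!: differentiable_mult differentiable_add dest!: symb_smooth simp: smooth_differentiable)

lemma product_sum_dir_deriv:
  "product_sum I W1 W2 h \<Longrightarrow> product_sum I W1 W2 (\<lambda>i. dir_deriv v (h i))"
proof (induction rule: product_sum.induct)
  case (product f g)
  have "product_sum I W1 W2 (\<lambda>i x. f i x * dir_deriv v (g i) x + dir_deriv v (f i) x * g i x)"
    by (rule product_sum.plus; rule product_sum.product) (auto intro: product symb_dir_deriv)
  then show ?case
    by (rule product_sum.cong)
      (auto simp: dir_deriv_mult[OF smooth_differentiable smooth_differentiable] symb_smooth[OF product(1)] symb_smooth[OF product(2)])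
next
  case (plus f g)
  show ?case
    by (rule product_sum.cong[OF product_sum.plus[OF plus.IH]])
      (auto simp: dir_deriv_add[OF product_sum_differentiable[OF plus.hyps(1)] product_sum_differentiable[OF plus.hyps(2)]])
next
  case (cong f g)
  show ?case by (rule product_sum.cong[OF cong.IH]) (simp add: cong.hyps)
qed

lemma product_sum_bound:
  "product_sum I W1 W2 h \<Longrightarrow> \<exists>C. \<forall>i\<in>I. \<forall>x. norm (h i x) \<le> C * (W1 i x * W2 i x)"
proof (induction rule: product_sum.induct)
  case (product f g)
  obtain C where C: "0 \<le> C" "\<And>i x. i \<in> I \<Longrightarrow> norm (f i x) \<le> C * W1 i x"
    using symb_bound[OF product(1)] by blast
  obtain D where D: "0 \<le> D" "\<And>i x. i \<in> I \<Longrightarrow> norm (g i x) \<le> D * W2 i x"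
    using symb_bound[OF product(2)] by blast
  have "norm (f i x * g i x) \<le> (C * D) * (W1 i x * W2 i x)" if "i \<in> I" for i x
  proof -
    have "norm (f i x) * norm (g i x) \<le> (C * W1 i x) * (D * W2 i x)"
      using C(1) symb_nonneg[OF product(1) that] by (intro mult_mono C(2) D(2) that) auto
    then show ?thesis by (simp add: norm_mult ac_simps)
  qed
  then show ?case by blast
next
  case (plus f g)
  then obtain C D where C: "\<And>i x. i \<in> I \<Longrightarrow> norm (f i x) \<le> C * (W1 i x * W2 i x)"
    and D: "\<And>i x. i \<in> I \<Longrightarrow> norm (g i x) \<le> D * (W1 i x * W2 i x)" by blast
  have "norm (f i x + g i x) \<le> (C + D) * (W1 i x * W2 i x)" if "i \<in> I" for i x
    using norm_triangle_le[OF add_mono[OF C[OF that, of x] D[OF that, of x]]] by (simp add: algebra_simps)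
  then show ?case by blast
next
  case (cong f g)
  then show ?case by metis
qed

lemma symb_mult:
  fixes f g :: "'i \<Rightarrow> 'a::euclidean_space \<Rightarrow> complex"
  assumes "symb I W1 f" "symb I W2 g"
  shows "symb I (\<lambda>i x. W1 i x * W2 i x) (\<lambda>i x. f i x * g i x)"
  by (rule symb_coinduct[where P = "product_sum I W1 W2"])
    (auto intro: product_sum.product assms product_sum_differentiable product_sum_bound product_sum_dir_deriv
      mult_nonneg_nonneg symb_nonneg[OF assms(1)] symb_nonneg[OF assms(2)])

text \<open>The linear parts may vary with the index as long as the images of each vector stay
  bounded, which bounds the directions produced by the chain rule; the translations are
  unrestricted. Taylor parameters enter through the linear parts, points treated as indices through
  the translations.\<close>

lemma symb_affine:
  fixes f :: "'i \<Rightarrow> 'a::euclidean_space \<Rightarrow> 'b::real_normed_vector"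
    and A :: "'i \<Rightarrow> 'c::euclidean_space \<Rightarrow> 'a"
  assumes f: "symb I W f" and A: "\<And>i. i \<in> I \<Longrightarrow> linear (A i)"
    and A_bound: "\<And>v. \<exists>C. \<forall>i\<in>I. norm (A i v) \<le> C"
  shows "symb I (\<lambda>i x. W i (A i x + c i)) (\<lambda>i x. f i (A i x + c i))"
  unfolding symb_def
proof (intro conjI allI ballI)
  fix vs :: "'c list"
  obtain K where K: "\<And>v i. i \<in> I \<Longrightarrow> norm (A i v) \<le> K v"
    using A_bound by metis
  have "\<forall>bs. \<exists>C. \<forall>i\<in>I. \<forall>x. norm (dir_derivs bs (f i) x) \<le> C * W i x"
    using f unfolding symb_def by blast
  then obtain C where C: "\<And>bs i x. i \<in> I \<Longrightarrow> norm (dir_derivs bs (f i) x) \<le> C bs * W i x"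
    by metis
  have "norm (dir_derivs vs (\<lambda>x. f i (A i x + c i)) x) \<le>
      (prod_list (map K vs) * (\<Sum>bs\<in>basis_lists (length vs). C bs)) * W i (A i x + c i)"
    if i: "i \<in> I" for i x
  proof -
    have prod: "prod_list (map norm (map (A i) vs)) \<le> prod_list (map K vs)"
    proof (induction vs)
      case (Cons v vs)
      then show ?case
        using K[OF i, of v] order_trans[OF norm_ge_zero K[OF i]]
        by (auto intro!: mult_mono prod_list_nonneg)
    qed simp
    have "norm (dir_derivs (map (A i) vs) (f i) (A i x + c i)) \<le>
      prod_list (map norm (map (A i) vs)) * (\<Sum>bs\<in>basis_lists (length vs). norm (dir_derivs bs (f i) (A i x + c i)))"
      using norm_dir_derivs_le[OF symb_smooth[OF f i], of "map (A i) vs"] by simp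
    also have "\<dots> \<le> prod_list (map K vs) * (\<Sum>bs\<in>basis_lists (length vs). C bs * W i (A i x + c i))"
      using order_trans[OF norm_ge_zero K[OF i]]
      by (intro mult_mono sum_mono C i prod sum_nonneg prod_list_nonneg) auto
    finally show ?thesis
      by (simp add: dir_derivs_affine[OF A[OF i]] sum_distrib_right mult.assoc)
  qed
  then show "\<exists>C. \<forall>i\<in>I. \<forall>x. norm (dir_derivs vs (\<lambda>x. f i (A i x + c i)) x) \<le> C * W i (A i x + c i)"
    by blast
qed (use f A in \<open>auto simp: symb_def intro!: smooth_affine\<close>)

lemma symb_linear:
  assumes "symb I W f" "linear A"
  shows "symb I (\<lambda>i x. W i (A x)) (\<lambda>i x. f i (A x))"
  using symb_affine[OF assms(1), of "\<lambda>_. A" "\<lambda>_. 0"] assms(2) by auto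

section \<open>The weight \<langle>x\<rangle> and Peetre's inequality\<close>

lemma jbracket_ge_1: "1 \<le> jbracket x"
  by (simp add: jbracket_def)

lemma jbracket_pos [simp]: "0 < jbracket x"
  using jbracket_ge_1[of x] by linarith

lemma jbracket_nonneg [simp]: "0 \<le> jbracket x"
  using jbracket_ge_1[of x] by linarith

lemma jbracket_neq_0 [simp]: "jbracket x \<noteq> 0"
  using jbracket_pos[of x] by linarith

lemma jbracket_minus [simp]: "jbracket (- x) = jbracket x"
  by (simp add: jbracket_def)

lemma jbracket_0 [simp]: "jbracket 0 = 1"
  by (simp add: jbracket_def)

lemma norm_le_jbracket: "norm x \<le> jbracket x"
  unfolding jbracket_def by (rule real_le_rsqrt) simp

lemma jbracket_mono: "norm x \<le> norm y \<Longrightarrow> jbracket x \<le> jbracket y"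
  unfolding jbracket_def by (simp add: power_mono)

lemma continuous_on_jbracket [continuous_intros]:
  "continuous_on S f \<Longrightarrow> continuous_on S (\<lambda>x. jbracket (f x))"
  unfolding jbracket_def by (intro continuous_intros)

lemma continuous_on_jbracket_powr [continuous_intros]:
  "continuous_on S f \<Longrightarrow> continuous_on S (\<lambda>x. jbracket (f x) powr s)"
  by (intro continuous_intros) auto

lemma borel_measurable_jbracket [measurable]: "jbracket \<in> borel_measurable borel"
  by (rule borel_measurable_continuous_onI) (intro continuous_intros)

lemma jbracket_fst_le: "jbracket (fst q) \<le> jbracket q"
  by (rule jbracket_mono) (metis norm_fst_le prod.collapse)

lemma jbracket_snd_le: "jbracket (snd q) \<le> jbracket q"
  by (rule jbracket_mono) (metis norm_snd_le prod.collapse)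

lemma jbracket_add_le: "jbracket (x + y) \<le> 2 * jbracket x * jbracket y"
proof -
  have "(norm (x + y))\<^sup>2 \<le> (norm x + norm y)\<^sup>2"
    by (simp add: norm_triangle_ineq power_mono)
  also have "\<dots> \<le> 2 * (norm x)\<^sup>2 + 2 * (norm y)\<^sup>2"
    by (smt (verit) power2_diff power2_sum zero_le_power2)
  finally have "1 + (norm (x + y))\<^sup>2 \<le> 4 * ((1 + (norm x)\<^sup>2) * (1 + (norm y)\<^sup>2))"
    by (simp add: algebra_simps add_nonneg_nonneg) (smt (verit) zero_le_mult_iff zero_le_power2)
  then have "sqrt (1 + (norm (x + y))\<^sup>2) \<le> sqrt (4 * ((1 + (norm x)\<^sup>2) * (1 + (norm y)\<^sup>2)))"
    by simp
  then show ?thesis by (simp add: jbracket_def real_sqrt_mult)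
qed

lemma jbracket_powr_mono: "s \<le> t \<Longrightarrow> jbracket x powr s \<le> jbracket x powr t"
  by (simp add: jbracket_ge_1 powr_mono)

lemma jbracket_powr_ge_1: "0 \<le> s \<Longrightarrow> 1 \<le> jbracket x powr s"
  using jbracket_powr_mono[of 0 s x] by simp

text \<open>For s \<ge> 0 the bound on \<langle>x + y\<rangle> is raised to the power s. For s < 0
  the same bound is applied to x = (x + y) + (-y), and the negative power reverses it.\<close>

lemma peetre: "jbracket (x + y) powr s \<le> 2 powr \<bar>s\<bar> * (jbracket x powr s * jbracket y powr \<bar>s\<bar>)"
proof (cases "0 \<le> s")
  case True
  have "jbracket (x + y) powr s \<le> (2 * jbracket x * jbracket y) powr s"
    using True jbracket_add_le by (intro powr_mono2) auto
  then show ?thesis using True by (simp add: powr_mult mult.assoc)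
next
  case False
  have "jbracket x \<le> 2 * jbracket (x + y) * jbracket y"
    using jbracket_add_le[of "x + y" "- y"] by simp
  then have "(2 * jbracket (x + y) * jbracket y) powr s \<le> jbracket x powr s"
    using False by (intro powr_mono2') auto
  then have *: "2 powr s * jbracket (x + y) powr s * jbracket y powr s \<le> jbracket x powr s"
    by (simp add: powr_mult)
  have "jbracket (x + y) powr s = (2 powr -s * jbracket y powr -s) * (2 powr s * jbracket (x + y) powr s * jbracket y powr s)"
    by (simp add: powr_minus field_simps)
  also have "\<dots> \<le> (2 powr -s * jbracket y powr -s) * jbracket x powr s"
    using * by (intro mult_left_mono) auto
  finally show ?thesis using False by (simp add: ac_simps)
qed

section \<open>Linear functions, reciprocal phase factors and Gaussians as symbols\<close>

lemma symb_inner: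
  fixes v :: "'a::euclidean_space"
  shows "symb I (\<lambda>_. jbracket) (\<lambda>_ q. complex_of_real (q \<bullet> v))"
proof -
  let ?P = "\<lambda>g :: 'b \<Rightarrow> 'a \<Rightarrow> complex. g = (\<lambda>_ q. complex_of_real (q \<bullet> v)) \<or> (\<exists>c. g = (\<lambda>_ _. c))"
  have hd: "((\<lambda>q. complex_of_real (q \<bullet> v)) has_derivative (\<lambda>h. complex_of_real (h \<bullet> v))) (at x)" for x
    by (auto intro!: derivative_eq_intros)
  have dd: "dir_deriv w (\<lambda>q. complex_of_real (q \<bullet> v)) = (\<lambda>_. complex_of_real (w \<bullet> v))" for w
    using dir_deriv_eq[OF hd] by (simp add: fun_eq_iff)
  show ?thesis
  proof (rule symb_coinduct[where P = ?P])
    fix g :: "'b \<Rightarrow> 'a \<Rightarrow> complex" assume "?P g"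
    then show "\<exists>C. \<forall>i\<in>I. \<forall>x. norm (g i x) \<le> C * jbracket x"
    proof
      assume g: "g = (\<lambda>_ q. complex_of_real (q \<bullet> v))"
      have "norm (g i x) \<le> norm v * jbracket x" for i x
        using Cauchy_Schwarz_ineq2[of x v] mult_left_mono[OF norm_le_jbracket[of x] norm_ge_zero[of v]]
        by (simp add: g mult.commute)
      then show ?thesis by blast
    next
      assume "\<exists>c. g = (\<lambda>_ _. c)"
      then obtain c where "g = (\<lambda>_ _. c)" by blast
      then have "norm (g i x) \<le> norm c * jbracket x" for i x
        using mult_left_mono[OF jbracket_ge_1[of x] norm_ge_zero[of c]] by simp
      then show ?thesis by blast
    qed
  qed (use hd in \<open>auto simp: dd intro: differentiableI\<close>)
qed

text \<open>With \<open>u = swap v\<close> and \<open>q = (w, \<theta>)\<close> this is the reciprocal of the factor that \<open>1 - \<partial>\<^sub>v\<close>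
  produces on \<open>e\<^bsup>iw\<cdot>\<theta>\<^esup>\<close>.  Unlike \<open>\<langle>q\<rangle>\<^sup>-\<^sup>2\<close>, which belongs to the Laplacian, it leads to
  first-order steps.\<close>

definition conv_factor :: "'a::real_inner \<Rightarrow> 'a \<Rightarrow> complex" where
  "conv_factor u q = 1 / (1 - \<i> * complex_of_real (q \<bullet> u))"

lemma conv_factor_denom_nonzero: "1 - \<i> * complex_of_real r \<noteq> 0"
  by (auto simp: complex_eq_iff)

lemma norm_conv_factor: "norm (conv_factor u q) = 1 / sqrt (1 + (q \<bullet> u)\<^sup>2)"
proof -
  have "norm (1 - \<i> * complex_of_real (q \<bullet> u)) = sqrt (1 + (q \<bullet> u)\<^sup>2)"
    by (simp add: cmod_def)
  then show ?thesis by (simp add: conv_factor_def norm_divide)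
qed

lemma norm_conv_factor_le_1: "norm (conv_factor u q) \<le> 1"
proof -
  have "1 \<le> sqrt (1 + (q \<bullet> u)\<^sup>2)" by simp
  then show ?thesis unfolding norm_conv_factor by (subst divide_le_eq_1_pos) (auto intro: add_pos_nonneg)
qed

lemma has_derivative_conv_factor:
  "((\<lambda>q. c * conv_factor u q ^ Suc k) has_derivative
     (\<lambda>h. (c * of_nat (Suc k) * \<i> * complex_of_real (h \<bullet> u)) * conv_factor u q ^ Suc (Suc k))) (at q)"
proof -
  have "((\<lambda>q. conv_factor u q) has_derivative (\<lambda>h. \<i> * complex_of_real (h \<bullet> u) * (conv_factor u q)\<^sup>2)) (at q)"
    unfolding conv_factor_def
    by (auto intro!: derivative_eq_intros simp: conv_factor_denom_nonzero power2_eq_square field_simps)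
  from has_derivative_mult_right[OF has_derivative_power[OF this, of "Suc k"], of c]
  show ?thesis by (simp add: power2_eq_square ac_simps)
qed

text \<open>Each derivative is a constant multiple of a higher power of the factor, whose norm is at
  most 1. The weight is kept as the norm itself because the decay is in one direction only; a power
  of \<langle>q\<rangle> results from multiplying over a basis.\<close>

lemma symb_conv_factor:
  "symb I (\<lambda>_ q. norm (conv_factor u q)) (\<lambda>_. conv_factor (u::'a::euclidean_space))"
proof -
  let ?P = "\<lambda>g :: 'b \<Rightarrow> 'a \<Rightarrow> complex. \<exists>c k. g = (\<lambda>_ q. c * conv_factor u q ^ Suc k)"
  show ?thesis
  proof (rule symb_coinduct[where P = ?P])
    show "?P (\<lambda>_. conv_factor u)" by (intro exI[of _ 1] exI[of _ 0]) simp
  next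
    fix g i x assume "?P g"
    then obtain c k where g: "g = (\<lambda>_ q. c * conv_factor u q ^ Suc k)" by blast
    show "g i differentiable (at x)"
      unfolding g using has_derivative_conv_factor by (rule differentiableI)
  next
    fix g assume "?P g"
    then obtain c k where g: "g = (\<lambda>_ q. c * conv_factor u q ^ Suc k)" by blast
    have "norm (g i x) \<le> norm c * norm (conv_factor u x)" for i x
    proof -
      have "norm (conv_factor u x) * norm (conv_factor u x) ^ k \<le> norm (conv_factor u x) * 1"
        by (intro mult_left_mono power_le_one norm_conv_factor_le_1) auto
      then show ?thesis by (simp add: g norm_mult norm_power mult_left_mono)
    qed
    then show "\<exists>C. \<forall>i\<in>I. \<forall>x. norm (g i x) \<le> C * norm (conv_factor u x)" by blast
  next
    fix g v assume "?P g"
    then obtain c k where g: "g = (\<lambda>_ q. c * conv_factor u q ^ Suc k)" by blast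
    show "?P (\<lambda>i. dir_deriv v (g i))"
      unfolding g
      by (intro exI[of _ "c * of_nat (Suc k) * \<i> * complex_of_real (v \<bullet> u)"] exI[of _ "Suc k"] ext)
        (rule dir_deriv_eq[OF has_derivative_conv_factor])
  qed auto
qed

definition gauss :: "'a::real_inner \<Rightarrow> complex" where
  "gauss q = complex_of_real (exp (- (norm q)\<^sup>2 / 2))"

lemma gauss_0 [simp]: "gauss 0 = 1"
  by (simp add: gauss_def)

lemma has_derivative_gauss:
  "(gauss has_derivative (\<lambda>h. - complex_of_real (q \<bullet> h) * gauss q)) (at q)"
proof -
  have "((\<lambda>q. exp (- (q \<bullet> q) / 2)) has_derivative (\<lambda>h. - (q \<bullet> h) * exp (- (q \<bullet> q) / 2))) (at q)"
    by (auto intro!: derivative_eq_intros simp: inner_commute)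
  from bounded_linear.has_derivative[OF bounded_linear_of_real this]
  show ?thesis unfolding gauss_def power2_norm_eq_inner by simp
qed

text \<open>With y = \<langle>q\<rangle>^2 / 2 the Gaussian is exp(1/2 - y), and (y / N)^N \<le> (1
  + y / N)^N \<le> exp y bounds \<langle>q\<rangle>^(2N) = (2y)^N by a multiple of exp y.\<close>

lemma jbracket_powr_gauss_bounded:
  "\<exists>C. \<forall>q. jbracket q powr s * norm (gauss q) \<le> C"
proof -
  obtain m :: nat where m: "s \<le> real m" using real_arch_simple by blast
  \<comment> \<open>The successor makes N positive, as the division by N requires.\<close>
  define N where "N = Suc m"
  have N: "N > 0" by (simp add: N_def)
  have sN: "s \<le> 2 * real N" using m by (simp add: N_def)
  have "jbracket q powr s * norm (gauss q) \<le> (2 * real N) ^ N * exp (1/2)" for q :: 'a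
  proof -
    define y where "y = (1 + (norm q)\<^sup>2) / 2"
    have y: "y \<ge> 0" by (simp add: y_def)
    have "(y / real N) ^ N \<le> (1 + y / real N) ^ N" using y by (intro power_mono) auto
    also have "\<dots> \<le> exp y" using y N by (intro exp_ge_one_plus_x_over_n_power_n) auto
    finally have "y ^ N \<le> real N ^ N * exp y" using N by (simp add: power_divide field_simps)
    moreover have "jbracket q powr (2 * real N) = (2 * y) ^ N"
    proof -
      have "jbracket q powr (2 * real N) = jbracket q ^ (2 * N)"
        using powr_realpow[OF jbracket_pos, of q "2 * N"] by simp
      also have "\<dots> = ((jbracket q)\<^sup>2) ^ N" by (simp add: power_mult)
      also have "(jbracket q)\<^sup>2 = 2 * y"
        unfolding y_def jbracket_def by (simp add: add_nonneg_nonneg)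
      finally show ?thesis .
    qed
    ultimately have "jbracket q powr (2 * real N) \<le> (2 * real N) ^ N * exp y"
      by (simp add: power_mult_distrib)
    then have "jbracket q powr s \<le> (2 * real N) ^ N * exp y"
      using jbracket_powr_mono[OF sN, of q] by linarith
    then have "jbracket q powr s * exp (1/2 - y) \<le> (2 * real N) ^ N * exp y * exp (1/2 - y)"
      by (intro mult_right_mono) auto
    moreover have "norm (gauss q) = exp (1/2 - y)"
      by (simp add: gauss_def y_def field_simps)
    ultimately show ?thesis by (simp add: mult.assoc flip: exp_add)
  qed
  then show ?thesis by blast
qed

text \<open>The invariant class consists of symbols of some order m times the Gaussian: a derivative
  raises m by one, and the Gaussian turns every m into the prescribed s.\<close>

lemma symb_gauss:
  "symb I (\<lambda>_ q. jbracket q powr s) (\<lambda>_. gauss :: 'a::euclidean_space \<Rightarrow> complex)"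
proof -
  let ?P = "\<lambda>g :: 'b \<Rightarrow> 'a \<Rightarrow> complex. \<exists>f m. symb I (\<lambda>_ q. jbracket q powr m) f \<and>
     (\<forall>i\<in>I. g i = (\<lambda>q. f i q * gauss q))"
  have gauss_diff: "gauss differentiable (at x)" for x :: 'a
    using has_derivative_gauss by (rule differentiableI)
  show ?thesis
  proof (rule symb_coinduct[where P = ?P])
    show "?P (\<lambda>_. gauss)"
      by (rule exI[of _ "\<lambda>_ _. 1"], rule exI[of _ 0]) (use symb_const[of I 1] in auto)
  next
    fix g i x assume "?P g" "i \<in> I"
    then obtain f m where "symb I (\<lambda>_ q. jbracket q powr m) f" "g i = (\<lambda>q. f i q * gauss q)" by blast
    then show "g i differentiable (at x)"
      using gauss_diff smooth_differentiable[OF symb_smooth] \<open>i \<in> I\<close> by (auto intro!: differentiable_mult)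
  next
    fix g assume "?P g"
    then obtain f m where f: "symb I (\<lambda>_ q. jbracket q powr m) f"
      and g: "\<And>i. i \<in> I \<Longrightarrow> g i = (\<lambda>q. f i q * gauss q)" by blast
    obtain C where C: "0 \<le> C" "\<And>i x. i \<in> I \<Longrightarrow> norm (f i x) \<le> C * jbracket x powr m"
      using symb_bound[OF f] by blast
    obtain D where D: "\<And>q :: 'a. jbracket q powr (m - s) * norm (gauss q) \<le> D"
      using jbracket_powr_gauss_bounded by blast
    have "norm (g i x) \<le> (C * D) * jbracket x powr s" if "i \<in> I" for i x
    proof -
      have "norm (g i x) \<le> (C * jbracket x powr m) * norm (gauss x)"
        using C(2)[OF that, of x] by (simp add: g[OF that] norm_mult mult_right_mono)
      also have "\<dots> = C * (jbracket x powr (m - s) * norm (gauss x)) * jbracket x powr s"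
        by (simp add: powr_diff)
      also have "\<dots> \<le> C * D * jbracket x powr s"
        using D C(1) by (intro mult_right_mono mult_left_mono) auto
      finally show ?thesis .
    qed
    then show "\<exists>C. \<forall>i\<in>I. \<forall>x. norm (g i x) \<le> C * jbracket x powr s" by blast
  next
    fix g and v :: 'a assume "?P g"
    then obtain f m where f: "symb I (\<lambda>_ q. jbracket q powr m) f"
      and g: "\<And>i. i \<in> I \<Longrightarrow> g i = (\<lambda>q. f i q * gauss q)" by blast
    have 1: "symb I (\<lambda>_ q. jbracket q powr (m + 1)) (\<lambda>i q. f i q * (- complex_of_real (q \<bullet> v)))"
      by (rule symb_weight_eq[OF symb_mult[OF f symb_uminus[OF symb_inner]]]) (simp add: powr_add)
    have 2: "symb I (\<lambda>_ q. jbracket q powr (m + 1)) (\<lambda>i. dir_deriv v (f i))"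
      by (rule symb_mono[OF symb_dir_deriv[OF f], where C = 1]) (auto intro: jbracket_powr_mono)
    have "dir_deriv v (g i) = (\<lambda>q. (f i q * (- complex_of_real (q \<bullet> v)) + dir_deriv v (f i) q) * gauss q)"
      if "i \<in> I" for i
      unfolding g[OF that]
      by (subst dir_deriv_mult[OF smooth_differentiable[OF symb_smooth[OF f that]] gauss_diff])
        (simp add: dir_deriv_eq[OF has_derivative_gauss] algebra_simps)
    then show "?P (\<lambda>i. dir_deriv v (g i))" using symb_add[OF 1 2] by blast
  qed auto
qed

section \<open>Integration\<close>

text \<open>The derivative in t of the Taylor polynomial at x + th with increment (1 - t)h
  telescopes to the integrand. At t = 1 this polynomial is f(x + h), at t = 0 it is the polynomial
  at x.\<close>

lemma taylor_has_integral:
  fixes f :: "'a::euclidean_space \<Rightarrow> complex"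
  assumes f: "smooth f"
  shows "((\<lambda>t. ((1 - t) ^ m / fact m) *\<^sub>R dir_derivs (replicate (Suc m) h) f (x + t *\<^sub>R h)) has_integral
    f (x + h) - (\<Sum>k\<le>m. (1 / fact k) *\<^sub>R dir_derivs (replicate k h) f x)) {0..1}"
proof -
  define D where "D = (\<lambda>k. dir_derivs (replicate k h) f)"
  have D: "((\<lambda>t. D k (x + t *\<^sub>R h)) has_vector_derivative D (Suc k) (x + t *\<^sub>R h)) (at t within S)" for k t S
    unfolding D_def using f
    by (auto intro!: has_vector_derivative_dir_deriv smooth_differentiable smooth_dir_derivs)
  define G where "G = (\<lambda>m t. \<Sum>k\<le>m. ((1 - t) ^ k / fact k) *\<^sub>R D k (x + t *\<^sub>R h))"
  have G: "(G m has_vector_derivative ((1 - t) ^ m / fact m) *\<^sub>R D (Suc m) (x + t *\<^sub>R h)) (at t within S)" for m t S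
  proof (induction m)
    case 0
    then show ?case using D[of 0] by (simp add: G_def)
  next
    case (Suc m)
    have "((\<lambda>t. (1 - t) ^ Suc m / fact (Suc m)) has_real_derivative - ((1 - t) ^ m / fact m)) (at t within S)"
    proof -
      have "((\<lambda>t. 1 - t) has_real_derivative - 1) (at t within S)"
        by (auto intro!: derivative_eq_intros)
      from DERIV_cdivide[OF DERIV_power[OF this, of "Suc m"], of "fact (Suc m)"]
      have "((\<lambda>t. (1 - t) ^ Suc m / fact (Suc m)) has_real_derivative
          - (real (Suc m) * (1 - t) ^ m) / (real (Suc m) * fact m)) (at t within S)"
        by (simp del: power_Suc of_nat_Suc)
      also have "- (real (Suc m) * (1 - t) ^ m) / (real (Suc m) * fact m) = - ((1 - t) ^ m / fact m)"
        unfolding minus_divide_left[symmetric] by (subst mult_divide_mult_cancel_left) auto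
      finally show ?thesis .
    qed
    from has_vector_derivative_add[OF Suc has_vector_derivative_scaleR[OF this D[of "Suc m"]]]
    show ?case by (simp add: G_def)
  qed
  have "((\<lambda>t. ((1 - t) ^ m / fact m) *\<^sub>R D (Suc m) (x + t *\<^sub>R h)) has_integral G m 1 - G m 0) {0..1}"
    by (rule fundamental_theorem_of_calculus) (auto intro: G)
  moreover have "G m 1 = f (x + h)"
    by (simp add: G_def D_def sum.atMost_shift power_0_left if_distrib[of "\<lambda>r. r / _"])
  ultimately show ?thesis by (simp add: G_def D_def)
qed

text \<open>The indicator turns the Taylor remainder into an integral over the whole line, to which
  the results on parameter integrals apply.\<close>

definition taylor_kernel :: "nat \<Rightarrow> real \<Rightarrow> complex" where
  "taylor_kernel m t = complex_of_real (indicator {0..1} t * ((1 - t) ^ m / fact m))"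

lemma borel_measurable_taylor_kernel [measurable]: "taylor_kernel m \<in> borel_measurable borel"
  unfolding taylor_kernel_def by measurable

lemma integrable_taylor_kernel: "integrable lborel (taylor_kernel m)"
proof -
  have "set_integrable lborel {0..1::real} (\<lambda>t. complex_of_real ((1 - t) ^ m / fact m))"
    by (intro borel_integrable_atLeastAtMost' continuous_intros) auto
  then show ?thesis
    by (simp add: set_integrable_def taylor_kernel_def[abs_def] scaleR_conv_of_real of_real_indicator)
qed

lemma taylor_lebesgue:
  fixes f :: "'a::euclidean_space \<Rightarrow> complex"
  assumes f: "smooth f"
  shows "f (x + h) = (\<Sum>k\<le>m. (1 / fact k) *\<^sub>R dir_derivs (replicate k h) f x)
     + (LINT t|lborel. taylor_kernel m t * dir_derivs (replicate (Suc m) h) f (x + t *\<^sub>R h))"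
proof -
  let ?g = "\<lambda>t. ((1 - t) ^ m / fact m) *\<^sub>R dir_derivs (replicate (Suc m) h) f (x + t *\<^sub>R h)"
  have "continuous_on {0..1} (\<lambda>t. dir_derivs (replicate (Suc m) h) f (x + t *\<^sub>R h))"
    by (rule continuous_on_compose2[OF smooth_continuous_on[OF smooth_dir_derivs[OF f], where S = UNIV]])
      (auto intro!: continuous_intros)
  then have "set_integrable lborel {0..1::real} ?g"
    by (intro borel_integrable_atLeastAtMost' continuous_intros) auto
  from set_borel_integral_eq_integral(2)[OF this]
  have "integral {0..1} ?g = (LINT t:{0..1}|lborel. ?g t)" by simp
  also have "\<dots> = (LINT t|lborel. taylor_kernel m t * dir_derivs (replicate (Suc m) h) f (x + t *\<^sub>R h))"
    unfolding set_lebesgue_integral_def taylor_kernel_def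
    by (intro Bochner_Integration.integral_cong) (auto simp: scaleR_conv_of_real of_real_indicator)
  finally show ?thesis
    using integral_unique[OF taylor_has_integral[OF f, of m h x]] by (simp add: algebra_simps)
qed

lemma taylor_first_order_bound:
  fixes f :: "'a::euclidean_space \<Rightarrow> complex"
  assumes f: "smooth f" and "0 \<le> B"
    and B: "\<And>t. t \<in> {0..1} \<Longrightarrow> norm (dir_derivs [h, h] f (x + t *\<^sub>R h)) \<le> B"
  shows "norm (f (x + h) - f x - dir_deriv h f x) \<le> B"
proof -
  have "norm (f (x + h) - (\<Sum>k\<le>1. (1 / fact k) *\<^sub>R dir_derivs (replicate k h) f x)) \<le> B * measure lborel (cbox (0::real) 1)"
  proof (rule has_integral_bound[OF \<open>0 \<le> B\<close>])
    show "((\<lambda>t. ((1 - t) ^ 1 / fact 1) *\<^sub>R dir_derivs (replicate (Suc 1) h) f (x + t *\<^sub>R h)) has_integral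
    f (x + h) - (\<Sum>k\<le>1. (1 / fact k) *\<^sub>R dir_derivs (replicate k h) f x)) (cbox 0 1)"
      using taylor_has_integral[OF f, of 1 h x] by (simp only: box_real)
  next
    fix t :: real assume "t \<in> cbox 0 1"
    then have t: "t \<in> {0..1}" by simp
    have "\<bar>1 - t\<bar> * norm (dir_derivs [h, h] f (x + t *\<^sub>R h)) \<le> 1 * B"
      using t by (intro mult_mono B) auto
    then show "norm (((1 - t) ^ 1 / fact 1) *\<^sub>R dir_derivs (replicate (Suc 1) h) f (x + t *\<^sub>R h)) \<le> B"
      by simp
  qed
  then show ?thesis by (simp add: algebra_simps)
qed

section \<open>Integrals over Euclidean space\<close>

lemma
  fixes f :: "'a::euclidean_space \<Rightarrow> 'b::{banach, second_countable_topology}"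
  shows integrable_lborel_translate: "integrable lborel f \<Longrightarrow> integrable lborel (\<lambda>x. f (x + c))"
    and integral_lborel_translate: "f \<in> borel_measurable borel \<Longrightarrow> (LINT x|lborel. f (x + c)) = (LINT x|lborel. f x)"
proof -
  assume f: "integrable lborel f"
  then have "integrable (distr lborel borel ((+) c)) f" by (simp add: lborel_distr_plus)
  then show "integrable lborel (\<lambda>x. f (x + c))"
    by (subst (asm) integrable_distr_eq) (auto simp: add.commute borel_measurable_integrable[OF f, simplified])
next
  assume f: "f \<in> borel_measurable borel"
  have "(LINT x|lborel. f x) = (LINT x|distr lborel borel ((+) c). f x)" by (simp add: lborel_distr_plus)
  also have "\<dots> = (LINT x|lborel. f (c + x))" using f by (intro integral_distr) auto
  finally show "(LINT x|lborel. f (x + c)) = (LINT x|lborel. f x)" by (simp add: add.commute)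
qed

text \<open>The difference f(x + v) - f(x) has integral 0 by translation invariance. It is also the
  integral over t in [0,1] of the derivative at x + tv, so by Fubini's theorem and translation
  invariance its integral is that of the derivative. Integrability thus replaces compact
  support.\<close>

lemma integral_dir_deriv_eq_0:
  fixes f :: "'a::euclidean_space \<Rightarrow> complex"
  assumes diff: "\<And>x. f differentiable (at x)" and cont: "continuous_on UNIV (dir_deriv v f)"
    and f: "integrable lborel f" and df: "integrable lborel (dir_deriv v f)"
  shows "(LINT x|lborel. dir_deriv v f x) = 0"
proof -
  let ?D = "dir_deriv v f"
  have D_meas [measurable]: "?D \<in> borel_measurable borel"
    using cont by (rule borel_measurable_continuous_onI)
  have f_meas [measurable]: "f \<in> borel_measurable borel"
    using borel_measurable_integrable[OF f] by simp
  let ?F = "\<lambda>t x. complex_of_real (indicator {0..1::real} t) * ?D (x + t *\<^sub>R v)"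
  have int_x: "(LINT x|lborel. norm (?F t x)) = indicator {0..1} t * (LINT x|lborel. norm (?D x))" for t
  proof -
    have "(LINT x|lborel. norm (?D (x + t *\<^sub>R v))) = (LINT x|lborel. norm (?D x))"
      by (rule integral_lborel_translate[where f = "\<lambda>x. norm (?D x)"]) measurable
    then show ?thesis by (simp add: norm_mult)
  qed
  have int: "integrable (lborel \<Otimes>\<^sub>M lborel) (\<lambda>(t, x). ?F t x)"
  proof (rule lborel_pair.Fubini_integrable)
    show "(\<lambda>(t, x). ?F t x) \<in> borel_measurable (lborel \<Otimes>\<^sub>M lborel)" by measurable
    have "integrable lborel (\<lambda>t. indicator {0..1::real} t * (LINT x|lborel. norm (?D x)))"
      by (intro integrable_mult_left integrable_real_indicator) auto
    then show "integrable lborel (\<lambda>t. LINT x|lborel. norm (case (t, x) of (t, x) \<Rightarrow> ?F t x))"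
      by (simp add: int_x)
    show "AE t in lborel. integrable lborel (\<lambda>x. case (t, x) of (t, x) \<Rightarrow> ?F t x)"
      using integrable_lborel_translate[OF df] by (auto intro!: AE_I2)
  qed
  have tay: "(LINT t|lborel. ?F t x) = f (x + v) - f x" for x
  proof -
    have c: "continuous_on {0..1} (\<lambda>t. ?D (x + t *\<^sub>R v))"
      by (intro continuous_on_compose2[OF cont] continuous_intros) auto
    have "((\<lambda>t. ?D (x + t *\<^sub>R v)) has_integral f (x + 1 *\<^sub>R v) - f (x + 0 *\<^sub>R v)) {0..1}"
      by (rule fundamental_theorem_of_calculus)
        (auto intro!: has_vector_derivative_dir_deriv diff)
    then have "integral {0..1} (\<lambda>t. ?D (x + t *\<^sub>R v)) = f (x + v) - f x"
      by (simp add: integral_unique)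
    moreover have "(LINT t|lborel. ?F t x) = (LINT t:{0..1}|lborel. ?D (x + t *\<^sub>R v))"
      unfolding set_lebesgue_integral_def by (simp add: scaleR_conv_of_real)
    ultimately show ?thesis
      using set_borel_integral_eq_integral(2)[OF borel_integrable_atLeastAtMost'[OF c]] by simp
  qed
  have "0 = (LINT x|lborel. f (x + v)) - (LINT x|lborel. f x)"
    by (simp add: integral_lborel_translate)
  also have "\<dots> = (LINT x|lborel. f (x + v) - f x)"
    by (rule Bochner_Integration.integral_diff[symmetric]) (intro integrable_lborel_translate f)+
  also have "\<dots> = (LINT x|lborel. LINT t|lborel. ?F t x)" by (simp add: tay)
  also have "\<dots> = (LINT t|lborel. LINT x|lborel. ?F t x)"
    by (rule lborel_pair.Fubini_integral[OF int])
  also have "\<dots> = (LINT t|lborel. complex_of_real (indicator {0..1::real} t) * (LINT x|lborel. ?D x))"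
    by (simp add: integral_lborel_translate)
  also have "\<dots> = (LINT x|lborel. ?D x)"
    using integral_mult_left_zero[of lborel "\<lambda>t. complex_of_real (indicator {0..1::real} t)" "LINT x|lborel. ?D x"]
    by (simp add: integral_complex_of_real)
  finally show ?thesis by simp
qed

lemma
  fixes g :: "'a::euclidean_space \<Rightarrow> real \<Rightarrow> 'b::{real_normed_field, banach, second_countable_topology}"
  assumes g: "\<And>b. b \<in> Basis \<Longrightarrow> integrable lborel (g b)"
  shows integrable_lborel_prod_Basis: "integrable lborel (\<lambda>x::'a. \<Prod>b\<in>Basis. g b (x \<bullet> b))" (is ?int)
    and integral_lborel_prod_Basis:
      "(LINT x|lborel. (\<Prod>b\<in>Basis. g b (x \<bullet> b))) = (\<Prod>b\<in>Basis. (LINT t|lborel. g b t))" (is ?eq)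
proof -
  interpret product_sigma_finite "\<lambda>_::'a. lborel :: real measure" ..
  let ?T = "\<lambda>f::'a \<Rightarrow> real. \<Sum>b\<in>Basis. f b *\<^sub>R b"
  let ?h = "\<lambda>x::'a. \<Prod>b\<in>Basis. g b (x \<bullet> b)"
  have [measurable]: "g b \<in> borel_measurable borel" if "b \<in> Basis" for b
    using borel_measurable_integrable[OF g[OF that]] by simp
  have T: "?T \<in> measurable (Pi\<^sub>M Basis (\<lambda>_. lborel)) borel" by measurable
  have h: "?h \<in> borel_measurable borel" by measurable
  have hT: "?h (?T f) = (\<Prod>b\<in>Basis. g b (f b))" for f
    by (intro prod.cong) auto
  show ?int
    by (subst lborel_eq, subst integrable_distr_eq[OF T h])
      (unfold hT, intro product_integrable_prod g finite_Basis)
  have "(LINT x|lborel. ?h x) = (LINT f|Pi\<^sub>M Basis (\<lambda>_. lborel). (\<Prod>b\<in>Basis. g b (f b)))"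
    by (subst lborel_eq, subst integral_distr[OF T h]) (simp only: hT)
  also have "\<dots> = (\<Prod>b\<in>Basis. (LINT t|lborel. g b t))"
    by (intro product_integral_prod g finite_Basis)
  finally show ?eq .
qed

lemma integrable_inverse_1_plus_square_lborel: "integrable lborel (\<lambda>x::real. inverse (1 + x\<^sup>2))"
proof -
  have "einterval (-\<infinity>) \<infinity> = UNIV" by (auto simp: einterval_def)
  then show ?thesis using integrable_inverse_1_plus_square by (simp add: set_integrable_def)
qed

text \<open>Every factor 1 + (x\<cdot>b)^2 is at most \<langle>x\<rangle>^2, so the function is
  dominated by a product of functions of one variable. This costs a factor 2 in the exponent, which
  is harmless because any power of decay can be gained by integration by parts.\<close>

lemma integrable_jbracket_powr:
  assumes "s \<le> - 2 * real DIM('a)"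
  shows "integrable lborel (\<lambda>x::'a::euclidean_space. jbracket x powr s)"
proof (rule Bochner_Integration.integrable_bound)
  show "integrable lborel (\<lambda>x::'a. \<Prod>b\<in>Basis. inverse (1 + (x \<bullet> b)\<^sup>2))"
    by (rule integrable_lborel_prod_Basis[where g = "\<lambda>_ t. inverse (1 + t\<^sup>2)"])
      (rule integrable_inverse_1_plus_square_lborel)
  show "(\<lambda>x::'a. jbracket x powr s) \<in> borel_measurable lborel" by measurable
  show "AE x::'a in lborel. norm (jbracket x powr s) \<le> norm (\<Prod>b\<in>Basis. inverse (1 + (x \<bullet> b)\<^sup>2))"
  proof (intro AE_I2)
    fix x :: 'a
    have "(\<Prod>b\<in>Basis. 1 + (x \<bullet> b)\<^sup>2) \<le> (\<Prod>b\<in>(Basis::'a set). (jbracket x)\<^sup>2)"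
    proof (intro prod_mono conjI)
      fix b :: 'a assume "b \<in> Basis"
      from Basis_le_norm[OF this, of x] show "1 + (x \<bullet> b)\<^sup>2 \<le> (jbracket x)\<^sup>2"
        unfolding jbracket_def by (simp add: add_nonneg_nonneg abs_le_square_iff[symmetric])
    qed simp
    also have "\<dots> = jbracket x powr (2 * real DIM('a))"
      using powr_realpow[OF jbracket_pos, of x "2 * DIM('a)"] by (simp add: power_mult)
    finally have *: "(\<Prod>b\<in>Basis. 1 + (x \<bullet> b)\<^sup>2) \<le> jbracket x powr (2 * real DIM('a))" .
    have pos: "0 < (\<Prod>b\<in>Basis. 1 + (x \<bullet> b)\<^sup>2)" by (intro prod_pos) (auto intro: add_pos_nonneg)
    have "jbracket x powr s \<le> jbracket x powr - (2 * real DIM('a))"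
      using assms by (intro jbracket_powr_mono) simp
    also have "\<dots> \<le> inverse (\<Prod>b\<in>Basis. 1 + (x \<bullet> b)\<^sup>2)"
      unfolding powr_minus using * pos by (rule le_imp_inverse_le)
    finally have le: "jbracket x powr s \<le> inverse (\<Prod>b\<in>Basis. 1 + (x \<bullet> b)\<^sup>2)" .
    show "norm (jbracket x powr s) \<le> norm (\<Prod>b\<in>Basis. inverse (1 + (x \<bullet> b)\<^sup>2))"
    proof -
      have "(\<Prod>b\<in>Basis. inverse (1 + (x \<bullet> b)\<^sup>2)) = inverse (\<Prod>b\<in>Basis. 1 + (x \<bullet> b)\<^sup>2)"
        using prod_inversef[of "\<lambda>b. 1 + (x \<bullet> b)\<^sup>2" Basis] by (simp add: o_def)
      then show ?thesis using le pos by simp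
    qed
  qed
qed

section \<open>Differentiation under the integral sign\<close>

lemma
  fixes f :: "'t \<Rightarrow> 'b::{banach, second_countable_topology}"
  assumes "integrable M g" "f \<in> borel_measurable M" "\<And>t. t \<in> space M \<Longrightarrow> norm (f t) \<le> g t"
  shows integrable_norm_le: "integrable M f"
    and norm_integral_le: "norm (integral\<^sup>L M f) \<le> integral\<^sup>L M g"
proof -
  show f: "integrable M f"
    by (rule Bochner_Integration.integrable_bound[OF assms(1,2)])
      (auto intro!: AE_I2 order_trans[OF assms(3) abs_ge_self])
  have "norm (integral\<^sup>L M f) \<le> (LINT t|M. norm (f t))" by simp
  also have "\<dots> \<le> integral\<^sup>L M g"
    using f assms by (intro integral_mono) auto
  finally show "norm (integral\<^sup>L M f) \<le> integral\<^sup>L M g" .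
qed

text \<open>Taylor's formula bounds the error of the linear approximation by |h|^2 times an
  integrable function of t, and this yields the total derivative at once. The estimates are demanded
  on T only, because the Taylor kernel vanishes outside [0,1].\<close>

lemma has_derivative_param_integral:
  fixes g :: "'t \<Rightarrow> 'a::euclidean_space \<Rightarrow> complex"
  assumes g: "\<And>t. t \<in> T \<Longrightarrow> smooth (g t)"
    and bnd: "\<And>vs. \<exists>C. \<forall>t\<in>T. \<forall>x. norm (dir_derivs vs (g t) x) \<le> C * (W x * H t)"
    and W: "continuous_on UNIV W" "\<And>x. 0 \<le> W x" and H: "\<And>t. t \<in> T \<Longrightarrow> 0 \<le> H t"
    and meas: "\<And>vs x. (\<lambda>t. k t * dir_derivs vs (g t) x) \<in> borel_measurable M"
    and kH: "integrable M (\<lambda>t. norm (k t) * H t)"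
    and kT: "\<And>t. t \<in> space M \<Longrightarrow> t \<notin> T \<Longrightarrow> k t = 0"
  shows "((\<lambda>x. LINT t|M. k t * g t x) has_derivative (\<lambda>h. LINT t|M. k t * dir_deriv h (g t) x)) (at x)"
proof -
  have int: "integrable M (\<lambda>t. k t * dir_derivs vs (g t) y)" for vs y
  proof -
    obtain C where C: "\<And>t x. t \<in> T \<Longrightarrow> norm (dir_derivs vs (g t) x) \<le> C * (W x * H t)"
      using bnd by blast
    show ?thesis
    proof (rule Bochner_Integration.integrable_bound)
      show "integrable M (\<lambda>t. (\<bar>C\<bar> * W y) * (norm (k t) * H t))"
        using kH by (rule integrable_mult_right)
      show "AE t in M. norm (k t * dir_derivs vs (g t) y) \<le> norm ((\<bar>C\<bar> * W y) * (norm (k t) * H t))"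
      proof (intro AE_I2)
        fix t assume t: "t \<in> space M"
        show "norm (k t * dir_derivs vs (g t) y) \<le> norm ((\<bar>C\<bar> * W y) * (norm (k t) * H t))"
        proof (cases "t \<in> T")
          case True
          have "norm (dir_derivs vs (g t) y) \<le> \<bar>C\<bar> * (W y * H t)"
            using order_trans[OF C[OF True] mult_right_mono[OF abs_ge_self]] W(2) H[OF True] by auto
          from mult_left_mono[OF this norm_ge_zero[of "k t"]]
          show ?thesis using W(2)[of y] H[OF True] by (simp add: norm_mult abs_mult ac_simps)
        qed (use kT t in auto)
      qed
    qed (rule meas)
  qed
  have int1: "integrable M (\<lambda>t. k t * g t y)" and int2: "integrable M (\<lambda>t. k t * dir_deriv h (g t) y)" for y h
    using int[of "[]"] int[of "[h]"] by simp_all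
  let ?L = "\<lambda>h. LINT t|M. k t * dir_deriv h (g t) x"
  have L_eq: "?L h = (\<Sum>b\<in>Basis. (h \<bullet> b) *\<^sub>R ?L b)" for h
  proof -
    have "?L h = (LINT t|M. (\<Sum>b\<in>Basis. (h \<bullet> b) *\<^sub>R (k t * dir_deriv b (g t) x)))"
    proof (rule Bochner_Integration.integral_cong[OF refl])
      fix t assume "t \<in> space M"
      show "k t * dir_deriv h (g t) x = (\<Sum>b\<in>Basis. (h \<bullet> b) *\<^sub>R (k t * dir_deriv b (g t) x))"
      proof (cases "t \<in> T")
        case True
        show ?thesis
          by (subst dir_deriv_expand[OF smooth_differentiable[OF g[OF True]]]) (simp add: sum_distrib_left)
      qed (use kT \<open>t \<in> space M\<close> in auto)
    qed
    also have "\<dots> = (\<Sum>b\<in>Basis. (LINT t|M. (h \<bullet> b) *\<^sub>R (k t * dir_deriv b (g t) x)))"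
      by (rule Bochner_Integration.integral_sum) (intro integrable_scaleR_right int2)
    finally show ?thesis by simp
  qed
  have bl: "bounded_linear ?L"
    by (subst L_eq) (intro bounded_linear_sum bounded_linear_scaleR_const bounded_linear_inner_left)
  have "\<forall>bs. \<exists>C. \<forall>t\<in>T. \<forall>x. norm (dir_derivs bs (g t) x) \<le> C * (W x * H t)" using bnd by blast
  then obtain C where C: "\<And>bs t x. t \<in> T \<Longrightarrow> norm (dir_derivs bs (g t) x) \<le> C bs * (W x * H t)" by metis
  define C2 where "C2 = (\<Sum>bs\<in>basis_lists 2. \<bar>C bs\<bar>)"
  have C2: "0 \<le> C2" by (simp add: C2_def sum_nonneg)
  \<comment> \<open>The weight W may be unbounded, but the remainder involves it only on the unit
    ball around x, where it is at most B.\<close>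
  have "compact (W ` cball x 1)"
    by (intro compact_continuous_image continuous_on_subset[OF W(1)]) auto
  then obtain B where B: "\<And>y. y \<in> cball x 1 \<Longrightarrow> W y \<le> B"
    using compact_imp_bounded bounded_iff by (metis (no_types, lifting) abs_le_D1 image_eqI real_norm_def)
  have B0: "0 \<le> B" using order_trans[OF W(2) B[of x]] by simp
  define J where "J = (LINT t|M. norm (k t) * H t)"
  have est: "norm ((LINT t|M. k t * g t (x + h)) - (LINT t|M. k t * g t x) - ?L h) \<le> (C2 * B * J) * (norm h)\<^sup>2"
    if h: "norm h \<le> 1" for h
  proof -
    have "(LINT t|M. k t * g t (x + h)) - (LINT t|M. k t * g t x) - ?L h =
        (LINT t|M. k t * (g t (x + h) - g t x - dir_deriv h (g t) x))"
      by (simp add: right_diff_distrib Bochner_Integration.integral_diff Bochner_Integration.integrable_diff int1 int2)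
    also have "norm \<dots> \<le> (LINT t|M. (C2 * B * (norm h)\<^sup>2) * (norm (k t) * H t))"
    proof (rule norm_integral_le)
      have "integrable M (\<lambda>t. k t * (g t (x + h) - g t x - dir_deriv h (g t) x))"
        unfolding right_diff_distrib by (intro Bochner_Integration.integrable_diff int1 int2)
      then show "(\<lambda>t. k t * (g t (x + h) - g t x - dir_deriv h (g t) x)) \<in> borel_measurable M"
        by (rule borel_measurable_integrable)
      show "integrable M (\<lambda>t. (C2 * B * (norm h)\<^sup>2) * (norm (k t) * H t))"
        using kH by (rule integrable_mult_right)
      fix t assume t: "t \<in> space M"
      show "norm (k t * (g t (x + h) - g t x - dir_deriv h (g t) x)) \<le> (C2 * B * (norm h)\<^sup>2) * (norm (k t) * H t)"
      proof (cases "t \<in> T")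
        case True
        have "norm (g t (x + h) - g t x - dir_deriv h (g t) x) \<le> (norm h)\<^sup>2 * (C2 * B * H t)"
        proof (rule taylor_first_order_bound[OF g[OF True]])
          show "0 \<le> (norm h)\<^sup>2 * (C2 * B * H t)" using C2 B0 H[OF True] by simp
          fix s :: real assume s: "s \<in> {0..1}"
          have sx: "W (x + s *\<^sub>R h) \<le> B"
            using s h by (intro B) (auto simp: dist_norm intro: mult_le_one)
          have "norm (dir_derivs [h, h] (g t) (x + s *\<^sub>R h)) \<le>
              prod_list (map norm [h, h]) * (\<Sum>bs\<in>basis_lists (length [h, h]). norm (dir_derivs bs (g t) (x + s *\<^sub>R h)))"
            by (rule norm_dir_derivs_le[OF g[OF True]])
          also have "\<dots> = (norm h)\<^sup>2 * (\<Sum>bs\<in>basis_lists 2. norm (dir_derivs bs (g t) (x + s *\<^sub>R h)))"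
            by (simp add: power2_eq_square numeral_2_eq_2)
          also have "\<dots> \<le> (norm h)\<^sup>2 * (\<Sum>bs\<in>basis_lists 2. \<bar>C bs\<bar> * (B * H t))"
          proof (intro mult_left_mono sum_mono)
            fix bs :: "'a list"
            have "norm (dir_derivs bs (g t) (x + s *\<^sub>R h)) \<le> \<bar>C bs\<bar> * (W (x + s *\<^sub>R h) * H t)"
              using order_trans[OF C[OF True] mult_right_mono[OF abs_ge_self]] W(2) H[OF True] by auto
            also have "\<dots> \<le> \<bar>C bs\<bar> * (B * H t)"
              using sx H[OF True] by (intro mult_left_mono mult_right_mono) auto
            finally show "norm (dir_derivs bs (g t) (x + s *\<^sub>R h)) \<le> \<bar>C bs\<bar> * (B * H t)" .
          qed simp
          also have "\<dots> = (norm h)\<^sup>2 * (C2 * B * H t)" by (simp add: C2_def sum_distrib_right mult.assoc)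
          finally show "norm (dir_derivs [h, h] (g t) (x + s *\<^sub>R h)) \<le> (norm h)\<^sup>2 * (C2 * B * H t)" .
        qed
        from mult_left_mono[OF this norm_ge_zero[of "k t"]] show ?thesis
          by (simp add: norm_mult ac_simps)
      qed (use kT t in auto)
    qed
    also have "\<dots> = (C2 * B * (norm h)\<^sup>2) * J"
      unfolding J_def by (rule integral_mult_right_zero)
    finally show ?thesis by (simp only: ac_simps)
  qed
  define K where "K = \<bar>C2 * B * J\<bar> + 1"
  show ?thesis
    unfolding has_derivative_at_alt
  proof (intro conjI bl allI impI)
    fix e :: real assume e: "0 < e"
    define d where "d = min 1 (e / K)"
    have K: "K > 0" by (simp add: K_def)
    have "norm ((LINT t|M. k t * g t y) - (LINT t|M. k t * g t x) - ?L (y - x)) \<le> e * norm (y - x)"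
      if y: "norm (y - x) < d" for y
    proof -
      have "norm ((LINT t|M. k t * g t y) - (LINT t|M. k t * g t x) - ?L (y - x)) \<le> (C2 * B * J) * (norm (y - x))\<^sup>2"
        using est[of "y - x"] y by (simp add: d_def)
      also have "\<dots> \<le> K * (norm (y - x))\<^sup>2" unfolding K_def by (intro mult_right_mono) auto
      also have "\<dots> = (K * norm (y - x)) * norm (y - x)" by (simp add: power2_eq_square)
      also have "\<dots> \<le> e * norm (y - x)"
        using y K by (intro mult_right_mono) (auto simp: d_def pos_less_divide_eq mult.commute)
      finally show ?thesis .
    qed
    moreover have "d > 0" using e K by (simp add: d_def)
    ultimately show "\<exists>d>0. \<forall>y. norm (y - x) < d \<longrightarrow>
        norm ((LINT t|M. k t * g t y) - (LINT t|M. k t * g t x) - ?L (y - x)) \<le> e * norm (y - x)"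
      by blast
  qed
qed

text \<open>The integration variable is joined to the index, so one family estimate provides bounds
  uniform in t. Differentiation under the integral reproduces the situation with f replaced by its
  derivative; for this reason measurability is demanded of all derivatives.\<close>

lemma symb_param_integral:
  fixes f :: "'t \<Rightarrow> 'i \<Rightarrow> 'a::euclidean_space \<Rightarrow> complex"
  assumes f: "symb (T \<times> I) (\<lambda>(t, i) x. W i x * H t) (\<lambda>(t, i). f t i)"
    and W: "\<And>i. i \<in> I \<Longrightarrow> continuous_on UNIV (W i)" "\<And>i x. i \<in> I \<Longrightarrow> 0 \<le> W i x"
    and H: "\<And>t. t \<in> T \<Longrightarrow> 0 \<le> H t"
    and meas: "\<And>i vs x. i \<in> I \<Longrightarrow> (\<lambda>t. k t * dir_derivs vs (f t i) x) \<in> borel_measurable M"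
    and kH: "integrable M (\<lambda>t. norm (k t) * H t)"
    and kT: "\<And>t. t \<in> space M \<Longrightarrow> t \<notin> T \<Longrightarrow> k t = 0"
  shows "symb I W (\<lambda>i x. LINT t|M. k t * f t i x)"
proof -
  let ?P = "\<lambda>G. \<exists>f. symb (T \<times> I) (\<lambda>(t, i) x. W i x * H t) (\<lambda>(t, i). f t i) \<and>
     (\<forall>i\<in>I. \<forall>vs x. (\<lambda>t. k t * dir_derivs vs (f t i) x) \<in> borel_measurable M) \<and>
     (\<forall>i\<in>I. G i = (\<lambda>x. LINT t|M. k t * f t i x))"
  have der: "((\<lambda>x. LINT t|M. k t * f t i x) has_derivative (\<lambda>h. LINT t|M. k t * dir_deriv h (f t i) x)) (at x)"
    if f: "symb (T \<times> I) (\<lambda>(t, i) x. W i x * H t) (\<lambda>(t, i). f t i)"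
      and meas: "\<forall>i\<in>I. \<forall>vs x. (\<lambda>t. k t * dir_derivs vs (f t i) x) \<in> borel_measurable M"
      and i: "i \<in> I" for f i x
  proof (rule has_derivative_param_integral[where T = T and W = "W i" and H = H])
    show "smooth (f t i)" if "t \<in> T" for t
      using symb_smooth[OF f, of "(t, i)"] that i by simp
    show "\<exists>C. \<forall>t\<in>T. \<forall>x. norm (dir_derivs vs (f t i) x) \<le> C * (W i x * H t)" for vs
      using symb_derivs_bound[OF f, of vs] i by (metis (mono_tags, lifting) SigmaI case_prod_conv)
  qed (use W H meas kH kT i in auto)
  show ?thesis
  proof (rule symb_coinduct[where P = ?P])
    show "?P (\<lambda>i x. LINT t|M. k t * f t i x)" using f meas by blast
  next
    fix G i x assume "?P G" "i \<in> I"
    then obtain f where "symb (T \<times> I) (\<lambda>(t, i) x. W i x * H t) (\<lambda>(t, i). f t i)"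
      "\<forall>i\<in>I. \<forall>vs x. (\<lambda>t. k t * dir_derivs vs (f t i) x) \<in> borel_measurable M"
      "G i = (\<lambda>x. LINT t|M. k t * f t i x)" by blast
    with der[OF this(1,2) \<open>i \<in> I\<close>] show "G i differentiable (at x)" by (auto intro: differentiableI)
  next
    fix G v assume "?P G"
    then obtain f where f: "symb (T \<times> I) (\<lambda>(t, i) x. W i x * H t) (\<lambda>(t, i). f t i)"
      and meas: "\<forall>i\<in>I. \<forall>vs x. (\<lambda>t. k t * dir_derivs vs (f t i) x) \<in> borel_measurable M"
      and G: "\<And>i. i \<in> I \<Longrightarrow> G i = (\<lambda>x. LINT t|M. k t * f t i x)" by blast
    show "?P (\<lambda>i. dir_deriv v (G i))"
    proof (intro exI[of _ "\<lambda>t i. dir_deriv v (f t i)"] conjI ballI allI)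
      show "symb (T \<times> I) (\<lambda>(t, i) x. W i x * H t) (\<lambda>(t, i). dir_deriv v (f t i))"
        using symb_dir_deriv[OF f, of v] by (simp add: case_prod_unfold)
      fix i assume i: "i \<in> I"
      show "(\<lambda>t. k t * dir_derivs vs (dir_deriv v (f t i)) x) \<in> borel_measurable M" for vs x
        using meas[rule_format, OF i, of "vs @ [v]" x] by (simp add: dir_derivs_append)
      show "dir_deriv v (G i) = (\<lambda>x. LINT t|M. k t * dir_deriv v (f t i) x)"
        unfolding G[OF i] by (rule ext, rule dir_deriv_eq[OF der[OF f meas i]])
    qed
  next
    fix G assume "?P G"
    then obtain f where f: "symb (T \<times> I) (\<lambda>(t, i) x. W i x * H t) (\<lambda>(t, i). f t i)"
      and meas: "\<forall>i\<in>I. \<forall>vs x. (\<lambda>t. k t * dir_derivs vs (f t i) x) \<in> borel_measurable M"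
      and G: "\<And>i. i \<in> I \<Longrightarrow> G i = (\<lambda>x. LINT t|M. k t * f t i x)" by blast
    obtain C where C: "0 \<le> C" "\<And>t i x. t \<in> T \<Longrightarrow> i \<in> I \<Longrightarrow> norm (f t i x) \<le> C * (W i x * H t)"
      using symb_bound[OF f] by (metis (mono_tags, lifting) SigmaI case_prod_conv)
    have "norm (G i x) \<le> (C * (LINT t|M. norm (k t) * H t)) * W i x" if i: "i \<in> I" for i x
    proof -
      have b: "norm (k t * f t i x) \<le> (C * W i x) * (norm (k t) * H t)" if "t \<in> space M" for t
      proof (cases "t \<in> T")
        case True
        from mult_left_mono[OF C(2)[OF True i, of x] norm_ge_zero[of "k t"]] show ?thesis
          by (simp add: norm_mult ac_simps)
      qed (use kT that in auto)
      have "norm (G i x) \<le> (LINT t|M. (C * W i x) * (norm (k t) * H t))"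
        unfolding G[OF i]
      proof (rule norm_integral_le)
        show "integrable M (\<lambda>t. (C * W i x) * (norm (k t) * H t))" using kH by (rule integrable_mult_right)
        show "(\<lambda>t. k t * f t i x) \<in> borel_measurable M" using meas[rule_format, OF i, of "[]" x] by simp
      qed (rule b)
      then show ?thesis unfolding integral_mult_right_zero by (simp only: ac_simps)
    qed
    then show "\<exists>C. \<forall>i\<in>I. \<forall>x. norm (G i x) \<le> C * W i x" by blast
  qed (rule W)
qed

section \<open>Oscillatory integrals\<close>

text \<open>A single function is a family over the one-point type, so the results on families apply
  to it.\<close>

abbreviation symb1 :: "('a::euclidean_space \<Rightarrow> real) \<Rightarrow> ('a \<Rightarrow> 'b::real_normed_vector) \<Rightarrow> bool" where
  "symb1 W f \<equiv> symb (UNIV :: unit set) (\<lambda>_. W) (\<lambda>_. f)"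

lemma symb1I: "symb I W f \<Longrightarrow> i \<in> I \<Longrightarrow> symb1 (W i) (f i)"
  by (rule symb_single)

lemma symb1D: "symb1 W f \<Longrightarrow> symb I (\<lambda>_. W) (\<lambda>_. f)"
  by (erule symb_single[where i = "()"]) simp

lemma symb1_smooth: "symb1 W f \<Longrightarrow> smooth f"
  by (erule symb_smooth[where i = "()"]) simp

lemma symb1_nonneg: "symb1 W f \<Longrightarrow> 0 \<le> W x"
  by (erule symb_nonneg[where i = "()"]) simp

lemma symb1_bound:
  assumes "symb1 W f"
  obtains C where "0 \<le> C" "\<And>x. norm (f x) \<le> C * W x"
  using symb_bound[OF assms] by auto

definition osc_phase :: "'e::euclidean_space \<times> 'e \<Rightarrow> complex" where
  "osc_phase q = cis (fst q \<bullet> snd q)"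

lemma norm_osc_phase [simp]: "norm (osc_phase q) = 1"
  by (simp add: osc_phase_def)

lemma inner_swap: "prod.swap p \<bullet> q = p \<bullet> prod.swap q"
  by (cases p; cases q) (simp add: add.commute)

lemma norm_swap [simp]: "norm (prod.swap p) = norm p"
  by (cases p) (simp add: norm_prod_def add.commute)

text \<open>The gradient of w\<cdot>\<theta> at q = (w, \<theta>) is (\<theta>, w), which is the
  source of every \<open>prod.swap\<close>.\<close>

lemma has_derivative_osc_phase:
  "(osc_phase has_derivative (\<lambda>h. \<i> * complex_of_real (q \<bullet> prod.swap h) * osc_phase q)) (at q)"
proof -
  have "((\<lambda>q. \<i> * complex_of_real (fst q \<bullet> snd q)) has_derivative
      (\<lambda>h. \<i> * complex_of_real (fst q \<bullet> snd h + fst h \<bullet> snd q))) (at q)"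
    by (auto intro!: derivative_eq_intros)
  moreover have "(exp has_derivative (\<lambda>h. exp x * h)) (at x)" for x :: complex
    using DERIV_exp[of x] by (simp add: has_field_derivative_def)
  ultimately have "((\<lambda>q. exp (\<i> * complex_of_real (fst q \<bullet> snd q))) has_derivative
      (\<lambda>h. exp (\<i> * complex_of_real (fst q \<bullet> snd q)) * (\<i> * complex_of_real (fst q \<bullet> snd h + fst h \<bullet> snd q)))) (at q)"
    by (rule has_derivative_compose)
  then have "((\<lambda>q. exp (\<i> * complex_of_real (fst q \<bullet> snd q))) has_derivative
      (\<lambda>h. \<i> * complex_of_real (fst q \<bullet> snd h + fst h \<bullet> snd q) * exp (\<i> * complex_of_real (fst q \<bullet> snd q)))) (at q)"
    by (simp only: mult.commute)
  moreover have "fst q \<bullet> snd h + fst h \<bullet> snd q = q \<bullet> prod.swap h" for h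
    by (cases q; cases h) (simp add: inner_commute)
  ultimately show ?thesis
    by (simp add: osc_phase_def[abs_def] cis_conv_exp)
qed

lemma continuous_on_osc_phase: "continuous_on S osc_phase"
  unfolding osc_phase_def[abs_def] cis_conv_exp by (intro continuous_intros)

lemma borel_measurable_osc_phase [measurable]: "osc_phase \<in> borel_measurable borel"
  by (rule borel_measurable_continuous_onI[OF continuous_on_osc_phase])

lemma dir_deriv_fixed_fst:
  "dir_deriv v (\<lambda>q. f (a, q)) q = dir_deriv (0, v) f (a, q)"
  by (simp add: dir_deriv_def)

lemma symb_fixed_fst:
  fixes f :: "'i \<Rightarrow> 'a::euclidean_space \<times> 'q::euclidean_space \<Rightarrow> complex"
  assumes "symb I W f"
  shows "symb I (\<lambda>i q. W i (a, q)) (\<lambda>i q. f i (a, q))"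
  using symb_affine[OF assms, of "\<lambda>_ q. (0, q)" "\<lambda>_. (a, 0)"]
  by (auto simp: linear_iff intro!: exI)

text \<open>With e the phase and c the factor, e = c (1 - \<partial>_v) e; moving 1 - \<partial>_v
  over to the amplitude gives (1 + \<partial>_v)(c f). The direction (0, v) leaves the parameter
  alone.\<close>

definition osc_step ::
  "'e \<times> 'e \<Rightarrow> ('a::euclidean_space \<times> ('e::euclidean_space \<times> 'e) \<Rightarrow> complex) \<Rightarrow> 'a \<times> ('e \<times> 'e) \<Rightarrow> complex" where
  "osc_step v f = (\<lambda>z. conv_factor (prod.swap v) (snd z) * f z
     + dir_deriv (0, v) (\<lambda>z. conv_factor (prod.swap v) (snd z) * f z) z)"

lemma symb_conv_factor_snd:
  "symb I (\<lambda>_ z. norm (conv_factor u (snd z)))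
    (\<lambda>_ z::'a::euclidean_space \<times> 'q::euclidean_space. conv_factor u (snd z))"
  by (rule symb_linear[OF symb_conv_factor linear_snd])

lemma symb_conv_factor_mult:
  fixes f :: "'i \<Rightarrow> 'a::euclidean_space \<times> 'q::euclidean_space \<Rightarrow> complex"
  assumes "symb I W f"
  shows "symb I (\<lambda>i z. norm (conv_factor u (snd z)) * W i z) (\<lambda>i z. conv_factor u (snd z) * f i z)"
  by (rule symb_mult[OF symb_conv_factor_snd assms])

lemma symb_osc_step:
  assumes "symb I W f"
  shows "symb I (\<lambda>i z. norm (conv_factor (prod.swap v) (snd z)) * W i z) (\<lambda>i. osc_step v (f i))"
  unfolding osc_step_def by (intro symb_add symb_dir_deriv symb_conv_factor_mult assms)

lemma osc_step_add:
  assumes "symb1 W f" "symb1 W g"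
  shows "osc_step v (\<lambda>z. f z + g z) = (\<lambda>z. osc_step v f z + osc_step v g z)"
proof -
  note sm = smooth_differentiable[OF symb1_smooth[OF symb_conv_factor_mult]]
  show ?thesis
    unfolding osc_step_def distrib_left
    by (subst dir_deriv_add[OF sm[OF assms(1)] sm[OF assms(2)]]) (simp add: algebra_simps)
qed

lemma osc_step_cmult:
  assumes "symb1 W f"
  shows "osc_step v (\<lambda>z. c * f z) = (\<lambda>z. c * osc_step v f z)"
proof -
  note sm = smooth_differentiable[OF symb1_smooth[OF symb_conv_factor_mult[OF assms]]]
  show ?thesis
    unfolding osc_step_def mult.left_commute[of _ c]
    by (subst dir_deriv_bounded_linear[OF sm bounded_linear_mult_right]) (simp add: algebra_simps)
qed

lemma osc_step_fixed_fst:
  "osc_step v (\<lambda>z. f (a, snd z)) = (\<lambda>z. osc_step v f (a, snd z))"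
  by (simp add: osc_step_def dir_deriv_def fun_eq_iff)

definition osc_int :: "('a::euclidean_space \<times> ('e::euclidean_space \<times> 'e) \<Rightarrow> complex) \<Rightarrow> 'a \<Rightarrow> complex" where
  "osc_int f a = complex_of_real (1 / (2 * pi) ^ DIM('e)) * (LINT q|lborel. osc_phase q * f (a, q))"

abbreviation osc_weight :: "('i \<Rightarrow> 'a \<Rightarrow> real) \<Rightarrow> real \<Rightarrow> 'i \<Rightarrow> 'a \<times> 'q::real_normed_vector \<Rightarrow> real" where
  "osc_weight V k \<equiv> (\<lambda>i z. V i (fst z) * jbracket (snd z) powr k)"

lemma borel_measurable_smooth: "smooth f \<Longrightarrow> f \<in> borel_measurable borel"
  by (rule borel_measurable_continuous_onI[OF smooth_continuous_on])

lemma integrable_symb1: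
  fixes f :: "'a::euclidean_space \<Rightarrow> complex"
  assumes f: "symb1 (\<lambda>x. c * jbracket x powr k) f" and k: "k \<le> - 2 * real DIM('a)"
    and g: "g \<in> borel_measurable borel" "\<And>x. norm (g x) \<le> 1"
  shows "integrable lborel (\<lambda>x. g x * f x)"
proof -
  obtain C where C: "0 \<le> C" "\<And>x. norm (f x) \<le> C * (c * jbracket x powr k)"
    using symb1_bound[OF f] by blast
  show ?thesis
  proof (rule integrable_norm_le)
    show "integrable lborel (\<lambda>x::'a. C * (c * jbracket x powr k))"
      by (intro integrable_mult_right integrable_jbracket_powr k)
    show "(\<lambda>x. g x * f x) \<in> borel_measurable lborel"
      using g(1) borel_measurable_smooth[OF symb1_smooth[OF f]] by simp
    show "norm (g x * f x) \<le> C * (c * jbracket x powr k)" for x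
      using mult_mono[OF g(2) C(2), of x x] by (simp add: norm_mult)
  qed
qed

lemma symb1_osc_fixed:
  fixes f :: "'i \<Rightarrow> 'a::euclidean_space \<times> 'q::euclidean_space \<Rightarrow> complex"
  assumes "symb I (osc_weight V k) f" "i \<in> I"
  shows "symb1 (\<lambda>q. V i a * jbracket q powr k) (\<lambda>q. f i (a, q))"
  using symb1I[OF symb_fixed_fst[OF assms(1)] assms(2)] by simp

text \<open>Multiplication by the conjugated factor is undone by \<open>1 - \<partial>\<^sub>v\<close> acting on the phase.\<close>

lemma osc_int_step:
  fixes f :: "'i \<Rightarrow> 'a::euclidean_space \<times> ('e::euclidean_space \<times> 'e) \<Rightarrow> complex"
  assumes f: "symb I (osc_weight V k) f" and i: "i \<in> I" and k: "k \<le> - 2 * real DIM('e \<times> 'e)"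
  shows "osc_int (osc_step v (f i)) a = osc_int (f i) a"
proof -
  define c where "c = conv_factor (prod.swap v)"
  define g where "g = (\<lambda>q. c q * f i (a, q))"
  define B where "B = (\<lambda>q. \<i> * complex_of_real (q \<bullet> prod.swap v))"
  have g: "symb1 (\<lambda>q. V i a * jbracket q powr k) g"
  proof -
    have "symb1 (\<lambda>q. norm (c q) * (V i a * jbracket q powr k)) g"
      unfolding g_def c_def by (intro symb_mult symb_conv_factor symb1_osc_fixed[OF f i])
    then show ?thesis
      using symb1_nonneg[OF symb1_osc_fixed[OF f i]] norm_conv_factor_le_1
      by (elim symb_mono[where C = 1]) (auto simp: c_def intro!: mult_left_le_one_le)
  qed
  have dg: "symb1 (\<lambda>q. V i a * jbracket q powr k) (dir_deriv v g)"
    by (rule symb_dir_deriv[OF g])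
  have gd: "g differentiable (at q)" for q by (rule smooth_differentiable[OF symb1_smooth[OF g]])
  have pd: "osc_phase differentiable (at (q::'e \<times> 'e))" for q by (rule differentiableI[OF has_derivative_osc_phase])
  have D: "dir_deriv v (\<lambda>q. osc_phase q * g q) = (\<lambda>q. osc_phase q * dir_deriv v g q + B q * osc_phase q * g q)"
    by (subst dir_deriv_mult[OF pd gd]) (simp add: dir_deriv_eq[OF has_derivative_osc_phase] B_def)
  \<comment> \<open>Since c = 1 / (1 - B), it follows that B c = c - 1.\<close>
  have Bg: "B q * g q = g q - f i (a, q)" for q
    using conv_factor_denom_nonzero[of "q \<bullet> prod.swap v"]
    by (simp add: B_def g_def c_def conv_factor_def field_simps)
  note int = integrable_symb1[OF _ k borel_measurable_osc_phase]
  have i1: "integrable lborel (\<lambda>q. osc_phase q * g q)" and i2: "integrable lborel (\<lambda>q. osc_phase q * dir_deriv v g q)"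
    and i3: "integrable lborel (\<lambda>q. osc_phase q * f i (a, q))"
    by (auto intro!: int g dg symb1_osc_fixed[OF f i])
  have D2: "dir_deriv v (\<lambda>q. osc_phase q * g q) =
      (\<lambda>q. (osc_phase q * dir_deriv v g q + osc_phase q * g q) - osc_phase q * f i (a, q))"
  proof
    fix q
    have "B q * osc_phase q * g q = osc_phase q * (B q * g q)" by simp
    also have "\<dots> = osc_phase q * (g q - f i (a, q))" by (simp only: Bg)
    finally show "dir_deriv v (\<lambda>q. osc_phase q * g q) q =
        (osc_phase q * dir_deriv v g q + osc_phase q * g q) - osc_phase q * f i (a, q)"
      unfolding D by (simp add: algebra_simps)
  qed
  have "(LINT q|lborel. dir_deriv v (\<lambda>q. osc_phase q * g q) q) = 0"
  proof (rule integral_dir_deriv_eq_0)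
    show "continuous_on UNIV (dir_deriv v (\<lambda>q. osc_phase q * g q))"
      unfolding D2 by (intro continuous_intros continuous_on_osc_phase smooth_continuous_on
          symb1_smooth[OF dg] symb1_smooth[OF g] symb1_smooth[OF symb1_osc_fixed[OF f i]])
    show "integrable lborel (dir_deriv v (\<lambda>q. osc_phase q * g q))"
      unfolding D2 by (intro Bochner_Integration.integrable_diff Bochner_Integration.integrable_add i1 i2 i3)
  qed (auto intro: differentiable_mult pd gd i1)
  then have "(LINT q|lborel. osc_phase q * dir_deriv v g q) + (LINT q|lborel. osc_phase q * g q)
      = (LINT q|lborel. osc_phase q * f i (a, q))"
    unfolding D2 by (simp add: i1 i2 i3)
  moreover have "osc_phase q * osc_step v (f i) (a, q) = osc_phase q * dir_deriv v g q + osc_phase q * g q" for q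
    by (simp add: osc_step_def g_def c_def dir_deriv_fixed_fst[where f = "\<lambda>z. conv_factor (prod.swap v) (snd z) * f i z", simplified] algebra_simps)
  ultimately show ?thesis
    by (simp add: osc_int_def i1 i2)
qed

section \<open>Iterated integration by parts and the oscillatory integral\<close>

primrec osc_steps ::
  "('e \<times> 'e) list \<Rightarrow> ('a::euclidean_space \<times> ('e::euclidean_space \<times> 'e) \<Rightarrow> complex) \<Rightarrow> 'a \<times> ('e \<times> 'e) \<Rightarrow> complex" where
  "osc_steps [] f = f"
| "osc_steps (v # vs) f = osc_step v (osc_steps vs f)"

definition Basis_list :: "'a::euclidean_space list" where
  "Basis_list = (SOME xs. set xs = Basis \<and> distinct xs)"

lemma Basis_list: "set (Basis_list :: 'a::euclidean_space list) = Basis" "distinct (Basis_list :: 'a list)"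
  unfolding Basis_list_def using someI_ex[OF finite_distinct_list[OF finite_Basis]] by auto

text \<open>A single step gains decay in one direction of q only; one step for each basis vector
  gains a full power of \<langle>q\<rangle>.\<close>

definition osc_block :: "('a::euclidean_space \<times> ('e::euclidean_space \<times> 'e) \<Rightarrow> complex) \<Rightarrow> 'a \<times> ('e \<times> 'e) \<Rightarrow> complex" where
  "osc_block = osc_steps Basis_list"

lemma symb_osc_steps:
  assumes "symb I W f"
  shows "symb I (\<lambda>i z. prod_list (map (\<lambda>v. norm (conv_factor (prod.swap v) (snd z))) vs) * W i z) (\<lambda>i. osc_steps vs (f i))"
proof (induction vs)
  case (Cons v vs)
  from symb_osc_step[OF Cons, of v] show ?case by (simp add: mult.assoc)
qed (simp add: assms)

lemma one_plus_sum_le_prod: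
  "finite A \<Longrightarrow> (\<And>x. x \<in> A \<Longrightarrow> 0 \<le> (f x :: real)) \<Longrightarrow> 1 + sum f A \<le> (\<Prod>x\<in>A. 1 + f x)"
proof (induction A rule: finite_induct)
  case (insert x A)
  then have "1 + sum f A \<le> (\<Prod>x\<in>A. 1 + f x)" by auto
  then have "(1 + f x) * (1 + sum f A) \<le> (1 + f x) * (\<Prod>x\<in>A. 1 + f x)"
    using insert.prems[of x] by (intro mult_left_mono) auto
  moreover have "0 \<le> f x * sum f A" using insert.prems by (intro mult_nonneg_nonneg sum_nonneg) auto
  ultimately show ?case using insert.hyps by (simp add: algebra_simps)
qed simp

lemma norm_sq_Basis: "(norm (x::'a::euclidean_space))\<^sup>2 = (\<Sum>b\<in>Basis. (x \<bullet> b)\<^sup>2)"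
  by (subst power2_norm_eq_inner, subst euclidean_inner) (simp add: power2_eq_square)

text \<open>The product of the numbers 1 + (q\<cdot>v)^2 over the basis is at least 1 + their sum of
  squares, that is 1 + |q|^2; the claim is the inverse square root of this.\<close>

lemma prod_conv_factor_Basis_le:
  fixes q :: "'e::euclidean_space"
  shows "prod_list (map (\<lambda>v. norm (conv_factor v q)) Basis_list) \<le> jbracket q powr - 1"
proof -
  let ?s = "\<lambda>v. (q \<bullet> v)\<^sup>2"
  have "(norm q)\<^sup>2 = sum ?s Basis" by (rule norm_sq_Basis)
  then have *: "1 + (norm q)\<^sup>2 \<le> (\<Prod>v\<in>Basis. 1 + ?s v)"
    using one_plus_sum_le_prod[of "Basis :: 'e set" ?s] by simp
  have le: "jbracket q \<le> (\<Prod>v\<in>Basis. sqrt (1 + ?s v))"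
  proof -
    have "(\<Prod>v\<in>A. sqrt (1 + ?s v)) = sqrt (\<Prod>v\<in>A. 1 + ?s v)" for A
      by (induction A rule: infinite_finite_induct) (auto simp: real_sqrt_mult)
    with * show ?thesis by (simp add: jbracket_def)
  qed
  have "prod_list (map (\<lambda>v. norm (conv_factor v q)) Basis_list) = (\<Prod>v\<in>Basis. norm (conv_factor v q))"
    using Basis_list prod.distinct_set_conv_list[of Basis_list "\<lambda>v. norm (conv_factor v q)"] by metis
  also have "\<dots> = inverse (\<Prod>v\<in>Basis. sqrt (1 + ?s v))"
    using prod_inversef[of "\<lambda>v. sqrt (1 + ?s v)" Basis] by (simp add: norm_conv_factor o_def inverse_eq_divide)
  also have "\<dots> \<le> inverse (jbracket q)"
    using le by (intro le_imp_inverse_le) auto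
  finally show ?thesis by (simp add: powr_minus)
qed

lemma prod_conv_factor_swap_le:
  "prod_list (map (\<lambda>v. norm (conv_factor (prod.swap v) q)) Basis_list) \<le> jbracket (q :: 'e::euclidean_space \<times> 'e) powr - 1"
  using prod_conv_factor_Basis_le[of "prod.swap q"]
  by (simp add: norm_conv_factor inner_swap jbracket_def)

lemma symb_osc_block:
  fixes f :: "'i \<Rightarrow> 'a::euclidean_space \<times> ('e::euclidean_space \<times> 'e) \<Rightarrow> complex"
  assumes f: "symb I (osc_weight V k) f"
  shows "symb I (osc_weight V (k - 1)) (\<lambda>i. osc_block (f i))"
  unfolding osc_block_def
proof (rule symb_mono[OF symb_osc_steps[OF f, of Basis_list], where C = 1])
  fix i and z :: "'a \<times> ('e \<times> 'e)" assume i: "i \<in> I"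
  have nn: "0 \<le> V i (fst z) * jbracket (snd z) powr k" using symb_nonneg[OF f i, of z] .
  have V: "0 \<le> V i (fst z)" using symb_nonneg[OF f i, of "(fst z, 0)"] by simp
  then show "0 \<le> V i (fst z) * jbracket (snd z) powr (k - 1)" by simp
  show "prod_list (map (\<lambda>v. norm (conv_factor (prod.swap v) (snd z))) Basis_list) * (V i (fst z) * jbracket (snd z) powr k)
      \<le> 1 * (V i (fst z) * jbracket (snd z) powr (k - 1))"
    using mult_right_mono[OF prod_conv_factor_swap_le[of "snd z"] nn] powr_add[of "jbracket (snd z)" k "- 1"]
    by (simp add: ac_simps)
qed

lemma symb_osc_blocks:
  "symb I (osc_weight V k) f \<Longrightarrow> symb I (osc_weight V (k - real K)) (\<lambda>i. (osc_block ^^ K) (f i))"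
proof (induction K)
  case (Suc K)
  from symb_osc_block[OF Suc.IH[OF Suc.prems]] show ?case by (simp add: algebra_simps)
qed simp

lemma osc_int_block:
  fixes f :: "'i \<Rightarrow> 'a::euclidean_space \<times> ('e::euclidean_space \<times> 'e) \<Rightarrow> complex"
  assumes f: "symb I (osc_weight V k) f" and i: "i \<in> I" and k: "k \<le> - 2 * real DIM('e \<times> 'e)"
  shows "osc_int (osc_block (f i)) a = osc_int (f i) a"
proof -
  have s: "symb I (osc_weight V k) (\<lambda>i. osc_steps vs (f i))" for vs
  proof (induction vs)
    case (Cons v vs)
    show ?case unfolding osc_steps.simps
      by (rule symb_mono[OF symb_osc_step[OF Cons], where C = 1])
        (use norm_conv_factor_le_1 symb_nonneg[OF f] in \<open>auto intro!: mult_left_le_one_le\<close>)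
  qed (simp add: f)
  have "osc_int (osc_steps vs (f i)) a = osc_int (f i) a" for vs
    by (induction vs) (simp_all add: osc_int_step[OF s i k])
  then show ?thesis by (simp add: osc_block_def)
qed

text \<open>Every block gains one power of decay, so the sequence is eventually constant; see
  \<open>osc_eq\<close>.\<close>

definition osc :: "('a::euclidean_space \<times> ('e::euclidean_space \<times> 'e) \<Rightarrow> complex) \<Rightarrow> 'a \<Rightarrow> complex" where
  "osc f a = lim (\<lambda>K. osc_int ((osc_block ^^ K) f) a)"

lemma osc_eq:
  fixes f :: "'i \<Rightarrow> 'a::euclidean_space \<times> ('e::euclidean_space \<times> 'e) \<Rightarrow> complex"
  assumes f: "symb I (osc_weight V k) f" and i: "i \<in> I" and K: "k + 2 * real DIM('e \<times> 'e) \<le> real K"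
  shows "osc (f i) a = osc_int ((osc_block ^^ K) (f i)) a"
proof -
  have "osc_int ((osc_block ^^ (m + K)) (f i)) a = osc_int ((osc_block ^^ K) (f i)) a" for m
  proof (induction m)
    case (Suc m)
    have "osc_int (osc_block ((osc_block ^^ (m + K)) (f i))) a = osc_int ((osc_block ^^ (m + K)) (f i)) a"
      by (rule osc_int_block[OF symb_osc_blocks[OF f] i]) (use K in simp)
    with Suc show ?case by simp
  qed simp
  then have "(\<lambda>m. osc_int ((osc_block ^^ (m + K)) (f i)) a) \<longlonglongrightarrow> osc_int ((osc_block ^^ K) (f i)) a"
    by simp
  then show ?thesis
    unfolding osc_def by (intro limI) (rule LIMSEQ_offset)
qed

text \<open>Integration by parts does not touch the parameter, so it may be frozen at a; the new
  parameter b may even live in another space.\<close>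

lemma osc_fixed_fst:
  fixes f :: "'a::euclidean_space \<times> ('e::euclidean_space \<times> 'e) \<Rightarrow> complex"
    and b :: "'b::euclidean_space"
  shows "osc (\<lambda>z. f (a, snd z)) b = osc f a"
proof -
  have steps: "osc_steps vs (\<lambda>z::'b \<times> ('e \<times> 'e). f (a, snd z)) = (\<lambda>z. osc_steps vs f (a, snd z))" for vs and f :: "'a \<times> ('e \<times> 'e) \<Rightarrow> complex"
    by (induction vs) (simp_all add: osc_step_fixed_fst)
  have "(osc_block ^^ K) (\<lambda>z::'b \<times> ('e \<times> 'e). f (a, snd z)) = (\<lambda>z. (osc_block ^^ K) f (a, snd z))" for K
    unfolding osc_block_def by (induction K) (simp_all add: steps)
  then show ?thesis by (simp add: osc_def osc_int_def)
qed

section \<open>Linearity and parameter dependence of the oscillatory integral\<close>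

lemma osc_blocks_add:
  assumes f: "symb1 (\<lambda>z. V (fst z) * jbracket (snd z) powr k) f" and g: "symb1 (\<lambda>z. V (fst z) * jbracket (snd z) powr k) g"
  shows "(osc_block ^^ K) (\<lambda>z. f z + g z) = (\<lambda>z. (osc_block ^^ K) f z + (osc_block ^^ K) g z)"
proof -
  have steps: "osc_steps vs (\<lambda>z. f z + g z) = (\<lambda>z. osc_steps vs f z + osc_steps vs g z)"
    if "symb1 W f" "symb1 W g" for vs W and f g :: "'a \<times> 'b \<times> 'b \<Rightarrow> complex"
    by (induction vs) (simp_all add: osc_step_add[OF symb_osc_steps[OF that(1)] symb_osc_steps[OF that(2)]])
  show ?thesis
  proof (induction K)
    case (Suc K)
    then show ?case
      using steps[OF symb_osc_blocks[OF f] symb_osc_blocks[OF g], of Basis_list K] by (simp add: osc_block_def)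
  qed simp
qed

lemma osc_blocks_cmult:
  assumes f: "symb1 (\<lambda>z. V (fst z) * jbracket (snd z) powr k) f"
  shows "(osc_block ^^ K) (\<lambda>z. c * f z) = (\<lambda>z. c * (osc_block ^^ K) f z)"
proof -
  have steps: "osc_steps vs (\<lambda>z. c * f z) = (\<lambda>z. c * osc_steps vs f z)"
    if "symb1 W f" for vs W and f :: "'a \<times> 'b \<times> 'b \<Rightarrow> complex"
    by (induction vs) (simp_all add: osc_step_cmult[OF symb_osc_steps[OF that]])
  show ?thesis
  proof (induction K)
    case (Suc K)
    then show ?case
      using steps[OF symb_osc_blocks[OF f], of Basis_list K] by (simp add: osc_block_def)
  qed simp
qed

lemma osc_eq1:
  fixes f :: "'a::euclidean_space \<times> ('e::euclidean_space \<times> 'e) \<Rightarrow> complex"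
  assumes "symb1 (\<lambda>z. V (fst z) * jbracket (snd z) powr k) f" "k + 2 * real DIM('e \<times> 'e) \<le> real K"
  shows "osc f a = osc_int ((osc_block ^^ K) f) a"
  using osc_eq[where I = UNIV and V = "\<lambda>_::unit. V" and f = "\<lambda>_. f", OF assms(1) UNIV_I assms(2)] .

lemma osc_add:
  fixes f g :: "'a::euclidean_space \<times> ('e::euclidean_space \<times> 'e) \<Rightarrow> complex"
  assumes f: "symb1 (\<lambda>z. V (fst z) * jbracket (snd z) powr k) f" and g: "symb1 (\<lambda>z. V (fst z) * jbracket (snd z) powr k) g"
  shows "osc (\<lambda>z. f z + g z) a = osc f a + osc g a"
proof -
  obtain K where K: "k + 2 * real DIM('e \<times> 'e) \<le> real K" using real_arch_simple by blast
  have int: "integrable lborel (\<lambda>q. osc_phase q * (osc_block ^^ K) f (a, q))"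
    if "symb1 (\<lambda>z. V (fst z) * jbracket (snd z) powr k) f" for f :: "'a \<times> ('e \<times> 'e) \<Rightarrow> complex"
    by (rule integrable_symb1[OF symb1_osc_fixed[OF symb_osc_blocks[OF that, where K = K]]])
      (use K in auto)
  show ?thesis
    unfolding osc_eq1[OF f K] osc_eq1[OF g K] osc_eq1[OF symb_add[OF f g] K]
    by (simp add: osc_int_def osc_blocks_add[OF f g] distrib_left int f g)
qed

lemma osc_cmult:
  fixes f :: "'a::euclidean_space \<times> ('e::euclidean_space \<times> 'e) \<Rightarrow> complex"
  assumes f: "symb1 (\<lambda>z. V (fst z) * jbracket (snd z) powr k) f"
  shows "osc (\<lambda>z. c * f z) a = c * osc f a"
proof -
  obtain K where K: "k + 2 * real DIM('e \<times> 'e) \<le> real K" using real_arch_simple by blast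
  show ?thesis
    unfolding osc_eq1[OF f K] osc_eq1[OF symb_cmult[OF f] K]
    by (simp add: osc_int_def osc_blocks_cmult[OF f] mult.left_commute[of _ c])
qed

lemma osc_zero [simp]: "osc (\<lambda>z::'a::euclidean_space \<times> ('e::euclidean_space \<times> 'e). 0) a = 0"
proof -
  have z: "symb1 (\<lambda>z::'a \<times> ('e \<times> 'e). (\<lambda>_. 1) (fst z) * jbracket (snd z) powr 0) (\<lambda>_. 0 :: complex)"
    by (rule symb_zero) simp
  show ?thesis using osc_cmult[where V = "\<lambda>_. 1" and k = 0, OF z, of 0 a] by simp
qed

lemma osc_sum:
  fixes f :: "'j \<Rightarrow> 'a::euclidean_space \<times> ('e::euclidean_space \<times> 'e) \<Rightarrow> complex"
  assumes "\<And>j. j \<in> A \<Longrightarrow> symb1 (\<lambda>z. V (fst z) * jbracket (snd z) powr k) (f j)"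
    and V: "\<And>a. 0 \<le> V a"
  shows "osc (\<lambda>z. \<Sum>j\<in>A. f j z) a = (\<Sum>j\<in>A. osc (f j) a)"
  using assms(1)
proof (induction A rule: infinite_finite_induct)
  case (insert x F)
  then show ?case
    using osc_add[OF insert.prems[OF insertI1] symb_sum[of F UNIV "\<lambda>_ z. V (fst z) * jbracket (snd z) powr k" "\<lambda>j _. f j"]] V
    by simp
qed auto

text \<open>The number K of blocks depends on k alone and hence serves all indices. After K blocks
  the integral converges absolutely and may be differentiated in the parameter; the weight in q is
  integrated away and V remains.\<close>

theorem symb_osc:
  fixes f :: "'i \<Rightarrow> 'a::euclidean_space \<times> ('e::euclidean_space \<times> 'e) \<Rightarrow> complex"
  assumes f: "symb I (osc_weight V k) f" and V: "\<And>i. i \<in> I \<Longrightarrow> continuous_on UNIV (V i)"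
  shows "symb I V (\<lambda>i. osc (f i))"
proof -
  obtain K where K: "k + 2 * real DIM('e \<times> 'e) \<le> real K" using real_arch_simple by blast
  define g where "g = (\<lambda>i. (osc_block ^^ K) (f i))"
  have g: "symb I (osc_weight V (k - real K)) g"
    unfolding g_def by (rule symb_osc_blocks[OF f])
  have V0: "0 \<le> V i a" if "i \<in> I" for i a
    using symb_nonneg[OF f that, of "(a, 0)"] by simp
  have "symb I V (\<lambda>i a. LINT q|lborel. osc_phase q * g i (a, q))"
  proof (rule symb_param_integral[where T = UNIV and H = "\<lambda>q. jbracket q powr (k - real K)"])
    have "symb ((UNIV :: ('e \<times> 'e) set) \<times> I) (\<lambda>j. osc_weight V (k - real K) (snd j)) (\<lambda>j. g (snd j))"
      by (rule symb_reindex[OF g]) auto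
    from symb_affine[OF this, of "\<lambda>_ a. (a, 0)" "\<lambda>j. (0, fst j)"]
    show "symb (UNIV \<times> I) (\<lambda>(q, i) a. V i a * jbracket q powr (k - real K)) (\<lambda>(q, i) a. g i (a, q))"
      by (auto simp: linear_iff case_prod_unfold intro!: exI)
    show "integrable lborel (\<lambda>q::'e \<times> 'e. norm (osc_phase q) * jbracket q powr (k - real K))"
      using K by (simp add: integrable_jbracket_powr)
    fix i vs a assume i: "i \<in> I"
    have "dir_derivs vs (\<lambda>a. g i (a, q)) a = dir_derivs (map (\<lambda>v. (v, 0)) vs) (g i) (a, q)" for q
      using dir_derivs_affine[of "\<lambda>a. (a, 0)" vs "g i" "(0, q)"] by (simp add: linear_iff)
    moreover have "continuous_on UNIV (\<lambda>q. dir_derivs (map (\<lambda>v. (v, 0)) vs) (g i) (a, q))"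
      by (rule continuous_on_compose2[OF smooth_continuous_on[OF smooth_dir_derivs[OF symb_smooth[OF g i]], where S = UNIV]])
        (auto intro!: continuous_intros)
    ultimately show "(\<lambda>q. osc_phase q * dir_derivs vs (\<lambda>a. g i (a, q)) a) \<in> borel_measurable lborel"
      using borel_measurable_times[OF borel_measurable_osc_phase borel_measurable_continuous_onI] by simp
  qed (use V V0 in auto)
  then have "symb I V (\<lambda>i a. complex_of_real (1 / (2 * pi) ^ DIM('e)) * (LINT q|lborel. osc_phase q * g i (a, q)))"
    by (rule symb_cmult)
  moreover have "osc (f i) = (\<lambda>a. complex_of_real (1 / (2 * pi) ^ DIM('e)) * (LINT q|lborel. osc_phase q * g i (a, q)))"
    if "i \<in> I" for i
    by (rule ext) (simp add: osc_eq[OF f that K] osc_int_def g_def)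
  ultimately show ?thesis by (simp cong: symb_cong)
qed

section \<open>Removal of cutoffs\<close>

lemma symb1_lipschitz:
  fixes f :: "'a::euclidean_space \<Rightarrow> complex"
  assumes f: "symb1 (\<lambda>_. 1) f"
  obtains C where "0 \<le> C" "\<And>x h. norm (f (x + h) - f x) \<le> C * norm h"
proof -
  have "\<forall>bs. \<exists>C\<ge>0. \<forall>x. norm (dir_derivs bs f x) \<le> C"
    using symb_derivs_bound[OF f] by (metis UNIV_I mult.right_neutral)
  then obtain C where C: "\<And>bs. 0 \<le> C bs" "\<And>bs x. norm (dir_derivs bs f x) \<le> C bs" by metis
  define K where "K = sum C (basis_lists 1)"
  have K: "0 \<le> K" unfolding K_def by (intro sum_nonneg C)
  have sm: "smooth f" by (rule symb1_smooth[OF f])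
  have "norm (f (x + h) - f x) \<le> K * norm h" for x h
  proof -
    have d: "norm (dir_deriv h f y) \<le> K * norm h" for y
    proof -
      have "norm (dir_derivs [h] f y) \<le> prod_list (map norm [h]) * (\<Sum>bs\<in>basis_lists (length [h]). norm (dir_derivs bs f y))"
        by (rule norm_dir_derivs_le[OF sm])
      also have "\<dots> \<le> norm h * K"
        unfolding K_def by (auto intro!: mult_left_mono sum_mono C)
      finally show ?thesis by (simp add: mult.commute)
    qed
    have "norm (f (x + h) - (\<Sum>k\<le>0. (1 / fact k) *\<^sub>R dir_derivs (replicate k h) f x)) \<le> (K * norm h) * measure lborel (cbox (0::real) 1)"
    proof (rule has_integral_bound)
      show "((\<lambda>t. ((1 - t) ^ 0 / fact 0) *\<^sub>R dir_derivs (replicate (Suc 0) h) f (x + t *\<^sub>R h)) has_integral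
        f (x + h) - (\<Sum>k\<le>0. (1 / fact k) *\<^sub>R dir_derivs (replicate k h) f x)) (cbox 0 1)"
        using taylor_has_integral[OF sm, of 0 h x] by (simp only: box_real)
    qed (use d K in auto)
    then show ?thesis by simp
  qed
  with K show ?thesis using that by blast
qed

text \<open>The undifferentiated term is at most a Lipschitz constant times \<epsilon>|q|. Every
  derivative of \<gamma>(\<epsilon>q) produces a factor \<epsilon> by the chain rule, and
  \<langle>q\<rangle> \<ge> 1 allows the same weight to be used for it.\<close>

lemma symb_dilation_diff:
  fixes \<gamma> :: "'q::euclidean_space \<Rightarrow> complex"
  assumes \<gamma>: "symb1 (\<lambda>_. 1) \<gamma>" and "\<gamma> 0 = 1"
  shows "symb {0<..1} (\<lambda>\<epsilon> q. \<epsilon> * jbracket q) (\<lambda>\<epsilon> q. \<gamma> (\<epsilon> *\<^sub>R q) - 1)"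
proof -
  have sm: "smooth \<gamma>" by (rule symb1_smooth[OF \<gamma>])
  have lin: "linear (\<lambda>q::'q. \<epsilon> *\<^sub>R q)" for \<epsilon> by (simp add: linear_iff algebra_simps)
  have sm1: "smooth (\<lambda>q. \<gamma> (\<epsilon> *\<^sub>R q))" for \<epsilon>
    using smooth_affine[OF sm lin[of \<epsilon>], of 0] by simp
  have D: "dir_derivs vs (\<lambda>q. \<gamma> (\<epsilon> *\<^sub>R q) - 1) q =
      dir_derivs (map (\<lambda>v. \<epsilon> *\<^sub>R v) vs) \<gamma> (\<epsilon> *\<^sub>R q) - (if vs = [] then 1 else 0)" for vs \<epsilon> q
    using dir_derivs_add[OF sm1[of \<epsilon>] smooth_const[of "- 1"], of vs] dir_derivs_affine[OF lin[of \<epsilon>], of vs \<gamma> 0]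
    by (simp add: dir_derivs_const)
  show ?thesis
    unfolding symb_def
  proof (intro conjI ballI allI)
    fix \<epsilon> :: real assume "\<epsilon> \<in> {0<..1}"
    show "smooth (\<lambda>q. \<gamma> (\<epsilon> *\<^sub>R q) - 1)"
      using smooth_add[OF sm1[of \<epsilon>] smooth_const[of "- 1"]] by simp
  next
    fix vs :: "'q list"
    show "\<exists>C. \<forall>\<epsilon>\<in>{0<..1}. \<forall>q. norm (dir_derivs vs (\<lambda>q. \<gamma> (\<epsilon> *\<^sub>R q) - 1) q) \<le> C * (\<epsilon> * jbracket q)"
    proof (cases vs)
      case Nil
      obtain C where C: "0 \<le> C" "\<And>x h. norm (\<gamma> (x + h) - \<gamma> x) \<le> C * norm h"
        using symb1_lipschitz[OF \<gamma>] by blast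
      have "norm (\<gamma> (\<epsilon> *\<^sub>R q) - 1) \<le> C * (\<epsilon> * jbracket q)" if "\<epsilon> \<in> {0<..1}" for \<epsilon> q
      proof -
        have "norm (\<gamma> (\<epsilon> *\<^sub>R q) - 1) \<le> C * norm (\<epsilon> *\<^sub>R q)"
          using C(2)[of 0 "\<epsilon> *\<^sub>R q"] assms(2) by simp
        also have "\<dots> \<le> C * (\<epsilon> * jbracket q)"
          using C(1) that norm_le_jbracket[of q] by (intro mult_left_mono) auto
        finally show ?thesis .
      qed
      then show ?thesis unfolding Nil dir_derivs.simps by blast
    next
      case (Cons v us)
      have "\<forall>bs. \<exists>C\<ge>0. \<forall>x. norm (dir_derivs bs \<gamma> x) \<le> C"
        using symb_derivs_bound[OF \<gamma>] by (metis UNIV_I mult.right_neutral)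
      then obtain C where C: "\<And>bs. 0 \<le> C bs" "\<And>bs x. norm (dir_derivs bs \<gamma> x) \<le> C bs" by metis
      define K where "K = prod_list (map norm vs) * sum C (basis_lists (length vs))"
      have pl: "0 \<le> prod_list (map norm vs)" for vs :: "'q list" by (intro prod_list_nonneg) auto
      have K: "0 \<le> K" unfolding K_def by (intro mult_nonneg_nonneg sum_nonneg pl C)
      have "norm (dir_derivs vs (\<lambda>q. \<gamma> (\<epsilon> *\<^sub>R q) - 1) q) \<le> K * (\<epsilon> * jbracket q)" if \<epsilon>: "\<epsilon> \<in> {0<..1}" for \<epsilon> q
      proof -
        have p1: "prod_list (map norm (map (\<lambda>v. \<epsilon> *\<^sub>R v) us)) \<le> prod_list (map norm us)" for us :: "'q list"
        proof (induction us)
          case (Cons v us)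
          have "norm (\<epsilon> *\<^sub>R v) \<le> norm v" using \<epsilon> by (simp add: mult_left_le_one_le)
          from mult_mono[OF this Cons.IH] show ?case by (simp add: pl[of "map (\<lambda>v. \<epsilon> *\<^sub>R v) us", simplified])
        qed simp
        \<comment> \<open>One factor \<epsilon> is kept from the first direction v; the others are
          bounded by 1.\<close>
        have p: "prod_list (map norm (map (\<lambda>v. \<epsilon> *\<^sub>R v) vs)) \<le> \<epsilon> * prod_list (map norm vs)"
          using mult_left_mono[OF p1[of us], of "\<epsilon> * norm v"] \<epsilon> by (simp add: Cons mult.assoc)
        have "norm (dir_derivs vs (\<lambda>q. \<gamma> (\<epsilon> *\<^sub>R q) - 1) q) = norm (dir_derivs (map (\<lambda>v. \<epsilon> *\<^sub>R v) vs) \<gamma> (\<epsilon> *\<^sub>R q))"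
          by (simp only: D) (simp add: Cons)
        also have "\<dots> \<le> prod_list (map norm (map (\<lambda>v. \<epsilon> *\<^sub>R v) vs)) *
            (\<Sum>bs\<in>basis_lists (length vs). norm (dir_derivs bs \<gamma> (\<epsilon> *\<^sub>R q)))"
          using norm_dir_derivs_le[OF sm, of "map (\<lambda>v. \<epsilon> *\<^sub>R v) vs"] by simp
        also have "\<dots> \<le> (\<epsilon> * prod_list (map norm vs)) * sum C (basis_lists (length vs))"
          using \<epsilon> by (intro mult_mono p sum_mono C mult_nonneg_nonneg pl sum_nonneg) auto
        also have "\<dots> = K * (\<epsilon> * 1)" by (simp add: K_def)
        also have "\<dots> \<le> K * (\<epsilon> * jbracket q)"
          using K \<epsilon> jbracket_ge_1 by (intro mult_left_mono) auto
        finally show ?thesis .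
      qed
      then show ?thesis by blast
    qed
  qed auto
qed

lemma symb_regularize:
  fixes f :: "'a::euclidean_space \<times> 'q::euclidean_space \<Rightarrow> complex"
  assumes f: "symb1 (\<lambda>z. V (fst z) * jbracket (snd z) powr k) f" and \<gamma>: "symb1 (\<lambda>_. 1) \<gamma>" "\<gamma> 0 = 1"
  shows "symb {0<..1} (osc_weight (\<lambda>\<epsilon> a. \<epsilon> * V a) (k + 1)) (\<lambda>\<epsilon> z. f z * \<gamma> (\<epsilon> *\<^sub>R snd z) - f z)"
proof -
  have "symb {0<..1} (\<lambda>\<epsilon> z. (V (fst z) * jbracket (snd z) powr k) * (\<epsilon> * jbracket (snd z)))
      (\<lambda>\<epsilon> z. f z * (\<gamma> (\<epsilon> *\<^sub>R snd z) - 1))"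
    by (rule symb_mult[OF symb1D[OF f] symb_linear[OF symb_dilation_diff[OF \<gamma>] linear_snd]])
  then have "symb {0<..1} (osc_weight (\<lambda>\<epsilon> a. \<epsilon> * V a) (k + 1)) (\<lambda>\<epsilon> z. f z * (\<gamma> (\<epsilon> *\<^sub>R snd z) - 1))"
    by (rule symb_weight_eq) (simp add: powr_add)
  then show ?thesis by (simp add: right_diff_distrib)
qed

lemma tendsto_at_right_0I:
  fixes h :: "real \<Rightarrow> 'a::real_normed_vector"
  assumes "\<And>\<epsilon>. \<epsilon> \<in> {0<..1} \<Longrightarrow> norm (h \<epsilon> - l) \<le> C * \<epsilon>"
  shows "(h \<longlongrightarrow> l) (at_right 0)"
proof -
  have "((\<lambda>\<epsilon>. C * \<epsilon>) \<longlongrightarrow> C * 0) (at_right 0)" by (intro tendsto_intros)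
  then have "((\<lambda>\<epsilon>. h \<epsilon> - l) \<longlongrightarrow> 0) (at_right 0)"
  proof (rule Lim_null_comparison[rotated, OF tendsto_eq_rhs])
    show "\<forall>\<^sub>F \<epsilon> in at_right 0. norm (h \<epsilon> - l) \<le> C * \<epsilon>"
      using assms by (auto simp: eventually_at_right_field intro!: exI[of _ 1])
  qed simp
  then show ?thesis by (simp add: LIM_zero_iff)
qed

lemma symb_congI:
  "symb I W f \<Longrightarrow> (\<And>i. i \<in> I \<Longrightarrow> f i = g i) \<Longrightarrow> symb I W g"
  using symb_cong[of I f g W] by blast

text \<open>The difference of the amplitudes is a family with the factor \<epsilon> in its weight,
  and \<open>symb_osc\<close> keeps that factor. The amplitude f and the difference must be
  estimated with one order k, so orders are raised to a common value before use.\<close>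

lemma osc_diff_bound:
  fixes f :: "'a::euclidean_space \<times> ('e::euclidean_space \<times> 'e) \<Rightarrow> complex"
  assumes f: "symb1 (\<lambda>z. V (fst z) * jbracket (snd z) powr k) f" and V: "continuous_on UNIV V"
    and g: "symb {0<..1} (osc_weight (\<lambda>\<epsilon> a. \<epsilon> * V a) k) (\<lambda>\<epsilon> z. g \<epsilon> z - f z)"
  shows "symb {0<..1} (\<lambda>\<epsilon> a. \<epsilon> * V a) (\<lambda>\<epsilon> a. osc (g \<epsilon>) a - osc f a)"
proof -
  have V0: "0 \<le> V a" for a using symb1_nonneg[OF f, of "(a, 0)"] by simp
  have "symb {0<..1} (\<lambda>\<epsilon> a. \<epsilon> * V a) (\<lambda>\<epsilon>. osc (\<lambda>z. g \<epsilon> z - f z))"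
    by (rule symb_osc[OF g]) (intro continuous_intros V)
  moreover have "osc (\<lambda>z. g \<epsilon> z - f z) = (\<lambda>a. osc (g \<epsilon>) a - osc f a)" if \<epsilon>: "\<epsilon> \<in> {0<..1}" for \<epsilon>
  proof
    fix a
    have "symb1 (\<lambda>z. V (fst z) * jbracket (snd z) powr k) (\<lambda>z. g \<epsilon> z - f z)"
      by (rule symb_mono[OF symb1I[OF g \<epsilon>], where C = 1])
        (use V0 \<epsilon> in \<open>auto simp: mult.assoc intro!: mult_left_le_one_le\<close>)
    from osc_add[OF this f, of a] show "osc (\<lambda>z. g \<epsilon> z - f z) a = osc (g \<epsilon>) a - osc f a" by simp
  qed
  ultimately show ?thesis by (rule symb_congI)
qed

lemma osc_tendsto:
  fixes f :: "'a::euclidean_space \<times> ('e::euclidean_space \<times> 'e) \<Rightarrow> complex"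
  assumes f: "symb1 (\<lambda>z. V (fst z) * jbracket (snd z) powr k) f" and V: "continuous_on UNIV V"
    and g: "symb {0<..1} (osc_weight (\<lambda>\<epsilon> a. \<epsilon> * V a) k) (\<lambda>\<epsilon> z. g \<epsilon> z - f z)"
  shows "((\<lambda>\<epsilon>. osc (g \<epsilon>) a) \<longlongrightarrow> osc f a) (at_right 0)"
proof -
  obtain C where C: "\<And>\<epsilon> a. \<epsilon> \<in> {0<..1} \<Longrightarrow> norm (osc (g \<epsilon>) a - osc f a) \<le> C * (\<epsilon> * V a)"
    using symb_bound[OF osc_diff_bound[OF f V g]] by blast
  show ?thesis
    by (rule tendsto_at_right_0I[where C = "C * V a"]) (use C in \<open>auto simp: ac_simps\<close>)
qed

text \<open>Since \<epsilon>\<langle>q\<rangle> \<le> \<langle>\<epsilon>q\<rangle>, decay survives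
  the dilation. The constant \<open>\<epsilon> powr s\<close> need not stay bounded as \<epsilon>
  tends to 0; the result is used at fixed \<epsilon>, to make regularised integrals absolutely
  convergent.\<close>

lemma symb1_dilation_decay:
  fixes \<gamma> :: "'q::euclidean_space \<Rightarrow> complex"
  assumes \<gamma>: "\<And>s. symb1 (\<lambda>q. jbracket q powr s) \<gamma>" and \<epsilon>: "\<epsilon> \<in> {0<..1}" and s: "s \<le> 0"
  shows "symb1 (\<lambda>q. jbracket q powr s) (\<lambda>q. \<gamma> (\<epsilon> *\<^sub>R q))"
proof (rule symb_mono[where C = "\<epsilon> powr s"])
  have "linear (\<lambda>q::'q. \<epsilon> *\<^sub>R q)" by (simp add: linear_iff algebra_simps)
  then show "symb1 (\<lambda>q. jbracket (\<epsilon> *\<^sub>R q) powr s) (\<lambda>q. \<gamma> (\<epsilon> *\<^sub>R q))"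
    using symb_linear[OF \<gamma>] by blast
  fix q :: 'q
  have "\<epsilon>\<^sup>2 * (1 + (norm q)\<^sup>2) \<le> 1 + (\<epsilon> * norm q)\<^sup>2"
    using \<epsilon> power_le_one[of \<epsilon> 2] by (simp add: power_mult_distrib algebra_simps)
  then have "sqrt (\<epsilon>\<^sup>2 * (1 + (norm q)\<^sup>2)) \<le> jbracket (\<epsilon> *\<^sub>R q)"
    unfolding jbracket_def using \<epsilon> by (simp add: power_mult_distrib)
  then have "\<epsilon> * jbracket q \<le> jbracket (\<epsilon> *\<^sub>R q)"
    using \<epsilon> by (simp add: real_sqrt_mult jbracket_def)
  then have "jbracket (\<epsilon> *\<^sub>R q) powr s \<le> (\<epsilon> * jbracket q) powr s"
    using \<epsilon> s by (intro powr_mono2') auto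
  then show "jbracket (\<epsilon> *\<^sub>R q) powr s \<le> \<epsilon> powr s * jbracket q powr s"
    using \<epsilon> by (simp add: powr_mult)
qed simp

lemma symb1_gauss_bounded: "symb1 (\<lambda>_. 1) (gauss :: 'q::euclidean_space \<Rightarrow> complex)"
  by (rule symb_weight_eq[OF symb_gauss[where s = 0]]) simp

section \<open>Linear factors in oscillatory integrals\<close>

lemma symb1_inner_snd:
  "symb1 (\<lambda>z. jbracket (snd z)) (\<lambda>z::'a::euclidean_space \<times> 'q::euclidean_space. complex_of_real (snd z \<bullet> u))"
  by (rule symb_linear[OF symb_inner linear_snd])

lemma symb1_inner_mult:
  fixes f :: "'a::euclidean_space \<times> 'q::euclidean_space \<Rightarrow> complex"
  assumes "symb1 (\<lambda>z. V (fst z) * jbracket (snd z) powr k) f"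
  shows "symb1 (\<lambda>z. V (fst z) * jbracket (snd z) powr (k + 1)) (\<lambda>z. complex_of_real (snd z \<bullet> u) * f z)"
  by (rule symb_weight_eq[OF symb_mult[OF symb1_inner_snd assms]]) (simp add: powr_add)

text \<open>The derivative of e g, with e the phase, integrates to 0, and \<partial>_v e = i
  (q\<cdot>swap v) e. Solving for the term with the linear factor gives -1/i = i.\<close>

lemma osc_inner_swap_integrable:
  fixes f :: "'a::euclidean_space \<times> ('e::euclidean_space \<times> 'e) \<Rightarrow> complex"
  assumes f: "symb1 (\<lambda>z. V (fst z) * jbracket (snd z) powr k) f" and k: "k + 1 \<le> - 2 * real DIM('e \<times> 'e)"
  shows "osc (\<lambda>z. complex_of_real (snd z \<bullet> prod.swap v) * f z) a = \<i> * osc (dir_deriv (0, v) f) a"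
proof -
  define g where "g = (\<lambda>q. f (a, q))"
  have g: "symb1 (\<lambda>q. V a * jbracket q powr k) g"
    using symb1_osc_fixed[where I = UNIV and V = "\<lambda>_::unit. V" and f = "\<lambda>_. f", OF f UNIV_I] by (simp add: g_def)
  have Bf: "symb1 (\<lambda>z. V (fst z) * jbracket (snd z) powr (k + 1)) (\<lambda>z. complex_of_real (snd z \<bullet> prod.swap v) * f z)"
    by (rule symb1_inner_mult[OF f])
  have Bg: "symb1 (\<lambda>q. V a * jbracket q powr (k + 1)) (\<lambda>q. complex_of_real (q \<bullet> prod.swap v) * g q)"
    using symb1_osc_fixed[where I = UNIV and V = "\<lambda>_::unit. V" and f = "\<lambda>_ z. complex_of_real (snd z \<bullet> prod.swap v) * f z", OF Bf UNIV_I] by (simp add: g_def)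
  have df: "symb1 (\<lambda>z. V (fst z) * jbracket (snd z) powr k) (dir_deriv (0, v) f)"
    by (rule symb_dir_deriv[OF f])
  have dg: "symb1 (\<lambda>q. V a * jbracket q powr k) (dir_deriv v g)"
    by (rule symb_dir_deriv[OF g])
  note int = integrable_symb1[OF _ _ borel_measurable_osc_phase]
  have k': "k \<le> - 2 * real DIM('e \<times> 'e)" using k by simp
  have i1: "integrable lborel (\<lambda>q. osc_phase q * (complex_of_real (q \<bullet> prod.swap v) * g q))"
    by (rule int[OF Bg k]) simp
  have i2: "integrable lborel (\<lambda>q. osc_phase q * dir_deriv v g q)" by (rule int[OF dg k']) simp
  have i3: "integrable lborel (\<lambda>q. osc_phase q * g q)" by (rule int[OF g k']) simp
  have gd: "g differentiable (at q)" for q by (rule smooth_differentiable[OF symb1_smooth[OF g]])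
  have pd: "osc_phase differentiable (at (q::'e \<times> 'e))" for q by (rule differentiableI[OF has_derivative_osc_phase])
  have D: "dir_deriv v (\<lambda>q. osc_phase q * g q) =
      (\<lambda>q. osc_phase q * dir_deriv v g q + \<i> * (osc_phase q * (complex_of_real (q \<bullet> prod.swap v) * g q)))"
    by (subst dir_deriv_mult[OF pd gd]) (simp add: dir_deriv_eq[OF has_derivative_osc_phase] algebra_simps)
  have "(LINT q|lborel. dir_deriv v (\<lambda>q. osc_phase q * g q) q) = 0"
  proof (rule integral_dir_deriv_eq_0)
    show "continuous_on UNIV (dir_deriv v (\<lambda>q. osc_phase q * g q))"
      unfolding D by (intro continuous_intros continuous_on_osc_phase smooth_continuous_on
          symb1_smooth[OF dg] symb1_smooth[OF g])
    show "integrable lborel (dir_deriv v (\<lambda>q. osc_phase q * g q))"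
      unfolding D by (intro Bochner_Integration.integrable_add integrable_mult_right i1 i2)
  qed (auto intro: differentiable_mult pd gd i3)
  then have "(LINT q|lborel. osc_phase q * dir_deriv v g q) +
      \<i> * (LINT q|lborel. osc_phase q * (complex_of_real (q \<bullet> prod.swap v) * g q)) = 0"
    unfolding D by (simp add: i1 i2)
  then have "(LINT q|lborel. osc_phase q * (complex_of_real (q \<bullet> prod.swap v) * g q)) =
      \<i> * (LINT q|lborel. osc_phase q * dir_deriv v g q)"
    by (simp add: add_eq_0_iff) (metis (no_types, lifting) i_squared minus_mult_minus mult.assoc mult_1 mult_minus_left)
  then have "osc_int (\<lambda>z. complex_of_real (snd z \<bullet> prod.swap v) * f z) a = \<i> * osc_int (dir_deriv (0, v) f) a"
    by (simp add: osc_int_def g_def dir_deriv_fixed_fst)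
  then show ?thesis
    using osc_eq1[OF Bf, of 0] osc_eq1[OF df, of 0] k k' by simp
qed

text \<open>Gaussian damping reduces the formula to amplitudes with integrable decay, and both sides
  depend continuously on the amplitude. The damping costs one order and the linear factor another,
  hence the orders k + 1 and k + 1 + 1.\<close>

lemma osc_inner_swap:
  fixes f :: "'a::euclidean_space \<times> ('e::euclidean_space \<times> 'e) \<Rightarrow> complex"
  assumes f: "symb1 (\<lambda>z. V (fst z) * jbracket (snd z) powr k) f" and V: "continuous_on UNIV V"
  shows "osc (\<lambda>z. complex_of_real (snd z \<bullet> prod.swap v) * f z) a = \<i> * osc (dir_deriv (0, v) f) a"
proof -
  define B where "B = (\<lambda>z :: 'a \<times> ('e \<times> 'e). complex_of_real (snd z \<bullet> prod.swap v))"
  define g where "g = (\<lambda>\<epsilon> z. f z * gauss (\<epsilon> *\<^sub>R snd z))"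
  have V0: "0 \<le> V a" for a using symb1_nonneg[OF f, of "(a, 0)"] by simp
  have gf: "symb {0<..1} (osc_weight (\<lambda>\<epsilon> a. \<epsilon> * V a) (k + 1)) (\<lambda>\<epsilon> z. g \<epsilon> z - f z)"
    unfolding g_def by (rule symb_regularize[OF f symb1_gauss_bounded gauss_0])
  have gs: "symb1 (\<lambda>z. V (fst z) * jbracket (snd z) powr (k + s)) (g \<epsilon>)" if "\<epsilon> \<in> {0<..1}" "s \<le> 0" for \<epsilon> s
    unfolding g_def
    by (rule symb_weight_eq[OF symb_mult[OF f symb_linear[OF symb1_dilation_decay[OF symb_gauss that] linear_snd]]])
      (simp add: powr_add)
  have f1: "symb1 (\<lambda>z. V (fst z) * jbracket (snd z) powr (k + 1)) f"
    by (rule symb_mono[OF f, where C = 1]) (auto intro!: mult_left_mono jbracket_powr_mono simp: V0)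
  have 1: "((\<lambda>\<epsilon>. osc (\<lambda>z. B z * g \<epsilon> z) a) \<longlongrightarrow> osc (\<lambda>z. B z * f z) a) (at_right 0)"
  proof (rule osc_tendsto[OF _ V])
    show "symb1 (\<lambda>z. V (fst z) * jbracket (snd z) powr (k + 1 + 1)) (\<lambda>z. B z * f z)"
      unfolding B_def by (rule symb1_inner_mult[OF f1])
    have "symb {0<..1} (osc_weight (\<lambda>\<epsilon> a. \<epsilon> * V a) (k + 1 + 1)) (\<lambda>\<epsilon> z. B z * (g \<epsilon> z - f z))"
      unfolding B_def
      by (rule symb_weight_eq[OF symb_mult[OF symb1D[OF symb1_inner_snd] gf]]) (simp add: powr_add power2_eq_square)
    then show "symb {0<..1} (osc_weight (\<lambda>\<epsilon> a. \<epsilon> * V a) (k + 1 + 1)) (\<lambda>\<epsilon> z. B z * g \<epsilon> z - B z * f z)"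
      by (simp add: right_diff_distrib)
  qed
  have 2: "((\<lambda>\<epsilon>. osc (dir_deriv (0, v) (g \<epsilon>)) a) \<longlongrightarrow> osc (dir_deriv (0, v) f) a) (at_right 0)"
  proof (rule osc_tendsto[OF symb_dir_deriv[OF f1] V])
    have "dir_deriv (0, v) (\<lambda>z. g \<epsilon> z - f z) = (\<lambda>z. dir_deriv (0, v) (g \<epsilon>) z - dir_deriv (0, v) f z)"
      if "\<epsilon> \<in> {0<..1}" for \<epsilon>
    proof -
      have s: "smooth (g \<epsilon>)" "smooth f" "smooth (\<lambda>z. - f z)"
        using symb1_smooth[OF gs[OF that, of 0]] symb1_smooth[OF f] symb1_smooth[OF symb_uminus[OF f]] by auto
      show ?thesis
        using dir_deriv_add[OF smooth_differentiable[OF s(1)] smooth_differentiable[OF s(3)], of "(0, v)"]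
          dir_deriv_bounded_linear[OF smooth_differentiable[OF s(2)] bounded_linear_minus[OF bounded_linear_ident], of "(0, v)"]
        by simp
    qed
    then show "symb {0<..1} (osc_weight (\<lambda>\<epsilon> a. \<epsilon> * V a) (k + 1))
        (\<lambda>\<epsilon> z. dir_deriv (0, v) (g \<epsilon>) z - dir_deriv (0, v) f z)"
      by (rule symb_congI[OF symb_dir_deriv[OF gf]])
  qed
  have "osc (\<lambda>z. B z * g \<epsilon> z) a = \<i> * osc (dir_deriv (0, v) (g \<epsilon>)) a" if "\<epsilon> \<in> {0<..1}" for \<epsilon>
    unfolding B_def
  proof (rule osc_inner_swap_integrable)
    \<comment> \<open>Enough decay for the integrable case, and nonpositive as the estimate of a
      dilated Gaussian requires.\<close>
    let ?s = "min 0 (- k - 1 - 2 * real DIM('e \<times> 'e))"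
    show "symb1 (\<lambda>z. V (fst z) * jbracket (snd z) powr (k + ?s)) (g \<epsilon>)"
      by (rule gs[OF that]) simp
    show "k + ?s + 1 \<le> - 2 * real DIM('e \<times> 'e)" by linarith
  qed
  then have "\<forall>\<^sub>F \<epsilon> in at_right 0. \<i> * osc (dir_deriv (0, v) (g \<epsilon>)) a = osc (\<lambda>z. B z * g \<epsilon> z) a"
    by (auto simp: eventually_at_right_field intro!: exI[of _ 1])
  from tendsto_unique[OF _ 1 Lim_transform_eventually[OF tendsto_mult_left[OF 2] this]]
  show ?thesis by (simp add: B_def)
qed

section \<open>Fourier transforms of Gaussians and the oscillatory integral of the constant
  1\<close>

lemma fourier_gauss_real:
  assumes s: "0 < s"
  shows "integrable lborel (\<lambda>x::real. cis (x * t) * complex_of_real (exp (- (s * x)\<^sup>2 / 2)))"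
    and "(LINT x|lborel. cis (x * t) * complex_of_real (exp (- (s * x)\<^sup>2 / 2))) =
      complex_of_real (sqrt (2 * pi) / s * exp (- (t / s)\<^sup>2 / 2))"
proof -
  define h where "h = (\<lambda>u x::real. cis (x * u) * complex_of_real (exp (- x\<^sup>2 / 2)))"
  have h_meas: "h u \<in> borel_measurable borel" for u
    unfolding h_def cis_conv_exp by (intro borel_measurable_continuous_onI continuous_intros) simp_all
  have h: "integrable lborel (h u)" for u
  proof (rule Bochner_Integration.integrable_bound)
    show "integrable lborel (\<lambda>x::real. sqrt (2 * pi) * std_normal_density x)"
      by (intro integrable_mult_right integrable_normal_density) simp
    show "h u \<in> borel_measurable lborel" using h_meas by simp
    show "AE x in lborel. norm (h u x) \<le> norm (sqrt (2 * pi) * std_normal_density x)"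
      by (auto simp: h_def std_normal_density_def norm_mult abs_mult)
  qed
  have hu: "(LINT x|lborel. h u x) = complex_of_real (sqrt (2 * pi) * exp (- u\<^sup>2 / 2))" for u
  proof -
    \<comment> \<open>The Gaussian is sqrt(2\<pi>) times the standard normal density, whose
      characteristic function is known.\<close>
    have "complex_of_real (exp (- u\<^sup>2 / 2)) = (LINT x|std_normal_distribution. iexp (u * x))"
      using char_std_normal_distribution by (simp add: char_def fun_eq_iff)
    also have "\<dots> = (LINT x|lborel. std_normal_density x *\<^sub>R iexp (u * x))"
      by (subst integral_density) (auto simp: normal_density_nonneg)
    also have "\<dots> = (LINT x|lborel. complex_of_real (1 / sqrt (2 * pi)) * h u x)"
      by (intro Bochner_Integration.integral_cong refl)
        (simp add: h_def std_normal_density_def cis_conv_exp scaleR_conv_of_real mult.commute)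
    also have "\<dots> = complex_of_real (1 / sqrt (2 * pi)) * (LINT x|lborel. h u x)"
      by (rule integral_mult_right_zero)
    finally show ?thesis by (simp add: field_simps)
  qed
  have eq: "cis (x * t) * complex_of_real (exp (- (s * x)\<^sup>2 / 2)) = h (t / s) (0 + s * x)" for x
    using s by (simp add: h_def)
  show "integrable lborel (\<lambda>x::real. cis (x * t) * complex_of_real (exp (- (s * x)\<^sup>2 / 2)))"
    unfolding eq using s by (intro lborel_integrable_real_affine h) simp
  have "(LINT x|lborel. h (t / s) x) = \<bar>s\<bar> *\<^sub>R (LINT x|lborel. h (t / s) (0 + s * x))"
    using s by (intro lborel_integral_real_affine) simp
  then show "(LINT x|lborel. cis (x * t) * complex_of_real (exp (- (s * x)\<^sup>2 / 2))) =
      complex_of_real (sqrt (2 * pi) / s * exp (- (t / s)\<^sup>2 / 2))"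
    unfolding eq using s by (simp add: hu scaleR_conv_of_real field_simps)
qed

lemma gauss_prod: "gauss (s *\<^sub>R x) = (\<Prod>b\<in>Basis. complex_of_real (exp (- (s * (x \<bullet> b))\<^sup>2 / 2)))"
  for x :: "'a::euclidean_space"
proof -
  have "- (norm (s *\<^sub>R x))\<^sup>2 / 2 = (\<Sum>b\<in>Basis. - (s * (x \<bullet> b))\<^sup>2 / 2)"
    unfolding norm_sq_Basis by (simp add: sum_negf sum_divide_distrib)
  then show ?thesis by (simp only: gauss_def exp_sum finite_Basis of_real_prod)
qed

lemma fourier_gauss:
  fixes \<theta> :: "'e::euclidean_space"
  assumes s: "0 < s"
  shows "integrable lborel (\<lambda>w. cis (w \<bullet> \<theta>) * gauss (s *\<^sub>R w))"
    and "(LINT w|lborel. cis (w \<bullet> \<theta>) * gauss (s *\<^sub>R w)) =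
      complex_of_real ((sqrt (2 * pi) / s) ^ DIM('e)) * gauss ((1 / s) *\<^sub>R \<theta>)"
proof -
  let ?g = "\<lambda>b x. cis (x * (\<theta> \<bullet> b)) * complex_of_real (exp (- (s * x)\<^sup>2 / 2))"
  have eq: "cis (w \<bullet> \<theta>) * gauss (s *\<^sub>R w) = (\<Prod>b\<in>Basis. ?g b (w \<bullet> b))" for w
  proof -
    have "cis (w \<bullet> \<theta>) = (\<Prod>b\<in>Basis. cis ((w \<bullet> b) * (\<theta> \<bullet> b)))"
      by (subst euclidean_inner) (simp add: cis_conv_exp sum_distrib_left exp_sum)
    then show ?thesis by (simp add: gauss_prod prod.distrib)
  qed
  show "integrable lborel (\<lambda>w. cis (w \<bullet> \<theta>) * gauss (s *\<^sub>R w))"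
    unfolding eq by (rule integrable_lborel_prod_Basis) (rule fourier_gauss_real[OF s])
  have "(LINT w|lborel. cis (w \<bullet> \<theta>) * gauss (s *\<^sub>R w)) =
      (\<Prod>b\<in>Basis. complex_of_real (sqrt (2 * pi) / s * exp (- ((\<theta> \<bullet> b) / s)\<^sup>2 / 2)))"
    unfolding eq by (subst integral_lborel_prod_Basis) (simp_all only: fourier_gauss_real[OF s])
  also have "\<dots> = complex_of_real ((sqrt (2 * pi) / s) ^ DIM('e)) * gauss ((1 / s) *\<^sub>R \<theta>)"
    by (simp only: gauss_prod of_real_mult prod.distrib prod_constant) simp
  finally show "(LINT w|lborel. cis (w \<bullet> \<theta>) * gauss (s *\<^sub>R w)) =
      complex_of_real ((sqrt (2 * pi) / s) ^ DIM('e)) * gauss ((1 / s) *\<^sub>R \<theta>)" .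
qed

lemma
  fixes F :: "'a::euclidean_space \<times> 'b::euclidean_space \<Rightarrow> 'c::{banach, second_countable_topology}"
  assumes F: "integrable lborel F"
  shows integral_lborel_snd: "(LINT q|lborel. F q) = (LINT y|lborel. LINT x|lborel. F (x, y))"
    and integral_lborel_fst: "(LINT q|lborel. F q) = (LINT x|lborel. LINT y|lborel. F (x, y))"
proof -
  have F': "integrable (lborel \<Otimes>\<^sub>M lborel) (\<lambda>(x, y). F (x, y))"
    using F by (simp add: lborel_prod)
  show "(LINT q|lborel. F q) = (LINT y|lborel. LINT x|lborel. F (x, y))"
    using lborel_pair.integral_snd[OF F'] by (simp add: lborel_prod)
  show "(LINT q|lborel. F q) = (LINT x|lborel. LINT y|lborel. F (x, y))"
    using lborel_pair.integral_fst[OF F'] by (simp add: lborel_prod)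
qed

lemma gauss_Pair: "gauss (s *\<^sub>R (x, y)) = gauss (s *\<^sub>R x) * gauss (s *\<^sub>R y)"
  by (simp add: gauss_def norm_Pair power_mult_distrib exp_add[symmetric] add_divide_distrib flip: of_real_mult)

text \<open>Damped by a Gaussian, the integral has the explicit value (1 + \<epsilon>^4)^(-n/2),
  which tends to 1. Here the normalisation (2\<pi>)^(-n) is confirmed; the inversion formula in
  \<open>osc_fst_only\<close> is derived from this one value.\<close>

lemma osc_one: "osc (\<lambda>z::'a::euclidean_space \<times> ('e::euclidean_space \<times> 'e). 1) a = 1"
proof -
  let ?one = "\<lambda>z::'a \<times> ('e \<times> 'e). 1 :: complex"
  let ?g = "\<lambda>\<epsilon> z::'a \<times> ('e \<times> 'e). 1 * gauss (\<epsilon> *\<^sub>R snd z)"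
  have one: "symb1 (\<lambda>z. (\<lambda>_. 1) (fst z) * jbracket (snd z) powr 0) ?one"
    by (rule symb_weight_eq[OF symb_const]) simp
  have one1: "symb1 (\<lambda>z. (\<lambda>_. 1) (fst z) * jbracket (snd z) powr (0 + 1)) ?one"
    by (rule symb_mono[OF one, where C = 1]) (auto simp: jbracket_ge_1)
  have lim: "((\<lambda>\<epsilon>. osc (?g \<epsilon>) a) \<longlongrightarrow> osc ?one a) (at_right 0)"
    by (rule osc_tendsto[where V = "\<lambda>_. 1" and k = "0 + 1", OF one1 _
          symb_regularize[where V = "\<lambda>_. 1" and k = 0, OF one symb1_gauss_bounded gauss_0]]) simp
  have val: "osc (?g \<epsilon>) a = complex_of_real ((1 / sqrt (1 + \<epsilon> ^ 4)) ^ DIM('e))" if \<epsilon>: "\<epsilon> \<in> {0<..1}" for \<epsilon>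
  proof -
    let ?s = "- 2 * real DIM('e \<times> 'e)"
    have gs: "symb1 (\<lambda>q. 1 * jbracket q powr ?s) (\<lambda>q::'e \<times> 'e. gauss (\<epsilon> *\<^sub>R q))"
      using symb1_dilation_decay[OF symb_gauss \<epsilon>, of ?s] by simp
    have "symb1 (\<lambda>z::'a \<times> ('e \<times> 'e). (\<lambda>_. 1) (fst z) * jbracket (snd z) powr ?s) (?g \<epsilon>)"
      using symb_linear[OF gs linear_snd] by simp
    from osc_eq1[where V = "\<lambda>_. 1", OF this, of 0]
    have "osc (?g \<epsilon>) a = complex_of_real (1 / (2 * pi) ^ DIM('e)) * (LINT q|lborel. osc_phase q * gauss (\<epsilon> *\<^sub>R (q :: 'e \<times> 'e)))"
      by (simp add: osc_int_def)
    also have "(LINT q|lborel. osc_phase q * gauss (\<epsilon> *\<^sub>R (q :: 'e \<times> 'e))) =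
        (LINT \<theta>|lborel. LINT w|lborel. osc_phase (w :: 'e, \<theta>) * gauss (\<epsilon> *\<^sub>R (w, \<theta>)))"
      by (rule integral_lborel_snd[where F = "\<lambda>q. osc_phase q * gauss (\<epsilon> *\<^sub>R q)"],
          rule integrable_symb1[OF gs _ borel_measurable_osc_phase]) auto
    also have "\<dots> = (LINT \<theta>|lborel. gauss (\<epsilon> *\<^sub>R \<theta>) * (LINT w|lborel. cis (w \<bullet> \<theta>) * gauss (\<epsilon> *\<^sub>R (w::'e))))"
      unfolding gauss_Pair osc_phase_def fst_conv snd_conv
      by (subst integral_mult_right_zero[symmetric]) (simp add: ac_simps)
    \<comment> \<open>The w-integral is a Gaussian in \<theta>/\<epsilon>; multiplied by the damping
      in \<theta> it gives one Gaussian with squared scale \<epsilon>^2 + 1/\<epsilon>^2. The factor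
      cis(\<theta>\<cdot>0) = 1 brings the integral into the form of
      \<open>fourier_gauss\<close>.\<close>
    also have "\<dots> = (LINT \<theta>|lborel. complex_of_real ((sqrt (2 * pi) / \<epsilon>) ^ DIM('e)) *
        (cis (\<theta> \<bullet> 0) * gauss (sqrt (\<epsilon>\<^sup>2 + 1 / \<epsilon>\<^sup>2) *\<^sub>R (\<theta>::'e))))"
    proof (intro Bochner_Integration.integral_cong refl)
      fix \<theta> :: 'e
      have "gauss (\<epsilon> *\<^sub>R \<theta>) * gauss ((1 / \<epsilon>) *\<^sub>R \<theta>) = gauss (sqrt (\<epsilon>\<^sup>2 + 1 / \<epsilon>\<^sup>2) *\<^sub>R \<theta>)"
        by (simp add: gauss_def power_mult_distrib power_divide add_nonneg_nonneg field_simps flip: of_real_mult exp_add)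
      then show "gauss (\<epsilon> *\<^sub>R \<theta>) * (LINT w|lborel. cis (w \<bullet> \<theta>) * gauss (\<epsilon> *\<^sub>R (w::'e))) =
          complex_of_real ((sqrt (2 * pi) / \<epsilon>) ^ DIM('e)) * (cis (\<theta> \<bullet> 0) * gauss (sqrt (\<epsilon>\<^sup>2 + 1 / \<epsilon>\<^sup>2) *\<^sub>R \<theta>))"
        using \<epsilon> by (simp add: fourier_gauss(2) ac_simps)
    qed
    also have "\<dots> = complex_of_real ((sqrt (2 * pi) / \<epsilon>) ^ DIM('e)) *
        complex_of_real ((sqrt (2 * pi) / sqrt (\<epsilon>\<^sup>2 + 1 / \<epsilon>\<^sup>2)) ^ DIM('e))"
    proof -
      have "0 < sqrt (\<epsilon>\<^sup>2 + 1 / \<epsilon>\<^sup>2)" using \<epsilon> by (auto intro!: add_pos_pos)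
      from fourier_gauss(2)[OF this, of "0::'e"] show ?thesis
        by (simp only: integral_mult_right_zero) simp
    qed
    also have "complex_of_real (1 / (2 * pi) ^ DIM('e)) * \<dots> =
        complex_of_real ((1 / (2 * pi) * (sqrt (2 * pi) / \<epsilon>) * (sqrt (2 * pi) / sqrt (\<epsilon>\<^sup>2 + 1 / \<epsilon>\<^sup>2))) ^ DIM('e))"
    proof -
      have "1 / c ^ n * (x ^ n * y ^ n) = (1 / c * x * y) ^ n" for c x y :: real and n
        by (simp add: power_mult_distrib power_divide)
      from this[symmetric] show ?thesis by (simp only: of_real_mult)
    qed
    also have "1 / (2 * pi) * (sqrt (2 * pi) / \<epsilon>) * (sqrt (2 * pi) / sqrt (\<epsilon>\<^sup>2 + 1 / \<epsilon>\<^sup>2)) = 1 / sqrt (1 + \<epsilon> ^ 4)"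
    proof -
      have "\<epsilon> * sqrt (\<epsilon>\<^sup>2 + 1 / \<epsilon>\<^sup>2) = sqrt (\<epsilon>\<^sup>2 * (\<epsilon>\<^sup>2 + 1 / \<epsilon>\<^sup>2))"
        using \<epsilon> by (simp add: real_sqrt_mult)
      also have "\<epsilon>\<^sup>2 * (\<epsilon>\<^sup>2 + 1 / \<epsilon>\<^sup>2) = 1 + \<epsilon> ^ 4"
        using \<epsilon> by (simp add: field_simps flip: power_add)
      finally have e: "\<epsilon> * sqrt (\<epsilon>\<^sup>2 + 1 / \<epsilon>\<^sup>2) = sqrt (1 + \<epsilon> ^ 4)" .
      have "1 / (2 * pi) * (sqrt (2 * pi) / \<epsilon>) * (sqrt (2 * pi) / sqrt (\<epsilon>\<^sup>2 + 1 / \<epsilon>\<^sup>2)) =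
        (sqrt (2 * pi) * sqrt (2 * pi)) / (2 * pi) / (\<epsilon> * sqrt (\<epsilon>\<^sup>2 + 1 / \<epsilon>\<^sup>2))"
        by (simp add: field_simps)
      also have "\<dots> = 1 / sqrt (1 + \<epsilon> ^ 4)" unfolding e by simp
      finally show ?thesis .
    qed
    finally show ?thesis .
  qed
  have "((\<lambda>\<epsilon>::real. complex_of_real ((1 / sqrt (1 + \<epsilon> ^ 4)) ^ DIM('e))) \<longlongrightarrow>
      complex_of_real ((1 / sqrt (1 + 0 ^ 4)) ^ DIM('e))) (at_right 0)"
    by (intro tendsto_intros) auto
  then have "((\<lambda>\<epsilon>. osc (?g \<epsilon>) a) \<longlongrightarrow> 1) (at_right 0)"
    by (rule Lim_transform_eventually[OF tendsto_eq_rhs])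
      (use val in \<open>auto simp: eventually_at_right_field intro!: exI[of _ 1]\<close>)
  from tendsto_unique[OF _ lim this] show ?thesis by simp
qed

section \<open>Symbol estimates for Taylor remainders\<close>

lemma continuous_on_dir_derivs_linear_family:
  fixes f :: "'b::euclidean_space \<Rightarrow> complex" and A :: "'t::topological_space \<Rightarrow> 'c::euclidean_space \<Rightarrow> 'b"
  assumes f: "smooth f" and A: "\<And>t. linear (A t)" "\<And>v. continuous_on S (\<lambda>t. A t v)"
  shows "continuous_on S (\<lambda>t. dir_derivs vs (\<lambda>x. f (A t x)) x)"
proof -
  have coeff: "continuous_on S (\<lambda>t. coeff_prod (map (A t) vs) bs)" for bs
  proof (induction vs arbitrary: bs)
    case (Cons v vs)
    then show ?case
    proof (cases bs)
      case (Cons b bs')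
      have "continuous_on S (\<lambda>t. (A t v \<bullet> b) * coeff_prod (map (A t) vs) bs')"
        by (intro continuous_intros A Cons.IH)
      then show ?thesis by (simp add: Cons coeff_prod_def)
    qed (simp add: coeff_prod_def)
  qed (simp add: coeff_prod_def)
  have eq: "dir_derivs vs (\<lambda>x. f (A t x)) x =
      (\<Sum>bs\<in>basis_lists (length vs). coeff_prod (map (A t) vs) bs *\<^sub>R dir_derivs bs f (A t x))" for t
    using dir_derivs_affine[OF A(1), of vs f t 0] dir_derivs_expand[OF f, of "map (A t) vs"] by simp
  show ?thesis
    unfolding eq
    by (intro continuous_on_sum continuous_on_scaleR coeff
        continuous_on_compose2[OF smooth_continuous_on[OF smooth_dir_derivs[OF f], where S = UNIV] A(2)]) auto
qed

text \<open>Continuity of A in t and compactness of [0,1] bound the linear parts, so all A t form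
  one family. The comparison of U with W is demanded for t in [0,1] only, where the kernel
  lives.\<close>

lemma symb1_taylor_integral:
  fixes F :: "'b::euclidean_space \<Rightarrow> complex" and A :: "real \<Rightarrow> 'c::euclidean_space \<Rightarrow> 'b"
  assumes F: "symb1 U F" and A: "\<And>t. linear (A t)" "\<And>v. continuous_on UNIV (\<lambda>t. A t v)"
    and W: "continuous_on UNIV W" "\<And>x. 0 \<le> W x"
    and UW: "\<And>t x. t \<in> {0..1} \<Longrightarrow> U (A t x) \<le> C * W x"
  shows "symb1 W (\<lambda>x. LINT t|lborel. taylor_kernel m t * F (A t x))"
proof (rule symb_param_integral[where T = "{0..1}" and H = "\<lambda>_. 1"])
  have bnd: "\<exists>K. \<forall>j\<in>{0..1} \<times> UNIV. norm (A (fst j) v) \<le> K" for v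
  proof -
    have "compact ((\<lambda>t. A t v) ` {0..1})"
      by (intro compact_continuous_image continuous_on_subset[OF A(2)]) auto
    then obtain K where "\<And>y. y \<in> (\<lambda>t. A t v) ` {0..1} \<Longrightarrow> norm y \<le> K"
      using compact_imp_bounded bounded_iff by metis
    then show ?thesis by (intro exI[of _ K]) auto
  qed
  have "symb ({0..1} \<times> (UNIV :: unit set)) (\<lambda>j x. U (A (fst j) x + 0)) (\<lambda>j x. F (A (fst j) x + 0))"
    by (rule symb_affine[OF symb1D[OF F] A(1) bnd])
  then have "symb ({0..1} \<times> (UNIV :: unit set)) (\<lambda>(t, i) x. W x * 1) (\<lambda>j x. F (A (fst j) x + 0))"
    by (rule symb_mono[where C = C]) (use UW W in auto)
  then show "symb ({0..1} \<times> (UNIV :: unit set)) (\<lambda>(t, i) x. W x * 1) (\<lambda>(t, i) x. F (A t x))"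
    by (simp add: case_prod_unfold)
  show "(\<lambda>t. taylor_kernel m t * dir_derivs vs (\<lambda>x. F (A t x)) x) \<in> borel_measurable lborel" for vs x
    using borel_measurable_times[OF borel_measurable_taylor_kernel
        borel_measurable_continuous_onI[OF continuous_on_dir_derivs_linear_family[OF symb1_smooth[OF F] A]]]
    by simp
  show "integrable lborel (\<lambda>t. norm (taylor_kernel m t) * 1)"
    using integrable_taylor_kernel by simp
qed (use W in \<open>auto simp: taylor_kernel_def\<close>)

lemma integrable_taylor_kernel_mult:
  fixes g :: "real \<Rightarrow> complex"
  assumes "continuous_on UNIV g"
  shows "integrable lborel (\<lambda>t. taylor_kernel m t * g t)"
proof -
  have "continuous_on {0..1} g" using assms continuous_on_subset by blast
  then have "set_integrable lborel {0..1} (\<lambda>t. complex_of_real ((1 - t) ^ m / fact m) * g t)"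
    by (intro borel_integrable_atLeastAtMost' continuous_intros) auto
  then show ?thesis
    by (simp add: set_integrable_def taylor_kernel_def scaleR_conv_of_real mult.assoc)
qed

lemma powr_jbracket_mono2: "0 \<le> k \<Longrightarrow> norm x \<le> norm y \<Longrightarrow> jbracket x powr k \<le> jbracket y powr k"
  by (intro powr_mono2 jbracket_mono) auto

lemma norm_fst_snd_le: "norm (fst q) \<le> norm q" "norm (snd q) \<le> norm q"
  using norm_fst_le[of "fst q" "snd q"] norm_snd_le[of "snd q" "fst q"] by simp_all

lemma symb1_weight_fst_nonneg:
  assumes "symb1 (\<lambda>z::'a::euclidean_space \<times> 'q::euclidean_space. V (fst z) * jbracket (snd z) powr k) f"
  shows "0 \<le> V a"
  using symb1_nonneg[OF assms, of "(a, 0)"] by simp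

lemma dir_derivs_fixed_fst:
  "dir_derivs vs (\<lambda>q. f (a, q)) q = dir_derivs (map (\<lambda>v. (0, v)) vs) f (a, q)"
proof (induction vs arbitrary: q)
  case (Cons v vs)
  then have "dir_derivs vs (\<lambda>q. f (a, q)) = (\<lambda>q. dir_derivs (map (\<lambda>v. (0, v)) vs) f (a, q))" by blast
  then show ?case by (simp add: dir_deriv_fixed_fst)
qed simp

text \<open>This is Fourier inversion. By Taylor's formula h(a, w) = h(a, 0) + \<Sum> w_b r_b, and a
  factor w_b is traded for i times the \<theta>_b-derivative of r_b, which is 0 because r_b does not
  depend on \<theta>. The constant h(a, 0) is multiplied by the oscillatory integral of 1.\<close>

lemma osc_fst_only:
  fixes h :: "'a::euclidean_space \<times> 'e::euclidean_space \<Rightarrow> complex"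
  assumes h: "symb1 (\<lambda>x. V (fst x) * jbracket (snd x) powr k) h" and V: "continuous_on UNIV V" and k: "0 \<le> k"
  shows "osc (\<lambda>z. h (fst z, fst (snd z))) a = h (a, 0)"
proof -
  have V0: "0 \<le> V a" for a by (rule symb1_weight_fst_nonneg[OF h])
  define r where "r = (\<lambda>b (z :: 'a \<times> ('e \<times> 'e)). LINT t|lborel. taylor_kernel 0 t * dir_deriv (0, b) h (fst z, t *\<^sub>R fst (snd z)))"
  have hF: "symb1 (\<lambda>w. V a * jbracket w powr k) (\<lambda>w. h (a, w))" for a
    using symb_fixed_fst[OF h, of a] by simp
  have tay: "h (a, w) = h (a, 0) + (\<Sum>b\<in>Basis. complex_of_real (w \<bullet> b) * r b (a, (w, \<theta>)))" for a w \<theta>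
  proof -
    have sm: "smooth (\<lambda>w. h (a, w))" by (rule symb1_smooth[OF hF])
    have cont: "continuous_on UNIV (\<lambda>t. dir_deriv (0, b) h (a, t *\<^sub>R w))" for b
      by (rule continuous_on_compose2[OF smooth_continuous_on[OF smooth_dir_deriv[OF symb1_smooth[OF h]], where S = UNIV]])
        (auto intro!: continuous_intros)
    have "h (a, 0 + w) = h (a, 0) + (LINT t|lborel. taylor_kernel 0 t * dir_deriv w (\<lambda>w. h (a, w)) (0 + t *\<^sub>R w))"
      using taylor_lebesgue[OF sm, of 0 w 0] by simp
    also have "(LINT t|lborel. taylor_kernel 0 t * dir_deriv w (\<lambda>w. h (a, w)) (0 + t *\<^sub>R w)) =
        (LINT t|lborel. (\<Sum>b\<in>Basis. complex_of_real (w \<bullet> b) * (taylor_kernel 0 t * dir_deriv (0, b) h (a, t *\<^sub>R w))))"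
      by (subst dir_deriv_expand[OF smooth_differentiable[OF sm]])
        (simp add: sum_distrib_left dir_deriv_fixed_fst scaleR_conv_of_real ac_simps)
    also have "\<dots> = (\<Sum>b\<in>Basis. complex_of_real (w \<bullet> b) * r b (a, (w, \<theta>)))"
      unfolding r_def by (subst Bochner_Integration.integral_sum)
        (auto intro!: integrable_mult_right integrable_taylor_kernel_mult cont)
    finally show ?thesis by simp
  qed
  have r: "symb1 (\<lambda>z. V (fst z) * jbracket (snd z) powr k) (r b)" for b
    unfolding r_def
  proof (rule symb1_taylor_integral[where A = "\<lambda>t z. (fst z, t *\<^sub>R fst (snd z))", OF symb_dir_deriv[OF h], where C = 1])
    show "continuous_on UNIV (\<lambda>z::'a \<times> ('e \<times> 'e). V (fst z) * jbracket (snd z) powr k)"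
      by (intro continuous_intros continuous_on_compose2[OF V]) auto
    fix t :: real and z :: "'a \<times> ('e \<times> 'e)" assume t: "t \<in> {0..1}"
    have "norm (t *\<^sub>R fst (snd z)) \<le> norm (fst (snd z))" using t by (simp add: mult_left_le_one_le)
    also have "\<dots> \<le> norm (snd z)" by (rule norm_fst_snd_le)
    finally show "V (fst (fst z, t *\<^sub>R fst (snd z))) * jbracket (snd (fst z, t *\<^sub>R fst (snd z))) powr k
        \<le> 1 * (V (fst z) * jbracket (snd z) powr k)"
      using V0 k by (auto intro!: mult_left_mono powr_jbracket_mono2)
  qed (auto simp: linear_iff algebra_simps V0 intro!: continuous_intros)
  \<comment> \<open>The constant term and the linear terms are brought to the common order k + 1, as
    additivity requires.\<close>
  have k1: "symb1 (\<lambda>z. V (fst z) * jbracket (snd z) powr (k + 1)) (\<lambda>z::'a \<times> ('e \<times> 'e). h (fst z, 0))"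
  proof (rule symb_mono[where C = 1])
    show "symb1 (\<lambda>z::'a \<times> ('e \<times> 'e). V (fst (fst z, 0::'e)) * jbracket (snd (fst z, 0::'e)) powr k) (\<lambda>z. h (fst z, 0))"
      by (rule symb_linear[where A = "\<lambda>z. (fst z, 0)", OF h]) (auto simp: linear_iff)
    show "V (fst (fst z, 0::'e)) * jbracket (snd (fst z, 0::'e)) powr k \<le> 1 * (V (fst z) * jbracket (snd z) powr (k + 1))"
      for z :: "'a \<times> ('e \<times> 'e)"
      using mult_left_mono[OF jbracket_powr_ge_1[of "k + 1" "snd z"] V0[of "fst z"]] k by simp
  qed (simp add: V0)
  have k2: "symb1 (\<lambda>z. V (fst z) * jbracket (snd z) powr (k + 1)) (\<lambda>z. complex_of_real (snd z \<bullet> prod.swap (0, b)) * r b z)" for b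
    by (rule symb1_inner_mult[OF r])
  have *: "(\<lambda>z. h (fst z, fst (snd z))) = (\<lambda>z. h (fst z, 0) + (\<Sum>b\<in>Basis. complex_of_real (snd z \<bullet> prod.swap (0, b)) * r b z))"
    (is "?f = _")
  proof
    fix z :: "'a \<times> ('e \<times> 'e)"
    show "h (fst z, fst (snd z)) = h (fst z, 0) + (\<Sum>b\<in>Basis. complex_of_real (snd z \<bullet> prod.swap (0, b)) * r b z)"
      using tay[of "fst z" "fst (snd z)" "snd (snd z)"] by (simp add: inner_Pair_0)
  qed
  have "osc ?f a = osc (\<lambda>z :: 'a \<times> ('e \<times> 'e). h (fst z, 0)) a + osc (\<lambda>z. \<Sum>b\<in>Basis. complex_of_real (snd z \<bullet> prod.swap (0, b)) * r b z) a"
  proof -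
    have "symb1 (\<lambda>z. V (fst z) * jbracket (snd z) powr (k + 1)) (\<lambda>z. \<Sum>b\<in>Basis. complex_of_real (snd z \<bullet> prod.swap (0, b)) * r b z)"
      by (rule symb_sum[OF k2]) (simp add: V0)
    from osc_add[OF k1 this] show ?thesis by (simp only: *)
  qed
  also have "osc (\<lambda>z. \<Sum>b\<in>Basis. complex_of_real (snd z \<bullet> prod.swap (0, b)) * r b z) a =
      (\<Sum>b\<in>Basis. osc (\<lambda>z. complex_of_real (snd z \<bullet> prod.swap (0, b)) * r b z) a)"
    by (rule osc_sum[OF k2 V0])
  also have "\<dots> = 0"
  proof (rule sum.neutral, rule ballI)
    fix b :: 'e
    \<comment> \<open>The factor w_b is q\<cdot>swap (0, b), so the derivative that replaces it is
      in the \<theta>-direction (0, b), in which r_b is constant.\<close>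
    have "dir_deriv (0, (0, b)) (r b) = (\<lambda>_. 0)"
    proof -
      have "r b (z + t *\<^sub>R (0, (0, b))) = r b z" for z t by (simp add: r_def)
      then show ?thesis by (simp only: fun_eq_iff dir_deriv_def vector_derivative_const_at simp_thms)
    qed
    then show "osc (\<lambda>z. complex_of_real (snd z \<bullet> prod.swap (0, b)) * r b z) a = 0"
      unfolding osc_inner_swap[OF r V] by simp
  qed
  also have "osc (\<lambda>z::'a \<times> ('e \<times> 'e). h (fst z, 0)) a = h (a, 0)"
  proof -
    have one: "symb1 (\<lambda>z::'a \<times> ('e \<times> 'e). (\<lambda>_. 1) (fst z) * jbracket (snd z) powr 0) (\<lambda>_. 1 :: complex)"
      by (rule symb_weight_eq[OF symb_const]) simp
    have "osc (\<lambda>z::'a \<times> ('e \<times> 'e). h (fst z, 0)) a = osc (\<lambda>z::'a \<times> ('e \<times> 'e). h (a, 0) * 1) a"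
      using osc_fixed_fst[of "\<lambda>z :: 'a \<times> ('e \<times> 'e). h (fst z, 0)" a a] by simp
    also have "\<dots> = h (a, 0)"
      by (subst osc_cmult[where V = "\<lambda>_. 1", OF one]) (simp add: osc_one)
    finally show ?thesis .
  qed
  finally show ?thesis by simp
qed

section \<open>Taylor expansion in \<theta>\<close>

definition snd_monomial :: "'e list \<Rightarrow> 'a \<times> ('e::euclidean_space \<times> 'e) \<Rightarrow> complex" where
  "snd_monomial js z = prod_list (map (\<lambda>j. complex_of_real (snd (snd z) \<bullet> j)) js)"

lemma symb1_snd_monomial:
  "symb1 (\<lambda>z. jbracket (snd z) powr real (length js))
    (snd_monomial js :: 'a::euclidean_space \<times> ('e::euclidean_space \<times> 'e) \<Rightarrow> complex)"
proof (induction js)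
  case Nil
  have "snd_monomial [] = (\<lambda>_ :: 'a \<times> ('e \<times> 'e). 1)" by (simp add: snd_monomial_def[abs_def])
  then show ?case using symb_weight_eq[OF symb_const, of UNIV "\<lambda>(_::unit) z. jbracket (snd z) powr real 0" 1] by simp
next
  case (Cons j js)
  have eq: "snd_monomial (j # js) = (\<lambda>z :: 'a \<times> ('e \<times> 'e). complex_of_real (snd z \<bullet> (0, j)) * snd_monomial js z)"
    by (simp add: snd_monomial_def fun_eq_iff)
  show ?case
    unfolding eq
    by (rule symb_weight_eq[OF symb_mult[OF symb1_inner_snd Cons]]) (simp add: powr_add)
qed

lemma symb1_snd_monomial_mult:
  assumes "symb1 (\<lambda>z. V (fst z) * jbracket (snd z) powr k) g"
  shows "symb1 (\<lambda>z. V (fst z) * jbracket (snd z) powr (k + real (length js))) (\<lambda>z. snd_monomial js z * g z)"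
  by (rule symb_weight_eq[OF symb_mult[OF symb1_snd_monomial assms]]) (simp add: powr_add)

text \<open>Each factor \<theta>_j is traded for i times a derivative in w_j. The remaining monomial
  does not depend on w, so the derivative falls on g alone.\<close>

lemma osc_snd_monomial:
  fixes g :: "'a::euclidean_space \<times> ('e::euclidean_space \<times> 'e) \<Rightarrow> complex"
  assumes g: "symb1 (\<lambda>z. V (fst z) * jbracket (snd z) powr k) g" and V: "continuous_on UNIV V"
  shows "osc (\<lambda>z. snd_monomial js z * g z) a = \<i> ^ length js * osc (dir_derivs (map (\<lambda>j. (0, (j, 0))) js) g) a"
  using g
proof (induction js arbitrary: g)
  case Nil
  then show ?case by (simp add: snd_monomial_def)
next
  case (Cons j js)
  have eq: "(\<lambda>z. snd_monomial (j # js) z * g z) = (\<lambda>z. complex_of_real (snd z \<bullet> prod.swap (j, 0)) * (snd_monomial js z * g z))"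
    by (simp add: snd_monomial_def fun_eq_iff)
  have "dir_deriv (0, (j, 0)) (\<lambda>z. snd_monomial js z * g z) = (\<lambda>z. snd_monomial js z * dir_deriv (0, (j, 0)) g z)"
  proof -
    have "dir_deriv (0, (j, 0)) (snd_monomial js) = (\<lambda>_ :: 'a \<times> ('e \<times> 'e). 0)"
      by (simp add: fun_eq_iff dir_deriv_def snd_monomial_def)
    then show ?thesis
      by (subst dir_deriv_mult) (auto simp: smooth_differentiable symb1_smooth[OF symb1_snd_monomial] symb1_smooth[OF Cons.prems])
  qed
  then have "osc (\<lambda>z. snd_monomial (j # js) z * g z) a = \<i> * osc (\<lambda>z. snd_monomial js z * dir_deriv (0, (j, 0)) g z) a"
    unfolding eq by (subst osc_inner_swap[OF symb1_snd_monomial_mult[OF Cons.prems] V]) simp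
  also have "\<dots> = \<i> * (\<i> ^ length js * osc (dir_derivs (map (\<lambda>j. (0, (j, 0))) js) (dir_deriv (0, (j, 0)) g)) a)"
    by (simp only: Cons.IH[OF symb_dir_deriv[OF Cons.prems]])
  finally show ?case
    by (simp add: dir_derivs_dir_deriv_commute[OF symb1_smooth[OF Cons.prems]])
qed

lemma coeff_prod_replicate:
  "complex_of_real (coeff_prod (replicate (length js) \<theta>) js) = snd_monomial js (a, (w, \<theta>))"
  by (induction js) (simp_all add: coeff_prod_def snd_monomial_def)

text \<open>The Taylor polynomial of f in \<theta> at 0 has coefficients depending on w only.
  Trading its monomials for w-derivatives leaves functions of (a, w), which integrate to their
  values at w = 0. The remainder estimate is a hypothesis with a weight U of its own, because the
  gain in it comes from the special form of f.\<close>

theorem osc_expansion: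
  fixes f :: "'a::euclidean_space \<times> ('e::euclidean_space \<times> 'e) \<Rightarrow> complex"
  defines "D1 \<equiv> \<lambda>js. dir_derivs (map (\<lambda>j. (0 :: 'a, (j :: 'e, 0 :: 'e))) js)"
    and "D2 \<equiv> \<lambda>js. dir_derivs (map (\<lambda>j. (0 :: 'a, (0 :: 'e, j :: 'e))) js)"
  assumes f: "symb1 (\<lambda>z. V (fst z) * jbracket (snd z) powr k) f" and V: "continuous_on UNIV V" and k: "0 \<le> k"
    and U: "continuous_on UNIV U" and k': "0 \<le> k'"
    and rem: "\<And>js. js \<in> basis_lists (Suc m) \<Longrightarrow> symb1 (\<lambda>z. U (fst z) * jbracket (snd z) powr k')
      (\<lambda>z. LINT t|lborel. taylor_kernel m t * D2 js f (fst z, (fst (snd z), t *\<^sub>R snd (snd z))))"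
  shows "\<exists>R. symb1 U R \<and> (\<forall>a. osc f a =
    (\<Sum>n\<le>m. \<i> ^ n / fact n * (\<Sum>js\<in>basis_lists n. D1 js (D2 js f) (a, 0))) + R a)"
proof -
  define r where "r = (\<lambda>js (z :: 'a \<times> ('e \<times> 'e)). LINT t|lborel. taylor_kernel m t * D2 js f (fst z, (fst (snd z), t *\<^sub>R snd (snd z))))"
  define g where "g = (\<lambda>js (z :: 'a \<times> ('e \<times> 'e)). D2 js f (fst z, (fst (snd z), 0)))"
  have sf: "smooth f" by (rule symb1_smooth[OF f])
  have V0: "0 \<le> V a" for a by (rule symb1_weight_fst_nonneg[OF f])
  \<comment> \<open>Any word of length m + 1 will do: it gives an instance of the remainder
    hypothesis, from which U \<ge> 0 is read off.\<close>
  obtain j0 :: 'e where "j0 \<in> Basis" using nonempty_Basis by blast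
  then have "replicate (Suc m) j0 \<in> basis_lists (Suc m)" by (auto simp: basis_lists_def)
  then have U0: "0 \<le> U a" for a using symb1_weight_fst_nonneg[OF rem] by blast
  have r: "symb1 (\<lambda>z. U (fst z) * jbracket (snd z) powr k') (r js)" if "js \<in> basis_lists (Suc m)" for js
    unfolding r_def by (rule rem[OF that])
  have D2f: "symb1 (\<lambda>z. V (fst z) * jbracket (snd z) powr k) (D2 js f)" for js
    unfolding D2_def by (rule symb_dir_derivs[OF f])
  have h: "symb1 (\<lambda>x. V (fst x) * jbracket (snd x) powr k) (\<lambda>x. D2 js f (fst x, (snd x, 0)))" for js
  proof (rule symb_weight_eq[OF symb_linear[OF D2f, of "\<lambda>x. (fst x, (snd x, 0))"]])
    show "linear (\<lambda>x::'a \<times> 'e. (fst x, (snd x, 0::'e)))" by (auto simp: linear_iff)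
  qed (simp add: jbracket_def norm_Pair)
  have g: "symb1 (\<lambda>z. V (fst z) * jbracket (snd z) powr k) (g js)" for js
    unfolding g_def
  proof (rule symb_mono[where C = 1])
    show "symb1 (\<lambda>z. V (fst (fst z, (fst (snd z), 0::'e))) * jbracket (snd (fst z, (fst (snd z), 0::'e))) powr k)
       (\<lambda>z::'a \<times> ('e \<times> 'e). D2 js f (fst z, (fst (snd z), 0)))"
      by (rule symb_linear[OF D2f, of "\<lambda>z. (fst z, (fst (snd z), 0))"]) (auto simp: linear_iff)
    show "V (fst (fst z, (fst (snd z), 0::'e))) * jbracket (snd (fst z, (fst (snd z), 0::'e))) powr k \<le>
        1 * (V (fst z) * jbracket (snd z) powr k)" for z :: "'a \<times> ('e \<times> 'e)"
      using V0 k norm_fst_snd_le(1)[of "snd z"] by (auto intro!: mult_left_mono powr_jbracket_mono2 simp: norm_Pair)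
  qed (simp add: V0)
  have D1g: "osc (D1 js (g js)) a = D1 js (D2 js f) (a, 0)" for js a
  proof -
    have D: "D1 vs (g js) = (\<lambda>z. D1 vs (D2 js f) (fst z, (fst (snd z), 0)))" for vs
      unfolding D1_def g_def
      by (induction vs) (auto simp: dir_deriv_def fun_eq_iff)
    have s: "symb1 (\<lambda>x. V (fst x) * jbracket (snd x) powr k) (\<lambda>x. D1 js (D2 js f) (fst x, (snd x, 0)))"
    proof (rule symb_weight_eq[OF symb_linear[of UNIV _ "\<lambda>_. D1 js (D2 js f)" "\<lambda>x. (fst x, (snd x, 0))"]])
      show "symb1 (\<lambda>z. V (fst z) * jbracket (snd z) powr k) (D1 js (D2 js f))"
        unfolding D1_def by (rule symb_dir_derivs[OF D2f])
      show "linear (\<lambda>x::'a \<times> 'e. (fst x, (snd x, 0::'e)))" by (auto simp: linear_iff)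
    qed (simp add: jbracket_def norm_Pair)
    show ?thesis
      unfolding D using osc_fst_only[OF s V k, of a] by (simp add: zero_prod_def)
  qed
  have tay: "f z = (\<Sum>n\<le>m. \<Sum>js\<in>basis_lists n. complex_of_real (1 / fact n) * (snd_monomial js z * g js z))
      + (\<Sum>js\<in>basis_lists (Suc m). snd_monomial js z * r js z)" for z
  proof -
    obtain a w \<theta> where z: "z = (a, (w, \<theta>))" by (cases z) auto
    define F where "F = (\<lambda>\<eta>. f (a, (w, \<eta>)))"
    have DF: "dir_derivs vs F \<eta> = D2 vs f (a, (w, \<eta>))" for vs \<eta>
      unfolding F_def D2_def dir_derivs_fixed_fst[of vs "\<lambda>q. f (a, q)"] dir_derivs_fixed_fst[of _ f a] by (simp add: o_def)
    have sF: "smooth F"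
      unfolding F_def using smooth_affine[OF sf, of "\<lambda>\<eta>. (0, (0, \<eta>))" "(a, (w, 0))"] by (auto simp: linear_iff)
    have exp: "dir_derivs (replicate n \<theta>) F \<eta> = (\<Sum>js\<in>basis_lists n. snd_monomial js z * D2 js f (a, (w, \<eta>)))" for n \<eta>
    proof -
      have "dir_derivs (replicate n \<theta>) F \<eta> = (\<Sum>js\<in>basis_lists n. coeff_prod (replicate n \<theta>) js *\<^sub>R dir_derivs js F \<eta>)"
        using dir_derivs_expand[OF sF, of "replicate n \<theta>"] by simp
      also have "\<dots> = (\<Sum>js\<in>basis_lists n. snd_monomial js z * D2 js f (a, (w, \<eta>)))"
      proof (rule sum.cong[OF refl])
        fix js :: "'e list" assume "js \<in> basis_lists n"
        then have "length js = n" by (simp add: basis_lists_def)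
        then show "coeff_prod (replicate n \<theta>) js *\<^sub>R dir_derivs js F \<eta> = snd_monomial js z * D2 js f (a, (w, \<eta>))"
          using coeff_prod_replicate[of js \<theta> a w] by (simp add: DF scaleR_conv_of_real z)
      qed
      finally show ?thesis .
    qed
    have cont: "continuous_on UNIV (\<lambda>t. D2 js f (a, (w, t *\<^sub>R \<theta>)))" for js
      by (rule continuous_on_compose2[OF smooth_continuous_on[OF symb1_smooth[OF D2f], where S = UNIV]])
        (auto intro!: continuous_intros)
    have "(LINT t|lborel. taylor_kernel m t * dir_derivs (replicate (Suc m) \<theta>) F (0 + t *\<^sub>R \<theta>)) =
        (LINT t|lborel. (\<Sum>js\<in>basis_lists (Suc m). snd_monomial js z * (taylor_kernel m t * D2 js f (a, (w, t *\<^sub>R \<theta>)))))"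
      unfolding exp by (simp add: sum_distrib_left ac_simps)
    also have "\<dots> = (\<Sum>js\<in>basis_lists (Suc m). snd_monomial js z * r js z)"
      unfolding r_def z by (subst Bochner_Integration.integral_sum)
        (auto intro!: integrable_mult_right integrable_taylor_kernel_mult cont)
    finally have rest: "(LINT t|lborel. taylor_kernel m t * dir_derivs (replicate (Suc m) \<theta>) F (0 + t *\<^sub>R \<theta>)) =
        (\<Sum>js\<in>basis_lists (Suc m). snd_monomial js z * r js z)" .
    have "f z = F (0 + \<theta>)" by (simp add: F_def z)
    also have "\<dots> = (\<Sum>n\<le>m. (1 / fact n) *\<^sub>R dir_derivs (replicate n \<theta>) F 0) + (\<Sum>js\<in>basis_lists (Suc m). snd_monomial js z * r js z)"
      unfolding taylor_lebesgue[OF sF, of 0 \<theta> m] rest ..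
    finally show ?thesis
      unfolding exp by (simp add: g_def z scaleR_conv_of_real sum_distrib_left)
  qed
  \<comment> \<open>W and K are a common weight and order for all terms, used for additivity of the
    oscillatory integral; the remainder R is afterwards estimated with U alone.\<close>
  define W where "W = (\<lambda>a. V a + U a)"
  define K where "K = k + k' + real (Suc m)"
  have WK: "symb1 (\<lambda>z. W (fst z) * jbracket (snd z) powr K) F"
    if F: "symb1 (\<lambda>z. X (fst z) * jbracket (snd z) powr s) F" and X: "\<And>a. X a \<le> W a" and s: "s \<le> K" for X s and F :: "'a \<times> ('e \<times> 'e) \<Rightarrow> complex"
    by (rule symb_mono[OF F, where C = 1])
      (use X s V0 U0 in \<open>auto simp: W_def intro!: mult_mono jbracket_powr_mono\<close>)
  have t1: "symb1 (\<lambda>z. W (fst z) * jbracket (snd z) powr K) (\<lambda>z. snd_monomial js z * g js z)"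
    if "js \<in> basis_lists n" "n \<le> m" for js n
    by (rule WK[OF symb1_snd_monomial_mult[OF g]]) (use that k k' U0 in \<open>auto simp: W_def K_def basis_lists_def\<close>)
  have t2: "symb1 (\<lambda>z. W (fst z) * jbracket (snd z) powr K) (\<lambda>z. snd_monomial js z * r js z)"
    if "js \<in> basis_lists (Suc m)" for js
    by (rule WK[OF symb1_snd_monomial_mult[OF r[OF that]]]) (use that k k' V0 in \<open>auto simp: W_def K_def basis_lists_def\<close>)
  have W0: "0 \<le> W a" for a using V0 U0 by (simp add: W_def)
  define R where "R = (\<lambda>a. \<Sum>js\<in>basis_lists (Suc m). \<i> ^ Suc m * osc (D1 js (r js)) a)"
  have "osc f a = (\<Sum>n\<le>m. \<i> ^ n / fact n * (\<Sum>js\<in>basis_lists n. D1 js (D2 js f) (a, 0))) + R a" for a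
  proof -
    have in1: "symb1 (\<lambda>z. W (fst z) * jbracket (snd z) powr K)
        (\<lambda>z. \<Sum>js\<in>basis_lists n. complex_of_real (1 / fact n) * (snd_monomial js z * g js z))" if "n \<le> m" for n
      by (intro symb_sum symb_cmult t1[OF _ that] mult_nonneg_nonneg W0) auto
    have in2: "symb1 (\<lambda>z. W (fst z) * jbracket (snd z) powr K) (\<lambda>z. \<Sum>js\<in>basis_lists (Suc m). snd_monomial js z * r js z)"
      by (intro symb_sum t2 mult_nonneg_nonneg W0) auto
    have in3: "symb1 (\<lambda>z. W (fst z) * jbracket (snd z) powr K)
        (\<lambda>z. \<Sum>n\<le>m. \<Sum>js\<in>basis_lists n. complex_of_real (1 / fact n) * (snd_monomial js z * g js z))"
      by (rule symb_sum, rule in1) (auto simp: W0)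
    have "osc f a = osc (\<lambda>z. (\<Sum>n\<le>m. \<Sum>js\<in>basis_lists n. complex_of_real (1 / fact n) * (snd_monomial js z * g js z))
        + (\<Sum>js\<in>basis_lists (Suc m). snd_monomial js z * r js z)) a"
      using tay by (intro arg_cong[where f = "\<lambda>f. osc f a"]) blast
    also have "\<dots> = osc (\<lambda>z. \<Sum>n\<le>m. \<Sum>js\<in>basis_lists n. complex_of_real (1 / fact n) * (snd_monomial js z * g js z)) a
        + osc (\<lambda>z. \<Sum>js\<in>basis_lists (Suc m). snd_monomial js z * r js z) a"
      by (rule osc_add[OF in3 in2])
    also have "osc (\<lambda>z. \<Sum>js\<in>basis_lists (Suc m). snd_monomial js z * r js z) a = R a"
    proof -
      have "osc (\<lambda>z. \<Sum>js\<in>basis_lists (Suc m). snd_monomial js z * r js z) a =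
          (\<Sum>js\<in>basis_lists (Suc m). osc (\<lambda>z. snd_monomial js z * r js z) a)"
        by (rule osc_sum[OF t2 W0])
      also have "\<dots> = R a"
        unfolding R_def D1_def by (intro sum.cong refl, subst osc_snd_monomial[OF r U]) (auto simp: basis_lists_def)
      finally show ?thesis .
    qed
    also have "osc (\<lambda>z. \<Sum>n\<le>m. \<Sum>js\<in>basis_lists n. complex_of_real (1 / fact n) * (snd_monomial js z * g js z)) a =
        (\<Sum>n\<le>m. \<i> ^ n / fact n * (\<Sum>js\<in>basis_lists n. D1 js (D2 js f) (a, 0)))"
    proof -
      have "osc (\<lambda>z. \<Sum>n\<le>m. \<Sum>js\<in>basis_lists n. complex_of_real (1 / fact n) * (snd_monomial js z * g js z)) a =
          (\<Sum>n\<le>m. osc (\<lambda>z. \<Sum>js\<in>basis_lists n. complex_of_real (1 / fact n) * (snd_monomial js z * g js z)) a)"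
        by (rule osc_sum[OF in1 W0]) simp
      also have "\<dots> = (\<Sum>n\<le>m. \<i> ^ n / fact n * (\<Sum>js\<in>basis_lists n. D1 js (D2 js f) (a, 0)))"
      proof (rule sum.cong[OF refl])
        fix n assume "n \<in> {..m}"
        then have n: "n \<le> m" by simp
        have "osc (\<lambda>z. \<Sum>js\<in>basis_lists n. complex_of_real (1 / fact n) * (snd_monomial js z * g js z)) a =
            (\<Sum>js\<in>basis_lists n. osc (\<lambda>z. complex_of_real (1 / fact n) * (snd_monomial js z * g js z)) a)"
          by (rule osc_sum[OF symb_cmult[OF t1[OF _ n]] W0])
        also have "\<dots> = (\<Sum>js\<in>basis_lists n. \<i> ^ n / fact n * D1 js (D2 js f) (a, 0))"
        proof (rule sum.cong[OF refl])
          fix js :: "'e list" assume js: "js \<in> basis_lists n"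
          then have "length js = n" by (simp add: basis_lists_def)
          then show "osc (\<lambda>z. complex_of_real (1 / fact n) * (snd_monomial js z * g js z)) a =
              \<i> ^ n / fact n * D1 js (D2 js f) (a, 0)"
            by (subst osc_cmult[OF t1[OF js n]], subst osc_snd_monomial[OF g V])
              (simp add: D1g[unfolded D1_def] D1_def)
        qed
        finally show "osc (\<lambda>z. \<Sum>js\<in>basis_lists n. complex_of_real (1 / fact n) * (snd_monomial js z * g js z)) a =
            \<i> ^ n / fact n * (\<Sum>js\<in>basis_lists n. D1 js (D2 js f) (a, 0))"
          by (simp add: sum_distrib_left)
      qed
      finally show ?thesis .
    qed
    finally show ?thesis .
  qed
  moreover have "symb1 U R"
    unfolding R_def
  proof (intro symb_sum symb_cmult)
    fix js :: "'e list" assume js: "js \<in> basis_lists (Suc m)"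
    have "symb1 (\<lambda>z. U (fst z) * jbracket (snd z) powr k') (D1 js (r js))"
      unfolding D1_def by (rule symb_dir_derivs[OF r[OF js]])
    then show "symb1 U (osc (D1 js (r js)))" by (rule symb_osc) (rule U)
  qed (rule U0)
  ultimately show ?thesis by blast
qed

section \<open>Multi-indices and the classes of the statement\<close>

text \<open>Moving x in direction v moves e x in direction L v, so both sides have the same
  difference quotients. Meant for affine embeddings such as y -> (x, y, \<xi>), which turn partial
  derivatives into derivatives on a product space.\<close>

lemma dir_derivs_embed:
  assumes "\<And>v t x. e (x + t *\<^sub>R v) = e x + t *\<^sub>R L v"
  shows "dir_derivs vs (\<lambda>x. f (e x)) = (\<lambda>x. dir_derivs (map L vs) f (e x))"
  by (induction vs) (simp_all add: dir_deriv_def assms)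

abbreviation cart_list :: "'n::finite list \<Rightarrow> (real^'n) list" where
  "cart_list is \<equiv> map (\<lambda>i. axis i 1) is"

text \<open>A name for the list chosen inside \<open>mi_deriv\<close>.\<close>

definition mi_list :: "('n::finite \<Rightarrow> nat) \<Rightarrow> 'n list" where
  "mi_list \<alpha> = (SOME is. \<forall>i. count_list is i = \<alpha> i)"

text \<open>On a finite type every function with values in the natural numbers is a multiset, and
  every multiset is that of a list; so the choice has a witness.\<close>

lemma count_mi_list [simp]: "count_list (mi_list \<alpha>) = \<alpha>"
proof -
  obtain xs where "mset xs = Abs_multiset \<alpha>" using ex_mset by blast
  then have "\<forall>i. count_list xs i = \<alpha> i"
    by (metis count_Abs_multiset count_mset finite_code)
  from someI[where P = "\<lambda>is. \<forall>i. count_list is i = \<alpha> i", OF this] show ?thesis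
    unfolding mi_list_def by auto
qed

lemma mi_deriv_eq: "mi_deriv \<alpha> f = dir_derivs (cart_list (mi_list \<alpha>)) f"
  by (simp add: mi_deriv_def mi_list_def)

lemma mset_mi_list: "mset (mi_list (count_list is)) = mset is"
  by (rule multiset_eqI) (simp add: count_mset)

lemma mi_deriv_count_list:
  "smooth f \<Longrightarrow> mi_deriv (count_list is) f = dir_derivs (cart_list is) f"
  unfolding mi_deriv_eq by (rule dir_derivs_mset) (simp_all add: mset_mi_list)

lemma length_mi_list: "length (mi_list \<alpha>) = mi_order \<alpha>"
  using sum_count_set[of "mi_list \<alpha>" UNIV] by (simp add: mi_order_def)

lemma Basis_cart_list:
  assumes "set vs \<subseteq> (Basis :: (real^'n) set)"
  obtains "is" where "vs = cart_list is"
proof -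
  have "\<exists>is. vs = cart_list is" using assms
  proof (induction vs)
    case (Cons v vs)
    then obtain "is" where "vs = cart_list is" by auto
    moreover obtain i where "v = axis i 1" using Cons.prems by (auto simp: Basis_vec_def)
    ultimately show ?case by (intro exI[of _ "i # is"]) simp
  qed simp
  with that show ?thesis by blast
qed

lemma cart_list_Basis [simp]: "set (cart_list is) \<subseteq> Basis"
  by (auto simp: Basis_vec_def)

lemma mi_deriv3_eq:
  "mi_deriv3 \<alpha> \<beta> \<gamma> a x y \<xi> = dir_derivs
     (map (\<lambda>i. (axis i 1, 0, 0)) (mi_list \<alpha>) @ map (\<lambda>i. (0, axis i 1, 0)) (mi_list \<beta>) @ map (\<lambda>i. (0, 0, axis i 1)) (mi_list \<gamma>))
     (\<lambda>(x, y, \<xi>). a x y \<xi>) (x, y, \<xi>)"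
proof -
  let ?A = "\<lambda>(x, y, \<xi>). a x y \<xi>"
  have 3: "dir_derivs vs (\<lambda>\<xi>. a x y \<xi>) = (\<lambda>\<xi>. dir_derivs (map (\<lambda>v. (0, 0, v)) vs) ?A (x, y, \<xi>))" for vs x y
    using dir_derivs_embed[of "\<lambda>\<xi>. (x, y, \<xi>)" "\<lambda>v. (0, 0, v)" vs ?A] by simp
  have 2: "dir_derivs vs (\<lambda>y. f (x, y, \<xi>)) = (\<lambda>y. dir_derivs (map (\<lambda>v. (0, v, 0)) vs) f (x, y, \<xi>))"
    for vs x \<xi> and f :: "(real^'n) \<times> (real^'n) \<times> (real^'n) \<Rightarrow> complex"
    by (rule dir_derivs_embed) simp
  have 1: "dir_derivs vs (\<lambda>x. f (x, y, \<xi>)) = (\<lambda>x. dir_derivs (map (\<lambda>v. (v, 0, 0)) vs) f (x, y, \<xi>))"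
    for vs y \<xi> and f :: "(real^'n) \<times> (real^'n) \<times> (real^'n) \<Rightarrow> complex"
    by (rule dir_derivs_embed) (simp add: zero_prod_def[symmetric])
  show ?thesis
    unfolding mi_deriv3_def mi_deriv_eq 1 2 3 dir_derivs_append by (simp add: o_def)
qed

lemma mi_deriv2_eq:
  "mi_deriv2 \<alpha> \<beta> p y \<eta> = dir_derivs
     (map (\<lambda>i. (axis i 1, 0)) (mi_list \<alpha>) @ map (\<lambda>i. (0, axis i 1)) (mi_list \<beta>)) (\<lambda>(y, \<eta>). p y \<eta>) (y, \<eta>)"
proof -
  let ?P = "\<lambda>(y, \<eta>). p y \<eta>"
  have 2: "dir_derivs vs (\<lambda>\<eta>. p y \<eta>) = (\<lambda>\<eta>. dir_derivs (map (\<lambda>v. (0, v)) vs) ?P (y, \<eta>))" for vs y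
    using dir_derivs_embed[of "\<lambda>\<eta>. (y, \<eta>)" "\<lambda>v. (0, v)" vs ?P] by simp
  have 1: "dir_derivs vs (\<lambda>y. f (y, \<eta>)) = (\<lambda>y. dir_derivs (map (\<lambda>v. (v, 0)) vs) f (y, \<eta>))"
    for vs \<eta> and f :: "(real^'n) \<times> (real^'n) \<Rightarrow> complex"
    by (rule dir_derivs_embed) simp
  show ?thesis
    unfolding mi_deriv2_def mi_deriv_eq 1 2 dir_derivs_append by (simp add: o_def)
qed

text \<open>Derivatives are sorted into x, y and \<xi>, the order used by \<open>mi_deriv3\<close>.
  Equality of multisets suffices because derivatives of smooth functions commute.\<close>

lemma Basis_triple_split:
  assumes "set vs \<subseteq> (Basis :: ((real^'n) \<times> (real^'n) \<times> (real^'n)) set)"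
  shows "\<exists>is js ks. mset vs = mset (map (\<lambda>i. (axis i 1, 0, 0)) is @ map (\<lambda>i. (0, axis i 1, 0)) js @ map (\<lambda>i. (0, 0, axis i 1)) ks)"
  using assms
proof (induction vs)
  case (Cons v vs)
  then obtain "is" js ks where IH: "mset vs = mset (map (\<lambda>i. (axis i 1, 0, 0)) is @ map (\<lambda>i. (0, axis i 1, 0)) js @ map (\<lambda>i. (0, 0, axis i 1)) ks)"
    by auto
  from Cons.prems have "v \<in> Basis" by simp
  then consider i where "v = (axis i 1, 0, 0)" | i where "v = (0, axis i 1, 0)" | i where "v = (0, 0, axis i 1)"
    by (auto simp: Basis_prod_def Basis_vec_def zero_prod_def)
  then show ?case
  proof cases
    case (1 i)
    then show ?thesis using IH by (intro exI[of _ "i # is"] exI[of _ js] exI[of _ ks]) simp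
  next
    case (2 i)
    then show ?thesis using IH by (intro exI[of _ "is"] exI[of _ "i # js"] exI[of _ ks]) simp
  next
    case (3 i)
    then show ?thesis using IH by (intro exI[of _ "is"] exI[of _ js] exI[of _ "i # ks"]) simp
  qed
qed simp

lemma Basis_pair_split:
  assumes "set vs \<subseteq> (Basis :: ((real^'n) \<times> (real^'n)) set)"
  shows "\<exists>is js. mset vs = mset (map (\<lambda>i. (axis i 1, 0)) is @ map (\<lambda>i. (0, axis i 1)) js)"
  using assms
proof (induction vs)
  case (Cons v vs)
  then obtain "is" js where IH: "mset vs = mset (map (\<lambda>i. (axis i 1, 0)) is @ map (\<lambda>i. (0, axis i 1)) js)"
    by auto
  from Cons.prems have "v \<in> Basis" by simp
  then consider i where "v = (axis i 1, 0)" | i where "v = (0, axis i 1)"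
    by (auto simp: Basis_prod_def Basis_vec_def)
  then show ?case
  proof cases
    case (1 i)
    then show ?thesis using IH by (intro exI[of _ "i # is"] exI[of _ js]) simp
  next
    case (2 i)
    then show ?thesis using IH by (intro exI[of _ "is"] exI[of _ "i # js"]) simp
  qed
qed simp

section \<open>Amplitudes, symbols, Schwartz functions and cutoffs as weighted classes\<close>

definition amp_weight :: "real \<Rightarrow> real \<Rightarrow> real \<Rightarrow> (real^'n) \<times> (real^'n) \<times> (real^'n) \<Rightarrow> real" where
  "amp_weight m1 m2 m3 = (\<lambda>(x, y, \<xi>). jbracket x powr m1 * jbracket y powr m2 * jbracket \<xi> powr m3)"

lemma amp_weight_nonneg [simp]: "0 \<le> amp_weight m1 m2 m3 X"
  by (simp add: amp_weight_def case_prod_unfold)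

lemma continuous_on_amp_weight: "continuous_on S (amp_weight m1 m2 m3)"
  unfolding amp_weight_def case_prod_unfold by (intro continuous_intros)

lemma symb1_derivs_bound:
  assumes "symb1 W f"
  obtains C where "0 \<le> C" "\<And>x. norm (dir_derivs vs f x) \<le> C * W x"
  using symb_derivs_bound[OF assms, of vs] by (metis UNIV_I)

lemma symb1_amplitude:
  fixes a :: "real^'n \<Rightarrow> real^'n \<Rightarrow> real^'n \<Rightarrow> complex"
  assumes sm: "smooth (\<lambda>(x, y, \<xi>). a x y \<xi>)" and b: "amplitude_bounds m1 m2 m3 a"
  shows "symb1 (amp_weight m1 m2 m3) (\<lambda>(x, y, \<xi>). a x y \<xi>)"
proof (rule symbI_Basis)
  fix vs :: "((real^'n) \<times> (real^'n) \<times> (real^'n)) list" assume "set vs \<subseteq> Basis"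
  from Basis_triple_split[OF this] obtain "is" js ks where vs:
    "mset vs = mset (map (\<lambda>i. (axis i 1, 0, 0)) is @ map (\<lambda>i. (0, axis i 1, 0)) js @ map (\<lambda>i. (0, 0, axis i 1)) ks)"
    by blast
  let ?\<alpha> = "count_list is" and ?\<beta> = "count_list js" and ?\<gamma> = "count_list ks"
  have "dir_derivs vs (\<lambda>(x, y, \<xi>). a x y \<xi>) (x, y, \<xi>) = mi_deriv3 ?\<alpha> ?\<beta> ?\<gamma> a x y \<xi>" for x y \<xi>
    unfolding mi_deriv3_eq by (intro fun_cong[OF dir_derivs_mset[OF sm]]) (simp add: vs mset_mi_list)
  moreover obtain C where "\<And>x y \<xi>. norm (mi_deriv3 ?\<alpha> ?\<beta> ?\<gamma> a x y \<xi>) \<le> C * jbracket x powr m1 * jbracket y powr m2 * jbracket \<xi> powr m3"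
    using b unfolding amplitude_bounds_def by metis
  ultimately have "norm (dir_derivs vs (\<lambda>(x, y, \<xi>). a x y \<xi>) X) \<le> C * amp_weight m1 m2 m3 X" for X
    by (cases X) (simp add: amp_weight_def mult.assoc)
  then show "\<exists>C. \<forall>i\<in>UNIV. \<forall>X. norm (dir_derivs vs (\<lambda>(x, y, \<xi>). a x y \<xi>) X) \<le> C * amp_weight m1 m2 m3 X" by blast
qed (simp_all add: sm)

lemma mi_deriv3_bound:
  assumes "symb1 (amp_weight m1 m2 m3) (\<lambda>(x, y, \<xi>). a x y \<xi>)"
  shows "\<exists>C. \<forall>x y \<xi>. norm (mi_deriv3 \<alpha> \<beta> \<gamma> a x y \<xi>) \<le> C * jbracket x powr m1 * jbracket y powr m2 * jbracket \<xi> powr m3"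
proof -
  let ?vs = "map (\<lambda>i. (axis i 1, 0, 0)) (mi_list \<alpha>) @ map (\<lambda>i. (0, axis i 1, 0)) (mi_list \<beta>) @ map (\<lambda>i. (0, 0, axis i 1)) (mi_list \<gamma>)"
  obtain C where C: "\<And>X. norm (dir_derivs ?vs (\<lambda>(x, y, \<xi>). a x y \<xi>) X) \<le> C * amp_weight m1 m2 m3 X"
    using symb1_derivs_bound[OF assms, of ?vs] by blast
  have "norm (mi_deriv3 \<alpha> \<beta> \<gamma> a x y \<xi>) \<le> C * jbracket x powr m1 * jbracket y powr m2 * jbracket \<xi> powr m3" for x y \<xi>
    using C[of "(x, y, \<xi>)"] unfolding mi_deriv3_eq by (simp add: amp_weight_def mult.assoc)
  then show ?thesis by blast
qed

text \<open>The relation \<open>symb\<close> uses one weight for all derivatives and so cannot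
  express a gain per derivative. The gain in \<eta> is recorded by the n derivatives taken
  beforehand; what further \<eta>-derivatives would gain is discarded by monotonicity.\<close>

lemma symb1_symbol:
  fixes p :: "real^'n \<Rightarrow> real^'n \<Rightarrow> complex"
  assumes sm: "smooth (\<lambda>(y, \<eta>). p y \<eta>)" and b: "symbol_bounds t1 t2 p" and js: "js \<in> basis_lists n"
  shows "symb1 (\<lambda>(y, \<eta>). jbracket y powr t1 * jbracket \<eta> powr (t2 - real n))
    (dir_derivs (map (\<lambda>j. (0, j)) js) (\<lambda>(y, \<eta>). p y \<eta>))"
proof (rule symbI_Basis)
  fix vs :: "((real^'n) \<times> (real^'n)) list" assume "set vs \<subseteq> Basis"
  from Basis_pair_split[OF this] obtain "is" ks where vs:
    "mset vs = mset (map (\<lambda>i. (axis i 1, 0)) is @ map (\<lambda>i. (0, axis i 1)) ks)"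
    by blast
  obtain ls where ls: "js = cart_list ls" using Basis_cart_list js by (auto simp: basis_lists_def)
  then have len: "length ls = n" using js by (auto simp: basis_lists_def)
  let ?\<alpha> = "count_list is" and ?\<beta> = "count_list (ks @ ls)"
  have "dir_derivs (vs @ map (\<lambda>j. (0, j)) js) (\<lambda>(y, \<eta>). p y \<eta>) (y, \<eta>) = mi_deriv2 ?\<alpha> ?\<beta> p y \<eta>" for y \<eta>
    unfolding mi_deriv2_eq by (intro fun_cong[OF dir_derivs_mset[OF sm]]) (simp add: vs mset_mi_list ls o_def)
  note D = this
  obtain C where C: "\<And>y \<eta>. norm (mi_deriv2 ?\<alpha> ?\<beta> p y \<eta>) \<le> C * jbracket y powr t1 * jbracket \<eta> powr (t2 - real (mi_order ?\<beta>))"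
    using b unfolding symbol_bounds_def by metis
  have E: "C * jbracket y powr t1 * jbracket \<eta> powr (t2 - real (mi_order ?\<beta>)) \<le> \<bar>C\<bar> * (jbracket y powr t1 * jbracket \<eta> powr (t2 - real n))" for y \<eta> :: "real^'n"
  proof -
    have "mi_order ?\<beta> = length ks + n"
      using length_mi_list[of ?\<beta>] arg_cong[OF mset_mi_list[of "ks @ ls"], of size] by (simp add: len)
    then have "jbracket \<eta> powr (t2 - real (mi_order ?\<beta>)) \<le> jbracket \<eta> powr (t2 - real n)"
      by (intro jbracket_powr_mono) simp
    then have "(C * jbracket y powr t1) * jbracket \<eta> powr (t2 - real (mi_order ?\<beta>)) \<le> (\<bar>C\<bar> * jbracket y powr t1) * jbracket \<eta> powr (t2 - real n)"
      by (intro mult_mono mult_right_mono) auto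
    then show ?thesis by (simp add: mult.assoc)
  qed
  have "norm (dir_derivs vs (dir_derivs (map (\<lambda>j. (0, j)) js) (\<lambda>(y, \<eta>). p y \<eta>)) X) \<le>
      \<bar>C\<bar> * (case X of (y, \<eta>) \<Rightarrow> jbracket y powr t1 * jbracket \<eta> powr (t2 - real n))" for X
  proof -
    obtain y \<eta> where X: "X = (y, \<eta>)" by (cases X)
    show ?thesis
      unfolding X case_prod_conv dir_derivs_append[symmetric] D[unfolded case_prod_eta] by (rule order_trans[OF C E])
  qed
  then show "\<exists>C. \<forall>i\<in>UNIV. \<forall>X. norm (dir_derivs vs (dir_derivs (map (\<lambda>j. (0, j)) js) (\<lambda>(y, \<eta>). p y \<eta>)) X) \<le>
      C * (case X of (y, \<eta>) \<Rightarrow> jbracket y powr t1 * jbracket \<eta> powr (t2 - real n))" by blast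
qed (auto simp: smooth_dir_derivs sm)

text \<open>Together with \<open>schwartzI\<close> this identifies the Schwartz functions with the
  symbols of every order s; the power k of the seminorm is chosen with -s \<le> k.\<close>

lemma schwartz_symb1:
  fixes u :: "real^'n \<Rightarrow> complex"
  assumes u: "u \<in> schwartz"
  shows "symb1 (\<lambda>x. jbracket x powr s) u"
proof (rule symbI_Basis)
  have sm: "smooth u" using u by (simp add: schwartz_def)
  then show "smooth u" .
  fix vs :: "(real^'n) list" assume "set vs \<subseteq> Basis"
  then obtain "is" where "is": "vs = cart_list is" by (rule Basis_cart_list)
  obtain k :: nat where k: "- s \<le> real k" using real_arch_simple by blast
  obtain C where C: "\<And>x. jbracket x ^ k * norm (mi_deriv (count_list is) u x) \<le> C"
    using u unfolding schwartz_def by blast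
  have "norm (dir_derivs vs u x) \<le> C * jbracket x powr s" for x
  proof -
    have "norm (dir_derivs vs u x) = jbracket x powr - real k * (jbracket x ^ k * norm (mi_deriv (count_list is) u x))"
      by (simp add: mi_deriv_count_list[OF sm] "is" powr_minus powr_realpow)
    also have "\<dots> \<le> jbracket x powr - real k * C" by (intro mult_left_mono C) auto
    also have "\<dots> \<le> jbracket x powr s * C"
      using k order_trans[OF _ C[of x]] by (intro mult_right_mono jbracket_powr_mono) auto
    finally show ?thesis by (simp add: mult.commute)
  qed
  then show "\<exists>C. \<forall>i\<in>UNIV. \<forall>x. norm (dir_derivs vs u x) \<le> C * jbracket x powr s" by blast
qed simp

lemma schwartzI:
  fixes u :: "real^'n \<Rightarrow> complex"
  assumes "\<And>s. symb1 (\<lambda>x. jbracket x powr s) u"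
  shows "u \<in> schwartz"
  unfolding schwartz_def
proof (intro CollectI conjI allI)
  show "smooth u" by (rule symb1_smooth[OF assms])
  fix k :: nat and \<alpha> :: "'n \<Rightarrow> nat"
  obtain C where C: "\<And>x. norm (mi_deriv \<alpha> u x) \<le> C * jbracket x powr - real k"
    using symb1_derivs_bound[OF assms[of "- real k"], of "cart_list (mi_list \<alpha>)"] unfolding mi_deriv_eq by blast
  have "jbracket x ^ k * norm (mi_deriv \<alpha> u x) \<le> C" for x
  proof -
    have "jbracket x ^ k * norm (mi_deriv \<alpha> u x) \<le> jbracket x ^ k * (C * jbracket x powr - real k)"
      by (intro mult_left_mono C) auto
    also have "\<dots> = C" by (simp add: powr_minus powr_realpow)
    finally show ?thesis .
  qed
  then show "\<exists>C. \<forall>x. jbracket x ^ k * norm (mi_deriv \<alpha> u x) \<le> C" by blast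
qed

lemma dir_derivs_zero_on_open:
  assumes "open S" "\<And>x. x \<in> S \<Longrightarrow> f x = 0" "x \<in> S"
  shows "dir_derivs vs f x = 0"
  using assms(3)
proof (induction vs arbitrary: x)
  case Nil
  then show ?case using assms(2) by simp
next
  case (Cons v vs)
  have "(dir_derivs vs f has_derivative (\<lambda>_. 0)) (at x)"
    by (rule has_derivative_transform_within_open[OF has_derivative_const[of 0] assms(1) Cons.prems]) (simp add: Cons.IH)
  from dir_deriv_eq[OF this] show ?case by simp
qed

text \<open>On the compact support all derivatives are bounded against any weight; off the support
  they vanish, the complement being open.\<close>

lemma cutoffs_symb1:
  fixes \<gamma> :: "(real^'n) \<times> (real^'n) \<Rightarrow> complex"
  assumes \<gamma>: "\<gamma> \<in> cutoffs"
  shows "symb1 (\<lambda>q. jbracket q powr s) \<gamma>" and "\<gamma> 0 = 1"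
proof -
  let ?K = "closure {w. \<gamma> w \<noteq> 0}"
  have sm: "smooth \<gamma>" and K: "compact ?K" using \<gamma> by (auto simp: cutoffs_def)
  show "\<gamma> 0 = 1" using \<gamma> by (auto simp: cutoffs_def dest: eventually_nhds_x_imp_x)
  show "symb1 (\<lambda>q. jbracket q powr s) \<gamma>"
    unfolding symb_def
  proof (intro conjI allI ballI)
    fix vs :: "((real^'n) \<times> (real^'n)) list"
    have "compact ((\<lambda>q. jbracket q powr - s * norm (dir_derivs vs \<gamma> q)) ` ?K)"
      by (intro compact_continuous_image continuous_intros smooth_continuous_on smooth_dir_derivs sm K)
    then obtain B where B: "\<And>q. q \<in> ?K \<Longrightarrow> norm (jbracket q powr - s * norm (dir_derivs vs \<gamma> q)) \<le> B"
      using compact_imp_bounded bounded_iff by (metis (no_types, lifting) image_eqI)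
    have "norm (dir_derivs vs \<gamma> q) \<le> \<bar>B\<bar> * jbracket q powr s" for q
    proof (cases "q \<in> ?K")
      case True
      have "norm (dir_derivs vs \<gamma> q) = (jbracket q powr - s * norm (dir_derivs vs \<gamma> q)) * jbracket q powr s"
        by (simp add: powr_minus)
      also have "\<dots> \<le> \<bar>B\<bar> * jbracket q powr s"
        using B[OF True] by (intro mult_right_mono) auto
      finally show ?thesis .
    next
      case False
      have "dir_derivs vs \<gamma> q = 0"
      proof (rule dir_derivs_zero_on_open[of "- ?K"])
        show "\<gamma> x = 0" if "x \<in> - ?K" for x using that closure_subset[of "{w. \<gamma> w \<noteq> 0}"] by auto
      qed (use False in auto)
      then show ?thesis by simp
    qed
    then show "\<exists>C. \<forall>i\<in>UNIV. \<forall>q. norm (dir_derivs vs \<gamma> q) \<le> C * jbracket q powr s" by blast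
  qed (simp_all add: sm)
qed

text \<open>These lists are the permutations of a multiset, counted by the multinomial
  coefficient.\<close>

lemma card_count_list_eq:
  assumes "mi_order \<alpha> = n"
  shows "real (card {is. length is = n \<and> count_list is = \<alpha>}) = fact n / real (mi_fact \<alpha>)"
proof -
  define A where "A = mset (mi_list \<alpha>)"
  have cA: "count A = \<alpha>" by (auto simp: A_def count_mset fun_eq_iff)
  have "{is. length is = n \<and> count_list is = \<alpha>} = permutations_of_multiset A"
  proof (intro set_eqI iffI)
    fix "is" assume "is \<in> {is. length is = n \<and> count_list is = \<alpha>}"
    then have "count (mset is) = count A" by (auto simp: count_mset cA)
    then show "is \<in> permutations_of_multiset A" by (simp add: permutations_of_multiset_def multiset_eqI)
  next
    fix "is" assume "is \<in> permutations_of_multiset A"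
    then have m: "mset is = A" by (simp add: permutations_of_multiset_def)
    then have "length is = n" using assms length_mi_list[of \<alpha>] by (metis A_def size_mset)
    moreover have "count_list is = \<alpha>" using m cA by (auto simp: count_mset fun_eq_iff)
    ultimately show "is \<in> {is. length is = n \<and> count_list is = \<alpha>}" by simp
  qed
  moreover have "card (permutations_of_multiset A) * (\<Prod>x\<in>set_mset A. fact (count A x)) = fact (size A)"
    by (rule card_permutations_of_multiset_aux)
  moreover have "(\<Prod>x\<in>set_mset A. fact (count A x)) = (mi_fact \<alpha> :: nat)"
    unfolding mi_fact_def cA[symmetric] by (intro prod.mono_neutral_left) (auto simp: not_in_iff)
  moreover have "size A = n" using assms by (simp add: A_def length_mi_list)
  ultimately have "card {is. length is = n \<and> count_list is = \<alpha>} * mi_fact \<alpha> = fact n" by simp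
  then have "real (card {is. length is = n \<and> count_list is = \<alpha>}) * real (mi_fact \<alpha>) = fact n"
    by (metis of_nat_fact of_nat_mult)
  moreover have "mi_fact \<alpha> \<noteq> 0" by (simp add: mi_fact_def)
  ultimately show ?thesis by (simp add: field_simps)
qed

text \<open>Words with the same letter counts contribute equally, and there are n!/\<alpha>! of
  them. The n! later cancels the 1/n! of Taylor's formula and leaves 1/\<alpha>!.\<close>

lemma sum_basis_lists_multi_index:
  fixes T :: "(real^'n) list \<Rightarrow> complex"
  assumes T: "\<And>vs us. mset vs = mset us \<Longrightarrow> T vs = T us"
  shows "(\<Sum>js\<in>basis_lists n. T js) =
    (\<Sum>\<alpha> | mi_order \<alpha> = n. complex_of_real (fact n / real (mi_fact \<alpha>)) * T (cart_list (mi_list \<alpha>)))"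
proof -
  let ?L = "{is :: 'n list. length is = n}"
  have fin: "finite ?L" using finite_lists_length_eq[of "UNIV :: 'n set" n] by simp
  have ord: "mi_order (count_list is) = length is" for "is" :: "'n list"
    using sum_count_set[of "is" UNIV] by (simp add: mi_order_def)
  have fin2: "finite {\<alpha> :: 'n \<Rightarrow> nat. mi_order \<alpha> = n}"
  proof (rule finite_subset[OF _ finite_imageI[OF fin, of count_list]])
    show "{\<alpha> :: 'n \<Rightarrow> nat. mi_order \<alpha> = n} \<subseteq> count_list ` ?L"
    proof
      fix \<alpha> :: "'n \<Rightarrow> nat" assume "\<alpha> \<in> {\<alpha>. mi_order \<alpha> = n}"
      then show "\<alpha> \<in> count_list ` ?L"
        by (intro image_eqI[of _ _ "mi_list \<alpha>"]) (simp_all add: length_mi_list)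
    qed
  qed
  have "basis_lists n = cart_list ` ?L"
  proof (intro set_eqI iffI)
    fix js :: "(real^'n) list" assume "js \<in> basis_lists n"
    then have js: "set js \<subseteq> Basis" "length js = n" by (auto simp: basis_lists_def)
    then obtain "is" where "js = cart_list is" using Basis_cart_list by blast
    with js show "js \<in> cart_list ` ?L" by auto
  qed (auto simp: basis_lists_def Basis_vec_def)
  moreover have "inj_on cart_list ?L"
    by (intro inj_onI) (auto simp: axis_eq_axis inj_on_def dest!: map_injective)
  ultimately have "(\<Sum>js\<in>basis_lists n. T js) = (\<Sum>is\<in>?L. T (cart_list is))"
    by (simp add: sum.reindex)
  also have "\<dots> = (\<Sum>\<alpha> | mi_order \<alpha> = n. \<Sum>is\<in>{is \<in> ?L. count_list is = \<alpha>}. T (cart_list is))"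
    by (rule sum.group[symmetric, OF fin fin2]) (auto simp: ord)
  also have "\<dots> = (\<Sum>\<alpha> | mi_order \<alpha> = n. complex_of_real (fact n / real (mi_fact \<alpha>)) * T (cart_list (mi_list \<alpha>)))"
  proof (rule sum.cong[OF refl])
    fix \<alpha> :: "'n \<Rightarrow> nat" assume "\<alpha> \<in> {\<alpha>. mi_order \<alpha> = n}"
    then have \<alpha>: "mi_order \<alpha> = n" by simp
    have "(\<Sum>is\<in>{is \<in> ?L. count_list is = \<alpha>}. T (cart_list is)) = (\<Sum>is\<in>{is \<in> ?L. count_list is = \<alpha>}. T (cart_list (mi_list \<alpha>)))"
    proof (rule sum.cong[OF refl])
      fix "is" assume "is \<in> {is \<in> ?L. count_list is = \<alpha>}"
      then have "mset (mi_list \<alpha>) = mset is" using mset_mi_list[of "is"] by simp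
      then show "T (cart_list is) = T (cart_list (mi_list \<alpha>))" by (intro T) simp
    qed
    also have "\<dots> = complex_of_real (real (card {is. length is = n \<and> count_list is = \<alpha>})) * T (cart_list (mi_list \<alpha>))"
      by simp
    finally show "(\<Sum>is\<in>{is \<in> ?L. count_list is = \<alpha>}. T (cart_list is)) =
        complex_of_real (fact n / real (mi_fact \<alpha>)) * T (cart_list (mi_list \<alpha>))"
      unfolding card_count_list_eq[OF \<alpha>] .
  qed
  finally show ?thesis .
qed

section \<open>The composed amplitude\<close>

text \<open>For \<open>t = 1\<close> this is the substitution \<open>y = z + w\<close>, \<open>\<eta> = \<xi> + \<theta>\<close>, which turns
  \<open>e\<^bsup>i(y-z)\<cdot>(\<eta>-\<xi>)\<^esup>\<close> into \<open>e\<^bsup>iw\<cdot>\<theta>\<^esup>\<close>; the parameter \<open>t\<close> serves the Taylor remainder.\<close>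

definition comp_map ::
  "real \<Rightarrow> ((real^'n) \<times> (real^'n) \<times> (real^'n)) \<times> ((real^'n) \<times> (real^'n)) \<Rightarrow>
    ((real^'n) \<times> (real^'n) \<times> (real^'n)) \<times> ((real^'n) \<times> (real^'n))" where
  "comp_map t = (\<lambda>((x, z, \<xi>), (w, \<theta>)). ((x, z + w, \<xi>), (z + w, \<xi> + t *\<^sub>R \<theta>)))"

lemma linear_comp_map: "linear (comp_map t)"
  by (auto simp: comp_map_def linear_iff algebra_simps)

lemma continuous_on_comp_map: "continuous_on S (\<lambda>t. comp_map t v)"
  by (cases v) (auto simp: comp_map_def intro!: continuous_intros)

definition quad_weight ::
  "real \<Rightarrow> real \<Rightarrow> real \<Rightarrow> real \<Rightarrow> real \<Rightarrow>
    ((real^'n) \<times> (real^'n) \<times> (real^'n)) \<times> ((real^'n) \<times> (real^'n)) \<Rightarrow> real" where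
  "quad_weight m1 m2 m3 t s = (\<lambda>(X, Y). amp_weight m1 m2 m3 X * (case Y of (y, \<eta>) \<Rightarrow> jbracket y powr t * jbracket \<eta> powr s))"

text \<open>Peetre's inequality is applied at z + w and at \<xi> + t\<theta>; the growth in (w,
  \<theta>) is harmless for oscillatory integrals. Since a and p are evaluated at the same point z +
  w, their orders m2 and t1 are added first. The constant does not depend on t in [0,1], as the
  Taylor remainder requires.\<close>

lemma quad_weight_comp_map_le:
  assumes t: "t \<in> {0..1}"
  shows "quad_weight m1 m2 m3 t1 s (comp_map t z) \<le> (2 powr \<bar>m2 + t1\<bar> * 2 powr \<bar>s\<bar>) *
    (amp_weight m1 (m2 + t1) (m3 + s) (fst z) * jbracket (snd z) powr (\<bar>m2 + t1\<bar> + \<bar>s\<bar>))"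
proof -
  obtain x y \<xi> w \<theta> where z: "z = ((x, y, \<xi>), (w, \<theta>))" by (metis prod.exhaust)
  have w: "jbracket w powr \<bar>m2 + t1\<bar> \<le> jbracket (w, \<theta>) powr \<bar>m2 + t1\<bar>"
    using norm_fst_snd_le(1)[of "(w, \<theta>)"] by (intro powr_jbracket_mono2) auto
  have "norm (t *\<^sub>R \<theta>) \<le> norm \<theta>" using t by (simp add: mult_left_le_one_le)
  also have "\<dots> \<le> norm (w, \<theta>)" using norm_fst_snd_le(2)[of "(w, \<theta>)"] by simp
  finally have \<theta>: "jbracket (t *\<^sub>R \<theta>) powr \<bar>s\<bar> \<le> jbracket (w, \<theta>) powr \<bar>s\<bar>"
    by (intro powr_jbracket_mono2) auto
  have 1: "jbracket (y + w) powr (m2 + t1) \<le> 2 powr \<bar>m2 + t1\<bar> * (jbracket y powr (m2 + t1) * jbracket (w, \<theta>) powr \<bar>m2 + t1\<bar>)"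
    by (rule order_trans[OF peetre]) (intro mult_left_mono w; simp)
  have 2: "jbracket (\<xi> + t *\<^sub>R \<theta>) powr s \<le> 2 powr \<bar>s\<bar> * (jbracket \<xi> powr s * jbracket (w, \<theta>) powr \<bar>s\<bar>)"
    by (rule order_trans[OF peetre]) (intro mult_left_mono \<theta>; simp)
  have "quad_weight m1 m2 m3 t1 s (comp_map t z) =
      jbracket x powr m1 * jbracket \<xi> powr m3 * (jbracket (y + w) powr (m2 + t1) * jbracket (\<xi> + t *\<^sub>R \<theta>) powr s)"
    by (simp add: z quad_weight_def comp_map_def amp_weight_def powr_add)
  also have "\<dots> \<le> jbracket x powr m1 * jbracket \<xi> powr m3 *
      ((2 powr \<bar>m2 + t1\<bar> * (jbracket y powr (m2 + t1) * jbracket (w, \<theta>) powr \<bar>m2 + t1\<bar>)) *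
       (2 powr \<bar>s\<bar> * (jbracket \<xi> powr s * jbracket (w, \<theta>) powr \<bar>s\<bar>)))"
    by (intro mult_left_mono mult_mono 1 2) auto
  also have "\<dots> = (2 powr \<bar>m2 + t1\<bar> * 2 powr \<bar>s\<bar>) *
    (amp_weight m1 (m2 + t1) (m3 + s) (fst z) * jbracket (snd z) powr (\<bar>m2 + t1\<bar> + \<bar>s\<bar>))"
    by (simp add: z amp_weight_def powr_add)
  finally show ?thesis .
qed

lemma symb1_quad:
  fixes A :: "(real^'n) \<times> (real^'n) \<times> (real^'n) \<Rightarrow> complex" and Q :: "(real^'n) \<times> (real^'n) \<Rightarrow> complex"
  assumes "symb1 (amp_weight m1 m2 m3) A" "symb1 (\<lambda>(y, \<eta>). jbracket y powr t1 * jbracket \<eta> powr s) Q"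
  shows "symb1 (quad_weight m1 m2 m3 t1 s) (\<lambda>Z. A (fst Z) * Q (snd Z))"
  by (rule symb_weight_eq[OF symb_mult[OF symb_linear[OF assms(1) linear_fst] symb_linear[OF assms(2) linear_snd]]])
    (simp add: quad_weight_def case_prod_unfold)

definition comp_amp ::
  "((real^'n) \<times> (real^'n) \<times> (real^'n) \<Rightarrow> complex) \<Rightarrow> ((real^'n) \<times> (real^'n) \<Rightarrow> complex) \<Rightarrow>
    ((real^'n) \<times> (real^'n) \<times> (real^'n)) \<times> ((real^'n) \<times> (real^'n)) \<Rightarrow> complex" where
  "comp_amp A Q z = A (fst (comp_map 1 z)) * Q (snd (comp_map 1 z))"

lemma comp_amp_eq: "comp_amp A Q ((x, z, \<xi>), (w, \<theta>)) = A (x, z + w, \<xi>) * Q (z + w, \<xi> + \<theta>)"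
  by (simp add: comp_amp_def comp_map_def)

text \<open>The scalar \<open>e i\<close> becomes \<epsilon> when a symbol is compared with its
  damped version, and 1 for a single symbol.\<close>

lemma symb_comp_amp_family:
  fixes A :: "(real^'n) \<times> (real^'n) \<times> (real^'n) \<Rightarrow> complex"
    and Q :: "'i \<Rightarrow> (real^'n) \<times> (real^'n) \<Rightarrow> complex"
  assumes A: "symb1 (amp_weight m1 m2 m3) A"
    and Q: "symb I (\<lambda>i (y, \<eta>). e i * (jbracket y powr t1 * jbracket \<eta> powr s)) Q"
    and e: "\<And>i. i \<in> I \<Longrightarrow> 0 \<le> e i"
  shows "symb I (osc_weight (\<lambda>i X. e i * amp_weight m1 (m2 + t1) (m3 + s) X) (\<bar>m2 + t1\<bar> + \<bar>s\<bar>)) (\<lambda>i. comp_amp A (Q i))"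
proof -
  have "symb I (\<lambda>i Z. amp_weight m1 m2 m3 (fst Z) * (case snd Z of (y, \<eta>) \<Rightarrow> e i * (jbracket y powr t1 * jbracket \<eta> powr s)))
      (\<lambda>i Z. A (fst Z) * Q i (snd Z))"
    by (rule symb_mult[OF symb_linear[OF symb1D[OF A] linear_fst] symb_linear[OF Q linear_snd]])
  then have "symb I (\<lambda>i Z. e i * quad_weight m1 m2 m3 t1 s Z) (\<lambda>i Z. A (fst Z) * Q i (snd Z))"
    by (rule symb_weight_eq) (simp add: quad_weight_def case_prod_unfold)
  from symb_linear[OF this linear_comp_map[of 1]]
  show ?thesis
    unfolding comp_amp_def[abs_def]
  proof (rule symb_mono)
    fix i and z :: "((real^'n) \<times> (real^'n) \<times> (real^'n)) \<times> ((real^'n) \<times> (real^'n))" assume "i \<in> I"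
    from mult_left_mono[OF quad_weight_comp_map_le e[OF this], of 1 m1 m2 m3 t1 s z]
    show "e i * quad_weight m1 m2 m3 t1 s (comp_map 1 z) \<le> (2 powr \<bar>m2 + t1\<bar> * 2 powr \<bar>s\<bar>) *
        (e i * amp_weight m1 (m2 + t1) (m3 + s) (fst z) * jbracket (snd z) powr (\<bar>m2 + t1\<bar> + \<bar>s\<bar>))"
      by (simp add: ac_simps)
  qed (simp add: e)
qed

lemma symb1_comp_amp:
  fixes A :: "(real^'n) \<times> (real^'n) \<times> (real^'n) \<Rightarrow> complex" and Q :: "(real^'n) \<times> (real^'n) \<Rightarrow> complex"
  assumes "symb1 (amp_weight m1 m2 m3) A" "symb1 (\<lambda>(y, \<eta>). jbracket y powr t1 * jbracket \<eta> powr s) Q"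
  shows "symb1 (\<lambda>z. amp_weight m1 (m2 + t1) (m3 + s) (fst z) * jbracket (snd z) powr (\<bar>m2 + t1\<bar> + \<bar>s\<bar>)) (comp_amp A Q)"
  using symb_comp_amp_family[OF assms(1), of UNIV "\<lambda>_::unit. 1" t1 s "\<lambda>_. Q"] assms(2) by simp

lemma symb1_comp_taylor:
  fixes A :: "(real^'n) \<times> (real^'n) \<times> (real^'n) \<Rightarrow> complex" and Q :: "(real^'n) \<times> (real^'n) \<Rightarrow> complex"
  assumes "symb1 (amp_weight m1 m2 m3) A" "symb1 (\<lambda>(y, \<eta>). jbracket y powr t1 * jbracket \<eta> powr s) Q"
  shows "symb1 (\<lambda>z. amp_weight m1 (m2 + t1) (m3 + s) (fst z) * jbracket (snd z) powr (\<bar>m2 + t1\<bar> + \<bar>s\<bar>))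
    (\<lambda>z. LINT t|lborel. taylor_kernel m t * (A (fst (comp_map t z)) * Q (snd (comp_map t z))))"
proof (rule symb1_taylor_integral[OF symb1_quad[OF assms] linear_comp_map continuous_on_comp_map _ _ quad_weight_comp_map_le])
  show "continuous_on UNIV (\<lambda>z::((real^'n) \<times> (real^'n) \<times> (real^'n)) \<times> ((real^'n) \<times> (real^'n)).
      amp_weight m1 (m2 + t1) (m3 + s) (fst z) * jbracket (snd z) powr (\<bar>m2 + t1\<bar> + \<bar>s\<bar>))"
    by (intro continuous_intros continuous_on_compose2[OF continuous_on_amp_weight[of UNIV]]) auto
qed auto

section \<open>The asymptotic expansion\<close>

lemma comp_amp_derivs_snd:
  assumes Q: "smooth Q"
  shows "dir_derivs (map (\<lambda>j. (0, (0, j))) js) (comp_amp A Q) z =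
    comp_amp A (dir_derivs (map (\<lambda>j. (0, j)) js) Q) z"
proof -
  obtain x y \<xi> w \<theta> where z: "z = ((x, y, \<xi>), (w, \<theta>))" by (metis prod.exhaust)
  have "dir_derivs js (\<lambda>\<eta>. comp_amp A Q ((x, y, \<xi>), (w, \<eta>))) =
      (\<lambda>\<eta>. dir_derivs (map (\<lambda>j. (0, (0, j))) js) (comp_amp A Q) ((x, y, \<xi>), (w, \<eta>)))"
    by (rule dir_derivs_embed) simp
  moreover have "dir_derivs js (\<lambda>\<eta>. comp_amp A Q ((x, y, \<xi>), (w, \<eta>))) =
      (\<lambda>\<eta>. A (x, y + w, \<xi>) * dir_derivs js (\<lambda>\<eta>. Q (y + w, \<xi> + \<eta>)) \<eta>)"
  proof -
    have "smooth (\<lambda>\<eta>. Q (y + w, \<xi> + \<eta>))"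
      using smooth_affine[OF Q, of "\<lambda>\<eta>. (0, \<eta>)" "(y + w, \<xi>)"] by (simp add: linear_iff add.commute)
    from dir_derivs_bounded_linear[OF this bounded_linear_mult_right] show ?thesis
      by (simp add: comp_amp_eq)
  qed
  moreover have "dir_derivs js (\<lambda>\<eta>. Q (y + w, \<xi> + \<eta>)) = (\<lambda>\<eta>. dir_derivs (map (\<lambda>j. (0, j)) js) Q (y + w, \<xi> + \<eta>))"
    by (rule dir_derivs_embed) simp
  ultimately show ?thesis by (simp add: z comp_amp_eq fun_eq_iff)
qed

lemma comp_amp_derivs_fst:
  "dir_derivs (map (\<lambda>j. (0, (j, 0))) js) (comp_amp A Q) ((x, z, \<xi>), (0, 0)) = dir_derivs js (\<lambda>y. A (x, y, \<xi>) * Q (y, \<xi>)) z"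
proof -
  have "dir_derivs js (\<lambda>w. comp_amp A Q ((x, z, \<xi>), (w, 0))) =
      (\<lambda>w. dir_derivs (map (\<lambda>j. (0, (j, 0))) js) (comp_amp A Q) ((x, z, \<xi>), (w, 0)))"
    by (rule dir_derivs_embed) simp
  moreover have "dir_derivs js (\<lambda>w. comp_amp A Q ((x, z, \<xi>), (w, 0))) =
      (\<lambda>w. dir_derivs (map (\<lambda>j. j) js) (\<lambda>y. A (x, y, \<xi>) * Q (y, \<xi>)) (z + w))"
    unfolding comp_amp_eq add_0_right
    by (rule dir_derivs_embed[where e = "\<lambda>w. z + w" and f = "\<lambda>y. A (x, y, \<xi>) * Q (y, \<xi>)"]) simp
  ultimately have "(\<lambda>w. dir_derivs (map (\<lambda>j. (0, (j, 0))) js) (comp_amp A Q) ((x, z, \<xi>), (w, 0))) =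
      (\<lambda>w. dir_derivs (map (\<lambda>j. j) js) (\<lambda>y. A (x, y, \<xi>) * Q (y, \<xi>)) (z + w))" by metis
  from fun_cong[OF this, of 0] show ?thesis by simp
qed

text \<open>The remainder contains N derivatives of p in its second variable, hence the order t2 -
  N, while all other orders are unchanged. The sums over words delivered by Taylor's formula are
  regrouped by multi-index into \<open>composition_term\<close>.\<close>

theorem comp_expansion:
  fixes a :: "real^'n \<Rightarrow> real^'n \<Rightarrow> real^'n \<Rightarrow> complex" and p :: "real^'n \<Rightarrow> real^'n \<Rightarrow> complex"
  defines "A \<equiv> \<lambda>(x, y, \<xi>). a x y \<xi>" and "P \<equiv> \<lambda>(y, \<eta>). p y \<eta>"
  assumes a: "smooth A" "amplitude_bounds m1 m2 m3 a"
    and p: "smooth P" "symbol_bounds t1 t2 p" and N: "1 \<le> N"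
  shows "symb1 (amp_weight m1 (m2 + t1) (m3 + (t2 - real N)))
    (\<lambda>(x, z, \<xi>). osc (comp_amp A P) (x, z, \<xi>) - (\<Sum>j=1..N. composition_term a p j x z \<xi>))"
proof -
  obtain m where m: "N = Suc m" using N by (cases N) auto
  have A: "symb1 (amp_weight m1 m2 m3) A"
    unfolding A_def by (rule symb1_amplitude[OF a[unfolded A_def]])
  have PS: "symb1 (\<lambda>(y, \<eta>). jbracket y powr t1 * jbracket \<eta> powr (t2 - real n)) (dir_derivs (map (\<lambda>j. (0, j)) js) P)"
    if "js \<in> basis_lists n" for js n
    unfolding P_def by (rule symb1_symbol[OF p[unfolded P_def] that])
  have P0: "symb1 (\<lambda>(y, \<eta>). jbracket y powr t1 * jbracket \<eta> powr t2) P"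
    using PS[of "[]" 0] by simp
  have "\<exists>R. symb1 (amp_weight m1 (m2 + t1) (m3 + (t2 - real N))) R \<and> (\<forall>X. osc (comp_amp A P) X =
    (\<Sum>n\<le>m. \<i> ^ n / fact n * (\<Sum>js\<in>basis_lists n. dir_derivs (map (\<lambda>j. (0, (j, 0))) js)
      (dir_derivs (map (\<lambda>j. (0, (0, j))) js) (comp_amp A P)) (X, 0))) + R X)"
  proof (rule osc_expansion[OF symb1_comp_amp[OF A P0]])
    fix js :: "(real^'n) list" assume js: "js \<in> basis_lists (Suc m)"
    have eq: "dir_derivs (map (\<lambda>j. (0, (0, j))) js) (comp_amp A P) (fst z, (fst (snd z), t *\<^sub>R snd (snd z))) =
        A (fst (comp_map t z)) * dir_derivs (map (\<lambda>j. (0, j)) js) P (snd (comp_map t z))" for t z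
      by (cases z) (auto simp: comp_amp_derivs_snd[OF p(1)] comp_amp_eq comp_map_def)
    show "symb1 (\<lambda>z. amp_weight m1 (m2 + t1) (m3 + (t2 - real N)) (fst z) * jbracket (snd z) powr (\<bar>m2 + t1\<bar> + \<bar>t2 - real N\<bar>))
      (\<lambda>z. LINT t|lborel. taylor_kernel m t *
        dir_derivs (map (\<lambda>j. (0, (0, j))) js) (comp_amp A P) (fst z, (fst (snd z), t *\<^sub>R snd (snd z))))"
      unfolding eq using symb1_comp_taylor[OF A PS[OF js]] by (simp add: m)
  qed (auto intro: continuous_on_amp_weight)
  then obtain R where R: "symb1 (amp_weight m1 (m2 + t1) (m3 + (t2 - real N))) R"
    and exp: "\<And>X. osc (comp_amp A P) X =
    (\<Sum>n\<le>m. \<i> ^ n / fact n * (\<Sum>js\<in>basis_lists n. dir_derivs (map (\<lambda>j. (0, (j, 0))) js)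
      (dir_derivs (map (\<lambda>j. (0, (0, j))) js) (comp_amp A P)) (X, 0))) + R X" by blast
  have "R (x, z, \<xi>) = osc (comp_amp A P) (x, z, \<xi>) - (\<Sum>j=1..N. composition_term a p j x z \<xi>)" for x z \<xi>
  proof -
    define G where "G = (\<lambda>js y. a x y \<xi> * dir_derivs js (p y) \<xi>)"
    have pP: "dir_derivs js (p y) \<xi> = dir_derivs (map (\<lambda>j. (0, j)) js) P (y, \<xi>)" for js y
      using dir_derivs_fixed_fst[of js P y \<xi>] by (simp add: P_def)
    have smG: "smooth (G js)" if js: "js \<in> basis_lists n" for js n
    proof -
      have "smooth (\<lambda>Z. A (fst Z) * dir_derivs (map (\<lambda>j. (0, j)) js) P (snd Z))"
        by (rule symb1_smooth[OF symb1_quad[OF A PS[OF js]]])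
      from smooth_affine[OF this, of "\<lambda>y. ((0, y, 0), (y, 0))" "((x, 0, \<xi>), (0, \<xi>))"]
      show ?thesis by (simp add: G_def pP A_def linear_iff)
    qed
    have "osc (comp_amp A P) (x, z, \<xi>) - R (x, z, \<xi>) =
        (\<Sum>n\<le>m. \<i> ^ n / fact n * (\<Sum>js\<in>basis_lists n. dir_derivs js (G js) z))"
    proof -
      have "dir_derivs (map (\<lambda>j. (0, (j, 0))) js) (dir_derivs (map (\<lambda>j. (0, (0, j))) js) (comp_amp A P)) ((x, z, \<xi>), 0) =
          dir_derivs js (G js) z" for js
      proof -
        have "dir_derivs (map (\<lambda>j. (0, (0, j))) js) (comp_amp A P) = comp_amp A (dir_derivs (map (\<lambda>j. (0, j)) js) P)"
          by (rule ext) (rule comp_amp_derivs_snd[OF p(1)])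
        then show ?thesis
          by (simp add: comp_amp_derivs_fst zero_prod_def[symmetric] comp_amp_derivs_fst[unfolded zero_prod_def[symmetric]] G_def pP A_def)
      qed
      then show ?thesis by (simp add: exp)
    qed
    also have "\<dots> = (\<Sum>n\<le>m. composition_term a p (Suc n) x z \<xi>)"
    proof (rule sum.cong[OF refl])
      fix n
      \<comment> \<open>Smoothness of \<open>G js\<close> is available for words in the basis;
        extension by zero makes the summand invariant under permutations of arbitrary lists, as the
        regrouping demands.\<close>
      let ?T = "\<lambda>js. if set js \<subseteq> Basis then dir_derivs js (G js) z else 0"
      have "(\<Sum>js\<in>basis_lists n. dir_derivs js (G js) z) = (\<Sum>js\<in>basis_lists n. ?T js)"
        by (rule sum.cong) (auto simp: basis_lists_def)
      also have "\<dots> = (\<Sum>\<alpha> | mi_order \<alpha> = n. complex_of_real (fact n / real (mi_fact \<alpha>)) * ?T (cart_list (mi_list \<alpha>)))"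
      proof (rule sum_basis_lists_multi_index)
        fix vs us :: "(real^'n) list" assume eq: "mset vs = mset us"
        then have set: "set vs = set us" by (rule mset_eq_setD)
        show "?T vs = ?T us"
        proof (cases "set us \<subseteq> Basis")
          case True
          have "dir_derivs (map (\<lambda>j. (0, j)) vs) P = dir_derivs (map (\<lambda>j. (0, j)) us) P"
            by (rule dir_derivs_mset[OF p(1)]) (simp add: eq)
          then have G: "G vs = G us" by (simp add: G_def pP)
          have "smooth (G us)" using smG[of us "length us"] True by (simp add: basis_lists_def)
          from dir_derivs_mset[OF this eq] show ?thesis using G set by simp
        qed (simp add: set)
      qed
      finally have S: "(\<Sum>js\<in>basis_lists n. dir_derivs js (G js) z) =
        (\<Sum>\<alpha> | mi_order \<alpha> = n. complex_of_real (fact n / real (mi_fact \<alpha>)) * dir_derivs (cart_list (mi_list \<alpha>)) (G (cart_list (mi_list \<alpha>))) z)"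
        by (simp only: cart_list_Basis if_True)
      show "\<i> ^ n / fact n * (\<Sum>js\<in>basis_lists n. dir_derivs js (G js) z) = composition_term a p (Suc n) x z \<xi>"
        unfolding S composition_term_def sum_distrib_left
        by (rule sum.cong) (auto simp: mi_deriv_eq G_def field_simps)
    qed
    \<comment> \<open>The j-th term collects order j - 1, so n = 0..m corresponds to j = 1..N with N
      = m + 1.\<close>
    also have "\<dots> = (\<Sum>j=1..N. composition_term a p j x z \<xi>)"
      using sum.atLeast1_atMost_eq[of "\<lambda>j. composition_term a p j x z \<xi>" "Suc m"] by (simp add: m lessThan_Suc_atMost)
    finally show ?thesis by (simp add: algebra_simps)
  qed
  then have "R = (\<lambda>(x, z, \<xi>). osc (comp_amp A P) (x, z, \<xi>) - (\<Sum>j=1..N. composition_term a p j x z \<xi>))"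
    by (auto simp: fun_eq_iff)
  with R show ?thesis by simp
qed

lemma comp_asymp_improving:
  fixes a :: "real^'n \<Rightarrow> real^'n \<Rightarrow> real^'n \<Rightarrow> complex" and p :: "real^'n \<Rightarrow> real^'n \<Rightarrow> complex"
  defines "A \<equiv> \<lambda>(x, y, \<xi>). a x y \<xi>" and "P \<equiv> \<lambda>(y, \<eta>). p y \<eta>"
  assumes a: "smooth A" "amplitude_bounds m1 m2 m3 a"
    and p: "smooth P" "symbol_bounds t1 t2 p"
  shows "asymp_improving m1 (m2 + t1) (m3 + t2) (\<lambda>x z \<xi>. osc (comp_amp A P) (x, z, \<xi>)) (composition_term a p)"
  unfolding asymp_improving_def
proof (intro allI)
  fix \<alpha> \<beta> \<gamma> :: "'n \<Rightarrow> nat" and M :: real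
  obtain N0 :: nat where N0: "M \<le> real N0" using real_arch_simple by blast
  \<comment> \<open>Both \<open>asymp_improving\<close> and the expansion ask for N \<ge> 1; raising
    N only improves the order.\<close>
  define N where "N = max 1 N0"
  have N: "1 \<le> N" "M \<le> real N" using N0 by (auto simp: N_def)
  obtain C where C: "\<And>x z \<xi>. norm (mi_deriv3 \<alpha> \<beta> \<gamma> (\<lambda>x z \<xi>. osc (comp_amp A P) (x, z, \<xi>) - (\<Sum>j=1..N. composition_term a p j x z \<xi>)) x z \<xi>)
      \<le> C * jbracket x powr m1 * jbracket z powr (m2 + t1) * jbracket \<xi> powr (m3 + (t2 - real N))"
    using mi_deriv3_bound[OF comp_expansion[OF a[unfolded A_def] p[unfolded P_def] N(1)], of \<alpha> \<beta> \<gamma>]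
    unfolding A_def P_def by blast
  have "norm (mi_deriv3 \<alpha> \<beta> \<gamma> (\<lambda>x z \<xi>. osc (comp_amp A P) (x, z, \<xi>) - (\<Sum>j=1..N. composition_term a p j x z \<xi>)) x z \<xi>)
      \<le> \<bar>C\<bar> * jbracket x powr m1 * jbracket z powr (m2 + t1) * jbracket \<xi> powr (m3 + t2 - M)" for x z \<xi>
  proof (rule order_trans[OF C])
    show "C * jbracket x powr m1 * jbracket z powr (m2 + t1) * jbracket \<xi> powr (m3 + (t2 - real N))
        \<le> \<bar>C\<bar> * jbracket x powr m1 * jbracket z powr (m2 + t1) * jbracket \<xi> powr (m3 + t2 - M)"
      using N by (intro mult_mono mult_right_mono jbracket_powr_mono mult_nonneg_nonneg) auto
  qed
  with N show "\<exists>N\<ge>1. \<exists>C. \<forall>x z \<xi>. norm (mi_deriv3 \<alpha> \<beta> \<gamma> (\<lambda>x z \<xi>. osc (comp_amp A P) (x, z, \<xi>) - (\<Sum>j=1..N. composition_term a p j x z \<xi>)) x z \<xi>)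
      \<le> C * jbracket x powr m1 * jbracket z powr (m2 + t1) * jbracket \<xi> powr (m3 + t2 - M)" by blast
qed

section \<open>The pseudo-differential operator\<close>

lemma jbracket_Pair_le: "jbracket (y, \<eta>) \<le> 2 * jbracket y * jbracket \<eta>"
proof -
  have "jbracket ((y, 0) + (0, \<eta>)) \<le> 2 * jbracket (y, 0 :: 'b) * jbracket (0 :: 'a, \<eta>)" by (rule jbracket_add_le)
  then show ?thesis by (simp add: jbracket_def norm_Pair)
qed

lemma jbracket_Pair_ge: "jbracket y \<le> jbracket (y, \<eta>)" "jbracket \<eta> \<le> jbracket (y, \<eta>)"
  using jbracket_fst_le[of "(y, \<eta>)"] jbracket_snd_le[of "(y, \<eta>)"] by simp_all

text \<open>From \<langle>(y,\<eta>)\<rangle> \<le> 2\<langle>y\<rangle>\<langle>\<eta>\<rangle>.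
  Separate decay in two variables is converted into joint decay, for which integrability is
  known.\<close>

lemma jbracket_powr_Pair_decay:
  assumes "0 \<le> M"
  shows "jbracket y powr - M * jbracket \<eta> powr - M \<le> 2 powr M * jbracket (y, \<eta>) powr - M"
proof -
  have "(2 * jbracket y * jbracket \<eta>) powr - M \<le> jbracket (y, \<eta>) powr - M"
    using assms jbracket_Pair_le[of y \<eta>] by (intro powr_mono2') auto
  then have "2 powr M * (2 powr - M * jbracket y powr - M * jbracket \<eta> powr - M) \<le> 2 powr M * jbracket (y, \<eta>) powr - M"
    by (intro mult_left_mono) (simp_all add: powr_mult)
  moreover have "2 powr M * (2 powr - M * jbracket y powr - M * jbracket \<eta> powr - M) = jbracket y powr - M * jbracket \<eta> powr - M"
    by (simp add: powr_minus)
  ultimately show ?thesis by simp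
qed

definition pair_weight :: "real \<Rightarrow> real \<Rightarrow> (real^'n) \<times> (real^'n) \<Rightarrow> real" where
  "pair_weight a b = (\<lambda>(y, \<eta>). jbracket y powr a * jbracket \<eta> powr b)"

lemma pair_weight_nonneg [simp]: "0 \<le> pair_weight a b Y"
  by (simp add: pair_weight_def case_prod_unfold)

lemma pair_weight_mono: "a \<le> a' \<Longrightarrow> b \<le> b' \<Longrightarrow> pair_weight a b Y \<le> pair_weight a' b' Y"
  unfolding pair_weight_def case_prod_unfold by (intro mult_mono jbracket_powr_mono) auto

text \<open>The power of \<langle>(y,\<eta>)\<rangle> lost to the cutoff is at most
  2\<langle>y\<rangle>\<langle>\<eta>\<rangle>, so it costs one order in each variable.\<close>

lemma symb_pair_cut:
  fixes F :: "(real^'n) \<times> (real^'n) \<Rightarrow> complex"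
  assumes F: "symb1 (pair_weight a b) F" and \<gamma>: "symb1 (\<lambda>_. 1) \<gamma>" "\<gamma> 0 = 1"
  shows "symb {0<..1} (\<lambda>\<epsilon> Y. \<epsilon> * pair_weight (a + 1) (b + 1) Y) (\<lambda>\<epsilon> Y. F Y * \<gamma> (\<epsilon> *\<^sub>R Y) - F Y)"
proof -
  have "symb {0<..1} (\<lambda>\<epsilon> Y. pair_weight a b Y * (\<epsilon> * jbracket Y)) (\<lambda>\<epsilon> Y. F Y * (\<gamma> (\<epsilon> *\<^sub>R Y) - 1))"
    by (rule symb_mult[OF symb1D[OF F] symb_dilation_diff[OF \<gamma>]])
  then have "symb {0<..1} (\<lambda>\<epsilon> Y. \<epsilon> * pair_weight (a + 1) (b + 1) Y) (\<lambda>\<epsilon> Y. F Y * (\<gamma> (\<epsilon> *\<^sub>R Y) - 1))"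
  proof (rule symb_mono[where C = 2])
    fix \<epsilon> :: real and Y :: "(real^'n) \<times> (real^'n)" assume \<epsilon>: "\<epsilon> \<in> {0<..1}"
    obtain y \<eta> where Y: "Y = (y, \<eta>)" by (cases Y)
    have "pair_weight a b Y * (\<epsilon> * jbracket Y) \<le> pair_weight a b Y * (\<epsilon> * (2 * jbracket y * jbracket \<eta>))"
      using \<epsilon> jbracket_Pair_le[of y \<eta>] by (intro mult_left_mono) (auto simp: Y)
    also have "\<dots> = 2 * (\<epsilon> * pair_weight (a + 1) (b + 1) Y)"
      by (simp add: Y pair_weight_def powr_add)
    finally show "pair_weight a b Y * (\<epsilon> * jbracket Y) \<le> 2 * (\<epsilon> * pair_weight (a + 1) (b + 1) Y)" .
  qed auto
  then show ?thesis by (simp add: right_diff_distrib)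
qed

lemma symb1_pair_cut_decay:
  fixes F :: "(real^'n) \<times> (real^'n) \<Rightarrow> complex"
  assumes F: "symb1 (pair_weight a b) F" and \<gamma>: "\<And>s. symb1 (\<lambda>q. jbracket q powr s) \<gamma>" and \<epsilon>: "\<epsilon> \<in> {0<..1}"
  shows "symb1 (pair_weight a' b') (\<lambda>Y. F Y * \<gamma> (\<epsilon> *\<^sub>R Y))"
proof (rule symb_mono[where C = 1])
  \<comment> \<open>Half of the decay \<open>jbracket Y powr (- 2 * s)\<close> is spent on y and
    half on \<eta>; s is large enough to move a to a' and b to b'.\<close>
  define s where "s = \<bar>a' - a\<bar> + \<bar>b' - b\<bar>"
  show "symb1 (\<lambda>Y. pair_weight a b Y * jbracket Y powr (- 2 * s)) (\<lambda>Y. F Y * \<gamma> (\<epsilon> *\<^sub>R Y))"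
    by (intro symb_mult F symb1_dilation_decay[OF \<gamma> \<epsilon>]) (simp add: s_def)
  fix Y :: "(real^'n) \<times> (real^'n)"
  obtain y \<eta> where Y: "Y = (y, \<eta>)" by (cases Y)
  have s0: "0 \<le> s" by (simp add: s_def)
  have 1: "jbracket Y powr - s \<le> jbracket y powr - s" "jbracket Y powr - s \<le> jbracket \<eta> powr - s"
    using s0 jbracket_Pair_ge unfolding Y by (auto intro!: powr_mono2')
  have "jbracket Y powr (- 2 * s) = jbracket Y powr - s * jbracket Y powr - s" by (simp flip: powr_add)
  also have "\<dots> \<le> jbracket y powr - s * jbracket \<eta> powr - s" by (intro mult_mono 1) auto
  also have "\<dots> \<le> jbracket y powr (a' - a) * jbracket \<eta> powr (b' - b)"
    by (intro mult_mono jbracket_powr_mono) (auto simp: s_def)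
  finally have "pair_weight a b Y * jbracket Y powr (- 2 * s) \<le> pair_weight a b Y * (jbracket y powr (a' - a) * jbracket \<eta> powr (b' - b))"
    by (intro mult_left_mono) auto
  also have "\<dots> = pair_weight a' b' Y" by (simp add: Y pair_weight_def powr_diff)
  finally show "pair_weight a b Y * jbracket Y powr (- 2 * s) \<le> 1 * pair_weight a' b' Y" by simp
qed simp

text \<open>The substitution \<open>w = z - y\<close>, \<open>\<theta> = -\<eta>\<close> turns \<open>e\<^bsup>i(y-z)\<cdot>\<eta>\<^esup>\<close> into \<open>e\<^bsup>iw\<cdot>\<theta>\<^esup>\<close>.\<close>

definition psdo_amp ::
  "((real^'n) \<times> (real^'n) \<Rightarrow> complex) \<Rightarrow> ((real^'n) \<times> (real^'n) \<Rightarrow> complex) \<Rightarrow> (real^'n) \<times> ((real^'n) \<times> (real^'n)) \<Rightarrow> complex" where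
  "psdo_amp P U z = P (fst z, - snd (snd z)) * U (fst z + fst (snd z), - snd (snd z))"

lemma symb_psdo_amp_raw:
  fixes P U :: "'i \<Rightarrow> (real^'n) \<times> (real^'n) \<Rightarrow> complex"
  assumes P: "symb I (\<lambda>i Y. e i * pair_weight t1 t2 Y) P" and U: "symb I (\<lambda>i Y. d i * pair_weight s r Y) U"
  shows "symb I (\<lambda>i (y, (w, \<theta>)). (e i * d i) * (jbracket y powr t1 * jbracket (y + w) powr s * jbracket \<theta> powr (t2 + r)))
    (\<lambda>i. psdo_amp (P i) (U i))"
  unfolding psdo_amp_def
proof (rule symb_weight_eq[OF symb_mult])
  show "symb I (\<lambda>i z. e i * pair_weight t1 t2 (fst z, - snd (snd z))) (\<lambda>i z::(real^'n) \<times> ((real^'n) \<times> (real^'n)). P i (fst z, - snd (snd z)))"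
    by (rule symb_linear[OF P]) (auto simp: linear_iff)
  show "symb I (\<lambda>i z. d i * pair_weight s r (fst z + fst (snd z), - snd (snd z)))
      (\<lambda>i z::(real^'n) \<times> ((real^'n) \<times> (real^'n)). U i (fst z + fst (snd z), - snd (snd z)))"
    by (rule symb_linear[OF U]) (auto simp: linear_iff algebra_simps)
qed (auto simp: pair_weight_def powr_add)

text \<open>Peetre's inequality moves the weight of U from y + w to the parameter y, at the price of
  growth in w. As s may be any negative number for a Schwartz function, this gives the decay of
  Pu.\<close>

lemma symb_psdo_amp:
  fixes P U :: "'i \<Rightarrow> (real^'n) \<times> (real^'n) \<Rightarrow> complex"
  assumes P: "symb I (\<lambda>i Y. e i * pair_weight t1 t2 Y) P" and U: "symb I (\<lambda>i Y. d i * pair_weight s r Y) U"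
    and ed: "\<And>i. i \<in> I \<Longrightarrow> 0 \<le> e i * d i"
  shows "symb I (osc_weight (\<lambda>i y. (e i * d i) * jbracket y powr (t1 + s)) (\<bar>s\<bar> + \<bar>t2 + r\<bar>)) (\<lambda>i. psdo_amp (P i) (U i))"
proof (rule symb_mono[OF symb_psdo_amp_raw[OF P U], where C = "2 powr \<bar>s\<bar>"])
  fix i and z :: "(real^'n) \<times> ((real^'n) \<times> (real^'n))" assume i: "i \<in> I"
  obtain y w \<theta> where z: "z = (y, (w, \<theta>))" by (metis prod.exhaust)
  have w: "jbracket w powr \<bar>s\<bar> \<le> jbracket (w, \<theta>) powr \<bar>s\<bar>"
    by (intro powr_mono2 jbracket_Pair_ge) auto
  have "jbracket \<theta> powr (t2 + r) \<le> jbracket \<theta> powr \<bar>t2 + r\<bar>" by (intro jbracket_powr_mono) simp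
  also have "\<dots> \<le> jbracket (w, \<theta>) powr \<bar>t2 + r\<bar>" by (intro powr_mono2 jbracket_Pair_ge) auto
  finally have \<theta>: "jbracket \<theta> powr (t2 + r) \<le> jbracket (w, \<theta>) powr \<bar>t2 + r\<bar>" .
  have yw: "jbracket (y + w) powr s \<le> 2 powr \<bar>s\<bar> * (jbracket y powr s * jbracket (w, \<theta>) powr \<bar>s\<bar>)"
    by (rule order_trans[OF peetre]) (intro mult_left_mono w; simp)
  have "(e i * d i) * (jbracket y powr t1 * jbracket (y + w) powr s * jbracket \<theta> powr (t2 + r)) \<le>
      (e i * d i) * (jbracket y powr t1 * (2 powr \<bar>s\<bar> * (jbracket y powr s * jbracket (w, \<theta>) powr \<bar>s\<bar>)) * jbracket (w, \<theta>) powr \<bar>t2 + r\<bar>)"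
    by (intro mult_left_mono mult_mono yw \<theta> ed i) auto
  also have "\<dots> = 2 powr \<bar>s\<bar> * ((e i * d i) * jbracket (fst z) powr (t1 + s) * jbracket (snd z) powr (\<bar>s\<bar> + \<bar>t2 + r\<bar>))"
    by (simp add: z powr_add)
  finally show "(case z of (y, (w, \<theta>)) \<Rightarrow> (e i * d i) * (jbracket y powr t1 * jbracket (y + w) powr s * jbracket \<theta> powr (t2 + r)))
      \<le> 2 powr \<bar>s\<bar> * ((e i * d i) * jbracket (fst z) powr (t1 + s) * jbracket (snd z) powr (\<bar>s\<bar> + \<bar>t2 + r\<bar>))"
    by (simp add: z)
qed (auto simp: ed)

lemma symb1_psdo_amp:
  fixes P U :: "(real^'n) \<times> (real^'n) \<Rightarrow> complex"
  assumes "symb1 (pair_weight t1 t2) P" "symb1 (pair_weight s r) U"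
  shows "symb1 (\<lambda>z. jbracket (fst z) powr (t1 + s) * jbracket (snd z) powr (\<bar>s\<bar> + \<bar>t2 + r\<bar>)) (psdo_amp P U)"
  using symb_psdo_amp[of UNIV "\<lambda>_. 1" t1 t2 "\<lambda>_::unit. P" "\<lambda>_. 1" s r "\<lambda>_. U"] assms by simp

text \<open>The opposite use of Peetre's inequality: the decay of U goes to w and the growth to y,
  so that the integral converges absolutely for each y.\<close>

lemma symb1_psdo_amp_decay:
  fixes P U :: "(real^'n) \<times> (real^'n) \<Rightarrow> complex"
  assumes P: "symb1 (pair_weight t1 t2) P" and U: "symb1 (pair_weight s r) U"
    and M: "0 \<le> M" "s \<le> - M" "t2 + r \<le> - M"
  shows "symb1 (\<lambda>z. jbracket (fst z) powr (t1 + \<bar>s\<bar>) * jbracket (snd z) powr - M) (psdo_amp P U)"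
proof -
  have "symb1 (\<lambda>(y, (w, \<theta>)). jbracket y powr t1 * jbracket (y + w) powr s * jbracket \<theta> powr (t2 + r)) (psdo_amp P U)"
    using symb_psdo_amp_raw[of UNIV "\<lambda>_. 1" t1 t2 "\<lambda>_::unit. P" "\<lambda>_. 1" s r "\<lambda>_. U"] P U by simp
  then show ?thesis
  proof (rule symb_mono[where C = "2 powr \<bar>s\<bar> * 2 powr M"])
    fix z :: "(real^'n) \<times> ((real^'n) \<times> (real^'n))"
    obtain y w \<theta> where z: "z = (y, (w, \<theta>))" by (metis prod.exhaust)
    have "jbracket (y + w) powr s \<le> 2 powr \<bar>s\<bar> * (jbracket w powr s * jbracket y powr \<bar>s\<bar>)"
      using peetre[of w y s] by (simp add: add.commute)
    also have "\<dots> \<le> 2 powr \<bar>s\<bar> * (jbracket w powr - M * jbracket y powr \<bar>s\<bar>)"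
      using M by (intro mult_left_mono mult_right_mono jbracket_powr_mono) auto
    finally have 1: "jbracket (y + w) powr s \<le> 2 powr \<bar>s\<bar> * (jbracket w powr - M * jbracket y powr \<bar>s\<bar>)" .
    have 2: "jbracket \<theta> powr (t2 + r) \<le> jbracket \<theta> powr - M" using M by (intro jbracket_powr_mono) auto
    have "jbracket y powr t1 * jbracket (y + w) powr s * jbracket \<theta> powr (t2 + r) \<le>
      jbracket y powr t1 * (2 powr \<bar>s\<bar> * (jbracket w powr - M * jbracket y powr \<bar>s\<bar>)) * jbracket \<theta> powr - M"
      by (intro mult_mono mult_left_mono 1 2) auto
    also have "\<dots> = (2 powr \<bar>s\<bar> * jbracket y powr (t1 + \<bar>s\<bar>)) * (jbracket w powr - M * jbracket \<theta> powr - M)"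
      by (simp add: powr_add)
    also have "\<dots> \<le> (2 powr \<bar>s\<bar> * jbracket y powr (t1 + \<bar>s\<bar>)) * (2 powr M * jbracket (w, \<theta>) powr - M)"
      by (intro mult_left_mono jbracket_powr_Pair_decay M) auto
    finally show "(case z of (y, (w, \<theta>)) \<Rightarrow> jbracket y powr t1 * jbracket (y + w) powr s * jbracket \<theta> powr (t2 + r)) \<le>
        (2 powr \<bar>s\<bar> * 2 powr M) * (jbracket (fst z) powr (t1 + \<bar>s\<bar>) * jbracket (snd z) powr - M)"
      by (simp add: z ac_simps)
  qed simp
qed

lemma integral_lborel_reflect:
  fixes f :: "'a::euclidean_space \<Rightarrow> 'b::{banach, second_countable_topology}"
  assumes f: "f \<in> borel_measurable borel"
  shows "(LINT x|lborel. f (- x)) = (LINT x|lborel. f x)"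
proof -
  have eq: "(lborel :: 'a measure) = distr lborel borel uminus"
    using lborel_affine[of "- 1" "0 :: 'a"] by (simp add: density_1)
  have "(LINT x|lborel. f x) = (LINT x|distr lborel borel uminus. f x)" using eq by simp
  also have "\<dots> = (LINT x|lborel. f (- x))" using f by (intro integral_distr) auto
  finally show ?thesis by simp
qed

text \<open>With this much decay the oscillatory integral is the plain one, the case K = 0 of
  \<open>osc_eq1\<close>. Fubini's theorem, a translation in w and a reflection in \<theta> undo the
  substitution.\<close>

lemma osc_psdo_amp_eq:
  fixes P U :: "(real^'n) \<times> (real^'n) \<Rightarrow> complex"
  assumes P: "symb1 (pair_weight t1 t2) P" and U: "symb1 (pair_weight s r) U"
    and s: "s \<le> - 2 * real DIM((real^'n) \<times> (real^'n))" "t2 + r \<le> - 2 * real DIM((real^'n) \<times> (real^'n))"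
  shows "osc (psdo_amp P U) y = complex_of_real (1 / (2 * pi) ^ CARD('n)) *
    (LINT \<eta>|lborel. LINT z|lborel. cis ((y - z) \<bullet> \<eta>) * (P (y, \<eta>) * U (z, \<eta>)))"
proof -
  let ?M = "2 * real DIM((real^'n) \<times> (real^'n))"
  have d: "symb1 (\<lambda>z. jbracket (fst z) powr (t1 + \<bar>s\<bar>) * jbracket (snd z) powr - ?M) (psdo_amp P U)"
    by (rule symb1_psdo_amp_decay[OF P U]) (use s in auto)
  define H where "H = (\<lambda>\<eta> z. cis ((y - z) \<bullet> \<eta>) * (P (y, \<eta>) * U (z, \<eta>)))"
  have cP: "continuous_on UNIV P" and cU: "continuous_on UNIV U"
    using symb1_smooth[OF P] symb1_smooth[OF U] by (auto intro: smooth_continuous_on)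
  have H: "(\<lambda>(\<eta>, z). H \<eta> z) \<in> borel_measurable borel"
    unfolding H_def cis_conv_exp case_prod_unfold
    by (intro borel_measurable_continuous_onI continuous_intros continuous_on_compose2[OF cP] continuous_on_compose2[OF cU]) auto
  have Hz: "H \<eta> \<in> borel_measurable borel" for \<eta>
    unfolding H_def cis_conv_exp
    by (intro borel_measurable_continuous_onI continuous_intros continuous_on_compose2[OF cP] continuous_on_compose2[OF cU]) auto
  have "osc (psdo_amp P U) y = osc_int (psdo_amp P U) y"
    using osc_eq1[OF d, of 0] by simp
  also have "\<dots> = complex_of_real (1 / (2 * pi) ^ CARD('n)) * (LINT q|lborel. osc_phase q * psdo_amp P U (y, q))"
    by (simp add: osc_int_def)
  also have "(LINT q|lborel. osc_phase q * psdo_amp P U (y, q)) =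
      (LINT \<theta>|lborel. LINT w|lborel. osc_phase (w, \<theta>) * psdo_amp P U (y, (w, \<theta>)))"
  proof (rule integral_lborel_snd[where F = "\<lambda>q. osc_phase q * psdo_amp P U (y, q)"])
    have "symb1 (\<lambda>q. jbracket y powr (t1 + \<bar>s\<bar>) * jbracket q powr - ?M) (\<lambda>q. psdo_amp P U (y, q))"
      using symb_fixed_fst[OF d, of y] by simp
    then show "integrable lborel (\<lambda>q. osc_phase q * psdo_amp P U (y, q))"
      by (rule integrable_symb1) auto
  qed
  also have "\<dots> = (LINT \<theta>|lborel. LINT w|lborel. H (- \<theta>) (w + y))"
    by (simp add: H_def osc_phase_def psdo_amp_def add.commute)
  also have "\<dots> = (LINT \<theta>|lborel. LINT z|lborel. H (- \<theta>) z)"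
    by (intro Bochner_Integration.integral_cong refl integral_lborel_translate Hz)
  also have "\<dots> = (LINT \<eta>|lborel. LINT z|lborel. H \<eta> z)"
  proof (rule integral_lborel_reflect[where f = "\<lambda>\<eta>. LINT z|lborel. H \<eta> z"])
    have "(\<lambda>(\<eta>, z). H \<eta> z) \<in> borel_measurable (lborel \<Otimes>\<^sub>M lborel)"
      using H by (simp add: lborel_prod)
    then have "(\<lambda>\<eta>. LINT z|lborel. H \<eta> z) \<in> borel_measurable lborel"
      by (rule lborel.borel_measurable_lebesgue_integral)
    then show "(\<lambda>\<eta>. LINT z|lborel. H \<eta> z) \<in> borel_measurable borel" by simp
  qed
  finally show ?thesis by (simp only: H_def)
qed

text \<open>The operators are defined by integrals over \<open>lebesgue\<close>, whereas Fubini's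
  theorem is applied over \<open>lborel\<close>; for Borel integrands the two agree.\<close>

lemma integral_lebesgue_double:
  fixes H :: "'a::euclidean_space \<Rightarrow> 'b::euclidean_space \<Rightarrow> complex"
  assumes H: "(\<lambda>(\<eta>, z). H \<eta> z) \<in> borel_measurable borel"
  shows "(LINT \<eta>|lebesgue. LINT z|lebesgue. H \<eta> z) = (LINT \<eta>|lborel. LINT z|lborel. H \<eta> z)"
proof -
  have Hz: "H \<eta> \<in> borel_measurable lborel" for \<eta>
    using measurable_compose[of "\<lambda>z. (\<eta>, z)" borel borel, OF _ H] by simp
  have "(\<lambda>(\<eta>, z). H \<eta> z) \<in> borel_measurable (lborel \<Otimes>\<^sub>M lborel)"
    using H by (simp add: lborel_prod)
  then have "(\<lambda>\<eta>. LINT z|lborel. H \<eta> z) \<in> borel_measurable lborel"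
    by (rule lborel.borel_measurable_lebesgue_integral)
  from integral_completion[OF this] show ?thesis
    by (simp only: integral_completion[OF Hz])
qed

lemma symb_powr_of_pair:
  fixes u :: "real^'n \<Rightarrow> complex"
  assumes u: "symb1 (\<lambda>x. jbracket x powr s) u"
  shows "symb1 (pair_weight s 0) (\<lambda>Y. u (fst Y))"
  by (rule symb_weight_eq[OF symb_linear[OF u linear_fst]]) (simp add: pair_weight_def case_prod_unfold)

definition psdo :: "(real^'n \<Rightarrow> real^'n \<Rightarrow> complex) \<Rightarrow> (real^'n \<Rightarrow> complex) \<Rightarrow> real^'n \<Rightarrow> complex" where
  "psdo p u = osc (psdo_amp (\<lambda>(y, \<eta>). p y \<eta>) (\<lambda>Y. u (fst Y)))"

lemma continuous_on_jbracket_powr': "continuous_on UNIV (\<lambda>y::'a::real_normed_vector. jbracket y powr s)"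
  by (intro continuous_intros)

text \<open>Against the growth \<open>jbracket y powr t1\<close> of the symbol, u is taken of order
  s - t1.\<close>

lemma psdo_schwartz:
  fixes p :: "real^'n \<Rightarrow> real^'n \<Rightarrow> complex"
  assumes P: "symb1 (pair_weight t1 t2) (\<lambda>(y, \<eta>). p y \<eta>)" and u: "u \<in> schwartz"
  shows "psdo p u \<in> schwartz"
proof (rule schwartzI)
  fix s
  show "symb1 (\<lambda>x. jbracket x powr s) (psdo p u)"
    unfolding psdo_def
    using symb_osc[OF symb1_psdo_amp[OF P symb_powr_of_pair[OF schwartz_symb1[OF u, of "s - t1"]]]]
    by (simp add: continuous_on_jbracket_powr')
qed

text \<open>The cutoff is absorbed into the second factor of the amplitude, U becoming V \<epsilon>.
  The regularised operator is then an oscillatory integral of the same kind, and its distance from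
  the limit is of size \<epsilon> in every Schwartz seminorm.\<close>

theorem psdo_value_psdo:
  fixes p :: "real^'n \<Rightarrow> real^'n \<Rightarrow> complex"
  assumes P: "symb1 (pair_weight t1 t2) (\<lambda>(y, \<eta>). p y \<eta>)" and u: "u \<in> schwartz"
  shows "psdo_value p u (psdo p u)"
  unfolding psdo_value_def
proof
  fix \<gamma> :: "(real^'n) \<times> (real^'n) \<Rightarrow> complex" assume \<gamma>: "\<gamma> \<in> cutoffs"
  define P' where "P' = (\<lambda>(y, \<eta>). p y \<eta>)"
  have P: "symb1 (pair_weight t1 t2) P'" using P by (simp add: P'_def)
  define U where "U = (\<lambda>Y::(real^'n) \<times> (real^'n). u (fst Y))"
  define V where "V = (\<lambda>\<epsilon> Y. U Y * \<gamma> (\<epsilon> *\<^sub>R Y))"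
  have U: "symb1 (pair_weight s 0) U" for s
    unfolding U_def by (rule symb_powr_of_pair[OF schwartz_symb1[OF u]])
  have \<gamma>1: "symb1 (\<lambda>_. 1) \<gamma>"
    by (rule symb_weight_eq[OF cutoffs_symb1(1)[OF \<gamma>, of 0]]) simp
  have V: "symb1 (pair_weight a b) (V \<epsilon>)" if "\<epsilon> \<in> {0<..1}" for a b \<epsilon>
    unfolding V_def by (rule symb1_pair_cut_decay[OF U[of 0] cutoffs_symb1(1)[OF \<gamma>] that])
  have diff: "symb {0<..1} (\<lambda>\<epsilon> y. \<epsilon> * jbracket y powr s) (\<lambda>\<epsilon> y. osc (psdo_amp P' (V \<epsilon>)) y - psdo p u y)" for s
  proof -
    define s' where "s' = s - t1"
    \<comment> \<open>U is taken of order s' - 1 because the cutoff costs one order in each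
      variable.\<close>
    have "symb {0<..1} (\<lambda>\<epsilon> Y. \<epsilon> * pair_weight (s' - 1 + 1) (0 + 1) Y) (\<lambda>\<epsilon> Y. V \<epsilon> Y - U Y)"
      unfolding V_def by (rule symb_pair_cut[OF U \<gamma>1 cutoffs_symb1(2)[OF \<gamma>]])
    then have VU: "symb {0<..1} (\<lambda>\<epsilon> Y. \<epsilon> * pair_weight s' 1 Y) (\<lambda>\<epsilon> Y. V \<epsilon> Y - U Y)" by simp
    have PI: "symb {0<..1::real} (\<lambda>_ Y. 1 * pair_weight t1 t2 Y) (\<lambda>_. P')"
      using symb1D[OF P] by simp
    \<comment> \<open>A common order for the amplitude built from U, of order 0 in \<eta>, and the
      one built from V \<epsilon> - U, of order 1 in \<eta>.\<close>
    let ?k = "\<bar>s'\<bar> + \<bar>t2\<bar> + \<bar>t2 + 1\<bar>"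
    have g: "symb {0<..1} (osc_weight (\<lambda>\<epsilon> y. \<epsilon> * jbracket y powr (t1 + s')) ?k)
        (\<lambda>\<epsilon> z. psdo_amp P' (V \<epsilon>) z - psdo_amp P' U z)"
    proof -
      have "symb {0<..1} (osc_weight (\<lambda>\<epsilon> y. (1 * \<epsilon>) * jbracket y powr (t1 + s')) (\<bar>s'\<bar> + \<bar>t2 + 1\<bar>))
          (\<lambda>\<epsilon>. psdo_amp P' (\<lambda>Y. V \<epsilon> Y - U Y))"
        by (rule symb_psdo_amp[OF PI VU]) simp
      then have "symb {0<..1} (osc_weight (\<lambda>\<epsilon> y. \<epsilon> * jbracket y powr (t1 + s')) ?k)
          (\<lambda>\<epsilon>. psdo_amp P' (\<lambda>Y. V \<epsilon> Y - U Y))"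
        by (rule symb_mono[where C = 1]) (auto intro!: mult_left_mono jbracket_powr_mono)
      then show ?thesis by (simp add: psdo_amp_def[abs_def] right_diff_distrib)
    qed
    have f: "symb1 (\<lambda>z. (\<lambda>y. jbracket y powr (t1 + s')) (fst z) * jbracket (snd z) powr ?k) (psdo_amp P' U)"
      by (rule symb_mono[OF symb1_psdo_amp[OF P U[of s']], where C = 1]) (auto intro!: mult_left_mono jbracket_powr_mono)
    show ?thesis
      using osc_diff_bound[OF f continuous_on_jbracket_powr' g] by (simp add: psdo_def U_def s'_def P'_def)
  qed
  have fio: "fio_reg (\<lambda>x \<xi>. x \<bullet> \<xi>) (\<lambda>x y \<xi>. p x \<xi>) \<gamma> \<epsilon> u = osc (psdo_amp P' (V \<epsilon>))" if \<epsilon>: "\<epsilon> \<in> {0<..1}" for \<epsilon>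
  proof
    fix x
    let ?b = "- 2 * real DIM((real^'n) \<times> (real^'n))"
    have cP: "continuous_on UNIV P'" and cV: "continuous_on UNIV (V \<epsilon>)"
      using symb1_smooth[OF P] symb1_smooth[OF V[OF \<epsilon>]] by (auto intro: smooth_continuous_on)
    have "osc (psdo_amp P' (V \<epsilon>)) x = complex_of_real (1 / (2 * pi) ^ CARD('n)) *
      (LINT \<eta>|lborel. LINT z|lborel. cis ((x - z) \<bullet> \<eta>) * (P' (x, \<eta>) * V \<epsilon> (z, \<eta>)))"
      by (rule osc_psdo_amp_eq[OF P V[OF \<epsilon>, of ?b "?b - t2"]]) auto
    also have "(LINT \<eta>|lborel. LINT z|lborel. cis ((x - z) \<bullet> \<eta>) * (P' (x, \<eta>) * V \<epsilon> (z, \<eta>))) =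
        (LINT \<eta>|lebesgue. LINT z|lebesgue. cis ((x - z) \<bullet> \<eta>) * (P' (x, \<eta>) * V \<epsilon> (z, \<eta>)))"
    proof (rule integral_lebesgue_double[symmetric])
      show "(\<lambda>(\<eta>, z). cis ((x - z) \<bullet> \<eta>) * (P' (x, \<eta>) * V \<epsilon> (z, \<eta>))) \<in> borel_measurable borel"
        unfolding cis_conv_exp case_prod_unfold
        by (intro borel_measurable_continuous_onI continuous_intros continuous_on_compose2[OF cP] continuous_on_compose2[OF cV]) auto
    qed
    also have "\<dots> = (LINT \<xi>|lebesgue. LINT y|lebesgue. cis (x \<bullet> \<xi> - y \<bullet> \<xi>) * (p x \<xi> * \<gamma> (\<epsilon> *\<^sub>R y, \<epsilon> *\<^sub>R \<xi>)) * u y)"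
      by (intro Bochner_Integration.integral_cong refl) (simp add: V_def U_def P'_def inner_diff_left ac_simps)
    finally show "fio_reg (\<lambda>x \<xi>. x \<bullet> \<xi>) (\<lambda>x y \<xi>. p x \<xi>) \<gamma> \<epsilon> u x = osc (psdo_amp P' (V \<epsilon>)) x"
      by (simp add: fio_reg_def)
  qed
  have v: "psdo p u \<in> schwartz" by (rule psdo_schwartz[OF P[unfolded P'_def] u])
  have ev: "\<forall>\<^sub>F \<epsilon> in at_right (0::real). \<epsilon> \<in> {0<..1}"
    by (auto simp: eventually_at_right_field intro!: exI[of _ 1])
  have sch: "osc (psdo_amp P' (V \<epsilon>)) \<in> schwartz" if \<epsilon>: "\<epsilon> \<in> {0<..1}" for \<epsilon>
  proof (rule schwartzI)
    fix s
    have "symb1 (\<lambda>y. \<epsilon> * jbracket y powr s) (\<lambda>y. osc (psdo_amp P' (V \<epsilon>)) y - psdo p u y)"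
      by (rule symb1I[OF diff \<epsilon>])
    then have "symb1 (\<lambda>y. jbracket y powr s) (\<lambda>y. osc (psdo_amp P' (V \<epsilon>)) y - psdo p u y)"
      by (rule symb_mono[where C = \<epsilon>]) auto
    from symb_add[OF this schwartz_symb1[OF v, of s]] show "symb1 (\<lambda>y. jbracket y powr s) (osc (psdo_amp P' (V \<epsilon>)))" by simp
  qed
  show "schwartz_tendsto (\<lambda>\<epsilon>. fio_reg (\<lambda>x \<xi>. x \<bullet> \<xi>) (\<lambda>x y \<xi>. p x \<xi>) \<gamma> \<epsilon> u) (psdo p u) (at_right 0)"
    unfolding schwartz_tendsto_def
  proof (intro conjI allI v)
    show "\<forall>\<^sub>F \<epsilon> in at_right 0. fio_reg (\<lambda>x \<xi>. x \<bullet> \<xi>) (\<lambda>x y \<xi>. p x \<xi>) \<gamma> \<epsilon> u \<in> schwartz"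
      using ev by eventually_elim (simp add: fio sch)
    fix k :: nat and \<alpha> :: "'n \<Rightarrow> nat"
    let ?vs = "cart_list (mi_list \<alpha>)"
    obtain C where C: "\<And>\<epsilon> y. \<epsilon> \<in> {0<..1} \<Longrightarrow>
        norm (dir_derivs ?vs (\<lambda>y. osc (psdo_amp P' (V \<epsilon>)) y - psdo p u y) y) \<le> C * (\<epsilon> * jbracket y powr - real k)"
      using symb_derivs_bound[OF diff[of "- real k"], of ?vs] by blast
    have bnd: "norm (jbracket x ^ k *\<^sub>R mi_deriv \<alpha> (fio_reg (\<lambda>x \<xi>. x \<bullet> \<xi>) (\<lambda>x y \<xi>. p x \<xi>) \<gamma> \<epsilon> u) x
        - jbracket x ^ k *\<^sub>R mi_deriv \<alpha> (psdo p u) x) \<le> C * \<epsilon>" if \<epsilon>: "\<epsilon> \<in> {0<..1}" for \<epsilon> x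
    proof -
      have sm: "smooth (osc (psdo_amp P' (V \<epsilon>)))" "smooth (psdo p u)"
        using sch[OF \<epsilon>] v by (auto simp: schwartz_def)
      have "smooth (\<lambda>y. - psdo p u y)" by (rule smooth_bounded_linear[OF sm(2) bounded_linear_minus[OF bounded_linear_ident]])
      from dir_derivs_add[OF sm(1) this, of ?vs] dir_derivs_bounded_linear[OF sm(2) bounded_linear_minus[OF bounded_linear_ident], of ?vs]
      have "mi_deriv \<alpha> (osc (psdo_amp P' (V \<epsilon>))) x - mi_deriv \<alpha> (psdo p u) x =
          dir_derivs ?vs (\<lambda>y. osc (psdo_amp P' (V \<epsilon>)) y - psdo p u y) x"
        by (simp add: mi_deriv_eq)
      then have "norm (jbracket x ^ k *\<^sub>R mi_deriv \<alpha> (fio_reg (\<lambda>x \<xi>. x \<bullet> \<xi>) (\<lambda>x y \<xi>. p x \<xi>) \<gamma> \<epsilon> u) x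
        - jbracket x ^ k *\<^sub>R mi_deriv \<alpha> (psdo p u) x) =
         jbracket x ^ k * norm (dir_derivs ?vs (\<lambda>y. osc (psdo_amp P' (V \<epsilon>)) y - psdo p u y) x)"
        by (simp add: fio[OF \<epsilon>] flip: scaleR_right_diff_distrib)
      also have "\<dots> \<le> jbracket x ^ k * (C * (\<epsilon> * jbracket x powr - real k))"
        by (intro mult_left_mono C \<epsilon>) auto
      also have "\<dots> = C * \<epsilon>" by (simp add: powr_minus powr_realpow)
      finally show ?thesis .
    qed
    show "uniform_limit UNIV (\<lambda>\<epsilon> x. jbracket x ^ k *\<^sub>R mi_deriv \<alpha> (fio_reg (\<lambda>x \<xi>. x \<bullet> \<xi>) (\<lambda>x y \<xi>. p x \<xi>) \<gamma> \<epsilon> u) x)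
        (\<lambda>x. jbracket x ^ k *\<^sub>R mi_deriv \<alpha> (psdo p u) x) (at_right 0)"
    proof (rule uniform_limitI)
      fix e :: real assume e: "0 < e"
      have "((\<lambda>\<epsilon>. C * \<epsilon>) \<longlongrightarrow> C * 0) (at_right 0)" by (intro tendsto_intros)
      then have "\<forall>\<^sub>F \<epsilon> in at_right 0. C * \<epsilon> < e" using e by (simp add: order_tendstoD(2))
      with ev show "\<forall>\<^sub>F \<epsilon> in at_right 0. \<forall>x\<in>UNIV. dist (jbracket x ^ k *\<^sub>R mi_deriv \<alpha> (fio_reg (\<lambda>x \<xi>. x \<bullet> \<xi>) (\<lambda>x y \<xi>. p x \<xi>) \<gamma> \<epsilon> u) x)
          (jbracket x ^ k *\<^sub>R mi_deriv \<alpha> (psdo p u) x) < e"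
      proof eventually_elim
        case (elim \<epsilon>)
        then show ?case using bnd[of \<epsilon>] by (auto simp: dist_norm intro: le_less_trans)
      qed
    qed
  qed
qed

section \<open>Fourier integral operators\<close>

lemma has_derivative_cis_inner:
  "((\<lambda>y. cis (- (y \<bullet> \<xi>))) has_derivative (\<lambda>h. - \<i> * complex_of_real (h \<bullet> \<xi>) * cis (- (y \<bullet> \<xi>)))) (at y)"
proof -
  have "((\<lambda>y. - \<i> * complex_of_real (y \<bullet> \<xi>)) has_derivative (\<lambda>h. - \<i> * complex_of_real (h \<bullet> \<xi>))) (at y)"
    by (auto intro!: derivative_eq_intros)
  moreover have "(exp has_derivative (\<lambda>h. exp x * h)) (at x)" for x :: complex
    using DERIV_exp[of x] by (simp add: has_field_derivative_def)
  ultimately have "((\<lambda>y. exp (- \<i> * complex_of_real (y \<bullet> \<xi>))) has_derivative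
      (\<lambda>h. exp (- \<i> * complex_of_real (y \<bullet> \<xi>)) * (- \<i> * complex_of_real (h \<bullet> \<xi>)))) (at y)"
    by (rule has_derivative_compose)
  then show ?thesis by (simp add: cis_conv_exp mult.commute)
qed

lemma continuous_on_cis_inner: "continuous_on S (\<lambda>y. cis (- (y \<bullet> \<xi>)))"
  unfolding cis_conv_exp by (intro continuous_intros)

text \<open>The Fourier transform turns 1 + \<partial>_v into multiplication by 1 + i v\<cdot>\<xi>,
  whose reciprocal is the factor at -\<xi>, the sign being that of the kernel
  e^{-iy\<cdot>\<xi>}.\<close>

lemma fourier_step:
  fixes f :: "'e::euclidean_space \<Rightarrow> complex"
  assumes f: "symb1 (\<lambda>y. U * jbracket y powr s) f" and s: "s \<le> - 2 * real DIM('e)"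
  shows "(LINT y|lborel. cis (- (y \<bullet> \<xi>)) * f y) =
    conv_factor v (- \<xi>) * (LINT y|lborel. cis (- (y \<bullet> \<xi>)) * (f y + dir_deriv v f y))"
proof -
  let ?e = "\<lambda>y. cis (- (y \<bullet> \<xi>))"
  have em: "?e \<in> borel_measurable borel"
    by (rule borel_measurable_continuous_onI[OF continuous_on_cis_inner])
  have df: "symb1 (\<lambda>y. U * jbracket y powr s) (dir_deriv v f)" by (rule symb_dir_deriv[OF f])
  have i1: "integrable lborel (\<lambda>y. ?e y * f y)" and i2: "integrable lborel (\<lambda>y. ?e y * dir_deriv v f y)"
    by (auto intro!: integrable_symb1[OF _ s em] f df)
  have fd: "f differentiable (at y)" for y by (rule smooth_differentiable[OF symb1_smooth[OF f]])
  have ed: "?e differentiable (at y)" for y by (rule differentiableI[OF has_derivative_cis_inner])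
  let ?b = "- \<i> * complex_of_real (v \<bullet> \<xi>)"
  have D: "dir_deriv v (\<lambda>y. ?e y * f y) = (\<lambda>y. ?e y * dir_deriv v f y + ?b * (?e y * f y))"
    by (subst dir_deriv_mult[OF ed fd]) (simp add: dir_deriv_eq[OF has_derivative_cis_inner] mult.assoc)
  have "(LINT y|lborel. dir_deriv v (\<lambda>y. ?e y * f y) y) = 0"
  proof (rule integral_dir_deriv_eq_0)
    show "continuous_on UNIV (dir_deriv v (\<lambda>y. ?e y * f y))"
      unfolding D by (intro continuous_intros continuous_on_cis_inner smooth_continuous_on symb1_smooth[OF df] symb1_smooth[OF f])
    show "integrable lborel (dir_deriv v (\<lambda>y. ?e y * f y))"
      unfolding D by (intro Bochner_Integration.integrable_add integrable_mult_right i1 i2)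
  qed (auto intro: differentiable_mult ed fd i1)
  then have "(LINT y|lborel. ?e y * dir_deriv v f y) + ?b * (LINT y|lborel. ?e y * f y) = 0"
    unfolding D by (simp add: i1 i2)
  then have 1: "(LINT y|lborel. ?e y * (f y + dir_deriv v f y)) = (1 - ?b) * (LINT y|lborel. ?e y * f y)"
    by (simp add: distrib_left i1 i2) (simp add: algebra_simps add_eq_0_iff)
  have 2: "conv_factor v (- \<xi>) * (1 - ?b) = 1"
    using conv_factor_denom_nonzero[of "- (\<xi> \<bullet> v)"] by (simp add: conv_factor_def inner_commute)
  show ?thesis
    unfolding 1 mult.assoc[of "conv_factor v (- \<xi>)" "1 - ?b", symmetric] 2 by simp
qed

primrec fourier_steps :: "'e list \<Rightarrow> ('e::euclidean_space \<Rightarrow> complex) \<Rightarrow> 'e \<Rightarrow> complex" where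
  "fourier_steps [] f = f"
| "fourier_steps (v # vs) f = fourier_steps vs (\<lambda>y. f y + dir_deriv v f y)"

lemma symb_fourier_steps: "symb I W f \<Longrightarrow> symb I W (\<lambda>i. fourier_steps vs (f i))"
proof (induction vs arbitrary: f)
  case (Cons v vs)
  from Cons.IH[OF symb_add[OF Cons.prems symb_dir_deriv[OF Cons.prems, of v]]] show ?case by simp
qed simp

lemma fourier_steps_integral:
  fixes f :: "'e::euclidean_space \<Rightarrow> complex"
  assumes f: "symb1 (\<lambda>y. U * jbracket y powr s) f" and s: "s \<le> - 2 * real DIM('e)"
  shows "norm (LINT y|lborel. cis (- (y \<bullet> \<xi>)) * f y) =
    prod_list (map (\<lambda>v. norm (conv_factor v (- \<xi>))) vs) * norm (LINT y|lborel. cis (- (y \<bullet> \<xi>)) * fourier_steps vs f y)"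
  using f
proof (induction vs arbitrary: f)
  case (Cons v vs)
  from Cons.IH[OF symb_add[OF Cons.prems symb_dir_deriv[OF Cons.prems, of v]]]
  show ?case by (subst fourier_step[OF Cons.prems s, of \<xi> v]) (simp add: norm_mult mult.assoc)
qed simp

text \<open>One step for every basis vector gains a power of \<langle>\<xi>\<rangle>, and this is
  repeated N times. The frequency is a function of the index, so that f may itself depend on \<xi>
  and the bound is uniform in it.\<close>

lemma fourier_decay:
  fixes f :: "'i \<Rightarrow> 'e::euclidean_space \<Rightarrow> complex" and \<xi> :: "'i \<Rightarrow> 'e"
  assumes f: "symb I (\<lambda>i y. U i * jbracket y powr s) f" and s: "s \<le> - 2 * real DIM('e)"
  shows "\<exists>C. \<forall>i\<in>I. norm (LINT y|lborel. cis (- (y \<bullet> \<xi> i)) * f i y) \<le> C * (U i * jbracket (\<xi> i) powr - real N)"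
  using f
proof (induction N arbitrary: f)
  case 0
  obtain C where C: "0 \<le> C" "\<And>i y. i \<in> I \<Longrightarrow> norm (f i y) \<le> C * (U i * jbracket y powr s)"
    using symb_bound[OF 0] by blast
  have "norm (LINT y|lborel. cis (- (y \<bullet> \<xi> i)) * f i y) \<le> (C * (LINT y|lborel. jbracket (y::'e) powr s)) * U i" if i: "i \<in> I" for i
  proof -
    have "norm (LINT y|lborel. cis (- (y \<bullet> \<xi> i)) * f i y) \<le> (LINT y|lborel. (C * U i) * jbracket (y::'e) powr s)"
    proof (rule norm_integral_le)
      show "integrable lborel (\<lambda>y::'e. (C * U i) * jbracket y powr s)"
        by (intro integrable_mult_right integrable_jbracket_powr s)
      show "(\<lambda>y. cis (- (y \<bullet> \<xi> i)) * f i y) \<in> borel_measurable lborel"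
        using borel_measurable_times[OF borel_measurable_continuous_onI[OF continuous_on_cis_inner] borel_measurable_smooth[OF symb_smooth[OF 0 i]]]
        by simp
    qed (use C(2)[OF i] in \<open>auto simp: norm_mult mult.assoc\<close>)
    then show ?thesis unfolding integral_mult_right_zero by (simp only: ac_simps)
  qed
  then show ?case by (intro exI[of _ "C * (LINT y|lborel. jbracket (y::'e) powr s)"]) simp
next
  case (Suc N)
  from Suc.IH[OF symb_fourier_steps[OF Suc.prems, of Basis_list]]
  obtain C where C: "\<And>i. i \<in> I \<Longrightarrow> norm (LINT y|lborel. cis (- (y \<bullet> \<xi> i)) * fourier_steps Basis_list (f i) y)
      \<le> C * (U i * jbracket (\<xi> i) powr - real N)" by blast
  have "norm (LINT y|lborel. cis (- (y \<bullet> \<xi> i)) * f i y) \<le> C * (U i * jbracket (\<xi> i) powr - real (Suc N))" if i: "i \<in> I" for i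
  proof -
    have "norm (LINT y|lborel. cis (- (y \<bullet> \<xi> i)) * f i y) =
        prod_list (map (\<lambda>v. norm (conv_factor v (- \<xi> i))) Basis_list) * norm (LINT y|lborel. cis (- (y \<bullet> \<xi> i)) * fourier_steps Basis_list (f i) y)"
      using fourier_steps_integral[OF symb1I[OF Suc.prems i] s] .
    also have "\<dots> \<le> jbracket (\<xi> i) powr - 1 * (C * (U i * jbracket (\<xi> i) powr - real N))"
      using prod_conv_factor_Basis_le[of "- \<xi> i"] by (intro mult_mono C i) auto
    also have "\<dots> = C * (U i * jbracket (\<xi> i) powr - real (Suc N))"
      using powr_add[of "jbracket (\<xi> i)" "- 1" "- real N"] by simp
    finally show ?thesis .
  qed
  then show ?case by blast
qed

text \<open>The frequency becomes part of the index and its weight a scalar factor, as needed for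
  Fourier estimates uniform in \<xi>.\<close>

lemma symb_pair_slice:
  fixes F :: "'j \<Rightarrow> (real^'n) \<times> (real^'n) \<Rightarrow> complex"
  assumes F: "symb J (\<lambda>j Y. e j * pair_weight a b Y) F" and v: "symb1 (\<lambda>y. jbracket y powr r) v"
  shows "symb (J \<times> UNIV) (\<lambda>(j, \<xi>) y. (e j * jbracket \<xi> powr b) * jbracket y powr (a + r)) (\<lambda>(j, \<xi>) y. F j (y, \<xi>) * v y)"
proof -
  have "symb (J \<times> (UNIV :: (real^'n) set)) (\<lambda>i Y. e (fst i) * pair_weight a b Y) (\<lambda>i. F (fst i))"
    by (rule symb_reindex[OF F]) auto
  from symb_affine[OF this, of "\<lambda>_ y. (y, 0)" "\<lambda>i. (0, snd i)"]
  have "symb (J \<times> (UNIV :: (real^'n) set)) (\<lambda>i y. e (fst i) * pair_weight a b (y, snd i)) (\<lambda>i y. F (fst i) (y, snd i))"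
    by (auto simp: linear_iff norm_Pair intro!: exI)
  from symb_mult[OF this symb1D[OF v]]
  show ?thesis
    unfolding case_prod_unfold by (rule symb_weight_eq) (simp add: pair_weight_def powr_add)
qed

text \<open>The function v absorbs the growth of order a in y, and N \<ge> M + b integrations by
  parts absorb the growth of order b in \<xi>. The factor \<open>e j\<close> later carries
  \<epsilon>.\<close>

lemma amplitude_fourier_decay:
  fixes F :: "'j \<Rightarrow> (real^'n) \<times> (real^'n) \<Rightarrow> complex"
  assumes F: "symb J (\<lambda>j Y. e j * pair_weight a b Y) F" and v: "v \<in> schwartz" and e: "\<And>j. j \<in> J \<Longrightarrow> 0 \<le> e j"
  shows "\<exists>C. \<forall>j\<in>J. \<forall>\<xi>. norm (LINT y|lborel. cis (- (y \<bullet> \<xi>)) * (F j (y, \<xi>) * v y)) \<le> C * (e j * jbracket \<xi> powr - M)"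
proof -
  let ?s = "- 2 * real DIM(real^'n)"
  have "symb1 (\<lambda>y. jbracket y powr (?s - a)) v" by (rule schwartz_symb1[OF v])
  from symb_pair_slice[OF F this]
  have "symb (J \<times> (UNIV :: (real^'n) set)) (\<lambda>i y. (e (fst i) * jbracket (snd i) powr b) * jbracket y powr ?s)
      (\<lambda>i y. F (fst i) (y, snd i) * v y)"
    by (simp add: case_prod_unfold)
  note S = this
  obtain N :: nat where N: "M + b \<le> real N" using real_arch_simple by blast
  obtain C where C: "\<And>i. i \<in> J \<times> UNIV \<Longrightarrow> norm (LINT y|lborel. cis (- (y \<bullet> snd i)) * (F (fst i) (y, snd i) * v y))
      \<le> C * ((e (fst i) * jbracket (snd i) powr b) * jbracket (snd i) powr - real N)"
    using fourier_decay[OF S order_refl, of snd N] by blast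
  have "norm (LINT y|lborel. cis (- (y \<bullet> \<xi>)) * (F j (y, \<xi>) * v y)) \<le> \<bar>C\<bar> * (e j * jbracket \<xi> powr - M)" if j: "j \<in> J" for j \<xi>
  proof -
    have "norm (LINT y|lborel. cis (- (y \<bullet> \<xi>)) * (F j (y, \<xi>) * v y)) \<le> C * (e j * jbracket \<xi> powr (b - real N))"
      using C[of "(j, \<xi>)"] j by (simp add: mult.assoc flip: powr_add)
    also have "\<dots> \<le> \<bar>C\<bar> * (e j * jbracket \<xi> powr - M)"
      using N e[OF j] by (intro mult_mono mult_left_mono jbracket_powr_mono) auto
    finally show ?thesis .
  qed
  then show ?thesis by blast
qed

lemma borel_measurable_slice_integral:
  fixes H :: "'a::euclidean_space \<Rightarrow> 'b::euclidean_space \<Rightarrow> complex"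
  assumes "(\<lambda>(\<xi>, y). H \<xi> y) \<in> borel_measurable borel"
  shows "(\<lambda>\<xi>. LINT y|lborel. H \<xi> y) \<in> borel_measurable borel"
proof -
  have "(\<lambda>(\<xi>, y). H \<xi> y) \<in> borel_measurable (lborel \<Otimes>\<^sub>M lborel)" using assms by (simp add: lborel_prod)
  then have "(\<lambda>\<xi>. LINT y|lborel. H \<xi> y) \<in> borel_measurable lborel"
    by (rule lborel.borel_measurable_lebesgue_integral)
  then show ?thesis by simp
qed

lemma borel_measurable_fourier_slice:
  fixes F :: "(real^'n) \<times> (real^'n) \<Rightarrow> complex"
  assumes F: "continuous_on UNIV F" and v: "continuous_on UNIV v"
  shows "(\<lambda>\<xi>. LINT y|lborel. cis (- (y \<bullet> \<xi>)) * (F (y, \<xi>) * v y)) \<in> borel_measurable borel"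
  unfolding cis_conv_exp
  by (rule borel_measurable_slice_integral, unfold case_prod_unfold)
    (intro borel_measurable_continuous_onI continuous_intros continuous_on_compose2[OF F] continuous_on_compose2[OF v]; simp)

lemma symb1_amplitude_slice:
  fixes a :: "real^'n \<Rightarrow> real^'n \<Rightarrow> real^'n \<Rightarrow> complex"
  assumes "symb1 (amp_weight m1 m2 m3) (\<lambda>(x, y, \<xi>). a x y \<xi>)"
  shows "symb1 (pair_weight m2 m3) (\<lambda>Y. a x (fst Y) (snd Y))"
proof (rule symb_mono[where C = "jbracket x powr m1"])
  show "symb1 (\<lambda>Y. amp_weight m1 m2 m3 (x, Y)) (\<lambda>Y. a x (fst Y) (snd Y))"
    using symb_fixed_fst[OF assms, of x] by (simp add: case_prod_unfold)
qed (auto simp: amp_weight_def pair_weight_def)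

lemma greaterThanAtMost_nonneg: "\<epsilon> \<in> {0<..1} \<Longrightarrow> 0 \<le> (\<epsilon> :: real)"
  by simp

text \<open>The inner integral over y decays rapidly in \<xi>, and the cutoff changes it by at most
  a multiple of \<epsilon> times an integrable function of \<xi>. The factor e^{i\<phi>} has modulus
  1 and does not disturb these estimates; being only Lebesgue measurable, it forces the outer
  integral to be taken over \<open>lebesgue\<close>.\<close>

theorem fio_value_amplitude:
  fixes a :: "real^'n \<Rightarrow> real^'n \<Rightarrow> real^'n \<Rightarrow> complex"
  assumes a: "symb1 (amp_weight m1 m2 m3) (\<lambda>(x, y, \<xi>). a x y \<xi>)" and v: "v \<in> schwartz"
    and \<phi>: "(\<lambda>\<xi>. cis (\<phi> x \<xi>)) \<in> borel_measurable lebesgue"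
  shows "fio_value \<phi> a v x (complex_of_real (1 / (2 * pi) ^ CARD('n)) *
    (LINT \<xi>|lebesgue. cis (\<phi> x \<xi>) * (LINT y|lborel. cis (- (y \<bullet> \<xi>)) * (a x y \<xi> * v y))))"
  unfolding fio_value_def
proof
  fix \<gamma> :: "(real^'n) \<times> (real^'n) \<Rightarrow> complex" assume \<gamma>: "\<gamma> \<in> cutoffs"
  define F where "F = (\<lambda>Y. a x (fst Y) (snd Y))"
  define F\<epsilon> where "F\<epsilon> = (\<lambda>\<epsilon> Y. F Y * \<gamma> (\<epsilon> *\<^sub>R Y))"
  define G where "G = (\<lambda>F \<xi>. LINT y|lborel. cis (- (y \<bullet> \<xi>)) * (F (y, \<xi>) * v y))"
  let ?M = "2 * real DIM(real^'n)"
  have F: "symb1 (pair_weight m2 m3) F" unfolding F_def by (rule symb1_amplitude_slice[OF a])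
  have \<gamma>1: "symb1 (\<lambda>_. 1) \<gamma>" by (rule symb_weight_eq[OF cutoffs_symb1(1)[OF \<gamma>, of 0]]) simp
  have F\<epsilon>: "symb1 (pair_weight 0 0) (F\<epsilon> \<epsilon>)" if "\<epsilon> \<in> {0<..1}" for \<epsilon>
    unfolding F\<epsilon>_def by (rule symb1_pair_cut_decay[OF F cutoffs_symb1(1)[OF \<gamma>] that])
  have smv: "smooth v" using v by (simp add: schwartz_def)
  have Gm: "G K \<in> borel_measurable borel" if "symb1 (pair_weight r s) K" for K r s
    unfolding G_def by (intro borel_measurable_fourier_slice smooth_continuous_on smv symb1_smooth[OF that])
  have Gb: "\<exists>C. \<forall>\<xi>. norm (G K \<xi>) \<le> C * jbracket \<xi> powr - ?M" if "symb1 (pair_weight r s) K" for K r s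
    using amplitude_fourier_decay[of "UNIV :: unit set" "\<lambda>_. 1" r s "\<lambda>_. K" v ?M] that v by (simp add: G_def)
  have int: "integrable lborel (\<lambda>y. cis (- (y \<bullet> \<xi>)) * (K (y, \<xi>) * v y))" if K: "symb1 (pair_weight r s) K" for K r s \<xi>
  proof (rule integrable_symb1)
    have "symb1 (\<lambda>Y. 1 * pair_weight r s Y) K" using K by simp
    from symb1I[OF symb_pair_slice[OF this schwartz_symb1[OF v, of "- ?M - r"]], of "((), \<xi>)"]
    show "symb1 (\<lambda>y. jbracket \<xi> powr s * jbracket y powr - ?M) (\<lambda>y. K (y, \<xi>) * v y)" by simp
    show "(\<lambda>y. cis (- (y \<bullet> \<xi>))) \<in> borel_measurable borel"
      by (rule borel_measurable_continuous_onI[OF continuous_on_cis_inner])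
  qed auto
  have cut: "symb {0<..1} (\<lambda>\<epsilon> Y. \<epsilon> * pair_weight (m2 + 1) (m3 + 1) Y) (\<lambda>\<epsilon> Y. F\<epsilon> \<epsilon> Y - F Y)"
    unfolding F\<epsilon>_def by (rule symb_pair_cut[OF F \<gamma>1 cutoffs_symb1(2)[OF \<gamma>]])
  obtain C where C: "\<And>\<epsilon> \<xi>. \<epsilon> \<in> {0<..1} \<Longrightarrow>
      norm (LINT y|lborel. cis (- (y \<bullet> \<xi>)) * ((F\<epsilon> \<epsilon> (y, \<xi>) - F (y, \<xi>)) * v y)) \<le> C * (\<epsilon> * jbracket \<xi> powr - ?M)"
    using amplitude_fourier_decay[OF cut v greaterThanAtMost_nonneg, of ?M] by blast
  have Gd: "norm (G (F\<epsilon> \<epsilon>) \<xi> - G F \<xi>) \<le> C * (\<epsilon> * jbracket \<xi> powr - ?M)" if \<epsilon>: "\<epsilon> \<in> {0<..1}" for \<epsilon> \<xi>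
  proof -
    have "G (F\<epsilon> \<epsilon>) \<xi> - G F \<xi> = (LINT y|lborel. cis (- (y \<bullet> \<xi>)) * ((F\<epsilon> \<epsilon> (y, \<xi>) - F (y, \<xi>)) * v y))"
      unfolding G_def by (simp add: left_diff_distrib right_diff_distrib Bochner_Integration.integral_diff[OF int[OF F\<epsilon>[OF \<epsilon>]] int[OF F]])
    then show ?thesis using C[OF \<epsilon>] by simp
  qed
  have J: "integrable lebesgue (\<lambda>\<xi>::real^'n. jbracket \<xi> powr - ?M)"
    by (subst integrable_completion) (auto intro!: integrable_jbracket_powr)
  have intG: "integrable lebesgue (\<lambda>\<xi>. cis (\<phi> x \<xi>) * G K \<xi>)" if K: "symb1 (pair_weight r s) K" for K r s
  proof -
    obtain C where C: "\<And>\<xi>. norm (G K \<xi>) \<le> C * jbracket \<xi> powr - ?M" using Gb[OF K] by blast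
    show ?thesis
    proof (rule integrable_norm_le)
      show "integrable lebesgue (\<lambda>\<xi>::real^'n. C * jbracket \<xi> powr - ?M)" by (intro integrable_mult_right J)
      show "(\<lambda>\<xi>. cis (\<phi> x \<xi>) * G K \<xi>) \<in> borel_measurable lebesgue"
        using Gm[OF K] by (intro borel_measurable_times \<phi> measurable_completion) simp
      show "norm (cis (\<phi> x \<xi>) * G K \<xi>) \<le> C * jbracket \<xi> powr - ?M" for \<xi>
        using C[of \<xi>] by (simp add: norm_mult)
    qed
  qed
  have fio: "fio_reg \<phi> a \<gamma> \<epsilon> v x = complex_of_real (1 / (2 * pi) ^ CARD('n)) * (LINT \<xi>|lebesgue. cis (\<phi> x \<xi>) * G (F\<epsilon> \<epsilon>) \<xi>)"
    if \<epsilon>: "\<epsilon> \<in> {0<..1}" for \<epsilon>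
  proof -
    have "(LINT y|lebesgue. cis (\<phi> x \<xi> - y \<bullet> \<xi>) * (a x y \<xi> * \<gamma> (\<epsilon> *\<^sub>R y, \<epsilon> *\<^sub>R \<xi>)) * v y) = cis (\<phi> x \<xi>) * G (F\<epsilon> \<epsilon>) \<xi>" for \<xi>
    proof -
      have eq: "cis (\<phi> x \<xi> - y \<bullet> \<xi>) * (a x y \<xi> * \<gamma> (\<epsilon> *\<^sub>R y, \<epsilon> *\<^sub>R \<xi>)) * v y =
          cis (\<phi> x \<xi>) * (cis (- (y \<bullet> \<xi>)) * (F\<epsilon> \<epsilon> (y, \<xi>) * v y))" for y
      proof -
        have "cis (\<phi> x \<xi> - y \<bullet> \<xi>) = cis (\<phi> x \<xi>) * cis (- (y \<bullet> \<xi>))"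
          by (simp add: cis_mult)
        then show ?thesis by (simp only: F\<epsilon>_def F_def fst_conv snd_conv scaleR_Pair mult.assoc)
      qed
      have "(LINT y|lebesgue. cis (- (y \<bullet> \<xi>)) * (F\<epsilon> \<epsilon> (y, \<xi>) * v y)) = G (F\<epsilon> \<epsilon>) \<xi>"
        unfolding G_def by (rule integral_completion) (rule borel_measurable_integrable[OF int[OF F\<epsilon>[OF \<epsilon>]]])
      then show ?thesis unfolding eq by simp
    qed
    then show ?thesis by (simp add: fio_reg_def)
  qed
  define c where "c = 1 / (2 * pi) ^ CARD('n)"
  have c: "0 \<le> c" by (simp add: c_def)
  have "((\<lambda>\<epsilon>. fio_reg \<phi> a \<gamma> \<epsilon> v x) \<longlongrightarrow> complex_of_real c * (LINT \<xi>|lebesgue. cis (\<phi> x \<xi>) * G F \<xi>)) (at_right 0)"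
  proof (rule tendsto_at_right_0I)
    fix \<epsilon> :: real assume \<epsilon>: "\<epsilon> \<in> {0<..1}"
    have "norm ((LINT \<xi>|lebesgue. cis (\<phi> x \<xi>) * G (F\<epsilon> \<epsilon>) \<xi>) - (LINT \<xi>|lebesgue. cis (\<phi> x \<xi>) * G F \<xi>)) =
        norm (LINT \<xi>|lebesgue. cis (\<phi> x \<xi>) * G (F\<epsilon> \<epsilon>) \<xi> - cis (\<phi> x \<xi>) * G F \<xi>)"
      by (simp add: Bochner_Integration.integral_diff intG[OF F\<epsilon>[OF \<epsilon>]] intG[OF F])
    also have "\<dots> \<le> (LINT \<xi>|lebesgue. (C * \<epsilon>) * jbracket (\<xi>::real^'n) powr - ?M)"
    proof (rule norm_integral_le)
      show "integrable lebesgue (\<lambda>\<xi>::real^'n. (C * \<epsilon>) * jbracket \<xi> powr - ?M)" by (intro integrable_mult_right J)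
      show "(\<lambda>\<xi>. cis (\<phi> x \<xi>) * G (F\<epsilon> \<epsilon>) \<xi> - cis (\<phi> x \<xi>) * G F \<xi>) \<in> borel_measurable lebesgue"
        by (intro borel_measurable_diff borel_measurable_integrable intG[OF F\<epsilon>[OF \<epsilon>]] intG[OF F])
      show "norm (cis (\<phi> x \<xi>) * G (F\<epsilon> \<epsilon>) \<xi> - cis (\<phi> x \<xi>) * G F \<xi>) \<le> (C * \<epsilon>) * jbracket \<xi> powr - ?M" for \<xi>
        using Gd[OF \<epsilon>, of \<xi>] by (simp add: norm_mult mult.assoc flip: right_diff_distrib)
    qed
    also have "\<dots> = (C * (LINT \<xi>|lebesgue. jbracket (\<xi>::real^'n) powr - ?M)) * \<epsilon>"
      unfolding integral_mult_right_zero by (simp only: ac_simps)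
    finally have "c * norm ((LINT \<xi>|lebesgue. cis (\<phi> x \<xi>) * G (F\<epsilon> \<epsilon>) \<xi>) - (LINT \<xi>|lebesgue. cis (\<phi> x \<xi>) * G F \<xi>)) \<le>
        c * ((C * (LINT \<xi>|lebesgue. jbracket (\<xi>::real^'n) powr - ?M)) * \<epsilon>)"
      by (rule mult_left_mono) (rule c)
    moreover have "fio_reg \<phi> a \<gamma> \<epsilon> v x - complex_of_real c * (LINT \<xi>|lebesgue. cis (\<phi> x \<xi>) * G F \<xi>) =
        complex_of_real c * ((LINT \<xi>|lebesgue. cis (\<phi> x \<xi>) * G (F\<epsilon> \<epsilon>) \<xi>) - (LINT \<xi>|lebesgue. cis (\<phi> x \<xi>) * G F \<xi>))"
      unfolding fio[OF \<epsilon>] c_def by (simp only: right_diff_distrib)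
    ultimately show "norm (fio_reg \<phi> a \<gamma> \<epsilon> v x - complex_of_real c * (LINT \<xi>|lebesgue. cis (\<phi> x \<xi>) * G F \<xi>)) \<le>
        (c * (C * (LINT \<xi>|lebesgue. jbracket (\<xi>::real^'n) powr - ?M))) * \<epsilon>"
      using c by (simp only: norm_mult norm_of_real abs_of_nonneg mult.assoc)
  qed
  then show "((\<lambda>\<epsilon>. fio_reg \<phi> a \<gamma> \<epsilon> v x) \<longlongrightarrow> complex_of_real (1 / (2 * pi) ^ CARD('n)) *
    (LINT \<xi>|lebesgue. cis (\<phi> x \<xi>) * (LINT y|lborel. cis (- (y \<bullet> \<xi>)) * (a x y \<xi> * v y)))) (at_right 0)"
    by (simp add: c_def G_def F_def)
qed

section \<open>Equality of the two operators\<close>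

lemma osc_psdo_diff:
  fixes P :: "(real^'n) \<times> (real^'n) \<Rightarrow> complex"
  assumes D: "symb {0<..1} (\<lambda>\<epsilon> Y. \<epsilon> * pair_weight t1 t2 Y) (\<lambda>\<epsilon> Y. P\<epsilon> \<epsilon> Y - P Y)"
    and P: "symb1 (pair_weight t1 t2) P" and u: "u \<in> schwartz"
  shows "symb {0<..1} (\<lambda>\<epsilon> y. \<epsilon> * jbracket y powr s)
    (\<lambda>\<epsilon> y. osc (psdo_amp (P\<epsilon> \<epsilon>) (\<lambda>Y. u (fst Y))) y - osc (psdo_amp P (\<lambda>Y. u (fst Y))) y)"
proof -
  let ?s = "s - t1" and ?U = "\<lambda>Y::(real^'n) \<times> (real^'n). u (fst Y)"
  have U: "symb1 (pair_weight ?s 0) ?U"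
    by (rule symb_powr_of_pair[OF schwartz_symb1[OF u]])
  have "symb {0<..1::real} (\<lambda>_ Y. 1 * pair_weight ?s 0 Y) (\<lambda>_. ?U)"
    using symb1D[OF U] by simp
  from symb_psdo_amp[OF D this]
  have "symb {0<..1} (osc_weight (\<lambda>\<epsilon> y. \<epsilon> * jbracket y powr (t1 + ?s)) (\<bar>?s\<bar> + \<bar>t2 + 0\<bar>))
      (\<lambda>\<epsilon> z. psdo_amp (P\<epsilon> \<epsilon>) ?U z - psdo_amp P ?U z)"
    by (simp add: psdo_amp_def[abs_def] left_diff_distrib)
  from osc_diff_bound[where V = "\<lambda>y. jbracket y powr (t1 + ?s)", OF symb1_psdo_amp[OF P U] continuous_on_jbracket_powr' this]
  show ?thesis by simp
qed

lemma osc_comp_amp_eq: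
  fixes A :: "(real^'n) \<times> (real^'n) \<times> (real^'n) \<Rightarrow> complex" and Q :: "(real^'n) \<times> (real^'n) \<Rightarrow> complex"
  assumes A: "symb1 (amp_weight m1 m2 m3) A" and Q: "\<And>a b. symb1 (pair_weight a b) Q"
  shows "osc (comp_amp A Q) (x, z, \<xi>) = complex_of_real (1 / (2 * pi) ^ CARD('n)) *
    (LINT \<eta>|lborel. LINT y|lborel. cis ((y - z) \<bullet> (\<eta> - \<xi>)) * (A (x, y, \<xi>) * Q (y, \<eta>)))"
proof -
  let ?L = "2 * real DIM((real^'n) \<times> (real^'n))"
  \<comment> \<open>Q is taken of order -L - m2 in y and -L in \<eta>, so that A and Q together
    decay like order -L at z + w and at \<xi> + \<theta>. Peetre's inequality based at w and
    \<theta> turns this into decay in (w, \<theta>), with growth of order L in z and \<xi>.\<close>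
  have d: "symb1 (\<lambda>Z. amp_weight m1 ?L (m3 + ?L) (fst Z) * jbracket (snd Z) powr - ?L) (comp_amp A Q)"
    unfolding comp_amp_def[abs_def]
  proof (rule symb_mono[where C = "2 powr ?L * 2 powr ?L * 2 powr ?L", OF symb_linear[OF symb1_quad[OF A Q[unfolded pair_weight_def]] linear_comp_map]])
    fix Z :: "((real^'n) \<times> (real^'n) \<times> (real^'n)) \<times> ((real^'n) \<times> (real^'n))"
    obtain x y \<xi> w \<theta> where Z: "Z = ((x, y, \<xi>), (w, \<theta>))" by (metis prod.exhaust)
    have 1: "jbracket (y + w) powr - ?L \<le> 2 powr ?L * (jbracket w powr - ?L * jbracket y powr ?L)"
      using peetre[of w y "- ?L"] by (simp add: add.commute)
    have 2: "jbracket (\<xi> + \<theta>) powr - ?L \<le> 2 powr ?L * (jbracket \<theta> powr - ?L * jbracket \<xi> powr ?L)"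
      using peetre[of \<theta> \<xi> "- ?L"] by (simp add: add.commute)
    have "quad_weight m1 m2 m3 (- ?L - m2) (- ?L) (comp_map 1 Z) =
        jbracket x powr m1 * jbracket \<xi> powr m3 * (jbracket (y + w) powr - ?L * jbracket (\<xi> + \<theta>) powr - ?L)"
      by (simp add: Z quad_weight_def comp_map_def amp_weight_def powr_diff)
    also have "\<dots> \<le> jbracket x powr m1 * jbracket \<xi> powr m3 *
        ((2 powr ?L * (jbracket w powr - ?L * jbracket y powr ?L)) * (2 powr ?L * (jbracket \<theta> powr - ?L * jbracket \<xi> powr ?L)))"
      by (intro mult_left_mono mult_mono 1 2) auto
    also have "\<dots> = (2 powr ?L * 2 powr ?L * amp_weight m1 ?L (m3 + ?L) (x, y, \<xi>)) * (jbracket w powr - ?L * jbracket \<theta> powr - ?L)"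
      by (simp add: amp_weight_def powr_add)
    also have "\<dots> \<le> (2 powr ?L * 2 powr ?L * amp_weight m1 ?L (m3 + ?L) (x, y, \<xi>)) * (2 powr ?L * jbracket (w, \<theta>) powr - ?L)"
      by (intro mult_left_mono jbracket_powr_Pair_decay mult_nonneg_nonneg) auto
    also have "\<dots> = (2 powr ?L * 2 powr ?L * 2 powr ?L) * (amp_weight m1 ?L (m3 + ?L) (fst Z) * jbracket (snd Z) powr - ?L)"
      by (simp only: Z fst_conv snd_conv ac_simps)
    finally show "quad_weight m1 m2 m3 (- ?L - m2) (- ?L) (comp_map 1 Z) \<le>
        (2 powr ?L * 2 powr ?L * 2 powr ?L) * (amp_weight m1 ?L (m3 + ?L) (fst Z) * jbracket (snd Z) powr - ?L)" .
  qed simp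
  define H where "H = (\<lambda>\<eta> y. cis ((y - z) \<bullet> (\<eta> - \<xi>)) * (A (x, y, \<xi>) * Q (y, \<eta>)))"
  have cA: "continuous_on UNIV A" and cQ: "continuous_on UNIV Q"
    using symb1_smooth[OF A] symb1_smooth[OF Q] by (auto intro: smooth_continuous_on)
  have H: "(\<lambda>(\<eta>, y). H \<eta> y) \<in> borel_measurable borel"
    unfolding H_def cis_conv_exp case_prod_unfold
    by (intro borel_measurable_continuous_onI continuous_intros continuous_on_compose2[OF cA] continuous_on_compose2[OF cQ]) auto
  have Hy: "H \<eta> \<in> borel_measurable borel" for \<eta>
    unfolding H_def cis_conv_exp
    by (intro borel_measurable_continuous_onI continuous_intros continuous_on_compose2[OF cA] continuous_on_compose2[OF cQ]) auto
  have "osc (comp_amp A Q) (x, z, \<xi>) = osc_int (comp_amp A Q) (x, z, \<xi>)"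
    using osc_eq1[OF d, of 0] by simp
  also have "\<dots> = complex_of_real (1 / (2 * pi) ^ CARD('n)) * (LINT q|lborel. osc_phase q * comp_amp A Q ((x, z, \<xi>), q))"
    by (simp add: osc_int_def)
  also have "(LINT q|lborel. osc_phase q * comp_amp A Q ((x, z, \<xi>), q)) =
      (LINT \<theta>|lborel. LINT w|lborel. osc_phase (w, \<theta>) * comp_amp A Q ((x, z, \<xi>), (w, \<theta>)))"
  proof (rule integral_lborel_snd[where F = "\<lambda>q. osc_phase q * comp_amp A Q ((x, z, \<xi>), q)"])
    have "symb1 (\<lambda>q. amp_weight m1 ?L (m3 + ?L) (x, z, \<xi>) * jbracket q powr - ?L) (\<lambda>q. comp_amp A Q ((x, z, \<xi>), q))"
      using symb_fixed_fst[OF d, of "(x, z, \<xi>)"] by simp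
    then show "integrable lborel (\<lambda>q. osc_phase q * comp_amp A Q ((x, z, \<xi>), q))"
      by (rule integrable_symb1) auto
  qed
  also have "\<dots> = (LINT \<theta>|lborel. LINT w|lborel. H (\<theta> + \<xi>) (w + z))"
    by (simp add: H_def osc_phase_def comp_amp_eq add.commute)
  also have "\<dots> = (LINT \<theta>|lborel. LINT y|lborel. H (\<theta> + \<xi>) y)"
    by (intro Bochner_Integration.integral_cong refl integral_lborel_translate Hy)
  also have "\<dots> = (LINT \<eta>|lborel. LINT y|lborel. H \<eta> y)"
    by (rule integral_lborel_translate[where f = "\<lambda>\<eta>. LINT y|lborel. H \<eta> y"]) (rule borel_measurable_slice_integral[OF H])
  finally show ?thesis by (simp only: H_def)
qed

lemma integrable_pair_decay:
  fixes K :: "(real^'n) \<times> (real^'n) \<Rightarrow> complex"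
  assumes M: "M = 2 * real DIM((real^'n) \<times> (real^'n))"
    and K: "K \<in> borel_measurable borel" "\<And>y \<eta>. norm (K (y, \<eta>)) \<le> C * (jbracket y powr - M * jbracket \<eta> powr - M)" and C: "0 \<le> C"
  shows "integrable lborel K"
proof (rule integrable_norm_le)
  show "integrable lborel (\<lambda>Y::(real^'n) \<times> (real^'n). C * (2 powr M * jbracket Y powr - M))"
    by (intro integrable_mult_right integrable_jbracket_powr) (simp add: M)
  show "K \<in> borel_measurable lborel" using K(1) by simp
  fix Y :: "(real^'n) \<times> (real^'n)"
  obtain y \<eta> where Y: "Y = (y, \<eta>)" by (cases Y)
  have "jbracket y powr - M * jbracket \<eta> powr - M \<le> 2 powr M * jbracket (y, \<eta>) powr - M"
    by (rule jbracket_powr_Pair_decay) (simp add: M)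
  from order_trans[OF K(2) mult_left_mono[OF this C]]
  show "norm (K Y) \<le> C * (2 powr M * jbracket Y powr - M)" by (simp only: Y)
qed

text \<open>For a symbol that decays in both variables all integrals converge absolutely, and the identity
  is Fubini's theorem.\<close>

lemma comp_identity_decaying:
  fixes A :: "(real^'n) \<times> (real^'n) \<times> (real^'n) \<Rightarrow> complex" and Q :: "(real^'n) \<times> (real^'n) \<Rightarrow> complex"
  assumes A: "symb1 (amp_weight m1 m2 m3) A" and Q: "\<And>a b. symb1 (pair_weight a b) Q" and u: "u \<in> schwartz"
  shows "(LINT y|lborel. cis (- (y \<bullet> \<xi>)) * (A (x, y, \<xi>) * osc (psdo_amp Q (\<lambda>Y. u (fst Y))) y)) =
    (LINT z|lborel. cis (- (z \<bullet> \<xi>)) * (osc (comp_amp A Q) (x, z, \<xi>) * u z))"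
proof -
  define M where "M = 2 * real DIM((real^'n) \<times> (real^'n))"
  define c0 where "c0 = complex_of_real (1 / (2 * pi) ^ CARD('n))"
  \<comment> \<open>Both sides are \<open>c0\<close> times the integral of
    \<open>K y \<eta> * uh \<eta>\<close>. Integrating z out into \<open>uh\<close> or y out into
    \<open>k\<close> splits the triple integral, so that Fubini's theorem is applied to the pairs
    (y, \<eta>) and (z, \<eta>) only.\<close>
  define K where "K = (\<lambda>y \<eta>. cis (y \<bullet> (\<eta> - \<xi>)) * (A (x, y, \<xi>) * Q (y, \<eta>)))"
  define uh where "uh = (\<lambda>\<eta>. LINT z|lborel. cis (- (z \<bullet> \<eta>)) * u z)"
  define k where "k = (\<lambda>\<eta>. LINT y|lborel. K y \<eta>)"
  have smu: "smooth u" using u by (simp add: schwartz_def)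
  have cu: "continuous_on UNIV u" by (rule smooth_continuous_on[OF smu])
  have cA: "continuous_on UNIV A" and cQ: "continuous_on UNIV Q"
    using symb1_smooth[OF A] symb1_smooth[OF Q] by (auto intro: smooth_continuous_on)
  obtain C where C: "0 \<le> C" "\<And>y \<eta>. norm (K y \<eta>) \<le> C * (jbracket y powr - M * jbracket \<eta> powr - M)"
  proof -
    obtain Ca where Ca: "0 \<le> Ca" "\<And>X. norm (A X) \<le> Ca * amp_weight m1 m2 m3 X" using symb1_bound[OF A] by blast
    obtain Cq where Cq: "0 \<le> Cq" "\<And>Y. norm (Q Y) \<le> Cq * pair_weight (- M - m2) (- M) Y" using symb1_bound[OF Q] by blast
    have "norm (K y \<eta>) \<le> (Ca * Cq * (jbracket x powr m1 * jbracket \<xi> powr m3)) * (jbracket y powr - M * jbracket \<eta> powr - M)" for y \<eta>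
    proof -
      have "norm (K y \<eta>) = norm (A (x, y, \<xi>)) * norm (Q (y, \<eta>))" by (simp add: K_def norm_mult)
      also have "\<dots> \<le> (Ca * amp_weight m1 m2 m3 (x, y, \<xi>)) * (Cq * pair_weight (- M - m2) (- M) (y, \<eta>))"
        using Ca(1) by (intro mult_mono Ca(2) Cq(2)) auto
      also have "\<dots> = (Ca * Cq * (jbracket x powr m1 * jbracket \<xi> powr m3)) * (jbracket y powr - M * jbracket \<eta> powr - M)"
        by (simp add: amp_weight_def pair_weight_def powr_diff)
      finally show ?thesis .
    qed
    then show ?thesis using that[of "Ca * Cq * (jbracket x powr m1 * jbracket \<xi> powr m3)"] Ca(1) Cq(1) by simp
  qed
  obtain Cu where Cu: "0 \<le> Cu" "\<And>z. norm (u z) \<le> Cu * jbracket z powr - M" using symb1_bound[OF schwartz_symb1[OF u]] by blast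
  have JM: "integrable lborel (\<lambda>y::real^'n. jbracket y powr - M)" by (rule integrable_jbracket_powr) (simp add: M_def)
  have Kc: "continuous_on UNIV (\<lambda>(y, \<eta>). K y \<eta>)"
    unfolding K_def cis_conv_exp case_prod_unfold
    by (intro continuous_intros continuous_on_compose2[OF cA] continuous_on_compose2[OF cQ]) auto
  have Km: "(\<lambda>(\<eta>, y). K y \<eta>) \<in> borel_measurable borel"
    unfolding K_def cis_conv_exp case_prod_unfold
    by (intro borel_measurable_continuous_onI continuous_intros continuous_on_compose2[OF cA] continuous_on_compose2[OF cQ]) auto
  have Kym: "(\<lambda>y. K y \<eta>) \<in> borel_measurable borel" for \<eta>
    unfolding K_def cis_conv_exp
    by (intro borel_measurable_continuous_onI continuous_intros continuous_on_compose2[OF cA] continuous_on_compose2[OF cQ]) auto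
  have km: "k \<in> borel_measurable borel" unfolding k_def by (rule borel_measurable_slice_integral[OF Km])
  have uhm: "uh \<in> borel_measurable borel" unfolding uh_def cis_conv_exp
    by (rule borel_measurable_slice_integral, unfold case_prod_unfold)
      (intro borel_measurable_continuous_onI continuous_intros continuous_on_compose2[OF cu]; simp)
  have eum: "(\<lambda>z. cis (- (z \<bullet> \<eta>)) * u z) \<in> borel_measurable borel" for \<eta>
    unfolding cis_conv_exp by (intro borel_measurable_continuous_onI continuous_intros continuous_on_compose2[OF cu]) auto
  define Iu where "Iu = (LINT z|lborel. Cu * jbracket (z::real^'n) powr - M)"
  have uhb: "norm (uh \<eta>) \<le> Iu" for \<eta>
    unfolding uh_def Iu_def
    by (rule norm_integral_le) (use JM eum Cu in \<open>auto simp: norm_mult\<close>)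
  have Iu0: "0 \<le> Iu" by (rule order_trans[OF norm_ge_zero uhb])
  define Ik where "Ik = (LINT y|lborel. C * jbracket (y::real^'n) powr - M)"
  have kb: "norm (k \<eta>) \<le> Ik * jbracket \<eta> powr - M" for \<eta>
  proof -
    have "norm (k \<eta>) \<le> (LINT y|lborel. jbracket \<eta> powr - M * (C * jbracket (y::real^'n) powr - M))"
      unfolding k_def
    proof (rule norm_integral_le)
      show "integrable lborel (\<lambda>y::real^'n. jbracket \<eta> powr - M * (C * jbracket y powr - M))" by (intro integrable_mult_right JM)
      show "norm (K y \<eta>) \<le> jbracket \<eta> powr - M * (C * jbracket y powr - M)" for y using C(2)[of y \<eta>] by (simp add: ac_simps)
    qed (use Kym in simp)
    then show ?thesis unfolding integral_mult_right_zero by (simp add: Ik_def mult.commute)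
  qed
  have "norm (k 0) \<le> Ik * jbracket (0 :: real^'n) powr - M" by (rule kb)
  then have "0 \<le> Ik" using order_trans[OF norm_ge_zero] by fastforce
  note Ik0 = this
  have sndm: "(\<lambda>Y::(real^'n) \<times> (real^'n). g (snd Y)) \<in> borel_measurable borel" if "g \<in> borel_measurable borel" for g :: "real^'n \<Rightarrow> complex"
    by (rule measurable_compose[OF borel_measurable_continuous_onI that]) (intro continuous_intros)
  have int1: "integrable lborel (\<lambda>Y. K (fst Y) (snd Y) * uh (snd Y))"
  proof (rule integrable_pair_decay[OF M_def, where C = "C * Iu"])
    show "(\<lambda>Y. K (fst Y) (snd Y) * uh (snd Y)) \<in> borel_measurable borel"
      using borel_measurable_times[OF borel_measurable_continuous_onI[OF Kc] sndm[OF uhm]] by (simp add: case_prod_unfold)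
    show "norm (K (fst (y, \<eta>)) (snd (y, \<eta>)) * uh (snd (y, \<eta>))) \<le> (C * Iu) * (jbracket y powr - M * jbracket \<eta> powr - M)" for y \<eta>
      using mult_mono[OF C(2)[of y \<eta>] uhb[of \<eta>]] C(1) by (simp add: norm_mult ac_simps)
  qed (use C Iu0 in auto)
  have int2: "integrable lborel (\<lambda>Y. cis (- (fst Y \<bullet> snd Y)) * u (fst Y) * k (snd Y))"
  proof (rule integrable_pair_decay[OF M_def, where C = "Cu * Ik"])
    have "(\<lambda>Y::(real^'n) \<times> (real^'n). cis (- (fst Y \<bullet> snd Y)) * u (fst Y)) \<in> borel_measurable borel"
      unfolding cis_conv_exp by (intro borel_measurable_continuous_onI continuous_intros continuous_on_compose2[OF cu]) auto
    then show "(\<lambda>Y. cis (- (fst Y \<bullet> snd Y)) * u (fst Y) * k (snd Y)) \<in> borel_measurable borel"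
      by (rule borel_measurable_times[OF _ sndm[OF km]])
    show "norm (cis (- (fst (y, \<eta>) \<bullet> snd (y, \<eta>))) * u (fst (y, \<eta>)) * k (snd (y, \<eta>))) \<le> (Cu * Ik) * (jbracket y powr - M * jbracket \<eta> powr - M)" for y \<eta>
      using mult_mono[OF Cu(2)[of y] kb[of \<eta>]] Cu(1) by (simp add: norm_mult ac_simps)
  qed (use Cu Ik0 in auto)
  have "(LINT y|lborel. cis (- (y \<bullet> \<xi>)) * (A (x, y, \<xi>) * osc (psdo_amp Q (\<lambda>Y. u (fst Y))) y)) =
      (LINT y|lborel. c0 * (LINT \<eta>|lborel. K y \<eta> * uh \<eta>))"
  proof (rule Bochner_Integration.integral_cong[OF refl])
    fix y
    have "osc (psdo_amp Q (\<lambda>Y. u (fst Y))) y = c0 * (LINT \<eta>|lborel. LINT z|lborel. cis ((y - z) \<bullet> \<eta>) * (Q (y, \<eta>) * u z))"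
      unfolding c0_def
      using osc_psdo_amp_eq[OF Q[of 0 "- M"] symb_powr_of_pair[OF schwartz_symb1[OF u, of "- M"]], of y] by (simp add: M_def)
    also have "(LINT \<eta>|lborel. LINT z|lborel. cis ((y - z) \<bullet> \<eta>) * (Q (y, \<eta>) * u z)) =
        (LINT \<eta>|lborel. cis (y \<bullet> \<eta>) * Q (y, \<eta>) * uh \<eta>)"
    proof (rule Bochner_Integration.integral_cong[OF refl])
      fix \<eta>
      have "cis ((y - z) \<bullet> \<eta>) * (Q (y, \<eta>) * u z) = (cis (y \<bullet> \<eta>) * Q (y, \<eta>)) * (cis (- (z \<bullet> \<eta>)) * u z)" for z
      proof -
        have "cis ((y - z) \<bullet> \<eta>) = cis (y \<bullet> \<eta>) * cis (- (z \<bullet> \<eta>))" by (simp add: cis_mult inner_diff_left)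
        then show ?thesis by (simp only: ac_simps)
      qed
      then show "(LINT z|lborel. cis ((y - z) \<bullet> \<eta>) * (Q (y, \<eta>) * u z)) = cis (y \<bullet> \<eta>) * Q (y, \<eta>) * uh \<eta>"
        by (simp only: integral_mult_right_zero uh_def)
    qed
    finally have "cis (- (y \<bullet> \<xi>)) * (A (x, y, \<xi>) * osc (psdo_amp Q (\<lambda>Y. u (fst Y))) y) =
        c0 * ((cis (- (y \<bullet> \<xi>)) * A (x, y, \<xi>)) * (LINT \<eta>|lborel. cis (y \<bullet> \<eta>) * Q (y, \<eta>) * uh \<eta>))"
      by (simp only: ac_simps)
    also have "(cis (- (y \<bullet> \<xi>)) * A (x, y, \<xi>)) * (LINT \<eta>|lborel. cis (y \<bullet> \<eta>) * Q (y, \<eta>) * uh \<eta>) =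
        (LINT \<eta>|lborel. (cis (- (y \<bullet> \<xi>)) * A (x, y, \<xi>)) * (cis (y \<bullet> \<eta>) * Q (y, \<eta>) * uh \<eta>))"
      by (rule integral_mult_right_zero[symmetric])
    also have "\<dots> = (LINT \<eta>|lborel. K y \<eta> * uh \<eta>)"
    proof (rule Bochner_Integration.integral_cong[OF refl])
      fix \<eta>
      have "cis (y \<bullet> (\<eta> - \<xi>)) = cis (y \<bullet> \<eta>) * cis (- (y \<bullet> \<xi>))" by (simp add: cis_mult inner_diff_right)
      then show "(cis (- (y \<bullet> \<xi>)) * A (x, y, \<xi>)) * (cis (y \<bullet> \<eta>) * Q (y, \<eta>) * uh \<eta>) = K y \<eta> * uh \<eta>"
        by (simp only: K_def ac_simps)
    qed
    finally show "cis (- (y \<bullet> \<xi>)) * (A (x, y, \<xi>) * osc (psdo_amp Q (\<lambda>Y. u (fst Y))) y) = c0 * (LINT \<eta>|lborel. K y \<eta> * uh \<eta>)" .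
  qed
  also have "\<dots> = c0 * (LINT y|lborel. LINT \<eta>|lborel. K y \<eta> * uh \<eta>)" by (rule integral_mult_right_zero)
  also have "(LINT y|lborel. LINT \<eta>|lborel. K y \<eta> * uh \<eta>) = (LINT \<eta>|lborel. LINT y|lborel. K y \<eta> * uh \<eta>)"
    using integral_lborel_fst[OF int1] integral_lborel_snd[OF int1] by (simp only: fst_conv snd_conv)
  also have "\<dots> = (LINT \<eta>|lborel. LINT z|lborel. cis (- (z \<bullet> \<eta>)) * u z * k \<eta>)"
    unfolding uh_def k_def integral_mult_left_zero integral_mult_right_zero by (simp only: mult.commute)
  also have "\<dots> = (LINT z|lborel. LINT \<eta>|lborel. cis (- (z \<bullet> \<eta>)) * u z * k \<eta>)"
    using integral_lborel_fst[OF int2] integral_lborel_snd[OF int2] by (simp only: fst_conv snd_conv)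
  also have "c0 * \<dots> = (LINT z|lborel. c0 * (LINT \<eta>|lborel. cis (- (z \<bullet> \<eta>)) * u z * k \<eta>))"
    by (rule integral_mult_right_zero[symmetric])
  also have "\<dots> = (LINT z|lborel. cis (- (z \<bullet> \<xi>)) * (osc (comp_amp A Q) (x, z, \<xi>) * u z))"
  proof (rule Bochner_Integration.integral_cong[OF refl])
    fix z
    have eq: "cis (- (z \<bullet> \<xi>)) * u z * (LINT y|lborel. cis ((y - z) \<bullet> (\<eta> - \<xi>)) * (A (x, y, \<xi>) * Q (y, \<eta>))) =
        cis (- (z \<bullet> \<eta>)) * u z * k \<eta>" for \<eta>
    proof -
      have "cis ((y - z) \<bullet> (\<eta> - \<xi>)) * (A (x, y, \<xi>) * Q (y, \<eta>)) = (cis (- (z \<bullet> \<eta>)) * cis (z \<bullet> \<xi>)) * K y \<eta>" for y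
      proof -
        have "cis ((y - z) \<bullet> (\<eta> - \<xi>)) = (cis (- (z \<bullet> \<eta>)) * cis (z \<bullet> \<xi>)) * cis (y \<bullet> (\<eta> - \<xi>))"
          by (simp add: cis_mult inner_diff_left inner_diff_right algebra_simps)
        then show ?thesis by (simp only: K_def ac_simps)
      qed
      then have "(LINT y|lborel. cis ((y - z) \<bullet> (\<eta> - \<xi>)) * (A (x, y, \<xi>) * Q (y, \<eta>))) = (cis (- (z \<bullet> \<eta>)) * cis (z \<bullet> \<xi>)) * k \<eta>"
        by (simp only: integral_mult_right_zero k_def)
      moreover have "cis (- (z \<bullet> \<xi>)) * u z * ((cis (- (z \<bullet> \<eta>)) * cis (z \<bullet> \<xi>)) * k \<eta>) =
          (cis (- (z \<bullet> \<xi>)) * cis (z \<bullet> \<xi>)) * (cis (- (z \<bullet> \<eta>)) * u z * k \<eta>)"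
        by (simp only: ac_simps)
      moreover have "cis (- (z \<bullet> \<xi>)) * cis (z \<bullet> \<xi>) = 1" by (simp add: cis_mult)
      ultimately show ?thesis by simp
    qed
    have "cis (- (z \<bullet> \<xi>)) * (osc (comp_amp A Q) (x, z, \<xi>) * u z) = c0 * ((cis (- (z \<bullet> \<xi>)) * u z) *
        (LINT \<eta>|lborel. LINT y|lborel. cis ((y - z) \<bullet> (\<eta> - \<xi>)) * (A (x, y, \<xi>) * Q (y, \<eta>))))"
      unfolding osc_comp_amp_eq[OF A Q] c0_def by (simp only: ac_simps)
    also have "(cis (- (z \<bullet> \<xi>)) * u z) *
        (LINT \<eta>|lborel. LINT y|lborel. cis ((y - z) \<bullet> (\<eta> - \<xi>)) * (A (x, y, \<xi>) * Q (y, \<eta>))) =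
        (LINT \<eta>|lborel. (cis (- (z \<bullet> \<xi>)) * u z) * (LINT y|lborel. cis ((y - z) \<bullet> (\<eta> - \<xi>)) * (A (x, y, \<xi>) * Q (y, \<eta>))))"
      by (rule integral_mult_right_zero[symmetric])
    finally show "c0 * (LINT \<eta>|lborel. cis (- (z \<bullet> \<eta>)) * u z * k \<eta>) = cis (- (z \<bullet> \<xi>)) * (osc (comp_amp A Q) (x, z, \<xi>) * u z)"
      unfolding eq by simp
  qed
  finally show ?thesis .
qed

lemma tendsto_integral_linear_rate:
  fixes h :: "real \<Rightarrow> 'a \<Rightarrow> complex"
  assumes w: "integrable M w" and h0: "integrable M h0" and h: "\<And>\<epsilon>. \<epsilon> \<in> {0<..1} \<Longrightarrow> h \<epsilon> \<in> borel_measurable M"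
    and b: "\<And>\<epsilon> x. \<epsilon> \<in> {0<..1} \<Longrightarrow> norm (h \<epsilon> x - h0 x) \<le> \<epsilon> * w x"
  shows "((\<lambda>\<epsilon>. LINT x|M. h \<epsilon> x) \<longlongrightarrow> (LINT x|M. h0 x)) (at_right 0)"
proof (rule tendsto_at_right_0I[where C = "LINT x|M. w x"])
  fix \<epsilon> :: real assume \<epsilon>: "\<epsilon> \<in> {0<..1}"
  have ew: "integrable M (\<lambda>x. \<epsilon> * w x)" by (intro integrable_mult_right w)
  have dm: "(\<lambda>x. h \<epsilon> x - h0 x) \<in> borel_measurable M"
    by (intro borel_measurable_diff h \<epsilon> borel_measurable_integrable h0)
  have "integrable M (\<lambda>x. h \<epsilon> x - h0 x)" by (rule integrable_norm_le[OF ew dm b[OF \<epsilon>]])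
  from Bochner_Integration.integrable_add[OF this h0] have hi: "integrable M (h \<epsilon>)" by simp
  have "norm (LINT x|M. h \<epsilon> x - h0 x) \<le> (LINT x|M. \<epsilon> * w x)" by (rule norm_integral_le[OF ew dm b[OF \<epsilon>]])
  then show "norm ((LINT x|M. h \<epsilon> x) - (LINT x|M. h0 x)) \<le> (LINT x|M. w x) * \<epsilon>"
    using hi h0 by (simp add: mult.commute)
qed

text \<open>For the symbol damped by a Gaussian this is \<open>comp_identity_decaying\<close>. As
  \<epsilon> tends to 0, both Fourier transforms converge with rate \<epsilon>: on the left because
  Pu depends continuously on p in the Schwartz seminorms, on the right because the composed
  amplitude does so in its symbol class.\<close>

theorem comp_identity:
  fixes a :: "real^'n \<Rightarrow> real^'n \<Rightarrow> real^'n \<Rightarrow> complex" and p :: "real^'n \<Rightarrow> real^'n \<Rightarrow> complex"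
  defines "A \<equiv> \<lambda>(x, y, \<xi>). a x y \<xi>" and "P \<equiv> \<lambda>(y, \<eta>). p y \<eta>"
  assumes A: "symb1 (amp_weight m1 m2 m3) A" and P: "symb1 (pair_weight t1 t2) P" and u: "u \<in> schwartz"
  shows "(LINT y|lborel. cis (- (y \<bullet> \<xi>)) * (a x y \<xi> * psdo p u y)) =
    (LINT z|lborel. cis (- (z \<bullet> \<xi>)) * (osc (comp_amp A P) (x, z, \<xi>) * u z))"
proof -
  define M where "M = 2 * real DIM(real^'n)"
  define P\<epsilon> where "P\<epsilon> = (\<lambda>\<epsilon> Y. P Y * gauss (\<epsilon> *\<^sub>R Y))"
  have JM: "integrable lborel (\<lambda>y::real^'n. C * jbracket y powr - M)" for C
    by (intro integrable_mult_right integrable_jbracket_powr) (simp add: M_def)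
  have cut: "symb {0<..1} (\<lambda>\<epsilon> Y. \<epsilon> * pair_weight (t1 + 1) (t2 + 1) Y) (\<lambda>\<epsilon> Y. P\<epsilon> \<epsilon> Y - P Y)"
    unfolding P\<epsilon>_def by (rule symb_pair_cut[OF P symb1_gauss_bounded gauss_0])
  have P\<epsilon>: "symb1 (pair_weight r s) (P\<epsilon> \<epsilon>)" if "\<epsilon> \<in> {0<..1}" for r s \<epsilon>
    unfolding P\<epsilon>_def by (rule symb1_pair_cut_decay[OF P symb_gauss that])
  \<comment> \<open>The damped symbols converge in the class with both orders raised by one, so P is
    regarded as a member of that class.\<close>
  have P1: "symb1 (pair_weight (t1 + 1) (t2 + 1)) P"
    by (rule symb_mono[OF P, where C = 1]) (auto intro: pair_weight_mono)
  have P1': "symb1 (\<lambda>(y, \<eta>). jbracket y powr (t1 + 1) * jbracket \<eta> powr (t2 + 1)) P"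
    using P1 by (simp add: pair_weight_def)
  let ?V = "\<lambda>\<epsilon>. osc (psdo_amp (P\<epsilon> \<epsilon>) (\<lambda>Y. u (fst Y)))" and ?v = "psdo p u"
  let ?W = "amp_weight m1 (m2 + (t1 + 1)) (m3 + (t2 + 1))"
  have v: "?v \<in> schwartz" by (rule psdo_schwartz[OF P[unfolded P_def] u])
  have slice: "symb1 (pair_weight m2 m3) (\<lambda>Y. a x (fst Y) (snd Y))"
    by (rule symb1_amplitude_slice[OF A[unfolded A_def]])
  obtain Ca where Ca: "0 \<le> Ca" "\<And>y. norm (a x y \<xi>) \<le> Ca * jbracket y powr m2"
  proof -
    obtain C where C: "0 \<le> C" "\<And>Y. norm (a x (fst Y) (snd Y)) \<le> C * pair_weight m2 m3 Y" using symb1_bound[OF slice] by blast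
    show ?thesis using that[of "C * jbracket \<xi> powr m3"] C(1) C(2)[of "(_, \<xi>)"] by (simp add: pair_weight_def ac_simps)
  qed
  have ca: "continuous_on UNIV (\<lambda>y. a x y \<xi>)"
  proof -
    have "continuous_on UNIV (\<lambda>y. (y, \<xi>))" by (intro continuous_intros)
    from continuous_on_compose2[OF smooth_continuous_on[OF symb1_smooth[OF slice], of UNIV] this] show ?thesis by simp
  qed
  have em: "(\<lambda>y. cis (- (y \<bullet> \<xi>))) \<in> borel_measurable borel"
    by (rule borel_measurable_continuous_onI[OF continuous_on_cis_inner])
  have dV: "symb {0<..1} (\<lambda>\<epsilon> y. \<epsilon> * jbracket y powr s) (\<lambda>\<epsilon> y. ?V \<epsilon> y - ?v y)" for s
    using osc_psdo_diff[OF cut P1 u, of s] by (simp add: psdo_def P_def)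
  have lhs: "((\<lambda>\<epsilon>. LINT y|lborel. cis (- (y \<bullet> \<xi>)) * (a x y \<xi> * ?V \<epsilon> y)) \<longlongrightarrow>
      (LINT y|lborel. cis (- (y \<bullet> \<xi>)) * (a x y \<xi> * ?v y))) (at_right 0)"
  proof -
    obtain C where C: "0 \<le> C" "\<And>\<epsilon> y. \<epsilon> \<in> {0<..1} \<Longrightarrow> norm (?V \<epsilon> y - ?v y) \<le> C * (\<epsilon> * jbracket y powr (- M - m2))"
      using symb_bound[OF dV] by blast
    obtain Cv where Cv: "0 \<le> Cv" "\<And>y. norm (?v y) \<le> Cv * jbracket y powr (- M - m2)" using symb1_bound[OF schwartz_symb1[OF v]] by blast
    have vm: "?v \<in> borel_measurable borel" by (rule borel_measurable_smooth[OF symb1_smooth[OF schwartz_symb1[OF v, of 0]]])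
    have Vm: "?V \<epsilon> \<in> borel_measurable borel" if "\<epsilon> \<in> {0<..1}" for \<epsilon>
      using borel_measurable_add[OF borel_measurable_smooth[OF symb_smooth[OF dV[of 0] that]] vm] by simp
    have am: "(\<lambda>y. a x y \<xi>) \<in> borel_measurable borel" by (rule borel_measurable_continuous_onI[OF ca])
    have J: "(Ca * jbracket y powr m2) * (c * jbracket y powr (- M - m2)) = (Ca * c) * jbracket y powr - M" for c and y :: "real^'n"
      by (simp add: powr_diff)
    show ?thesis
    proof (rule tendsto_integral_linear_rate[where w = "\<lambda>y. (Ca * C) * jbracket y powr - M"])
      show "integrable lborel (\<lambda>y. cis (- (y \<bullet> \<xi>)) * (a x y \<xi> * ?v y))"
      proof (rule integrable_norm_le[OF JM[of "Ca * Cv"]])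
        show "(\<lambda>y. cis (- (y \<bullet> \<xi>)) * (a x y \<xi> * ?v y)) \<in> borel_measurable lborel"
          using em am vm by simp
        show "norm (cis (- (y \<bullet> \<xi>)) * (a x y \<xi> * ?v y)) \<le> (Ca * Cv) * jbracket y powr - M" for y
          using mult_mono[OF Ca(2)[of y] Cv(2)[of y]] Ca(1) unfolding J by (simp add: norm_mult)
      qed
      show "(\<lambda>y. cis (- (y \<bullet> \<xi>)) * (a x y \<xi> * ?V \<epsilon> y)) \<in> borel_measurable lborel" if "\<epsilon> \<in> {0<..1}" for \<epsilon>
        using em am Vm[OF that] by simp
      show "norm (cis (- (y \<bullet> \<xi>)) * (a x y \<xi> * ?V \<epsilon> y) - cis (- (y \<bullet> \<xi>)) * (a x y \<xi> * ?v y)) \<le> \<epsilon> * ((Ca * C) * jbracket y powr - M)"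
        if \<epsilon>: "\<epsilon> \<in> {0<..1}" for \<epsilon> y
      proof -
        have "norm (a x y \<xi>) * norm (?V \<epsilon> y - ?v y) \<le> (Ca * jbracket y powr m2) * ((C * \<epsilon>) * jbracket y powr (- M - m2))"
          using Ca(1) C(2)[OF \<epsilon>, of y] by (intro mult_mono Ca(2)) (auto simp: mult.assoc)
        then have "norm (a x y \<xi>) * norm (?V \<epsilon> y - ?v y) \<le> \<epsilon> * ((Ca * C) * jbracket y powr - M)"
          unfolding J by (simp only: ac_simps)
        then show ?thesis by (simp add: norm_mult flip: right_diff_distrib)
      qed
    qed (rule JM)
  qed
  have cP: "symb1 (\<lambda>z. ?W (fst z) * jbracket (snd z) powr (\<bar>m2 + (t1 + 1)\<bar> + \<bar>t2 + 1\<bar>)) (comp_amp A P)"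
    by (rule symb1_comp_amp[OF A P1'])
  have dc: "symb {0<..1} (\<lambda>\<epsilon> X. \<epsilon> * ?W X) (\<lambda>\<epsilon> X. osc (comp_amp A (P\<epsilon> \<epsilon>)) X - osc (comp_amp A P) X)"
  proof (rule osc_diff_bound[OF cP continuous_on_amp_weight])
    have "symb {0<..1} (osc_weight (\<lambda>\<epsilon> X. \<epsilon> * ?W X) (\<bar>m2 + (t1 + 1)\<bar> + \<bar>t2 + 1\<bar>)) (\<lambda>\<epsilon>. comp_amp A (\<lambda>Y. P\<epsilon> \<epsilon> Y - P Y))"
      by (rule symb_comp_amp_family[OF A]) (use cut in \<open>auto simp: pair_weight_def case_prod_unfold\<close>)
    then show "symb {0<..1} (osc_weight (\<lambda>\<epsilon> X. \<epsilon> * ?W X) (\<bar>m2 + (t1 + 1)\<bar> + \<bar>t2 + 1\<bar>)) (\<lambda>\<epsilon> z. comp_amp A (P\<epsilon> \<epsilon>) z - comp_amp A P z)"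
      by (simp add: comp_amp_def[abs_def] right_diff_distrib)
  qed
  have sc: "symb1 ?W (osc (comp_amp A P))" by (rule symb_osc[OF cP]) (rule continuous_on_amp_weight)
  have rhs: "((\<lambda>\<epsilon>. LINT z|lborel. cis (- (z \<bullet> \<xi>)) * (osc (comp_amp A (P\<epsilon> \<epsilon>)) (x, z, \<xi>) * u z)) \<longlongrightarrow>
      (LINT z|lborel. cis (- (z \<bullet> \<xi>)) * (osc (comp_amp A P) (x, z, \<xi>) * u z))) (at_right 0)"
  proof -
    let ?m = "m2 + (t1 + 1)"
    define w0 where "w0 = jbracket x powr m1 * jbracket \<xi> powr (m3 + (t2 + 1))"
    have w0: "0 \<le> w0" by (simp add: w0_def)
    have W: "?W (x, z, \<xi>) = w0 * jbracket z powr ?m" for z by (simp add: amp_weight_def w0_def)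
    obtain C where C: "0 \<le> C" "\<And>\<epsilon> X. \<epsilon> \<in> {0<..1} \<Longrightarrow> norm (osc (comp_amp A (P\<epsilon> \<epsilon>)) X - osc (comp_amp A P) X) \<le> C * (\<epsilon> * ?W X)"
      using symb_bound[OF dc] by blast
    obtain Cc where Cc: "0 \<le> Cc" "\<And>X. norm (osc (comp_amp A P) X) \<le> Cc * ?W X" using symb1_bound[OF sc] by blast
    obtain Cu where Cu: "0 \<le> Cu" "\<And>z. norm (u z) \<le> Cu * jbracket z powr (- M - ?m)" using symb1_bound[OF schwartz_symb1[OF u]] by blast
    have um: "u \<in> borel_measurable borel" by (rule borel_measurable_smooth[OF symb1_smooth[OF schwartz_symb1[OF u, of 0]]])
    have slice_m: "(\<lambda>z. f (x, z, \<xi>)) \<in> borel_measurable borel" if "smooth f" for f :: "(real^'n) \<times> (real^'n) \<times> (real^'n) \<Rightarrow> complex"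
      by (rule borel_measurable_continuous_onI, rule continuous_on_compose2[OF smooth_continuous_on[OF that], of UNIV])
        (auto intro!: continuous_intros)
    have cm: "(\<lambda>z. osc (comp_amp A P) (x, z, \<xi>)) \<in> borel_measurable borel" by (rule slice_m[OF symb1_smooth[OF sc]])
    have cem: "(\<lambda>z. osc (comp_amp A (P\<epsilon> \<epsilon>)) (x, z, \<xi>)) \<in> borel_measurable borel" if "\<epsilon> \<in> {0<..1}" for \<epsilon>
      using borel_measurable_add[OF slice_m[OF symb_smooth[OF dc that]] cm] by simp
    have J: "(c * (w0 * jbracket z powr ?m)) * (Cu * jbracket z powr (- M - ?m)) = (c * w0 * Cu) * jbracket z powr - M" for c and z :: "real^'n"
    proof -
      have "jbracket z powr ?m * jbracket z powr (- M - ?m) = jbracket z powr - M" by (simp only: powr_add[symmetric]) simp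
      then show ?thesis by (simp only: ac_simps)
    qed
    show ?thesis
    proof (rule tendsto_integral_linear_rate[where w = "\<lambda>z. (C * w0 * Cu) * jbracket z powr - M"])
      show "integrable lborel (\<lambda>z. cis (- (z \<bullet> \<xi>)) * (osc (comp_amp A P) (x, z, \<xi>) * u z))"
      proof (rule integrable_norm_le[OF JM[of "Cc * w0 * Cu"]])
        show "(\<lambda>z. cis (- (z \<bullet> \<xi>)) * (osc (comp_amp A P) (x, z, \<xi>) * u z)) \<in> borel_measurable lborel"
          using em cm um by simp
        show "norm (cis (- (z \<bullet> \<xi>)) * (osc (comp_amp A P) (x, z, \<xi>) * u z)) \<le> (Cc * w0 * Cu) * jbracket z powr - M" for z
          using mult_mono[OF Cc(2)[of "(x, z, \<xi>)", unfolded W] Cu(2)[of z]] Cc(1) w0 unfolding J by (simp add: norm_mult)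
      qed
      show "(\<lambda>z. cis (- (z \<bullet> \<xi>)) * (osc (comp_amp A (P\<epsilon> \<epsilon>)) (x, z, \<xi>) * u z)) \<in> borel_measurable lborel" if "\<epsilon> \<in> {0<..1}" for \<epsilon>
        using em cem[OF that] um by simp
      show "norm (cis (- (z \<bullet> \<xi>)) * (osc (comp_amp A (P\<epsilon> \<epsilon>)) (x, z, \<xi>) * u z) - cis (- (z \<bullet> \<xi>)) * (osc (comp_amp A P) (x, z, \<xi>) * u z))
          \<le> \<epsilon> * ((C * w0 * Cu) * jbracket z powr - M)" if \<epsilon>: "\<epsilon> \<in> {0<..1}" for \<epsilon> z
      proof -
        have "norm (osc (comp_amp A (P\<epsilon> \<epsilon>)) (x, z, \<xi>) - osc (comp_amp A P) (x, z, \<xi>)) * norm (u z) \<le>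
            ((C * \<epsilon>) * (w0 * jbracket z powr ?m)) * (Cu * jbracket z powr (- M - ?m))"
          using C(1) C(2)[OF \<epsilon>, of "(x, z, \<xi>)"] w0 \<epsilon> by (intro mult_mono Cu(2)) (auto simp: W mult.assoc)
        then have "norm (osc (comp_amp A (P\<epsilon> \<epsilon>)) (x, z, \<xi>) - osc (comp_amp A P) (x, z, \<xi>)) * norm (u z) \<le>
            \<epsilon> * ((C * w0 * Cu) * jbracket z powr - M)" unfolding J by (simp only: ac_simps)
        then show ?thesis by (simp add: norm_mult flip: right_diff_distrib left_diff_distrib)
      qed
    qed (rule JM)
  qed
  have "\<forall>\<^sub>F \<epsilon> in at_right 0. (LINT z|lborel. cis (- (z \<bullet> \<xi>)) * (osc (comp_amp A (P\<epsilon> \<epsilon>)) (x, z, \<xi>) * u z)) =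
      (LINT y|lborel. cis (- (y \<bullet> \<xi>)) * (a x y \<xi> * ?V \<epsilon> y))"
  proof -
    have "\<forall>\<^sub>F \<epsilon> in at_right (0::real). \<epsilon> \<in> {0<..1}"
      by (auto simp: eventually_at_right_field intro!: exI[of _ 1])
    then show ?thesis
    proof eventually_elim
      case (elim \<epsilon>)
      from comp_identity_decaying[OF A P\<epsilon>[OF elim] u, of \<xi> x] show ?case by (simp add: A_def)
    qed
  qed
  from tendsto_unique[OF _ lhs Lim_transform_eventually[OF rhs this]] show ?thesis by simp
qed

text \<open>At a point x where \<xi> -> e^{i\<phi>(x,\<xi>)} is not Lebesgue measurable, the
  \<xi>-integral need not have a mathematical meaning, so the operators are compared at the points
  where it is. The amplitude c constructed here does not depend on \<phi>.\<close>

theorem theorem2p1: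
  fixes m1 m2 m3 t1 t2 :: real
    and \<phi> :: "real^'n \<Rightarrow> real^'n \<Rightarrow> real"
    and a :: "real^'n \<Rightarrow> real^'n \<Rightarrow> real^'n \<Rightarrow> complex"
    and p :: "real^'n \<Rightarrow> real^'n \<Rightarrow> complex"
  assumes "smooth (\<lambda>(x, y, \<xi>). a x y \<xi>)"
    and "amplitude_bounds m1 m2 m3 a"
    and "smooth (\<lambda>(y, \<eta>). p y \<eta>)"
    and "symbol_bounds t1 t2 p"
  shows "\<exists>c :: real^'n \<Rightarrow> real^'n \<Rightarrow> real^'n \<Rightarrow> complex.
           (\<forall>u\<in>schwartz. \<exists>v\<in>schwartz. psdo_value p u v \<and>
              (\<forall>x. (\<lambda>\<xi>. cis (\<phi> x \<xi>)) \<in> borel_measurable lebesgue \<longrightarrow>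
                 (\<exists>w. fio_value \<phi> a v x w \<and> fio_value \<phi> c u x w))) \<and>
           smooth (\<lambda>(x, z, \<xi>). c x z \<xi>) \<and>
           amplitude_bounds m1 (m2 + t1) (m3 + t2) c \<and>
           asymp_improving m1 (m2 + t1) (m3 + t2) c (composition_term a p)"
proof -
  let ?A = "\<lambda>(x, y, \<xi>). a x y \<xi>" and ?P = "\<lambda>(y, \<eta>). p y \<eta>"
  define c where "c = (\<lambda>x z \<xi>. osc (comp_amp ?A ?P) (x, z, \<xi>))"
  have A: "symb1 (amp_weight m1 m2 m3) ?A" by (rule symb1_amplitude[OF assms(1,2)])
  have P': "symb1 (\<lambda>(y, \<eta>). jbracket y powr t1 * jbracket \<eta> powr t2) ?P"
    using symb1_symbol[OF assms(3,4), of "[]" 0] by simp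
  then have P: "symb1 (pair_weight t1 t2) ?P" by (simp add: pair_weight_def)
  have "symb1 (amp_weight m1 (m2 + t1) (m3 + t2)) (osc (comp_amp ?A ?P))"
    by (rule symb_osc[OF symb1_comp_amp[OF A P']]) (rule continuous_on_amp_weight)
  then have C: "symb1 (amp_weight m1 (m2 + t1) (m3 + t2)) (\<lambda>(x, z, \<xi>). c x z \<xi>)"
    by (simp add: c_def)
  show ?thesis
  proof (intro exI[of _ c] conjI ballI)
    show "smooth (\<lambda>(x, z, \<xi>). c x z \<xi>)" by (rule symb1_smooth[OF C])
    show "amplitude_bounds m1 (m2 + t1) (m3 + t2) c"
      unfolding amplitude_bounds_def using mi_deriv3_bound[OF C] by blast
    show "asymp_improving m1 (m2 + t1) (m3 + t2) c (composition_term a p)"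
      unfolding c_def by (rule comp_asymp_improving[OF assms])
    fix u :: "real^'n \<Rightarrow> complex" assume u: "u \<in> schwartz"
    have v: "psdo p u \<in> schwartz" by (rule psdo_schwartz[OF P u])
    \<comment> \<open>Both values are \<xi>-integrals of the same factor e^{i\<phi>} against inner
      integrals that agree for every \<xi>.\<close>
    have "\<exists>w. fio_value \<phi> a (psdo p u) x w \<and> fio_value \<phi> c u x w"
      if \<phi>: "(\<lambda>\<xi>. cis (\<phi> x \<xi>)) \<in> borel_measurable lebesgue" for x
      using fio_value_amplitude[where \<phi> = \<phi> and x = x, OF A v \<phi>] fio_value_amplitude[where \<phi> = \<phi> and x = x, OF C u \<phi>]
      unfolding comp_identity[OF A P u] c_def by blast
    with v psdo_value_psdo[OF P u]
    show "\<exists>v\<in>schwartz. psdo_value p u v \<and>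
              (\<forall>x. (\<lambda>\<xi>. cis (\<phi> x \<xi>)) \<in> borel_measurable lebesgue \<longrightarrow>
                 (\<exists>w. fio_value \<phi> a v x w \<and> fio_value \<phi> c u x w))" by blast
  qed
qed

end
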